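(* Assume (H1), (H2), (H3). There exists $L_\infty\in\mathbb R$ such that for all $L>L_\infty$: the number of positive eigenvalues of $\mathcal L_L$ coincides with the number of positive eigenvalues of $\mathcal L$ on $\mathbb R$ (with domain $H^4(\mathbb R)$); moreover (a) $L$ is not a conjugate point and $\mathcal L_L$ is invertible; and (b) the number of conjugate points in $(-\infty,L)$ is finite and independent of $L$, so that $\mathrm{Mor}(\mathcal L)$ equals the number of conjugate points in $(-\infty,\infty)$ counted with multiplicity, where $\mathrm{Mor}$ denotes the number of positive eigenvalues.
   Context: Fix real $\nu,\mu$, $f(u)=\nu u^2-u^3-\mu u$. (H1): $\varphi$ is a smooth stationary solution of $u_t=-(1+\partial_x^2)^2u+f(u)$ with $\varphi\to0$ at $\pm\infty$. (H2): $f'(0)<0$. $\mathcal L=-\partial_x^4-2\partial_x^2-1+f'(\varphi(x))$; for $s\in\mathbb R$, $\mathcal L_s$ is the same differential expression on $(-\infty,s]$ with domain $\{u\in H^4((-\infty,s]):u(s)=u'(s)=0\}$. With $q=(u,u_{xx},u_{xxx}+2u_x,u_x)$, $\mathcal Lu=\lambda u$ becomes $q'=B(x,\lambda)q$, $B(x,\lambda)=\begin{pmatrix}0&0&0&1\\0&0&1&-2\\-\lambda-1+f'(\varphi(x))&0&0&0\\0&1&0&0\end{pmatrix}$. $\mathbb E^u_-(x,\lambda)$ is the set of values $q(x)$ of solutions with $q(y)\to0$ as $y\to-\infty$. $\ell_*^{sand}=\{q:q_1=q_4=0\}$. A conjugate point is $x$ with $\mathbb E^u_-(x,0)\cap\ell_*^{sand}\ne\{0\}$,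 with multiplicity the dimension of the intersection. (H3): $\dim(\mathbb E^u_-(x,0)\cap\ell_*^{sand})\le1$ for all $x$. *)

theory Defs
  imports "HOL-Analysis.Analysis"
begin

definition fnl :: "real \<Rightarrow> real \<Rightarrow> real \<Rightarrow> real" where
  "fnl \<nu> \<mu> u = \<nu> * u^2 - u^3 - \<mu> * u"

definition fnl' :: "real \<Rightarrow> real \<Rightarrow> real \<Rightarrow> real" where
  "fnl' \<nu> \<mu> u = 2 * \<nu> * u - 3 * u^2 - \<mu>"

text \<open>(H1): phi smooth, stationary for u_t = -(1+d_x^2)^2 u + f(u), and phi tends to 0 at both ends.\<close>
definition H1 :: "real \<Rightarrow> real \<Rightarrow> (real \<Rightarrow> real) \<Rightarrow> bool" where
  "H1 \<nu> \<mu> \<phi> \<longleftrightarrow>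
     (\<forall>k x. ((deriv ^^ k) \<phi>) differentiable (at x)) \<and>
     (\<forall>x. - (deriv ^^ 4) \<phi> x - 2 * (deriv ^^ 2) \<phi> x - \<phi> x + fnl \<nu> \<mu> (\<phi> x) = 0) \<and>
     (\<phi> \<longlongrightarrow> 0) at_top \<and> (\<phi> \<longlongrightarrow> 0) at_bot"

text \<open>H^4(S) for S = UNIV or S = {..s}: D k plays the role of the k-th derivative of u = D 0.
  D 0, ..., D 3 are classically differentiable on S (one-sided at an endpoint), D 3 is
  absolutely continuous with (a.e.) derivative D 4, and D 0, ..., D 4 are in L^2(S).\<close>
definition H4 :: "real set \<Rightarrow> (nat \<Rightarrow> real \<Rightarrow> real) \<Rightarrow> bool" where
  "H4 S D \<longleftrightarrow>
     (\<forall>k<3. \<forall>x\<in>S. (D k has_real_derivative D (Suc k) x) (at x within S)) \<and>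
     (\<forall>x\<in>S. \<forall>y\<in>S. x \<le> y \<longrightarrow> (D 4 has_integral (D 3 y - D 3 x)) {x..y}) \<and>
     (\<forall>k\<le>4. (\<lambda>x. (D k x)^2) integrable_on S)"

definition Lop :: "real \<Rightarrow> real \<Rightarrow> (real \<Rightarrow> real) \<Rightarrow> (nat \<Rightarrow> real \<Rightarrow> real) \<Rightarrow> real \<Rightarrow> real" where
  "Lop \<nu> \<mu> \<phi> D x = - D 4 x - 2 * D 2 x - D 0 x + fnl' \<nu> \<mu> (\<phi> x) * D 0 x"

definition dom_line :: "(nat \<Rightarrow> real \<Rightarrow> real) \<Rightarrow> bool" where
  "dom_line D \<longleftrightarrow> H4 UNIV D"

definition dom_half :: "real \<Rightarrow> (nat \<Rightarrow> real \<Rightarrow> real) \<Rightarrow> bool" where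
  "dom_half s D \<longleftrightarrow> H4 {..s} D \<and> D 0 s = 0 \<and> D 1 s = 0"

definition eigsp :: "real \<Rightarrow> real \<Rightarrow> (real \<Rightarrow> real) \<Rightarrow> real set \<Rightarrow> ((nat \<Rightarrow> real \<Rightarrow> real) \<Rightarrow> bool)
     \<Rightarrow> real \<Rightarrow> (nat \<Rightarrow> real \<Rightarrow> real) set" where
  "eigsp \<nu> \<mu> \<phi> S Dm lam =
     {D. Dm D \<and> (AE x in lborel. x \<in> S \<longrightarrow> Lop \<nu> \<mu> \<phi> D x = lam * D 0 x)}"

definition lin_indep_on :: "real set \<Rightarrow> nat \<Rightarrow> (nat \<Rightarrow> real \<Rightarrow> real) \<Rightarrow> bool" where
  "lin_indep_on S n us \<longleftrightarrow>
     (\<forall>c. (\<forall>x\<in>S. (\<Sum>i<n. c i * us i x) = 0) \<longrightarrow> (\<forall>i<n. c i = 0))"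

definition eigdim :: "real \<Rightarrow> real \<Rightarrow> (real \<Rightarrow> real) \<Rightarrow> real set \<Rightarrow> ((nat \<Rightarrow> real \<Rightarrow> real) \<Rightarrow> bool)
     \<Rightarrow> real \<Rightarrow> enat" where
  "eigdim \<nu> \<mu> \<phi> S Dm lam =
     Sup {enat n | n. \<exists>Ds. (\<forall>i<n. Ds i \<in> eigsp \<nu> \<mu> \<phi> S Dm lam) \<and>
                           lin_indep_on S n (\<lambda>i. Ds i 0)}"

definition Mor :: "real \<Rightarrow> real \<Rightarrow> (real \<Rightarrow> real) \<Rightarrow> real set \<Rightarrow> ((nat \<Rightarrow> real \<Rightarrow> real) \<Rightarrow> bool) \<Rightarrow> enat" where
  "Mor \<nu> \<mu> \<phi> S Dm =
     (let P = {lam. lam > 0 \<and> eigdim \<nu> \<mu> \<phi> S Dm lam > 0}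
      in if finite P then (\<Sum>lam\<in>P. eigdim \<nu> \<mu> \<phi> S Dm lam) else \<infinity>)"

definition invertible_op :: "real \<Rightarrow> real \<Rightarrow> (real \<Rightarrow> real) \<Rightarrow> real set \<Rightarrow> ((nat \<Rightarrow> real \<Rightarrow> real) \<Rightarrow> bool) \<Rightarrow> bool" where
  "invertible_op \<nu> \<mu> \<phi> S Dm \<longleftrightarrow>
     (\<forall>D. Dm D \<and> (AE x in lborel. x \<in> S \<longrightarrow> Lop \<nu> \<mu> \<phi> D x = 0) \<longrightarrow> (\<forall>x\<in>S. D 0 x = 0)) \<and>
     (\<forall>g. g \<in> borel_measurable lborel \<and> (\<lambda>x. (g x)^2) integrable_on S \<longrightarrow>
        (\<exists>D. Dm D \<and> (AE x in lborel. x \<in> S \<longrightarrow> Lop \<nu> \<mu> \<phi> D x = g x)))"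

definition Bmat :: "real \<Rightarrow> real \<Rightarrow> (real \<Rightarrow> real) \<Rightarrow> real \<Rightarrow> real \<Rightarrow> real^4^4" where
  "Bmat \<nu> \<mu> \<phi> x lam = vector
     [vector [0, 0, 0, 1],
      vector [0, 0, 1, -2],
      vector [- lam - 1 + fnl' \<nu> \<mu> (\<phi> x), 0, 0, 0],
      vector [0, 1, 0, 0]]"

definition Eu :: "real \<Rightarrow> real \<Rightarrow> (real \<Rightarrow> real) \<Rightarrow> real \<Rightarrow> real \<Rightarrow> (real^4) set" where
  "Eu \<nu> \<mu> \<phi> x lam =
     (\<lambda>q. q x) ` {q. (\<forall>y. (q has_vector_derivative (Bmat \<nu> \<mu> \<phi> y lam *v q y)) (at y)) \<and>
                     (q \<longlongrightarrow> 0) at_bot}"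

definition sand :: "(real^4) set" where
  "sand = {q. q $ 1 = 0 \<and> q $ 4 = 0}"

definition conj_point :: "real \<Rightarrow> real \<Rightarrow> (real \<Rightarrow> real) \<Rightarrow> real \<Rightarrow> bool" where
  "conj_point \<nu> \<mu> \<phi> x \<longleftrightarrow> Eu \<nu> \<mu> \<phi> x 0 \<inter> sand \<noteq> {0}"

definition conj_mult :: "real \<Rightarrow> real \<Rightarrow> (real \<Rightarrow> real) \<Rightarrow> real \<Rightarrow> nat" where
  "conj_mult \<nu> \<mu> \<phi> x = dim (Eu \<nu> \<mu> \<phi> x 0 \<inter> sand)"

end

theory Submission
  imports Defs
begin

text \<open>
  Write \<open>V x = f'(\<phi> x)\<close>, a continuous function tending to \<open>- m < 0\<close> at both ends. The number of
  positive eigenvalues on \<open>S\<close> (the line or a half-line) is identified with the index of the form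
  \<open>Q v w = \<integral> - (v'' + v) (w'' + w) + V v w\<close>, the largest dimension on which it is positive definite,
  taken over functions of compact support vanishing to first order at the end of \<open>S\<close>. If a family
  of maximal size is chosen, anything orthogonal to it on which the form is nonnegative lies in the
  kernel of the form, hence solves the equation. Two facts follow. In a limit of domains or of spectral
  parameters the index loses at most the dimension of the kernel of the limit problem: on a
  fixed fine grid a maximal family may be replaced by broken solutions, which form a
  finite-dimensional space where one can pass to the limit. And the index of the half-line
  problem at \<open>s\<close> increases strictly when \<open>s\<close> passes a conjugate point, since a kernel function extended by
  zero would otherwise have to solve the equation across \<open>s\<close>. As the index vanishes for very negative
  \<open>s\<close>, it counts the conjugate points to the left of \<open>s\<close>. For large \<open>s\<close> it equals the index of the
  line, because a maximal family on the line has compact support. Finally, solvability of the inhomogeneous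
  equation in the absence of a kernel is obtained by clamping at \<open>- n\<close> and letting \<open>n\<close> grow.
\<close>

subsection \<open>The fourth-order linear equation\<close>

text \<open>The form comes from \<open>L = - (1 + d^2)^2 + V\<close> by two integrations by parts.
  The obstacle is compactness on an unbounded interval, and coercivity answers it: where
  \<open>V <= - m / 2\<close> the form controls \<open>v\<close> and \<open>v''\<close> in mean
  square whatever the length of the interval. Hence a grid with finitely many points suffices, its
  outer intervals being tails of arbitrary length, and a broken solution is determined by finitely
  many numbers, so that limits are taken in a finite-dimensional space. The index at parameter
  \<open>lam\<close> vanishes once \<open>lam\<close> bounds \<open>V\<close>; on the way up from 0
  it can drop only at eigenvalues, by at most the nullity. Conversely, orthonormal eigenfunctions,
  cut off far out, form a positive family, so the index at 0 counts the positive eigenvalues. In the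
  end point \<open>s\<close> the index is left continuous, because a maximal family can be
  translated a little to the left. To the right of a conjugate point it grows by at least 1 by
  strictness, and by at most the nullity by semicontinuity; (H3) makes both bounds equal.\<close>

lemma antiderivative_exists:
  fixes f :: "real \<Rightarrow> real"
  assumes f: "continuous_on UNIV f"
  shows "\<exists>F. F a = c \<and> (\<forall>x. (F has_real_derivative f x) (at x))"
proof -
  define F where "F x = c + (if a \<le> x then integral {a..x} f else - integral {x..a} f)" for x
  have int: "f integrable_on {x..y}" for x y
    using f continuous_on_subset integrable_continuous_real by blast
  have eq: "F x = c + integral {b..x} f - integral {b..a} f" if "b \<le> x" "b \<le> a" for b x
    using Henstock_Kurzweil_Integration.integral_combine[where a = b and c = x and b = a and f = f]
      Henstock_Kurzweil_Integration.integral_combine[where a = b and c = a and b = x and f = f] int that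
    by (auto simp: F_def)
  have "(F has_real_derivative f x) (at x)" for x
  proof -
    \<comment> \<open>Left of both \<open>a\<close> and \<open>x\<close>: near \<open>x\<close> the
      two-case formula becomes a single integral from \<open>b\<close>, and \<open>x\<close> is
      interior to the interval on which the one-sided rule is applied.\<close>
    define b where "b = min a x - 1"
    have "((\<lambda>y. c + integral {b..y} f - integral {b..a} f) has_real_derivative f x) (at x within {b..x+1})"
      by (auto intro!: derivative_eq_intros integral_has_real_derivative continuous_on_subset[OF f] simp: b_def)
    then have "((\<lambda>y. c + integral {b..y} f - integral {b..a} f) has_real_derivative f x) (at x)"
      by (subst (asm) at_within_interior) (auto simp: b_def interior_atLeastAtMost_real)
    moreover have "\<forall>\<^sub>F y in nhds x. F y = c + integral {b..y} f - integral {b..a} f"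
      by (rule eventually_nhds_in_open[of "{b<..}", THEN eventually_mono]) (auto simp: b_def intro!: eq)
    ultimately show ?thesis
      by (subst DERIV_cong_ev[OF refl _ refl]) auto
  qed
  moreover have "F a = c" by (simp add: F_def)
  ultimately show ?thesis by blast
qed

definition antideriv :: "real \<Rightarrow> real \<Rightarrow> (real \<Rightarrow> real) \<Rightarrow> real \<Rightarrow> real" where
  "antideriv a c f = (SOME F. F a = c \<and> (\<forall>x. (F has_real_derivative f x) (at x)))"

lemma antideriv:
  assumes "continuous_on UNIV f"
  shows "antideriv a c f a = c" "(antideriv a c f has_real_derivative f x) (at x)"
    "continuous_on UNIV (antideriv a c f)"
proof -
  have *: "antideriv a c f a = c \<and> (\<forall>x. (antideriv a c f has_real_derivative f x) (at x))"
    unfolding antideriv_def by (rule someI_ex[OF antiderivative_exists[OF assms]])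
  then show "antideriv a c f a = c" "(antideriv a c f has_real_derivative f x) (at x)" by auto
  from * show "continuous_on UNIV (antideriv a c f)"
    using DERIV_continuous_on by blast
qed

text \<open>Since a power series bound is wanted on both sides of the base point, the comparison is
  stated with the distance to it.\<close>

lemma deriv_power_bound:
  fixes F :: "real \<Rightarrow> real"
  assumes "F a = 0" and d: "\<And>t. \<bar>t - a\<bar> \<le> T \<Longrightarrow> (F has_real_derivative f t) (at t)"
    and b: "\<And>t. \<bar>t - a\<bar> \<le> T \<Longrightarrow> \<bar>f t\<bar> \<le> K * \<bar>t - a\<bar> ^ n / fact n"
    and x: "\<bar>x - a\<bar> \<le> T"
  shows "\<bar>F x\<bar> \<le> K * \<bar>x - a\<bar> ^ Suc n / fact (Suc n)"
proof -
  have pw: "((\<lambda>t. K * t ^ Suc n / fact (Suc n)) has_real_derivative (K * t ^ n / fact n)) (at t)" for t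
    by (rule derivative_eq_intros refl | simp add: divide_simps del: of_nat_Suc)+
  \<comment> \<open>The estimate to the right of 0; below it is applied to \<open>F (a + t)\<close>
    and to \<open>F (a - t)\<close>.\<close>
  have main: "\<bar>G y - G 0\<bar> \<le> K * y ^ Suc n / fact (Suc n)"
    if y: "0 \<le> y" "y \<le> T" and G: "\<And>t. 0 \<le> t \<Longrightarrow> t \<le> T \<Longrightarrow> (G has_real_derivative g t) (at t)"
      "\<And>t. 0 \<le> t \<Longrightarrow> t \<le> T \<Longrightarrow> \<bar>g t\<bar> \<le> K * t ^ n / fact n" for y and G g :: "real \<Rightarrow> real"
  proof (cases "y = 0")
    case False
    have c: "continuous_on {0..y} G"
      using G y by (meson DERIV_isCont atLeastAtMost_iff continuous_at_imp_continuous_on order_trans)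
    have "norm (G y - G 0) \<le> K * y ^ Suc n / fact (Suc n) - K * 0 ^ Suc n / fact (Suc n)"
      by (rule differentiable_bound_general[of 0 y G "\<lambda>t. K * t ^ Suc n / fact (Suc n)" g "\<lambda>t. K * t ^ n / fact n"])
        (use False y G pw c in \<open>auto simp: has_real_derivative_iff_has_vector_derivative[symmetric] intro!: continuous_intros simp del: fact_Suc power_Suc\<close>)
    then show ?thesis by simp
  qed auto
  show ?thesis
  proof (cases "a \<le> x")
    case True
    have "\<bar>F (a + (x - a)) - F (a + 0)\<bar> \<le> K * (x - a) ^ Suc n / fact (Suc n)"
    proof (rule main[where g = "\<lambda>t. f (a + t)"])
      fix t assume "0 \<le> t" "t \<le> T"
      then have "(F has_real_derivative f (a + t)) (at (a + t))" using d by auto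
      then show "((\<lambda>t. F (a + t)) has_real_derivative f (a + t)) (at t)"
        using DERIV_chain2[of F "f (a + t)" "\<lambda>t. a + t" t 1 UNIV]
        by (simp add: DERIV_add[OF DERIV_const DERIV_ident, of a t, simplified])
      show "\<bar>f (a + t)\<bar> \<le> K * t ^ n / fact n"
        using b[of "a + t"] \<open>0 \<le> t\<close> \<open>t \<le> T\<close> by simp
    qed (use x True in auto)
    then show ?thesis using True \<open>F a = 0\<close> by simp
  next
    case False
    have "\<bar>F (a - (a - x)) - F (a - 0)\<bar> \<le> K * (a - x) ^ Suc n / fact (Suc n)"
    proof (rule main[where g = "\<lambda>t. - f (a - t)"])
      fix t assume t: "0 \<le> t" "t \<le> T"
      then have "(F has_real_derivative f (a - t)) (at (a - t))" using d by auto
      then show "((\<lambda>t. F (a - t)) has_real_derivative - f (a - t)) (at t)"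
        using DERIV_chain2[of F "f (a - t)" "\<lambda>t. a - t" t "-1" UNIV]
        by (simp add: DERIV_diff[OF DERIV_const DERIV_ident, of a t, simplified])
      show "\<bar>- f (a - t)\<bar> \<le> K * t ^ n / fact n"
        using b[of "a - t"] t by simp
    qed (use x False in auto)
    then show ?thesis using False \<open>F a = 0\<close> by simp
  qed
qed

text \<open>The integrating factor of the Gronwall argument: a differential inequality for
  \<open>N + e\<close> becomes monotonicity of the weighted function.\<close>

lemma exp_weight_deriv:
  fixes N :: "real \<Rightarrow> real"
  assumes "(N has_real_derivative D) (at t)"
  shows "((\<lambda>x. (N x + e) * exp (c * x)) has_real_derivative (D + c * (N t + e)) * exp (c * t)) (at t)"
  by (rule derivative_eq_intros assms refl | simp add: algebra_simps)+

text \<open>The wave enters only through the potential \<open>V = f' o \<phi>\<close> and the limit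
  \<open>m = - f'(0)\<close>; the locale is instantiated with these at the end.\<close>

locale pot =
  fixes V :: "real \<Rightarrow> real" and m :: real
  assumes V_cont: "continuous_on UNIV V" and m_pos: "m > 0"
    and V_top: "(V \<longlongrightarrow> - m) at_top" and V_bot: "(V \<longlongrightarrow> - m) at_bot"
begin

text \<open>The equation \<open>L u = lam u\<close> solved for the fourth derivative.\<close>

definition rhs :: "real \<Rightarrow> (nat \<Rightarrow> real \<Rightarrow> real) \<Rightarrow> real \<Rightarrow> real" where
  "rhs lam u x = - 2 * u 2 x - (1 - V x + lam) * u 0 x"

text \<open>A solution is carried together with its derivatives \<open>u 0, ..., u 4\<close>, in the
  same format as the families \<open>D\<close> of \<open>H4\<close>. It always lives on the whole
  line, also when only a half-line matters.\<close>

definition SolR :: "real \<Rightarrow> (real \<Rightarrow> real) \<Rightarrow> (nat \<Rightarrow> real \<Rightarrow> real) \<Rightarrow> bool" where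
  "SolR lam r u \<longleftrightarrow> (\<forall>k<4. \<forall>x. (u k has_real_derivative u (Suc k) x) (at x)) \<and>
     (\<forall>x. u 4 x = rhs lam u x + r x)"

abbreviation Sol :: "real \<Rightarrow> (nat \<Rightarrow> real \<Rightarrow> real) \<Rightarrow> bool" where
  "Sol lam \<equiv> SolR lam (\<lambda>x. 0)"

section \<open>Global existence by the Picard series\<close>

lemma V_cont_on: "continuous_on S V"
  using V_cont continuous_on_subset by blast

text \<open>The terms of the Picard series; the Picard iterates are their partial sums.\<close>

primrec picard :: "real \<Rightarrow> (real \<Rightarrow> real) \<Rightarrow> real \<Rightarrow> (nat \<Rightarrow> real) \<Rightarrow> nat \<Rightarrow> nat \<Rightarrow> real \<Rightarrow> real" where
  "picard lam r a c 0 = (\<lambda>k. antideriv a (c k) (if k = 3 then r else (\<lambda>x. 0)))"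
| "picard lam r a c (Suc n) = (\<lambda>k. antideriv a 0
     (if k = 3 then rhs lam (picard lam r a c n) else picard lam r a c n (Suc k)))"

lemma rhs_cont:
  assumes "continuous_on S (u 0)" "continuous_on S (u 2)"
  shows "continuous_on S (rhs lam u)"
  unfolding rhs_def by (intro continuous_intros assms V_cont_on)

lemma picard_cont:
  assumes "continuous_on UNIV r"
  shows "continuous_on UNIV (picard lam r a c n k)"
proof (induction n arbitrary: k)
  case 0
  then show ?case using assms by (auto intro!: antideriv(3))
next
  case (Suc n)
  then show ?case by (auto intro!: antideriv(3) rhs_cont)
qed

lemma picard_deriv:
  assumes r: "continuous_on UNIV r"
  shows "(picard lam r a c n k has_real_derivative
     (case n of 0 \<Rightarrow> if k = 3 then r x else 0
        | Suc n' \<Rightarrow> if k = 3 then rhs lam (picard lam r a c n') x else picard lam r a c n' (Suc k) x)) (at x)"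
proof (cases n)
  case 0
  have "continuous_on UNIV (if k = 3 then r else (\<lambda>x. 0))" using r by auto
  from antideriv(2)[OF this, of a "c k" x] show ?thesis using 0 by (auto split: if_splits)
next
  case (Suc n')
  have "continuous_on UNIV (if k = 3 then rhs lam (picard lam r a c n') else picard lam r a c n' (Suc k))"
    using picard_cont[OF r] by (auto intro!: rhs_cont)
  from antideriv(2)[OF this, of a 0 x] show ?thesis using Suc by (auto split: if_splits)
qed

lemma picard_at:
  assumes r: "continuous_on UNIV r"
  shows "picard lam r a c n k a = (if n = 0 then c k else 0)"
proof (cases n)
  case 0
  have "continuous_on UNIV (if k = 3 then r else (\<lambda>x. 0))" using r by auto
  from antideriv(1)[OF this, of a "c k"] show ?thesis using 0 by (auto split: if_splits)
next
  case (Suc n')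
  have "continuous_on UNIV (if k = 3 then rhs lam (picard lam r a c n') else picard lam r a c n' (Suc k))"
    using picard_cont[OF r] by (auto intro!: rhs_cont)
  from antideriv(1)[OF this, of a 0] show ?thesis using Suc by (auto split: if_splits)
qed

text \<open>The factor \<open>2 + |1 - V x + lam|\<close> bounds \<open>rhs\<close> by the larger of
  \<open>|u 0|\<close> and \<open>|u 2|\<close>; \<open>C >= 1\<close> covers the remaining rows,
  which merely shift the index. Uniformity in \<open>lam\<close> serves the comparison of solutions
  with different parameters.\<close>

lemma bounded_coeff:
  shows "\<exists>C\<ge>1. \<forall>x\<in>{\<alpha>..\<beta>}. \<forall>lam\<in>{-R..R}. 2 + \<bar>1 - V x + lam\<bar> \<le> C"
proof -
  have "\<exists>B. \<forall>x\<in>{\<alpha>..\<beta>}. \<bar>V x\<bar> \<le> B"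
    using compact_imp_bounded[OF compact_continuous_image[OF V_cont_on compact_Icc, of \<alpha> \<beta>]]
    by (simp add: bounded_iff)
  then obtain B where B: "\<And>x. x \<in> {\<alpha>..\<beta>} \<Longrightarrow> \<bar>V x\<bar> \<le> B" by blast
  show ?thesis
  proof (intro exI[of _ "3 + \<bar>B\<bar> + \<bar>R\<bar>"] conjI ballI)
    fix x lam assume "x \<in> {\<alpha>..\<beta>}" "lam \<in> {-R..R}"
    with B[of x] show "2 + \<bar>1 - V x + lam\<bar> \<le> 3 + \<bar>B\<bar> + \<bar>R\<bar>" by auto
  qed auto
qed

lemma bounded_coeff':
  obtains C where "C \<ge> 1" "\<And>x. \<bar>x - a\<bar> \<le> T \<Longrightarrow> 2 + \<bar>1 - V x + lam\<bar> \<le> C"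
proof -
  obtain C where "C \<ge> 1" "\<forall>x\<in>{a-T..a+T}. \<forall>l\<in>{-\<bar>lam\<bar>..\<bar>lam\<bar>}. 2 + \<bar>1 - V x + l\<bar> \<le> C"
    using bounded_coeff[of "a - T" "a + T" "\<bar>lam\<bar>"] by blast
  moreover have "lam \<in> {-\<bar>lam\<bar>..\<bar>lam\<bar>}" by auto
  ultimately show ?thesis by (intro that[of C]) (auto simp: abs_diff_le_iff)
qed

text \<open>Each term integrates its predecessor, so every step costs a factor \<open>C\<close> and
  one integration of the power of \<open>|x - a|\<close>. The constant \<open>K\<close> bounds the
  zeroth term, which already contains the initial data and the integrated inhomogeneity.\<close>

lemma picard_bound:
  assumes r: "continuous_on UNIV r"
  shows "\<exists>C\<ge>0. \<exists>K\<ge>0. \<forall>n. \<forall>k<4. \<forall>x. \<bar>x - a\<bar> \<le> T \<longrightarrow> \<bar>picard lam r a c n k x\<bar> \<le> K * C ^ n * \<bar>x - a\<bar> ^ n / fact n"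
proof -
  obtain C where C: "C \<ge> 1" "\<And>x. \<bar>x - a\<bar> \<le> T \<Longrightarrow> 2 + \<bar>1 - V x + lam\<bar> \<le> C"
    using bounded_coeff'[of a T lam] by blast
  have "\<exists>B. \<forall>x. \<bar>x - a\<bar> \<le> T \<longrightarrow> \<bar>picard lam r a c 0 k x\<bar> \<le> B" for k
    using compact_imp_bounded[OF compact_continuous_image[OF continuous_on_subset[OF picard_cont[OF r] subset_UNIV] compact_Icc, of lam a c 0 k "a - T" "a + T"]]
    by (fastforce simp: bounded_iff abs_le_iff simp del: picard.simps)
  then obtain B where B: "\<And>k x. \<bar>x - a\<bar> \<le> T \<Longrightarrow> \<bar>picard lam r a c 0 k x\<bar> \<le> B k" by metis
  define K where "K = (\<Sum>k<4. \<bar>B k\<bar>)"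
  have K: "K \<ge> 0" unfolding K_def by (simp add: sum_nonneg)
  have BK: "B k \<le> K" if "k < 4" for k
    using member_le_sum[of k "{..<4}" "\<lambda>k. \<bar>B k\<bar>"] that unfolding K_def by auto
  have "\<forall>k<4. \<forall>x. \<bar>x - a\<bar> \<le> T \<longrightarrow> \<bar>picard lam r a c n k x\<bar> \<le> K * C ^ n * \<bar>x - a\<bar> ^ n / fact n" for n
  proof (induction n)
    case 0
    show ?case
    proof (intro allI impI)
      fix k x assume "k < (4::nat)" "\<bar>x - a\<bar> \<le> T"
      with B[of x k] BK[of k] show "\<bar>picard lam r a c 0 k x\<bar> \<le> K * C ^ 0 * \<bar>x - a\<bar> ^ 0 / fact 0" by simp
    qed
  next
    case (Suc n)
    show ?case
    proof (intro allI impI)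
      fix k :: nat and x assume k: "k < 4" and x: "\<bar>x - a\<bar> \<le> T"
      show "\<bar>picard lam r a c (Suc n) k x\<bar> \<le> K * C ^ Suc n * \<bar>x - a\<bar> ^ Suc n / fact (Suc n)"
      proof (rule deriv_power_bound[where f = "\<lambda>x. if k = 3 then rhs lam (picard lam r a c n) x else picard lam r a c n (Suc k) x"])
        show "picard lam r a c (Suc n) k a = 0" using picard_at[OF r, of lam a c "Suc n"] by simp
      next
        fix t assume t: "\<bar>t - a\<bar> \<le> T"
        define b where "b = K * C ^ n * \<bar>t - a\<bar> ^ n / fact n"
        have b0: "b \<ge> 0" using K C unfolding b_def by auto
        have bb: "\<bar>picard lam r a c n k t\<bar> \<le> b" if "k < 4" for k using Suc t that unfolding b_def by blast
        have "\<bar>rhs lam (picard lam r a c n) t\<bar> \<le> 2 * \<bar>picard lam r a c n 2 t\<bar> + \<bar>1 - V t + lam\<bar> * \<bar>picard lam r a c n 0 t\<bar>"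
          unfolding rhs_def by (simp add: abs_mult[symmetric])
        also have "\<dots> \<le> 2 * b + \<bar>1 - V t + lam\<bar> * b"
          by (intro add_mono mult_left_mono bb) auto
        also have "\<dots> = (2 + \<bar>1 - V t + lam\<bar>) * b" by (simp add: algebra_simps)
        also have "\<dots> \<le> C * b" using C(2)[OF t] b0 by (rule mult_right_mono)
        finally have 1: "\<bar>rhs lam (picard lam r a c n) t\<bar> \<le> C * b" .
        have "1 * b \<le> C * b" using C b0 by (intro mult_right_mono) auto
        then have 2: "\<bar>picard lam r a c n (Suc k) t\<bar> \<le> C * b" if "k \<noteq> 3" using bb[of "Suc k"] k that by auto
        show "\<bar>if k = 3 then rhs lam (picard lam r a c n) t else picard lam r a c n (Suc k) t\<bar> \<le> K * C ^ Suc n * \<bar>t - a\<bar> ^ n / fact n"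
          using 1 2 unfolding b_def by (auto simp: algebra_simps)
      next
        fix t
        show "(picard lam r a c (Suc n) k has_real_derivative (if k = 3 then rhs lam (picard lam r a c n) t else picard lam r a c n (Suc k) t)) (at t)"
          using picard_deriv[OF r, of lam a c "Suc n" k t] by simp
      qed (use x in auto)
    qed
  qed
  then show ?thesis using C K by (intro exI[of _ C] conjI exI[of _ K]) auto
qed

lemma SolR_exists:
  assumes r: "continuous_on UNIV r"
  shows "\<exists>u. SolR lam r u \<and> (\<forall>k<4. u k a = c k)"
proof -
  define Y where "Y = picard lam r a c"
  \<comment> \<open>The termwise derivatives: the term of order 0 contributes the inhomogeneity, a
    later term the right-hand side formed with its predecessor.\<close>
  define Y' where "Y' n k x = (case n of 0 \<Rightarrow> if k = (3::nat) then r x else 0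
        | Suc n' \<Rightarrow> if k = 3 then rhs lam (Y n') x else Y n' (Suc k) x)" for n k x
  have bnd: "\<exists>M. summable M \<and> (\<forall>n. \<forall>k<4. \<forall>x. \<bar>x - a\<bar> \<le> T \<longrightarrow> \<bar>Y n k x\<bar> \<le> M n)" if "T \<ge> 0" for T
  proof -
    obtain C K where CK: "C \<ge> 0" "K \<ge> 0" "\<And>n k x. k < 4 \<Longrightarrow> \<bar>x - a\<bar> \<le> T \<Longrightarrow> \<bar>Y n k x\<bar> \<le> K * C ^ n * \<bar>x - a\<bar> ^ n / fact n"
      using picard_bound[OF r, of a T lam c] unfolding Y_def by metis
    have "\<bar>Y n k x\<bar> \<le> K * ((C * T) ^ n /\<^sub>R fact n)" if "k < 4" "\<bar>x - a\<bar> \<le> T" for n k x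
    proof -
      have "\<bar>x - a\<bar> ^ n \<le> T ^ n" using that by (intro power_mono) auto
      then have "K * C ^ n * \<bar>x - a\<bar> ^ n / fact n \<le> K * C ^ n * T ^ n / fact n"
        using CK by (intro divide_right_mono mult_left_mono) auto
      then show ?thesis using CK(3)[OF that, of n] by (simp add: power_mult_distrib divide_simps)
    qed
    moreover have "summable (\<lambda>n. K * ((C * T) ^ n /\<^sub>R fact n))"
      by (intro summable_mult summable_exp_generic)
    ultimately show ?thesis by blast
  qed
  have sm: "summable (\<lambda>n. Y n k x)" if "k < 4" for k x
  proof -
    obtain M where M: "summable M" "\<And>n k y. k < 4 \<Longrightarrow> \<bar>y - a\<bar> \<le> \<bar>x - a\<bar> \<Longrightarrow> \<bar>Y n k y\<bar> \<le> M n"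
      using bnd[of "\<bar>x - a\<bar>"] by auto
    show ?thesis by (rule summable_comparison_test'[OF M(1), of 0]) (use M that in auto)
  qed
  define u3 where "u3 k x = (\<Sum>n. Y n k x)" for k x
  \<comment> \<open>The fourth derivative is prescribed by the equation instead of a series; what
    remains is that \<open>u 4\<close> really differentiates \<open>u 3\<close>.\<close>
  define u where "u k x = (if k = 4 then rhs lam u3 x + r x else u3 k x)" for k x
  have derY: "(Y n k has_real_derivative Y' n k x) (at x)" for n k x
    using picard_deriv[OF r, of lam a c n k x] unfolding Y_def Y'_def by simp
  have Y'sums: "(\<lambda>n. Y' n k x) sums u (Suc k) x" if k: "k < 4" for k x
  proof -
    have "(\<lambda>n. Y' (Suc n) k x) sums (if k = 3 then rhs lam u3 x else u3 (Suc k) x)"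
    proof (cases "k = 3")
      case True
      have "(\<lambda>n. - 2 * Y n 2 x - (1 - V x + lam) * Y n 0 x) sums (- 2 * u3 2 x - (1 - V x + lam) * u3 0 x)"
        unfolding u3_def by (intro sums_diff sums_mult summable_sums sm) auto
      then show ?thesis using True by (simp add: Y'_def rhs_def)
    next
      case False
      then show ?thesis using k sm[of "Suc k" x] by (simp add: Y'_def u3_def summable_sums)
    qed
    then have "(\<lambda>n. Y' n k x) sums ((if k = 3 then rhs lam u3 x else u3 (Suc k) x) + Y' 0 k x)"
      by (rule sums_Suc)
    moreover have "(if k = 3 then rhs lam u3 x else u3 (Suc k) x) + Y' 0 k x = u (Suc k) x"
      using k by (auto simp: Y'_def u_def)
    ultimately show ?thesis by simp
  qed
  have der: "(u k has_real_derivative u (Suc k) x) (at x)" if k: "k < 4" for k x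
  proof -
    define T where "T = \<bar>x - a\<bar> + 1"
    obtain M where M: "summable M" "\<And>n k y. k < 4 \<Longrightarrow> \<bar>y - a\<bar> \<le> T \<Longrightarrow> \<bar>Y n k y\<bar> \<le> M n"
      using bnd[of T] by (auto simp: T_def)
    obtain C where C: "C \<ge> 1" "\<And>x. \<bar>x - a\<bar> \<le> T \<Longrightarrow> 2 + \<bar>1 - V x + lam\<bar> \<le> C"
      using bounded_coeff'[of a T lam] by blast
    have M0: "M n \<ge> 0" for n using M(2)[of 0 a n] by (auto simp: T_def)
    let ?S = "{a - T..a + T}"
    have "uniformly_convergent_on ?S (\<lambda>n y. \<Sum>i<n. Y' i k y)"
    proof (rule Weierstrass_m_test'_ev)
      \<comment> \<open>The differentiated series inherits the majorant of the series itself,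
        shifted by one and multiplied by \<open>C\<close>.\<close>
      show "\<forall>\<^sub>F n in sequentially. \<forall>y\<in>?S. norm (Y' n k y) \<le> C * M (n - 1)"
      proof (rule eventually_sequentiallyI[of 1], rule ballI)
        fix n :: nat and y assume n: "1 \<le> n" and y: "y \<in> ?S"
        obtain n' where n': "n = Suc n'" using n by (cases n) auto
        have y': "\<bar>y - a\<bar> \<le> T" using y by auto
        have bb: "\<bar>Y n' k y\<bar> \<le> M n'" if "k < 4" for k using M(2)[OF that y'] .
        have "\<bar>rhs lam (Y n') y\<bar> \<le> 2 * \<bar>Y n' 2 y\<bar> + \<bar>1 - V y + lam\<bar> * \<bar>Y n' 0 y\<bar>"
          unfolding rhs_def by (simp add: abs_mult[symmetric])
        also have "\<dots> \<le> 2 * M n' + \<bar>1 - V y + lam\<bar> * M n'"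
          by (intro add_mono mult_left_mono bb) auto
        also have "\<dots> = (2 + \<bar>1 - V y + lam\<bar>) * M n'" by (simp add: algebra_simps)
        also have "\<dots> \<le> C * M n'" using C(2)[OF y'] M0 by (rule mult_right_mono)
        finally have 1: "\<bar>rhs lam (Y n') y\<bar> \<le> C * M n'" .
        have "1 * M n' \<le> C * M n'" using C M0 by (intro mult_right_mono) auto
        then have "\<bar>Y n' (Suc k) y\<bar> \<le> C * M n'" if "k \<noteq> 3" using bb[of "Suc k"] k that by auto
        with 1 show "norm (Y' n k y) \<le> C * M (n - 1)" using n' by (auto simp: Y'_def)
      qed
      show "summable (\<lambda>n. C * M (n - 1))"
        using M(1) by (subst summable_Suc_iff[symmetric]) (auto intro: summable_mult)
    qed
    moreover have "x \<in> interior ?S"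
      unfolding interior_atLeastAtMost_real T_def by (auto simp: abs_if)
    moreover have "a \<in> ?S" by (simp add: T_def)
    ultimately have "((\<lambda>x. \<Sum>n. Y n k x) has_real_derivative (\<Sum>n. Y' n k x)) (at x)"
      using has_field_derivative_series'(2)[OF convex_real_interval(5), where f = "\<lambda>n. Y n k" and f' = "\<lambda>n. Y' n k",
          OF has_field_derivative_at_within[OF derY] _ _ sm[OF k]] by blast
    moreover have "(\<Sum>n. Y' n k x) = u (Suc k) x" using Y'sums[OF k] by (simp add: sums_iff)
    moreover have "u k = (\<lambda>x. \<Sum>n. Y n k x)" using k by (auto simp: u_def u3_def)
    ultimately show ?thesis by simp
  qed
  have "u k a = c k" if "k < 4" for k
  proof -
    have "(\<lambda>n. Y n k a) = (\<lambda>n. if n = 0 then c k else 0)"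
      using picard_at[OF r, of lam a c] by (auto simp: Y_def)
    moreover have "(\<lambda>n. if n = 0 then c k else 0) sums c k" using sums_single[of 0 "\<lambda>_. c k"] by simp
    ultimately show ?thesis using that by (simp add: u_def u3_def sums_iff)
  qed
  moreover have "SolR lam r u" unfolding SolR_def
    using der by (auto simp: u_def rhs_def)
  ultimately show ?thesis by blast
qed

lemma SolR_deriv: "SolR lam r u \<Longrightarrow> k < 4 \<Longrightarrow> (u k has_real_derivative u (Suc k) x) (at x)"
  by (simp add: SolR_def)

lemma SolR_4: "SolR lam r u \<Longrightarrow> u 4 x = rhs lam u x + r x"
  by (simp add: SolR_def)

lemma SolR_cont: "SolR lam r u \<Longrightarrow> k < 4 \<Longrightarrow> continuous_on S (u k)"
  by (meson SolR_deriv DERIV_isCont continuous_at_imp_continuous_on)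

lemma Sol_cont: "Sol lam u \<Longrightarrow> k \<le> 4 \<Longrightarrow> continuous_on S (u k)"
proof (cases "k = 4")
  case True
  assume u: "Sol lam u"
  have "u 4 = rhs lam u" using SolR_4[OF u] by auto
  then show ?thesis using True rhs_cont[of S u lam] SolR_cont[OF u] by auto
qed (auto intro: SolR_cont)

section \<open>Superposition, uniqueness and continuous dependence\<close>

lemma SolR_lincomb:
  assumes "\<And>i. i < n \<Longrightarrow> SolR lam (r i) (u i)"
  shows "SolR lam (\<lambda>x. \<Sum>i<n. c i * r i x) (\<lambda>k x. \<Sum>i<n. c i * u i k x)"
  unfolding SolR_def
proof (intro conjI allI impI)
  fix k x assume "k < (4::nat)"
  then show "((\<lambda>x. \<Sum>i<n. c i * u i k x) has_real_derivative (\<Sum>i<n. c i * u i (Suc k) x)) (at x)"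
    using SolR_deriv[OF assms] by (auto intro!: derivative_eq_intros sum.cong)
next
  fix x
  have "(\<Sum>i<n. c i * u i 4 x) = (\<Sum>i<n. c i * (rhs lam (u i) x + r i x))"
    using SolR_4[OF assms] by simp
  also have "\<dots> = rhs lam (\<lambda>k x. \<Sum>i<n. c i * u i k x) x + (\<Sum>i<n. c i * r i x)"
    unfolding rhs_def by (simp add: sum_distrib_left sum.distrib sum_subtractf algebra_simps sum_negf)
  finally show "(\<Sum>i<n. c i * u i 4 x) = rhs lam (\<lambda>k x. \<Sum>i<n. c i * u i k x) x + (\<Sum>i<n. c i * r i x)" .
qed

lemma Sol_lincomb:
  assumes "\<And>i. i < n \<Longrightarrow> Sol lam (u i)"
  shows "Sol lam (\<lambda>k x. \<Sum>i<n. c i * u i k x)"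
  using SolR_lincomb[of n lam "\<lambda>i x. 0" u c] assms by simp

lemma Sol_zero: "Sol lam (\<lambda>k x. 0)"
  by (auto simp: SolR_def rhs_def)

text \<open>Gronwall: the squared distance N satisfies \<open>\<bar>N'\<bar> \<le> 2 C (N + \<eta>)\<close> with
  \<open>\<eta>\<close> measuring the difference of the two parameters.\<close>

lemma Sol_gronwall:
  assumes S: "S = {\<alpha>..\<beta>}" and a: "a \<in> S"
    and du: "\<And>k x. k < 4 \<Longrightarrow> x \<in> S \<Longrightarrow> (u k has_real_derivative u (Suc k) x) (at x within S)"
    and u4: "\<And>x. x \<in> S \<Longrightarrow> u 4 x = rhs lam u x"
    and dv: "\<And>k x. k < 4 \<Longrightarrow> x \<in> S \<Longrightarrow> (v k has_real_derivative v (Suc k) x) (at x within S)"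
    and v4: "\<And>x. x \<in> S \<Longrightarrow> v 4 x = rhs lam' v x"
    and C: "C \<ge> 1" "\<And>x. x \<in> S \<Longrightarrow> 2 + \<bar>1 - V x + lam\<bar> \<le> C"
    and B: "\<And>x. x \<in> S \<Longrightarrow> \<bar>v 0 x\<bar> \<le> B" and x: "x \<in> S"
  defines "N \<equiv> \<lambda>x. \<Sum>k<4. (u k x - v k x)\<^sup>2"
  shows "N x \<le> (N a + (B * (lam - lam'))\<^sup>2) * exp (4 * C * \<bar>x - a\<bar>)"
proof -
  define \<eta> where "\<eta> = (B * (lam - lam'))\<^sup>2"
  define d where "d k x = u k x - v k x" for k x
  define N' where "N' x = (\<Sum>k<4. 2 * d k x * d (Suc k) x)" for x
  have dd: "(d k has_real_derivative d (Suc k) x) (at x within S)" if "k < 4" "x \<in> S" for k x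
    unfolding d_def by (intro derivative_intros du dv that)
  have NN: "N x = (\<Sum>k<4. (d k x)\<^sup>2)" for x by (simp add: N_def d_def)
  have N'der: "(N has_real_derivative N' x) (at x within S)" if "x \<in> S" for x
    unfolding NN[abs_def] N'_def
    by (auto intro!: derivative_eq_intros dd that simp: algebra_simps)
  have N'bd: "\<bar>N' x\<bar> \<le> 4 * C * (N x + \<eta>)" if xS: "x \<in> S" for x
  proof -
    have d4: "d 4 x = - 2 * d 2 x - (1 - V x + lam) * d 0 x - (lam - lam') * v 0 x"
      using u4[OF xS] v4[OF xS] by (simp add: d_def rhs_def algebra_simps)
    have "\<bar>(lam - lam') * v 0 x\<bar>\<^sup>2 \<le> \<bar>B * (lam - lam')\<bar>\<^sup>2"
      using mult_left_mono[OF B[OF xS], of "\<bar>lam - lam'\<bar>"] B[OF xS]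
      by (intro power_mono) (auto simp: abs_mult mult.commute)
    then have e: "((lam - lam') * v 0 x)\<^sup>2 \<le> \<eta>" by (simp add: \<eta>_def)
    have ab: "\<bar>2 * p * q\<bar> \<le> p\<^sup>2 + q\<^sup>2" for p q :: real
      using sum_squares_bound[of p q] sum_squares_bound[of "-p" q] by (auto simp: abs_le_iff)
    have Nx: "N x = (d 0 x)\<^sup>2 + (d 1 x)\<^sup>2 + (d 2 x)\<^sup>2 + (d 3 x)\<^sup>2"
      unfolding NN by (simp add: numeral_eq_Suc)
    have "N' x = 2 * d 0 x * d 1 x + 2 * d 1 x * d 2 x + 2 * d 2 x * d 3 x + 2 * d 3 x * d 4 x"
      unfolding N'_def by (simp add: numeral_eq_Suc)
    then have "\<bar>N' x\<bar> \<le> \<bar>2 * d 0 x * d 1 x\<bar> + \<bar>2 * d 1 x * d 2 x\<bar> + \<bar>2 * d 2 x * d 3 x\<bar> + \<bar>2 * d 3 x * d 4 x\<bar>"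
      by linarith
    also have "\<dots> \<le> 2 * N x + \<bar>2 * d 3 x * d 4 x\<bar>"
    proof -
      have "A + B + C + D \<le> 2 * (p + q + r + s) + D"
        if "A \<le> p + q" "B \<le> q + r" "C \<le> r + s" "0 \<le> p" "0 \<le> s" for A B C D p q r s :: real
        using that by (simp add: distrib_left)
      from this[OF ab[of "d 0 x" "d 1 x"] ab[of "d 1 x" "d 2 x"] ab[of "d 2 x" "d 3 x"]]
      show ?thesis unfolding Nx by simp
    qed
    also have "\<bar>2 * d 3 x * d 4 x\<bar> = \<bar>- 2 * (2 * d 3 x * d 2 x) - (1 - V x + lam) * (2 * d 3 x * d 0 x) - 2 * d 3 x * ((lam - lam') * v 0 x)\<bar>"
      unfolding d4 by (simp add: algebra_simps)
    also have "\<dots> \<le> 2 * \<bar>2 * d 3 x * d 2 x\<bar> + \<bar>1 - V x + lam\<bar> * \<bar>2 * d 3 x * d 0 x\<bar> + \<bar>2 * d 3 x * ((lam - lam') * v 0 x)\<bar>"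
    proof -
      have "\<bar>- 2 * p - q - r\<bar> \<le> 2 * \<bar>p\<bar> + \<bar>q\<bar> + \<bar>r\<bar>" for p q r :: real by linarith
      from this[of "2 * d 3 x * d 2 x" "(1 - V x + lam) * (2 * d 3 x * d 0 x)"] show ?thesis
        by (simp only: abs_mult[of "1 - V x + lam"])
    qed
    also have "\<dots> \<le> 2 * N x + \<bar>1 - V x + lam\<bar> * N x + (N x + \<eta>)"
    proof (intro add_mono mult_left_mono)
      show "\<bar>2 * d 3 x * d 2 x\<bar> \<le> N x" using ab[of "d 3 x" "d 2 x"]
        zero_le_power2[of "d 0 x"] zero_le_power2[of "d 1 x"] unfolding Nx by linarith
      show "\<bar>2 * d 3 x * d 0 x\<bar> \<le> N x" using ab[of "d 3 x" "d 0 x"]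
        zero_le_power2[of "d 2 x"] zero_le_power2[of "d 1 x"] unfolding Nx by linarith
      show "\<bar>2 * d 3 x * ((lam - lam') * v 0 x)\<bar> \<le> N x + \<eta>" using ab[of "d 3 x" "(lam - lam') * v 0 x"] e
        zero_le_power2[of "d 0 x"] zero_le_power2[of "d 1 x"] zero_le_power2[of "d 2 x"] unfolding Nx by linarith
    qed auto
    also have "2 * N x + (2 * N x + \<bar>1 - V x + lam\<bar> * N x + (N x + \<eta>)) = (2 + \<bar>1 - V x + lam\<bar>) * N x + 3 * N x + \<eta>"
      by (simp add: algebra_simps)
    also have "\<dots> \<le> C * N x + 3 * (C * N x) + C * \<eta>"
    proof -
      have N0: "N x \<ge> 0" unfolding NN by (simp add: sum_nonneg)
      have "(2 + \<bar>1 - V x + lam\<bar>) * N x \<le> C * N x" by (rule mult_right_mono[OF C(2)[OF xS] N0])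
      moreover have "1 * N x \<le> C * N x" by (rule mult_right_mono[OF C(1) N0])
      moreover have "1 * \<eta> \<le> C * \<eta>" by (rule mult_right_mono[OF C(1)]) (simp add: \<eta>_def)
      ultimately show ?thesis by linarith
    qed
    also have "\<dots> \<le> 4 * C * (N x + \<eta>)" using C(1) by (simp add: algebra_simps \<eta>_def)
    finally show ?thesis by simp
  qed
  have Nc: "continuous_on S N" by (rule DERIV_continuous_on) (rule N'der)
  \<comment> \<open>The bound on \<open>|N'|\<close> makes \<open>N + \<eta>\<close> increasing with
    the weight \<open>exp (4 C x)\<close> and decreasing with \<open>exp (- 4 C x)\<close>. The
    first covers points left of \<open>a\<close>, the second points right of it.\<close>
  have main: "(N y + \<eta>) * exp (4 * C * y) \<le> (N z + \<eta>) * exp (4 * C * z)"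
    if yz: "y \<le> z" "y \<in> S" "z \<in> S" for y z
  proof (rule DERIV_nonneg_imp_increasing_open[OF yz(1)])
    show "continuous_on {y..z} (\<lambda>x. (N x + \<eta>) * exp (4 * C * x))"
      using continuous_on_subset[OF Nc] yz S by (intro continuous_intros) auto
    fix t assume t: "y < t" "t < z"
    have int: "t \<in> interior S" using t yz(2,3) unfolding S interior_atLeastAtMost_real by simp
    then have tS: "t \<in> S" using interior_subset by blast
    have "(N has_real_derivative N' t) (at t)" using N'der[OF tS] unfolding at_within_interior[OF int] .
    then have "((\<lambda>x. (N x + \<eta>) * exp (4 * C * x)) has_real_derivative (N' t + 4 * C * (N t + \<eta>)) * exp (4 * C * t)) (at t)"
      by (rule exp_weight_deriv)
    moreover have "(N' t + 4 * C * (N t + \<eta>)) * exp (4 * C * t) \<ge> 0"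
    proof (rule mult_nonneg_nonneg)
      show "0 \<le> N' t + 4 * C * (N t + \<eta>)" using N'bd[OF tS] unfolding abs_le_iff by linarith
    qed simp
    ultimately show "\<exists>D. ((\<lambda>x. (N x + \<eta>) * exp (4 * C * x)) has_real_derivative D) (at t) \<and> 0 \<le> D" by blast
  qed
  have main': "(N z + \<eta>) * exp (- 4 * C * z) \<le> (N y + \<eta>) * exp (- 4 * C * y)"
    if yz: "y \<le> z" "y \<in> S" "z \<in> S" for y z
  proof (rule DERIV_nonpos_imp_decreasing_open[OF yz(1)])
    show "continuous_on {y..z} (\<lambda>x. (N x + \<eta>) * exp (- 4 * C * x))"
      using continuous_on_subset[OF Nc] yz S by (intro continuous_intros) auto
    fix t assume t: "y < t" "t < z"
    have int: "t \<in> interior S" using t yz(2,3) unfolding S interior_atLeastAtMost_real by simp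
    then have tS: "t \<in> S" using interior_subset by blast
    have "(N has_real_derivative N' t) (at t)" using N'der[OF tS] unfolding at_within_interior[OF int] .
    then have "((\<lambda>x. (N x + \<eta>) * exp (- 4 * C * x)) has_real_derivative (N' t - 4 * C * (N t + \<eta>)) * exp (- 4 * C * t)) (at t)"
      using exp_weight_deriv[of N "N' t" t \<eta> "- 4 * C"] by simp
    moreover have "(N' t - 4 * C * (N t + \<eta>)) * exp (- 4 * C * t) \<le> 0"
    proof (rule mult_nonpos_nonneg)
      show "N' t - 4 * C * (N t + \<eta>) \<le> 0" using N'bd[OF tS] unfolding abs_le_iff by linarith
    qed simp
    ultimately show "\<exists>D. ((\<lambda>x. (N x + \<eta>) * exp (- 4 * C * x)) has_real_derivative D) (at t) \<and> D \<le> 0" by blast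
  qed
  have "N x + \<eta> \<le> (N a + \<eta>) * exp (4 * C * \<bar>x - a\<bar>)"
  proof (cases "a \<le> x")
    case True
    from main'[OF True a x] have "(N x + \<eta>) * exp (- 4 * C * x) * exp (4 * C * x) \<le> (N a + \<eta>) * exp (- 4 * C * a) * exp (4 * C * x)"
      by (intro mult_right_mono) auto
    then show ?thesis using True by (simp add: mult.assoc exp_add[symmetric] algebra_simps)
  next
    case False
    then have "x \<le> a" by simp
    from main[OF this x a] have "(N x + \<eta>) * exp (4 * C * x) * exp (- 4 * C * x) \<le> (N a + \<eta>) * exp (4 * C * a) * exp (- 4 * C * x)"
      by (intro mult_right_mono) auto
    then show ?thesis using False by (simp add: mult.assoc exp_add[symmetric] algebra_simps)
  qed
  moreover have "\<eta> \<ge> 0" by (simp add: \<eta>_def)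
  ultimately show ?thesis unfolding \<eta>_def by linarith
qed


text \<open>Both constants depend only on the reference solution \<open>v\<close> and the window,
  not on the competitor \<open>u\<close> or its parameter. A whole sequence of solutions can
  therefore be compared with its limit at once.\<close>

lemma Sol_gronwall_bound:
  assumes "a \<in> {\<alpha>..\<beta>}" "Sol lam v"
  shows "\<exists>B C. \<forall>lam' u x k. Sol lam' u \<longrightarrow> \<bar>lam' - lam\<bar> \<le> 1 \<longrightarrow> x \<in> {\<alpha>..\<beta>} \<longrightarrow> k < 4 \<longrightarrow>
      (u k x - v k x)\<^sup>2 \<le> ((\<Sum>k<4. (u k a - v k a)\<^sup>2) + (B * (lam' - lam))\<^sup>2) * C"
proof -
  obtain C where C: "C \<ge> 1" "\<forall>x\<in>{\<alpha>..\<beta>}. \<forall>l\<in>{-(\<bar>lam\<bar>+1)..\<bar>lam\<bar>+1}. 2 + \<bar>1 - V x + l\<bar> \<le> C"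
    using bounded_coeff[of \<alpha> \<beta> "\<bar>lam\<bar>+1"] by blast
  have "\<exists>B. \<forall>x\<in>{\<alpha>..\<beta>}. \<bar>v 0 x\<bar> \<le> B"
    using compact_imp_bounded[OF compact_continuous_image[OF Sol_cont[OF assms(2), of 0] compact_Icc, of \<alpha> \<beta>]]
    by (simp add: bounded_iff)
  then obtain B where B: "\<And>x. x \<in> {\<alpha>..\<beta>} \<Longrightarrow> \<bar>v 0 x\<bar> \<le> B" by blast
  show ?thesis
  proof (intro exI allI impI)
    fix lam' u x k assume u: "Sol lam' u" and l: "\<bar>lam' - lam\<bar> \<le> 1" and x: "x \<in> {\<alpha>..\<beta>}" and k: "k < (4::nat)"
    have "(\<Sum>k<4. (u k x - v k x)\<^sup>2) \<le> ((\<Sum>k<4. (u k a - v k a)\<^sup>2) + (B * (lam' - lam))\<^sup>2) * exp (4 * C * \<bar>x - a\<bar>)"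
    proof (rule Sol_gronwall[where S = "{\<alpha>..\<beta>}" and lam = lam' and lam' = lam and v = v and u = u, OF refl assms(1) _ _ _ _ C(1) _ B x])
      fix y assume "y \<in> {\<alpha>..\<beta>}"
      moreover have "lam' \<in> {-(\<bar>lam\<bar>+1)..\<bar>lam\<bar>+1}" using l by auto
      ultimately show "2 + \<bar>1 - V y + lam'\<bar> \<le> C" using C(2) by blast
    qed (use SolR_deriv[OF u] SolR_deriv[OF assms(2)] SolR_4[OF u] SolR_4[OF assms(2)] in \<open>auto intro: has_field_derivative_at_within\<close>)
    also have "\<dots> \<le> ((\<Sum>k<4. (u k a - v k a)\<^sup>2) + (B * (lam' - lam))\<^sup>2) * exp (4 * C * (\<beta> - \<alpha>))"
    proof (rule mult_left_mono)
      have "\<bar>x - a\<bar> \<le> \<beta> - \<alpha>" using x assms(1) by auto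
      then show "exp (4 * C * \<bar>x - a\<bar>) \<le> exp (4 * C * (\<beta> - \<alpha>))" using C(1) by (simp add: mult_left_mono)
    qed (auto intro!: add_nonneg_nonneg sum_nonneg)
    finally show "(u k x - v k x)\<^sup>2 \<le> ((\<Sum>k<4. (u k a - v k a)\<^sup>2) + (B * (lam' - lam))\<^sup>2) * exp (4 * C * (\<beta> - \<alpha>))"
      using member_le_sum[of k "{..<4}" "\<lambda>k. (u k x - v k x)\<^sup>2"] k by auto
  qed
qed

lemma Sol_unique:
  assumes u: "Sol lam u" and v: "Sol lam v" and eq: "\<And>k. k < 4 \<Longrightarrow> u k a = v k a" and k: "k \<le> 4"
  shows "u k x = v k x"
proof -
  have a: "a \<in> {min a x..max a x}" by auto
  obtain B C where *: "\<And>lam' u x' k. Sol lam' u \<Longrightarrow> \<bar>lam' - lam\<bar> \<le> 1 \<Longrightarrow> x' \<in> {min a x..max a x} \<Longrightarrow> k < 4 \<Longrightarrow>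
      (u k x' - v k x')\<^sup>2 \<le> ((\<Sum>k<4. (u k a - v k a)\<^sup>2) + (B * (lam' - lam))\<^sup>2) * C"
    using Sol_gronwall_bound[OF a v] by blast
  have lt: "u k x = v k x" if "k < 4" for k
  proof -
    have "(u k x - v k x)\<^sup>2 \<le> 0" using *[OF u _ _ that, of x] eq by simp
    then show ?thesis by simp
  qed
  show ?thesis
  proof (cases "k = 4")
    case True
    then show ?thesis using SolR_4[OF u] SolR_4[OF v] lt[of 0] lt[of 2] by (simp add: rhs_def)
  qed (use k lt in auto)
qed

lemma Sol_zero_data:
  assumes "Sol lam u" and "\<And>k. k < 4 \<Longrightarrow> u k a = 0" and "k \<le> 4"
  shows "u k x = 0"
  using Sol_unique[OF assms(1) Sol_zero, of a k x] assms by simp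

lemma Sol_limit_uniform:
  assumes U: "\<And>n. Sol (l n) (U n)" and l: "l \<longlonglongrightarrow> lam" and u: "Sol lam u"
    and lim: "\<And>k. k < 4 \<Longrightarrow> (\<lambda>n. U n k a) \<longlonglongrightarrow> u k a" and k: "k < 4"
  shows "uniform_limit {\<alpha>..\<beta>} (\<lambda>n. U n k) (u k) sequentially"
proof -
  have a: "a \<in> {min a \<alpha>..max a \<beta>}" by auto
  obtain B C where *: "\<And>lam' u' x k. Sol lam' u' \<Longrightarrow> \<bar>lam' - lam\<bar> \<le> 1 \<Longrightarrow> x \<in> {min a \<alpha>..max a \<beta>} \<Longrightarrow> k < 4 \<Longrightarrow>
      (u' k x - u k x)\<^sup>2 \<le> ((\<Sum>k<4. (u' k a - u k a)\<^sup>2) + (B * (lam' - lam))\<^sup>2) * C"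
    using Sol_gronwall_bound[OF a u] by blast
  define s where "s n = ((\<Sum>k<4. (U n k a - u k a)\<^sup>2) + (B * (l n - lam))\<^sup>2) * C" for n
  have "s \<longlonglongrightarrow> ((\<Sum>k<(4::nat). (u k a - u k a)\<^sup>2) + (B * (lam - lam))\<^sup>2) * C"
    unfolding s_def by (intro tendsto_intros lim l) auto
  then have s: "s \<longlonglongrightarrow> 0" by simp
  show ?thesis
  proof (rule uniform_limitI)
    fix e :: real assume e: "e > 0"
    have "\<forall>\<^sub>F n in sequentially. s n < e\<^sup>2" using order_tendstoD(2)[OF s] e by simp
    moreover have "\<forall>\<^sub>F n in sequentially. dist (l n) lam < 1" using tendstoD[OF l, of 1] by simp
    ultimately show "\<forall>\<^sub>F n in sequentially. \<forall>x\<in>{\<alpha>..\<beta>}. dist (U n k x) (u k x) < e"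
    proof eventually_elim
      case (elim n)
      show ?case
      proof
        fix x assume "x \<in> {\<alpha>..\<beta>}"
        then have x: "x \<in> {min a \<alpha>..max a \<beta>}" by auto
        have "\<bar>l n - lam\<bar> \<le> 1" using elim(2) by (simp add: dist_real_def)
        from *[OF U this x k] have "(U n k x - u k x)\<^sup>2 < e\<^sup>2" using elim(1) by (simp add: s_def)
        then have "\<bar>U n k x - u k x\<bar> < e" using e by (metis abs_le_square_iff abs_of_pos linorder_not_le)
        then show "dist (U n k x) (u k x) < e" by (simp add: dist_real_def)
      qed
    qed
  qed
qed

text \<open>The point of evaluation may move as well: in the limit of half-line problems the clamped
  end itself converges.\<close>

lemma Sol_limit:
  assumes U: "\<And>n. Sol (l n) (U n)" and l: "l \<longlonglongrightarrow> lam" and u: "Sol lam u"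
    and lim: "\<And>k. k < 4 \<Longrightarrow> (\<lambda>n. U n k a) \<longlonglongrightarrow> u k a" and k: "k < 4" and xs: "xs \<longlonglongrightarrow> x"
  shows "(\<lambda>n. U n k (xs n)) \<longlonglongrightarrow> u k x"
proof -
  have ul: "uniform_limit {x-1..x+1} (\<lambda>n. U n k) (u k) sequentially"
    by (rule Sol_limit_uniform[OF U l u lim k])
  have c: "(\<lambda>n. u k (xs n)) \<longlonglongrightarrow> u k x"
    using continuous_on_tendsto_compose[OF SolR_cont[OF u k, of UNIV] xs] by simp
  have "(\<lambda>n. U n k (xs n) - u k (xs n)) \<longlonglongrightarrow> 0"
  proof (rule tendstoI)
    fix e :: real assume "e > 0"
    have "\<forall>\<^sub>F n in sequentially. dist (xs n) x < 1" using tendstoD[OF xs, of 1] by simp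
    with uniform_limitD[OF ul \<open>e > 0\<close>]
    show "\<forall>\<^sub>F n in sequentially. dist (U n k (xs n) - u k (xs n)) 0 < e"
    proof eventually_elim
      case (elim n)
      have "xs n \<in> {x-1..x+1}" using elim(2) by (auto simp: dist_real_def abs_if split: if_splits)
      with elim(1) show ?case by (auto simp: dist_real_def)
    qed
  qed
  from tendsto_add[OF this c] show ?thesis by simp
qed

lemma V_bounded: obtains K where "K \<ge> 0" "\<And>x. \<bar>V x\<bar> \<le> K"
proof -
  obtain b where b: "\<And>x. x \<ge> b \<Longrightarrow> \<bar>V x - (-m)\<bar> < 1"
    using tendstoD[OF V_top, of 1] unfolding eventually_at_top_linorder dist_real_def by auto
  obtain a where a: "\<And>x. x \<le> a \<Longrightarrow> \<bar>V x - (-m)\<bar> < 1"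
    using tendstoD[OF V_bot, of 1] unfolding eventually_at_bot_linorder dist_real_def by auto
  have "\<exists>B. \<forall>x\<in>{a..b}. \<bar>V x\<bar> \<le> B"
    using compact_imp_bounded[OF compact_continuous_image[OF V_cont_on compact_Icc, of a b]]
    by (simp add: bounded_iff)
  then obtain B where B: "\<And>x. x \<in> {a..b} \<Longrightarrow> \<bar>V x\<bar> \<le> B" by blast
  show ?thesis
  proof (rule that[of "max \<bar>B\<bar> (m + 1)"])
    fix x
    consider "x \<le> a" | "x \<ge> b" | "x \<in> {a..b}" by fastforce
    then show "\<bar>V x\<bar> \<le> max \<bar>B\<bar> (m + 1)"
    proof cases
      case 1 then show ?thesis using a[of x] m_pos by linarith
    next
      case 2 then show ?thesis using b[of x] m_pos by linarith
    next
      case 3 then show ?thesis using B[of x] by linarith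
    qed
  qed auto
qed

end

subsection \<open>The quadratic form\<close>

text \<open>A concrete substitute for \<open>H^2\<close>: continuously differentiable, with a second
  derivative off a finite set. The finite set is what permits gluing at breakpoints and extension by
  zero.\<close>

definition pw :: "(nat \<Rightarrow> real \<Rightarrow> real) \<Rightarrow> bool" where
  "pw v \<longleftrightarrow> continuous_on UNIV (v 0) \<and> continuous_on UNIV (v 1) \<and> v 2 \<in> borel_measurable borel \<and>
     (\<exists>F. finite F \<and> (\<forall>x. x \<notin> F \<longrightarrow> (v 0 has_real_derivative v 1 x) (at x) \<and> (v 1 has_real_derivative v 2 x) (at x)))"

text \<open>The form domain: v 0, v 1, v 2 stand for a function and its first two derivatives; the
  functions live on the whole line and vanish outside S, which encodes the clamped boundary
  conditions at the end points of S.\<close>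

definition HS :: "real set \<Rightarrow> (nat \<Rightarrow> real \<Rightarrow> real) \<Rightarrow> bool" where
  "HS S v \<longleftrightarrow> pw v \<and> (\<forall>k\<le>2. (\<lambda>x. (v k x)\<^sup>2) integrable_on UNIV) \<and> (\<forall>k\<le>2. \<forall>x. x \<notin> S \<longrightarrow> v k x = 0)"

text \<open>The test functions: compact support, so that integration by parts leaves no terms at
  infinity.\<close>

definition Hc :: "real set \<Rightarrow> (nat \<Rightarrow> real \<Rightarrow> real) \<Rightarrow> bool" where
  "Hc S v \<longleftrightarrow> (\<exists>T. HS (S \<inter> {-T..T}) v)"

definition lincomb :: "nat \<Rightarrow> (nat \<Rightarrow> real) \<Rightarrow> (nat \<Rightarrow> nat \<Rightarrow> real \<Rightarrow> real) \<Rightarrow> nat \<Rightarrow> real \<Rightarrow> real" where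
  "lincomb d c w = (\<lambda>k x. \<Sum>i<d. c i * w i k x)"

definition add_scaled :: "(nat \<Rightarrow> real \<Rightarrow> real) \<Rightarrow> real \<Rightarrow> (nat \<Rightarrow> real \<Rightarrow> real) \<Rightarrow> nat \<Rightarrow> real \<Rightarrow> real" where
  "add_scaled v t w = (\<lambda>k x. v k x + t * w k x)"

lemma add_scaled_lincomb: "add_scaled v t w = lincomb 2 (\<lambda>i. if i = 0 then 1 else t) (\<lambda>i. if i = 0 then v else w)"
  by (simp add: add_scaled_def lincomb_def numeral_2_eq_2)

lemma HS_mono: "HS S v \<Longrightarrow> S \<subseteq> S' \<Longrightarrow> HS S' v"
  unfolding HS_def by blast

lemma HS_UNIV: "HS S v \<Longrightarrow> HS UNIV v"
  using HS_mono by blast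

lemma Hc_HS: "Hc S v \<Longrightarrow> HS S v"
  unfolding Hc_def using HS_mono by blast

lemma Hc_mono: "Hc S v \<Longrightarrow> S \<subseteq> S' \<Longrightarrow> Hc S' v"
  unfolding Hc_def using HS_mono by (meson Int_mono order_refl)

lemma HS_zero_off: "HS S v \<Longrightarrow> k \<le> 2 \<Longrightarrow> x \<notin> S \<Longrightarrow> v k x = 0"
  unfolding HS_def by blast

lemma HS_borel:
  assumes "HS S v" "k \<le> 2"
  shows "v k \<in> borel_measurable borel"
proof -
  have "continuous_on UNIV (v 0)" "continuous_on UNIV (v 1)" "v 2 \<in> borel_measurable borel"
    using assms unfolding HS_def pw_def by auto
  moreover have "k = 0 \<or> k = 1 \<or> k = 2" using assms(2) by auto
  ultimately show ?thesis using borel_measurable_continuous_onI by blast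
qed

lemma HS_cont: "HS S v \<Longrightarrow> k \<le> 1 \<Longrightarrow> continuous_on A (v k)"
  unfolding HS_def pw_def by (metis One_nat_def continuous_on_subset le_Suc_eq le_zero_eq subset_UNIV)

lemma borel_imp_lebesgue_on_UNIV:
  fixes f :: "real \<Rightarrow> real"
  assumes "f \<in> borel_measurable borel"
  shows "f \<in> borel_measurable (lebesgue_on UNIV)"
proof -
  have "f \<in> borel_measurable lborel" using assms by simp
  then show ?thesis unfolding lebesgue_on_UNIV_eq by (rule measurable_completion)
qed

lemma HS_prod:
  assumes v: "HS S v" and w: "HS S' w" and i: "i \<le> 2" and j: "j \<le> 2"
    and f: "continuous_on UNIV f" "\<And>x. \<bar>f x\<bar> \<le> K"
  shows "(\<lambda>x. f x * v i x * w j x) absolutely_integrable_on UNIV"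
proof (rule measurable_bounded_by_integrable_imp_absolutely_integrable)
  have "(\<lambda>x. f x * v i x * w j x) \<in> borel_measurable borel"
    by (intro borel_measurable_times HS_borel[OF v i] HS_borel[OF w j] borel_measurable_continuous_onI f)
  then show "(\<lambda>x. f x * v i x * w j x) \<in> borel_measurable (lebesgue_on UNIV)"
    by (rule borel_imp_lebesgue_on_UNIV)
  show "(\<lambda>x. K * ((v i x)\<^sup>2 + (w j x)\<^sup>2)) integrable_on UNIV"
    using v w i j unfolding HS_def by (intro integrable_on_mult_right integrable_add) auto
  fix x
  have K: "K \<ge> 0" using f(2)[of 0] by linarith
  have "\<bar>v i x * w j x\<bar> \<le> (v i x)\<^sup>2 + (w j x)\<^sup>2"
  proof -
    have "2 * \<bar>v i x\<bar> * \<bar>w j x\<bar> \<le> \<bar>v i x\<bar>\<^sup>2 + \<bar>w j x\<bar>\<^sup>2" by (rule sum_squares_bound)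
    moreover have "0 \<le> \<bar>v i x\<bar> * \<bar>w j x\<bar>" by simp
    ultimately show ?thesis unfolding abs_mult power2_abs by linarith
  qed
  then have "\<bar>f x\<bar> * \<bar>v i x * w j x\<bar> \<le> K * ((v i x)\<^sup>2 + (w j x)\<^sup>2)"
    using f(2)[of x] K by (intro mult_mono) auto
  then show "norm (f x * v i x * w j x) \<le> K * ((v i x)\<^sup>2 + (w j x)\<^sup>2)"
    by (simp add: abs_mult mult.assoc)
qed auto

lemma HS_prod1:
  assumes "HS S v" "HS S' w" "i \<le> 2" "j \<le> 2"
  shows "(\<lambda>x. v i x * w j x) absolutely_integrable_on UNIV"
  using HS_prod[OF assms, of "\<lambda>x. 1" 1] by simp

lemma HS_prod_int:
  assumes "HS S v" "HS S' w" "i \<le> 2" "j \<le> 2"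
  shows "(\<lambda>x. v i x * w j x) integrable_on UNIV"
  using HS_prod1[OF assms] by (rule set_lebesgue_integral_eq_integral(1))

lemma HS_lincomb:
  assumes w: "\<And>i. i < d \<Longrightarrow> HS S (w i)"
  shows "HS S (lincomb d c w)"
proof -
  have "\<exists>F. \<forall>i<d. finite (F i) \<and> (\<forall>x. x \<notin> F i \<longrightarrow> (w i 0 has_real_derivative w i 1 x) (at x) \<and> (w i 1 has_real_derivative w i 2 x) (at x))"
    using w unfolding HS_def pw_def by metis
  then obtain F where F: "\<And>i. i < d \<Longrightarrow> finite (F i)"
    "\<And>i x. i < d \<Longrightarrow> x \<notin> F i \<Longrightarrow> (w i 0 has_real_derivative w i 1 x) (at x) \<and> (w i 1 has_real_derivative w i 2 x) (at x)"
    by metis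
  have D: "((\<lambda>x. \<Sum>i<d. c i * w i k x) has_real_derivative (\<Sum>i<d. c i * w i (Suc k) x)) (at x)"
    if x: "x \<notin> (\<Union>i<d. F i)" and k: "k \<le> 1" for x k
  proof (rule DERIV_sum)
    fix i assume i: "i \<in> {..<d}"
    have "(w i k has_real_derivative w i (Suc k) x) (at x)"
      using F(2)[of i x] i x k by (cases "k = 0") (auto simp: numeral_2_eq_2 le_Suc_eq)
    then show "((\<lambda>x. c i * w i k x) has_real_derivative c i * w i (Suc k) x) (at x)"
      by (rule DERIV_cmult)
  qed
  have 1: "pw (lincomb d c w)" unfolding pw_def lincomb_def
  proof (intro conjI exI[of _ "\<Union>i<d. F i"] allI impI)
    show "(\<lambda>x. \<Sum>i<d. c i * w i 2 x) \<in> borel_measurable borel"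
      using HS_borel[OF w] by (intro borel_measurable_sum borel_measurable_times) auto
    fix x assume x: "x \<notin> (\<Union>i<d. F i)"
    show "((\<lambda>x. \<Sum>i<d. c i * w i 0 x) has_real_derivative (\<Sum>i<d. c i * w i 1 x)) (at x)"
      "((\<lambda>x. \<Sum>i<d. c i * w i 1 x) has_real_derivative (\<Sum>i<d. c i * w i 2 x)) (at x)"
      using D[OF x, of 0] D[OF x, of 1] by (auto simp: numeral_2_eq_2)
  qed (use F(1) HS_cont[OF w] in \<open>auto intro!: continuous_intros\<close>)
  have 2: "(\<lambda>x. (lincomb d c w k x)\<^sup>2) integrable_on UNIV" if "k \<le> 2" for k
  proof -
    have "(\<lambda>x. \<Sum>i<d. \<Sum>j<d. c i * c j * (w i k x * w j k x)) integrable_on UNIV"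
      using HS_prod_int[OF w w] that by (intro integrable_sum integrable_on_mult_right) auto
    moreover have "(\<Sum>i<d. \<Sum>j<d. c i * c j * (w i k x * w j k x)) = (lincomb d c w k x)\<^sup>2" for x
      unfolding lincomb_def power2_eq_square sum_product by (intro sum.cong refl) (simp add: mult_ac)
    ultimately show ?thesis by simp
  qed
  show ?thesis unfolding HS_def using 1 2 HS_zero_off[OF w] by (auto simp: lincomb_def intro!: sum.neutral)
qed

lemma HS_add_scaled: "HS S v \<Longrightarrow> HS S w \<Longrightarrow> HS S (add_scaled v t w)"
  unfolding add_scaled_lincomb by (rule HS_lincomb) auto

lemma Hc_lincomb:
  assumes w: "\<And>i. i < d \<Longrightarrow> Hc S (w i)"
  shows "Hc S (lincomb d c w)"
proof -
  obtain T where T: "\<And>i. i < d \<Longrightarrow> HS (S \<inter> {-T i..T i}) (w i)" using w unfolding Hc_def by metis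
  define T' where "T' = (\<Sum>i<d. \<bar>T i\<bar>)"
  have "T i \<le> T'" if "i < d" for i
    using member_le_sum[of i "{..<d}" "\<lambda>i. \<bar>T i\<bar>"] that unfolding T'_def by auto
  then have "HS (S \<inter> {-T'..T'}) (w i)" if "i < d" for i
    using T[OF that] that by (elim HS_mono) force
  then have "HS (S \<inter> {-T'..T'}) (lincomb d c w)" by (rule HS_lincomb)
  then show ?thesis unfolding Hc_def by blast
qed

lemma lincomb_Suc: "lincomb (Suc d) c w = add_scaled (lincomb d c w) (c d) (w d)"
  by (auto simp: lincomb_def add_scaled_def)

definition N2 :: "(nat \<Rightarrow> real \<Rightarrow> real) \<Rightarrow> (nat \<Rightarrow> real \<Rightarrow> real) \<Rightarrow> real" where
  "N2 v w = integral UNIV (\<lambda>x. v 0 x * w 0 x)"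

lemma N2_nonneg: "HS S v \<Longrightarrow> N2 v v \<ge> 0"
  unfolding N2_def using HS_prod_int[of S v S v 0 0] by (intro integral_nonneg) auto

section \<open>The form and its boundary terms\<close>

context pot
begin

text \<open>The density of \<open><(L - lam) v, w>\<close> after two integrations by parts, with
  \<open>L = - (1 + d^2)^2 + V\<close>.\<close>

definition qi :: "real \<Rightarrow> (nat \<Rightarrow> real \<Rightarrow> real) \<Rightarrow> (nat \<Rightarrow> real \<Rightarrow> real) \<Rightarrow> real \<Rightarrow> real" where
  "qi lam v w x = - (v 2 x + v 0 x) * (w 2 x + w 0 x) + (V x - lam) * v 0 x * w 0 x"

definition Q :: "real \<Rightarrow> (nat \<Rightarrow> real \<Rightarrow> real) \<Rightarrow> (nat \<Rightarrow> real \<Rightarrow> real) \<Rightarrow> real" where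
  "Q lam v w = integral UNIV (qi lam v w)"

text \<open>With \<open>p = u'' + u\<close> this is \<open>p' y - p y'\<close>, the boundary term of
  that integration by parts.\<close>

definition bdry :: "(nat \<Rightarrow> real \<Rightarrow> real) \<Rightarrow> (nat \<Rightarrow> real \<Rightarrow> real) \<Rightarrow> real \<Rightarrow> real" where
  "bdry u y x = (u 3 x + u 1 x) * y 0 x - (u 2 x + u 0 x) * y 1 x"

lemma qi_abs_int:
  assumes v: "HS S v" and w: "HS S' w"
  shows "qi lam v w absolutely_integrable_on UNIV"
proof -
  obtain K where K: "\<And>x. \<bar>V x\<bar> \<le> K" using V_bounded by blast
  have b: "\<bar>V x - lam\<bar> \<le> K + \<bar>lam\<bar>" for x using K[of x] by linarith
  have "(\<lambda>x. (V x - lam) * v 0 x * w 0 x - (v 2 x * w 2 x + v 2 x * w 0 x + (v 0 x * w 2 x + v 0 x * w 0 x))) absolutely_integrable_on UNIV"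
    by (intro set_integral_diff(1) set_integral_add(1) HS_prod[OF v w _ _ _ b] HS_prod1[OF v w] continuous_intros V_cont_on) auto
  moreover have "(\<lambda>x. (V x - lam) * v 0 x * w 0 x - (v 2 x * w 2 x + v 2 x * w 0 x + (v 0 x * w 2 x + v 0 x * w 0 x))) = qi lam v w"
    by (auto simp: qi_def algebra_simps)
  ultimately show ?thesis by simp
qed

lemma qi_int: "HS S v \<Longrightarrow> HS S' w \<Longrightarrow> qi lam v w integrable_on UNIV"
  using qi_abs_int set_lebesgue_integral_eq_integral(1) by blast

lemma qi_int_Icc: "HS S v \<Longrightarrow> HS S' w \<Longrightarrow> qi lam v w integrable_on {a..b}"
  using qi_int integrable_on_subinterval by blast

lemma qi_sym: "qi lam v w = qi lam w v"
  by (auto simp: qi_def algebra_simps)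

lemma Q_sym: "Q lam v w = Q lam w v"
  unfolding Q_def by (subst qi_sym) (rule refl)

lemma N2_sym: "N2 v w = N2 w v"
  unfolding N2_def by (simp add: mult.commute)

lemma Q_lincomb:
  assumes w: "\<And>i. i < d \<Longrightarrow> HS S (w i)" and y: "HS S' y"
  shows "Q lam (lincomb d c w) y = (\<Sum>i<d. c i * Q lam (w i) y)"
proof -
  have "qi lam (lincomb d c w) y = (\<lambda>x. \<Sum>i<d. c i * qi lam (w i) y x)"
    unfolding qi_def lincomb_def
    by (rule ext) (simp add: sum_distrib_left sum_distrib_right sum.distrib sum_subtractf sum_negf algebra_simps)
  then have "Q lam (lincomb d c w) y = integral UNIV (\<lambda>x. \<Sum>i<d. c i * qi lam (w i) y x)" by (simp add: Q_def)
  also have "\<dots> = (\<Sum>i<d. integral UNIV (\<lambda>x. c i * qi lam (w i) y x))"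
    using qi_int[OF w y] by (intro integral_sum integrable_on_mult_right) auto
  finally show ?thesis by (simp add: Q_def)
qed

lemma Q_lincomb_right:
  assumes w: "\<And>i. i < d \<Longrightarrow> HS S (w i)" and y: "HS S' y"
  shows "Q lam y (lincomb d c w) = (\<Sum>i<d. c i * Q lam y (w i))"
  using Q_lincomb[OF assms, where lam = lam and c = c] by (simp add: Q_sym)

lemma Q_lincomb2:
  assumes w: "\<And>i. i < d \<Longrightarrow> HS S (w i)"
  shows "Q lam (lincomb d c w) (lincomb d c w) = (\<Sum>i<d. \<Sum>j<d. c i * c j * Q lam (w i) (w j))"
proof -
  have "Q lam (lincomb d c w) (lincomb d c w) = (\<Sum>i<d. c i * Q lam (w i) (lincomb d c w))"
    by (rule Q_lincomb[OF w HS_lincomb[OF w]])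
  also have "\<dots> = (\<Sum>i<d. c i * (\<Sum>j<d. c j * Q lam (w i) (w j)))"
    by (intro sum.cong refl arg_cong2[of _ _ _ _ "(*)"] Q_lincomb_right[OF w w]) auto
  finally show ?thesis by (simp add: sum_distrib_left mult.assoc)
qed

lemma Q_add_scaled: "HS S v \<Longrightarrow> HS S w \<Longrightarrow> HS S' y \<Longrightarrow> Q lam (add_scaled v t w) y = Q lam v y + t * Q lam w y"
  unfolding add_scaled_lincomb by (subst Q_lincomb[where S = S and S' = S']) (auto simp: numeral_2_eq_2)

lemma Q_add_scaled2:
  assumes "HS S v" "HS S w"
  shows "Q lam (add_scaled v t w) (add_scaled v t w) = Q lam v v + 2 * t * Q lam v w + t\<^sup>2 * Q lam w w"
proof -
  have "Q lam (add_scaled v t w) (add_scaled v t w) = Q lam v (add_scaled v t w) + t * Q lam w (add_scaled v t w)"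
    by (rule Q_add_scaled[OF assms HS_add_scaled[OF assms]])
  also have "\<dots> = Q lam (add_scaled v t w) v + t * Q lam (add_scaled v t w) w" by (simp add: Q_sym)
  finally show ?thesis using Q_add_scaled[OF assms assms(1)] Q_add_scaled[OF assms assms(2)] Q_sym[of lam w v]
    by (simp add: algebra_simps power2_eq_square)
qed

lemma Q_lam:
  assumes v: "HS S v" and w: "HS S' w"
  shows "Q lam' v w = Q lam v w - (lam' - lam) * N2 v w"
proof -
  have "qi lam' v w = (\<lambda>x. qi lam v w x - (lam' - lam) * (v 0 x * w 0 x))"
    by (auto simp: qi_def algebra_simps)
  moreover have "(\<lambda>x. v 0 x * w 0 x) integrable_on UNIV"
    using HS_prod1[OF v w, of 0 0] set_lebesgue_integral_eq_integral(1) by auto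
  ultimately show ?thesis
    unfolding Q_def N2_def using qi_int[OF v w, of lam]
    by (simp add: integral_diff integrable_on_mult_right)
qed

text \<open>The derivative of \<open>bdry u y\<close> is
  \<open>(u 4 + u 2) * y 0 - (u 2 + u 0) * y 2\<close>, and the equation for \<open>u\<close> turns
  this into the density. Breakpoints of \<open>y\<close> do no harm, since only \<open>y\<close> and
  \<open>y'\<close> occur in the boundary term and both are continuous.\<close>

lemma has_integral_bdry:
  assumes u: "Sol lam u" and y: "pw y" and ab: "a \<le> b"
  shows "(qi lam u y has_integral (bdry u y b - bdry u y a)) {a..b}"
proof -
  obtain F where F: "finite F" "\<And>x. x \<notin> F \<Longrightarrow> (y 0 has_real_derivative y 1 x) (at x)"
    "\<And>x. x \<notin> F \<Longrightarrow> (y 1 has_real_derivative y 2 x) (at x)"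
    using y unfolding pw_def by blast
  have yc: "continuous_on {a..b} (y 0)" "continuous_on {a..b} (y 1)"
    using y continuous_on_subset unfolding pw_def by blast+
  show ?thesis
  proof (rule fundamental_theorem_of_calculus_strong[OF F(1) ab])
    fix x assume "x \<in> {a..b} - F"
    then have x: "x \<notin> F" by auto
    have du: "(u k has_real_derivative u (Suc k) x) (at x)" if "k < 4" for k using SolR_deriv[OF u that] .
    have "(bdry u y has_real_derivative ((u 4 x + u 2 x) * y 0 x + (u 3 x + u 1 x) * y 1 x - ((u 3 x + u 1 x) * y 1 x + (u 2 x + u 0 x) * y 2 x))) (at x)"
      unfolding bdry_def[abs_def] using F(2)[OF x] F(3)[OF x] du[of 0] du[of 1] du[of 2] du[of 3]
      by (auto intro!: derivative_eq_intros simp: eval_nat_numeral)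
    moreover have "(u 4 x + u 2 x) * y 0 x + (u 3 x + u 1 x) * y 1 x - ((u 3 x + u 1 x) * y 1 x + (u 2 x + u 0 x) * y 2 x) = qi lam u y x"
      by (simp add: SolR_4[OF u] qi_def rhs_def algebra_simps)
    ultimately show "(bdry u y has_vector_derivative qi lam u y x) (at x)"
      by (simp add: has_real_derivative_iff_has_vector_derivative)
  qed (use yc in \<open>auto simp: bdry_def[abs_def] intro!: continuous_intros SolR_cont[OF u]\<close>)
qed

text \<open>Dominated convergence in the form needed for cutoffs, which at each point eventually
  agree with the limit.\<close>

lemma Q_dct:
  assumes v: "\<And>n. HS UNIV (v n)" "HS UNIV v'" and w: "\<And>n. HS UNIV (w n)" "HS UNIV w'"
    and g: "\<And>n k x. k \<le> 2 \<Longrightarrow> \<bar>v n k x\<bar> \<le> g x" "(\<lambda>x. (g x)\<^sup>2) integrable_on UNIV"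
    and h: "\<And>n k x. k \<le> 2 \<Longrightarrow> \<bar>w n k x\<bar> \<le> h x" "(\<lambda>x. (h x)\<^sup>2) integrable_on UNIV"
    and ev: "\<And>k x. k \<le> 2 \<Longrightarrow> \<forall>\<^sub>F n in sequentially. v n k x = v' k x \<and> w n k x = w' k x"
  shows "(\<lambda>n. Q lam (v n) (w n)) \<longlonglongrightarrow> Q lam v' w'"
proof -
  obtain K where K: "K \<ge> 0" "\<And>x. \<bar>V x\<bar> \<le> K" using V_bounded by blast
  show ?thesis unfolding Q_def
  proof (rule dominated_convergence(2))
  show "qi lam (v n) (w n) integrable_on UNIV" for n by (rule qi_int[OF v(1) w(1)])
  show "(\<lambda>x. (4 + K + \<bar>lam\<bar>) * ((g x)\<^sup>2 + (h x)\<^sup>2)) integrable_on UNIV"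
    using g(2) h(2) by (intro integrable_on_mult_right integrable_add)
  show "norm (qi lam (v n) (w n) x) \<le> (4 + K + \<bar>lam\<bar>) * ((g x)\<^sup>2 + (h x)\<^sup>2)" for n x
  proof -
    have g0: "0 \<le> g x" using g(1)[of 0 n x] by linarith
    have h0: "0 \<le> h x" using h(1)[of 0 n x] by linarith
    have a: "\<bar>v n 2 x + v n 0 x\<bar> \<le> 2 * g x" using g(1)[of 2 n x] g(1)[of 0 n x] by linarith
    have b: "\<bar>w n 2 x + w n 0 x\<bar> \<le> 2 * h x" using h(1)[of 2 n x] h(1)[of 0 n x] by linarith
    have 1: "\<bar>v n 2 x + v n 0 x\<bar> * \<bar>w n 2 x + w n 0 x\<bar> \<le> (2 * g x) * (2 * h x)"
      using a b g0 by (intro mult_mono) auto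
    have c: "\<bar>V x - lam\<bar> \<le> K + \<bar>lam\<bar>" using K(2)[of x] by linarith
    have 2: "\<bar>V x - lam\<bar> * (\<bar>v n 0 x\<bar> * \<bar>w n 0 x\<bar>) \<le> (K + \<bar>lam\<bar>) * (g x * h x)"
      using c g(1)[of 0 n x] h(1)[of 0 n x] g0 h0 K(1) by (intro mult_mono) auto
    have "norm (qi lam (v n) (w n) x) \<le> \<bar>v n 2 x + v n 0 x\<bar> * \<bar>w n 2 x + w n 0 x\<bar> + \<bar>V x - lam\<bar> * (\<bar>v n 0 x\<bar> * \<bar>w n 0 x\<bar>)"
    proof -
      have "\<bar>- p * q + r * s * t\<bar> \<le> \<bar>p\<bar> * \<bar>q\<bar> + \<bar>r\<bar> * (\<bar>s\<bar> * \<bar>t\<bar>)" for p q r s t :: real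
        using abs_triangle_ineq[of "- p * q" "r * s * t"] by (simp add: abs_mult mult.assoc)
      then show ?thesis unfolding qi_def real_norm_def by blast
    qed
    also have "\<dots> \<le> (2 * g x) * (2 * h x) + (K + \<bar>lam\<bar>) * (g x * h x)" using 1 2 by linarith
    also have "\<dots> = (4 + K + \<bar>lam\<bar>) * (g x * h x)" by (simp add: algebra_simps)
    also have "\<dots> \<le> (4 + K + \<bar>lam\<bar>) * ((g x)\<^sup>2 + (h x)\<^sup>2)"
    proof (rule mult_left_mono)
      have "2 * g x * h x \<le> (g x)\<^sup>2 + (h x)\<^sup>2" by (rule sum_squares_bound)
      moreover have "0 \<le> g x * h x" using g0 h0 by simp
      ultimately show "g x * h x \<le> (g x)\<^sup>2 + (h x)\<^sup>2" by linarith
    qed (use K in auto)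
    finally show ?thesis .
  qed
  show "(\<lambda>n. qi lam (v n) (w n) x) \<longlonglongrightarrow> qi lam v' w' x" for x
  proof (rule tendsto_eventually)
    show "\<forall>\<^sub>F n in sequentially. qi lam (v n) (w n) x = qi lam v' w' x"
      using ev[of 0 x, simplified] ev[of 2 x, simplified]
      by eventually_elim (auto simp: qi_def)
  qed
  qed
qed

end

section \<open>Cutoff functions\<close>

definition excess :: "real \<Rightarrow> real \<Rightarrow> real" where "excess r x = max 0 (x - r) + min 0 (x + r)"

text \<open>With \<open>e\<close> the signed distance to \<open>{-r..r}\<close>, the profile is
  \<open>(1 - e^2)^2\<close> on shoulders of width 1; \<open>k = 1, 2\<close> are its first and
  second derivatives. The second one jumps at \<open>r\<close>, \<open>r + 1\<close> and their
  negatives, where it is set to 0.\<close>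

definition bump :: "real \<Rightarrow> nat \<Rightarrow> real \<Rightarrow> real" where
  "bump r k x = (if k = 0 then (max 0 (1 - (excess r x)\<^sup>2))\<^sup>2
     else if k = 1 then - 4 * excess r x * max 0 (1 - (excess r x)\<^sup>2)
     else if \<bar>x\<bar> \<le> r \<or> \<bar>x\<bar> \<ge> r + 1 then 0 else 12 * (excess r x)\<^sup>2 - 4)"

lemma excess_simps:
  "\<bar>x\<bar> \<le> r \<Longrightarrow> excess r x = 0" "r \<ge> 0 \<Longrightarrow> x \<ge> r \<Longrightarrow> excess r x = x - r" "r \<ge> 0 \<Longrightarrow> x \<le> - r \<Longrightarrow> excess r x = x + r"
  by (auto simp: excess_def)

lemma excess_ge1: "r \<ge> 0 \<Longrightarrow> \<bar>x\<bar> \<ge> r + 1 \<Longrightarrow> (excess r x)\<^sup>2 \<ge> 1"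
  by (simp add: excess_def abs_square_le_1 one_le_power abs_if abs_le_square_iff[of 1, simplified, symmetric] split: if_splits)

lemma excess_le1: "r \<ge> 0 \<Longrightarrow> \<bar>x\<bar> \<le> r + 1 \<Longrightarrow> (excess r x)\<^sup>2 \<le> 1"
  by (simp add: excess_def abs_square_le_1 abs_if split: if_splits)

lemma bump_in: "\<bar>x\<bar> \<le> r \<Longrightarrow> bump r k x = (if k = 0 then 1 else 0)"
  by (simp add: bump_def excess_simps)

lemma bump_out: "r \<ge> 0 \<Longrightarrow> \<bar>x\<bar> \<ge> r + 1 \<Longrightarrow> bump r k x = 0"
  using excess_ge1[of r x] by (simp add: bump_def max_def)

text \<open>Independent of \<open>r\<close>, so a single dominating function serves all cutoff
  radii.\<close>

lemma bump_bound: assumes "r \<ge> 0" shows "\<bar>bump r k x\<bar> \<le> 12"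
proof (cases "\<bar>x\<bar> \<ge> r + 1")
  case True then show ?thesis using bump_out[OF assms True] by simp
next
  case False
  then have e: "(excess r x)\<^sup>2 \<le> 1" using excess_le1 assms by simp
  then have e': "\<bar>excess r x\<bar> \<le> 1" using abs_square_le_1 by blast
  have m: "0 \<le> max 0 (1 - (excess r x)\<^sup>2)" "max 0 (1 - (excess r x)\<^sup>2) \<le> 1" by auto
  have 0: "(max 0 (1 - (excess r x)\<^sup>2))\<^sup>2 \<le> 1" using m by (simp add: power_le_one)
  have 1: "\<bar>- 4 * excess r x * max 0 (1 - (excess r x)\<^sup>2)\<bar> \<le> 4 * 1 * 1"
    unfolding abs_mult using m e' by (intro mult_mono) auto
  have 2: "\<bar>12 * (excess r x)\<^sup>2 - 4\<bar> \<le> 12" using e zero_le_power2[of "excess r x"] by linarith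
  have a0: "\<bar>(max 0 (1 - (excess r x)\<^sup>2))\<^sup>2\<bar> \<le> 12" using 0 by simp
  have a1: "\<bar>- 4 * excess r x * max 0 (1 - (excess r x)\<^sup>2)\<bar> \<le> 12" using 1 by linarith
  show ?thesis unfolding bump_def using a0 a1 2 by (simp split: if_splits)
qed

lemma bump_cont: "continuous_on UNIV (bump r 0)" "continuous_on UNIV (bump r 1)"
  unfolding bump_def[abs_def] excess_def[abs_def] by (auto intro!: continuous_intros)

lemma bump_borel: "bump r k \<in> borel_measurable borel"
  unfolding bump_def[abs_def] excess_def[abs_def] by measurable

lemma bump_deriv:
  assumes r: "r > 0" and x: "x \<notin> {r, -r, r+1, -(r+1)}" and k: "k \<le> 1"
  shows "(bump r k has_real_derivative bump r (Suc k) x) (at x)"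
proof -
  have cong: "(bump r k has_real_derivative bump r (Suc k) x) (at x)"
    if S: "open S" "x \<in> S" and e: "\<And>y. y \<in> S \<Longrightarrow> bump r k y = g y"
      and d: "(g has_real_derivative bump r (Suc k) x) (at x)" for S g
    by (rule has_field_derivative_transform_within_open[OF d S]) (simp add: e)
  have "x \<noteq> r" "x \<noteq> -r" "x \<noteq> r+1" "x \<noteq> -(r+1)" using x by auto
  then have "\<bar>x\<bar> < r \<or> \<bar>x\<bar> > r + 1 \<or> (x > r \<and> x < r + 1) \<or> (x < -r \<and> x > -(r+1))" by linarith
  then consider "\<bar>x\<bar> < r" | "\<bar>x\<bar> > r + 1" | "x > r" "x < r + 1" | "x < -r" "x > -(r+1)" by blast
  then show ?thesis
  proof cases
    case 1
    show ?thesis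
      by (rule cong[of "{-r<..<r}" "\<lambda>y. if k = 0 then 1 else 0"])
        (use 1 in \<open>auto simp: bump_in abs_if split: if_splits\<close>)
  next
    case 2
    show ?thesis
    proof (rule cong[of "{y. \<bar>y\<bar> > r + 1}" "\<lambda>y. 0"])
      show "open {y. \<bar>y\<bar> > r + 1}" by (intro open_Collect_less continuous_intros)
    qed (use 2 r in \<open>auto simp: bump_out\<close>)
  next
    case 3
    have e: "excess r y = y - r" if "r < y" for y using that r by (simp add: excess_simps)
    have mx: "max 0 (1 - (y - r)\<^sup>2) = 1 - (y - r)\<^sup>2" if "r < y" "y < r + 1" for y
      using that by (simp add: abs_square_le_1 abs_if max_def)
    have "k = 0 \<or> k = 1" using k by auto
    then show ?thesis
    proof
      assume k: "k = 0"
      show ?thesis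
      proof (rule cong[of "{r<..<r+1}" "\<lambda>y. (1 - (y - r)\<^sup>2)\<^sup>2"])
        show "((\<lambda>y. (1 - (y - r)\<^sup>2)\<^sup>2) has_real_derivative bump r (Suc k) x) (at x)"
          using 3 k by (auto intro!: derivative_eq_intros simp: bump_def e mx)
      qed (use 3 k in \<open>auto simp: bump_def e mx\<close>)
    next
      assume k: "k = 1"
      show ?thesis
      proof (rule cong[of "{r<..<r+1}" "\<lambda>y. - 4 * (y - r) * (1 - (y - r)\<^sup>2)"])
        show "((\<lambda>y. - 4 * (y - r) * (1 - (y - r)\<^sup>2)) has_real_derivative bump r (Suc k) x) (at x)"
          using 3 k r by (auto intro!: derivative_eq_intros simp: bump_def e mx) (simp add: algebra_simps power2_eq_square)
      qed (use 3 k in \<open>auto simp: bump_def e mx\<close>)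
    qed
  next
    case 4
    have e: "excess r y = y + r" if "y < -r" for y using that r by (simp add: excess_simps)
    have mx: "max 0 (1 - (y + r)\<^sup>2) = 1 - (y + r)\<^sup>2" if "y < - r" "- (r + 1) < y" for y
      using that by (simp add: abs_square_le_1 abs_if max_def)
    have "k = 0 \<or> k = 1" using k by auto
    then show ?thesis
    proof
      assume k: "k = 0"
      show ?thesis
      proof (rule cong[of "{-(r+1)<..<-r}" "\<lambda>y. (1 - (y + r)\<^sup>2)\<^sup>2"])
        show "((\<lambda>y. (1 - (y + r)\<^sup>2)\<^sup>2) has_real_derivative bump r (Suc k) x) (at x)"
          using 4 k by (auto intro!: derivative_eq_intros simp: bump_def e mx)
      qed (use 4 k in \<open>auto simp: bump_def e mx\<close>)
    next
      assume k: "k = 1"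
      show ?thesis
      proof (rule cong[of "{-(r+1)<..<-r}" "\<lambda>y. - 4 * (y + r) * (1 - (y + r)\<^sup>2)"])
        show "((\<lambda>y. - 4 * (y + r) * (1 - (y + r)\<^sup>2)) has_real_derivative bump r (Suc k) x) (at x)"
          using 4 k r by (auto intro!: derivative_eq_intros simp: bump_def e mx) (simp add: algebra_simps power2_eq_square)
      qed (use 4 k in \<open>auto simp: bump_def e mx\<close>)
    qed
  qed
qed

text \<open>The Leibniz rule for \<open>bump * v\<close> up to second order. The radius is
  \<open>Suc n\<close> because \<open>bump_deriv\<close> asks for a positive one.\<close>

definition cutoff :: "nat \<Rightarrow> (nat \<Rightarrow> real \<Rightarrow> real) \<Rightarrow> nat \<Rightarrow> real \<Rightarrow> real" where
  "cutoff n v = (\<lambda>k x. let r = real (Suc n) in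
     if k = 0 then bump r 0 x * v 0 x
     else if k = 1 then bump r 0 x * v 1 x + bump r 1 x * v 0 x
     else bump r 0 x * v 2 x + 2 * bump r 1 x * v 1 x + bump r 2 x * v 0 x)"

text \<open>The 24 is the bound 12 for the bump, doubled by the middle term of the Leibniz
  rule.\<close>

definition dominator :: "(nat \<Rightarrow> real \<Rightarrow> real) \<Rightarrow> real \<Rightarrow> real" where
  "dominator v x = 24 * (\<bar>v 0 x\<bar> + \<bar>v 1 x\<bar> + \<bar>v 2 x\<bar>)"

lemma cutoff_in: "\<bar>x\<bar> \<le> real (Suc n) \<Longrightarrow> k \<le> 2 \<Longrightarrow> cutoff n v k x = v k x"
  by (auto simp: cutoff_def bump_in le_Suc_eq numeral_2_eq_2)

lemma cutoff_bound: "\<bar>cutoff n v k x\<bar> \<le> dominator v x"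
proof -
  let ?r = "real (Suc n)"
  have b: "\<bar>bump ?r i x * t\<bar> \<le> 12 * \<bar>t\<bar>" for i t
    unfolding abs_mult using bump_bound[of ?r i x] by (intro mult_right_mono) auto
  have "\<bar>2 * bump ?r 1 x * v 1 x\<bar> = 2 * \<bar>bump ?r 1 x * v 1 x\<bar>" by (simp add: abs_mult)
  then have "\<bar>2 * bump ?r 1 x * v 1 x\<bar> \<le> 24 * \<bar>v 1 x\<bar>" using b[of 1 "v 1 x"] by linarith
  moreover have "\<bar>p\<bar> \<le> 24 * (a + b + c) \<and> \<bar>q + r\<bar> \<le> 24 * (a + b + c) \<and> \<bar>s + t + w\<bar> \<le> 24 * (a + b + c)"
    if "\<bar>p\<bar> \<le> 12 * a" "\<bar>q\<bar> \<le> 12 * b" "\<bar>r\<bar> \<le> 12 * a" "\<bar>s\<bar> \<le> 12 * c" "\<bar>t\<bar> \<le> 24 * b" "\<bar>w\<bar> \<le> 12 * a"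
    for p q r s t w a b c :: real
    using that unfolding distrib_left by (intro conjI; linarith)
  note this[OF b[of 0 "v 0 x"] b[of 0 "v 1 x"] b[of 1 "v 0 x"] b[of 0 "v 2 x"] _ b[of 2 "v 0 x"], of "2 * bump ?r 1 x * v 1 x"]
  ultimately show ?thesis
    unfolding cutoff_def Let_def dominator_def by (cases "k = 0"; cases "k = 1") auto
qed

lemma Hc_cutoff:
  assumes v: "HS S v"
  shows "Hc S (cutoff n v)"
proof -
  let ?r = "real (Suc n)"
  obtain F where F: "finite F" "\<And>x. x \<notin> F \<Longrightarrow> (v 0 has_real_derivative v 1 x) (at x)"
    "\<And>x. x \<notin> F \<Longrightarrow> (v 1 has_real_derivative v 2 x) (at x)"
    using v unfolding HS_def pw_def by blast
  have 1: "pw (cutoff n v)" unfolding pw_def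
  proof (intro conjI exI[of _ "F \<union> {?r, -?r, ?r+1, -(?r+1)}"] allI impI)
    show "continuous_on UNIV (cutoff n v 0)" "continuous_on UNIV (cutoff n v 1)"
      unfolding cutoff_def Let_def by (auto intro!: continuous_intros bump_cont HS_cont[OF v] bump_cont[unfolded One_nat_def] HS_cont[OF v, unfolded One_nat_def])
    show "cutoff n v 2 \<in> borel_measurable borel"
      unfolding cutoff_def Let_def by (auto intro!: borel_measurable_add borel_measurable_times bump_borel HS_borel[OF v])
    fix x assume x: "x \<notin> F \<union> {?r, -?r, ?r+1, -(?r+1)}"
    then have xF: "x \<notin> F" by simp
    have c: "(bump ?r 0 has_real_derivative bump ?r 1 x) (at x)" "(bump ?r 1 has_real_derivative bump ?r 2 x) (at x)"
      using bump_deriv[of ?r x 0] bump_deriv[of ?r x 1] x by (auto simp: numeral_2_eq_2)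
    show "(cutoff n v 0 has_real_derivative cutoff n v 1 x) (at x)"
      unfolding cutoff_def Let_def using DERIV_mult[OF c(1) F(2)[OF xF]] by (simp add: algebra_simps)
    show "(cutoff n v 1 has_real_derivative cutoff n v 2 x) (at x)"
      unfolding cutoff_def Let_def using DERIV_add[OF DERIV_mult[OF c(1) F(3)[OF xF]] DERIV_mult[OF c(2) F(2)[OF xF]]]
      by (simp add: algebra_simps)
  qed (use F(1) in auto)
  have 2: "(\<lambda>x. (cutoff n v k x)\<^sup>2) integrable_on UNIV" if k: "k \<le> 2" for k
  proof -
    have "(\<lambda>x. (cutoff n v k x)\<^sup>2) absolutely_integrable_on UNIV"
    proof (rule measurable_bounded_by_integrable_imp_absolutely_integrable)
      have "cutoff n v k \<in> borel_measurable borel"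
        unfolding cutoff_def Let_def using HS_borel[OF v] bump_borel
        by (auto intro!: borel_measurable_add borel_measurable_times)
      then show "(\<lambda>x. (cutoff n v k x)\<^sup>2) \<in> borel_measurable (lebesgue_on UNIV)"
        by (intro borel_imp_lebesgue_on_UNIV borel_measurable_power)
      show "(\<lambda>x. 24\<^sup>2 * 3 * ((v 0 x)\<^sup>2 + (v 1 x)\<^sup>2 + (v 2 x)\<^sup>2)) integrable_on UNIV"
        using v unfolding HS_def by (intro integrable_on_mult_right integrable_add) auto
      fix x
      have "\<bar>cutoff n v k x\<bar>\<^sup>2 \<le> (dominator v x)\<^sup>2"
        using cutoff_bound by (intro power_mono) auto
      moreover have "(a + b + c)\<^sup>2 \<le> 3 * (a\<^sup>2 + b\<^sup>2 + c\<^sup>2)" for a b c :: real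
        using sum_squares_bound[of a b] sum_squares_bound[of a c] sum_squares_bound[of b c]
        by (simp add: power2_eq_square algebra_simps)
      from this[of "\<bar>v 0 x\<bar>" "\<bar>v 1 x\<bar>" "\<bar>v 2 x\<bar>"]
      have "(dominator v x)\<^sup>2 \<le> 24\<^sup>2 * 3 * ((v 0 x)\<^sup>2 + (v 1 x)\<^sup>2 + (v 2 x)\<^sup>2)"
        unfolding dominator_def power_mult_distrib by simp
      ultimately show "norm ((cutoff n v k x)\<^sup>2) \<le> 24\<^sup>2 * 3 * ((v 0 x)\<^sup>2 + (v 1 x)\<^sup>2 + (v 2 x)\<^sup>2)" by simp
    qed auto
    then show ?thesis using set_lebesgue_integral_eq_integral(1) by blast
  qed
  have 3: "cutoff n v k x = 0" if "k \<le> 2" "x \<notin> S \<inter> {-(?r+1)..?r+1}" for k x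
  proof (cases "x \<in> S")
    case True
    then have "\<bar>x\<bar> \<ge> ?r + 1" using that(2) by (auto simp: abs_if)
    then show ?thesis using bump_out[of ?r x] by (simp add: cutoff_def Let_def)
  next
    case False
    then show ?thesis using HS_zero_off[OF v] by (simp add: cutoff_def Let_def)
  qed
  have "HS (S \<inter> {-(?r+1)..?r+1}) (cutoff n v)" unfolding HS_def using 1 2 3 by blast
  then show ?thesis unfolding Hc_def by blast
qed

lemma HS_dominator:
  assumes v: "HS S v"
  shows "(\<lambda>x. (dominator v x)\<^sup>2) integrable_on UNIV"
proof -
  have "(\<lambda>x. (dominator v x)\<^sup>2) absolutely_integrable_on UNIV"
  proof (rule measurable_bounded_by_integrable_imp_absolutely_integrable)
    have "(\<lambda>x. (dominator v x)\<^sup>2) \<in> borel_measurable borel"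
      unfolding dominator_def by (intro borel_measurable_power borel_measurable_times borel_measurable_add borel_measurable_abs HS_borel[OF v]) auto
    then show "(\<lambda>x. (dominator v x)\<^sup>2) \<in> borel_measurable (lebesgue_on UNIV)"
      by (rule borel_imp_lebesgue_on_UNIV)
    show "(\<lambda>x. 24\<^sup>2 * 3 * ((v 0 x)\<^sup>2 + (v 1 x)\<^sup>2 + (v 2 x)\<^sup>2)) integrable_on UNIV"
      using v unfolding HS_def by (intro integrable_on_mult_right integrable_add) auto
    fix x
    have "(a + b + c)\<^sup>2 \<le> 3 * (a\<^sup>2 + b\<^sup>2 + c\<^sup>2)" for a b c :: real
      using sum_squares_bound[of a b] sum_squares_bound[of a c] sum_squares_bound[of b c]
      by (simp add: power2_eq_square algebra_simps)
    from this[of "\<bar>v 0 x\<bar>" "\<bar>v 1 x\<bar>" "\<bar>v 2 x\<bar>"]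
    show "norm ((dominator v x)\<^sup>2) \<le> 24\<^sup>2 * 3 * ((v 0 x)\<^sup>2 + (v 1 x)\<^sup>2 + (v 2 x)\<^sup>2)"
      unfolding dominator_def power_mult_distrib by simp
  qed auto
  then show ?thesis using set_lebesgue_integral_eq_integral(1) by blast
qed

lemma cutoff_eventually:
  assumes "k \<le> 2"
  shows "\<forall>\<^sub>F n in sequentially. cutoff n v k x = v k x"
proof (rule eventually_sequentiallyI[of "nat \<lceil>\<bar>x\<bar>\<rceil>"])
  fix n assume "nat \<lceil>\<bar>x\<bar>\<rceil> \<le> n"
  then have "\<bar>x\<bar> \<le> real n" by (simp add: nat_ceiling_le_eq)
  then show "cutoff n v k x = v k x" using assms by (intro cutoff_in) auto
qed

context pot
begin

lemma cutoff_lim2: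
  assumes "HS S v" "HS S' w"
  shows "(\<lambda>n. Q lam (cutoff n v) (cutoff n w)) \<longlonglongrightarrow> Q lam v w"
  by (rule Q_dct[where g = "\<lambda>x. dominator v x" and h = "\<lambda>x. dominator w x"])
    (use assms in \<open>auto intro: HS_UNIV Hc_HS Hc_cutoff eventually_conj cutoff_eventually cutoff_bound HS_dominator\<close>)

lemma cutoff_lim:
  assumes v: "HS S v" and w: "HS S' w"
  shows "(\<lambda>n. Q lam v (cutoff n w)) \<longlonglongrightarrow> Q lam v w"
proof (rule Q_dct[where g = "\<lambda>x. dominator v x" and h = "\<lambda>x. dominator w x"])
  fix k :: nat and x assume "k \<le> 2"
  then have "k = 0 \<or> k = 1 \<or> k = 2" by auto
  then show "\<bar>v k x\<bar> \<le> dominator v x"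
    unfolding dominator_def by (elim disjE) auto
qed (use assms in \<open>auto intro: HS_UNIV Hc_HS Hc_cutoff cutoff_eventually cutoff_bound HS_dominator\<close>)

end

subsection \<open>Clamped boundary value problems and broken solutions\<close>

text \<open>The local version of \<open>HS\<close>: square integrable on bounded intervals only, so
  that solutions of the equation, which may grow, belong to it.\<close>

definition pw2 :: "(nat \<Rightarrow> real \<Rightarrow> real) \<Rightarrow> bool" where
  "pw2 v \<longleftrightarrow> pw v \<and> (\<forall>k\<le>2. \<forall>a b. (\<lambda>x. (v k x)\<^sup>2) integrable_on {a..b})"

lemma pw_borel: "pw v \<Longrightarrow> k \<le> 2 \<Longrightarrow> v k \<in> borel_measurable borel"
proof -
  assume "pw v" "k \<le> 2"
  then have "continuous_on UNIV (v 0)" "continuous_on UNIV (v 1)" "v 2 \<in> borel_measurable borel" "k = 0 \<or> k = 1 \<or> k = 2"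
    unfolding pw_def by auto
  then show ?thesis using borel_measurable_continuous_onI by blast
qed

lemma pw_cont: "pw v \<Longrightarrow> k \<le> 1 \<Longrightarrow> continuous_on A (v k)"
  unfolding pw_def by (metis One_nat_def continuous_on_subset le_Suc_eq le_zero_eq subset_UNIV)

lemma pw_zero: "pw (\<lambda>k x. 0)"
  unfolding pw_def by (auto intro: exI[of _ "{}"])

lemma borel_bound_integrable:
  fixes f :: "real \<Rightarrow> real"
  assumes "f \<in> borel_measurable borel" "h integrable_on {a..b}" "\<And>x. \<bar>f x\<bar> \<le> h x"
  shows "f integrable_on {a..b}"
proof -
  have "f \<in> borel_measurable (lebesgue_on {a..b})"
    using borel_imp_lebesgue_on_UNIV[OF assms(1)] unfolding lebesgue_on_UNIV_eq by (rule measurable_restrict_space1)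
  then have "f absolutely_integrable_on {a..b}"
    by (rule measurable_bounded_by_integrable_imp_absolutely_integrable[OF _ _ assms(2)]) (use assms(3) in auto)
  then show ?thesis by (rule set_lebesgue_integral_eq_integral(1))
qed

lemma pw2_zero: "pw2 (\<lambda>k x. 0)"
  unfolding pw2_def using pw_zero by auto

lemma HS_pw2: "HS S v \<Longrightarrow> pw2 v"
  unfolding pw2_def HS_def using integrable_on_subinterval by blast

lemma pw2_add_scaled:
  assumes v: "pw2 v" and w: "pw2 w"
  shows "pw2 (add_scaled v t w)"
proof -
  obtain F where F: "finite F" "\<And>x. x \<notin> F \<Longrightarrow> (v 0 has_real_derivative v 1 x) (at x)"
    "\<And>x. x \<notin> F \<Longrightarrow> (v 1 has_real_derivative v 2 x) (at x)"
    using v unfolding pw2_def pw_def by blast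
  obtain G where G: "finite G" "\<And>x. x \<notin> G \<Longrightarrow> (w 0 has_real_derivative w 1 x) (at x)"
    "\<And>x. x \<notin> G \<Longrightarrow> (w 1 has_real_derivative w 2 x) (at x)"
    using w unfolding pw2_def pw_def by blast
  have pv: "pw v" and pww: "pw w" using v w by (auto simp: pw2_def)
  have 1: "pw (add_scaled v t w)" unfolding pw_def add_scaled_def
  proof (intro conjI exI[of _ "F \<union> G"] allI impI)
    show "(\<lambda>x. v 2 x + t * w 2 x) \<in> borel_measurable borel"
      by (intro borel_measurable_add borel_measurable_times pw_borel[OF pv] pw_borel[OF pww]) auto
    fix x assume "x \<notin> F \<union> G"
    then have x: "x \<notin> F" "x \<notin> G" by auto
    show "((\<lambda>x. v 0 x + t * w 0 x) has_real_derivative v 1 x + t * w 1 x) (at x)"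
      by (intro DERIV_add DERIV_cmult F(2) G(2) x)
    show "((\<lambda>x. v 1 x + t * w 1 x) has_real_derivative v 2 x + t * w 2 x) (at x)"
      by (intro DERIV_add DERIV_cmult F(3) G(3) x)
  qed (use F(1) G(1) pw_cont[OF pv] pw_cont[OF pww] in \<open>auto intro!: continuous_intros\<close>)
  have "(\<lambda>x. (add_scaled v t w k x)\<^sup>2) integrable_on {a..b}" if k: "k \<le> 2" for k a b
  proof (rule borel_bound_integrable)
    show "(\<lambda>x. (add_scaled v t w k x)\<^sup>2) \<in> borel_measurable borel" unfolding add_scaled_def
      by (intro borel_measurable_add borel_measurable_times borel_measurable_power pw_borel[OF pv] pw_borel[OF pww] k) auto
    show "(\<lambda>x. 2 * (v k x)\<^sup>2 + 2 * t\<^sup>2 * (w k x)\<^sup>2) integrable_on {a..b}"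
      using v w k unfolding pw2_def by (intro integrable_add integrable_on_mult_right) auto
    fix x
    have "(p + q)\<^sup>2 \<le> 2 * p\<^sup>2 + 2 * q\<^sup>2" for p q :: real
      using sum_squares_bound[of p q] by (simp add: power2_eq_square algebra_simps)
    from this[of "v k x" "t * w k x"] show "\<bar>(add_scaled v t w k x)\<^sup>2\<bar> \<le> 2 * (v k x)\<^sup>2 + 2 * t\<^sup>2 * (w k x)\<^sup>2"
      by (simp add: add_scaled_def power_mult_distrib)
  qed
  with 1 show ?thesis unfolding pw2_def by blast
qed

section \<open>Gluing and clipping\<close>

definition glue :: "real \<Rightarrow> (nat \<Rightarrow> real \<Rightarrow> real) \<Rightarrow> (nat \<Rightarrow> real \<Rightarrow> real) \<Rightarrow> nat \<Rightarrow> real \<Rightarrow> real" where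
  "glue c f g = (\<lambda>k x. if x \<le> c then f k x else g k x)"

text \<open>Matching value and slope suffices: the second derivative may jump, and \<open>c\<close>
  joins the exceptional set.\<close>

lemma pw_glue:
  assumes f: "pw f" and g: "pw g" and eq: "\<And>k. k \<le> 1 \<Longrightarrow> f k c = g k c"
  shows "pw (glue c f g)"
proof -
  obtain F where F: "finite F" "\<And>x. x \<notin> F \<Longrightarrow> (f 0 has_real_derivative f 1 x) (at x)"
    "\<And>x. x \<notin> F \<Longrightarrow> (f 1 has_real_derivative f 2 x) (at x)"
    using f unfolding pw_def by blast
  obtain G where G: "finite G" "\<And>x. x \<notin> G \<Longrightarrow> (g 0 has_real_derivative g 1 x) (at x)"
    "\<And>x. x \<notin> G \<Longrightarrow> (g 1 has_real_derivative g 2 x) (at x)"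
    using g unfolding pw_def by blast
  have c: "continuous_on UNIV (glue c f g k)" if "k \<le> 1" for k
    unfolding glue_def using pw_cont[OF f that] pw_cont[OF g that] eq[OF that]
    by (intro continuous_on_cases_le) auto
  have d: "(glue c f g k has_real_derivative glue c f g (Suc k) x) (at x)"
    if x: "x \<noteq> c" and df: "(f k has_real_derivative f (Suc k) x) (at x)" and dg: "(g k has_real_derivative g (Suc k) x) (at x)" for k x
  proof (cases "x < c")
    case True
    show ?thesis
      by (rule has_field_derivative_transform_within_open[of "f k" _ _ "{..<c}"]) (use True df in \<open>auto simp: glue_def\<close>)
  next
    case False
    show ?thesis
      by (rule has_field_derivative_transform_within_open[of "g k" _ _ "{c<..}"]) (use False x dg in \<open>auto simp: glue_def\<close>)
  qed
  show ?thesis unfolding pw_def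
  proof (intro conjI exI[of _ "insert c (F \<union> G)"] allI impI c)
    show "glue c f g 2 \<in> borel_measurable borel" unfolding glue_def
      by (intro measurable_If pw_borel f g) auto
    fix x assume "x \<notin> insert c (F \<union> G)"
    then have x: "x \<noteq> c" "x \<notin> F" "x \<notin> G" by auto
    show "(glue c f g 0 has_real_derivative glue c f g 1 x) (at x)"
      using d[OF x(1), of 0] F(2)[OF x(2)] G(2)[OF x(3)] by simp
    show "(glue c f g 1 has_real_derivative glue c f g 2 x) (at x)"
      using d[OF x(1), of 1] F(3)[OF x(2)] G(3)[OF x(3)] by (simp add: numeral_2_eq_2)
  qed (use F(1) G(1) in auto)
qed

lemma pw2_glue:
  assumes f: "pw2 f" and g: "pw2 g" and eq: "\<And>k. k \<le> 1 \<Longrightarrow> f k c = g k c"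
  shows "pw2 (glue c f g)"
proof -
  have p: "pw (glue c f g)" using pw_glue[of f g c] f g eq unfolding pw2_def by blast
  have "(\<lambda>x. (glue c f g k x)\<^sup>2) integrable_on {a..b}" if k: "k \<le> 2" for k a b
  proof (rule borel_bound_integrable)
    show "(\<lambda>x. (glue c f g k x)\<^sup>2) \<in> borel_measurable borel"
      by (intro borel_measurable_power pw_borel[OF p k])
    show "(\<lambda>x. (f k x)\<^sup>2 + (g k x)\<^sup>2) integrable_on {a..b}"
      using f g k unfolding pw2_def by (intro integrable_add) auto
  qed (auto simp: glue_def)
  with p show ?thesis unfolding pw2_def by blast
qed

text \<open>The result is 0 at \<open>l\<close> but equals \<open>f\<close> at \<open>r\<close>.
  This asymmetry concerns one point only; integrals of the density are corrected for it by
  discarding that point.\<close>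

definition clip :: "real \<Rightarrow> real \<Rightarrow> (nat \<Rightarrow> real \<Rightarrow> real) \<Rightarrow> nat \<Rightarrow> real \<Rightarrow> real" where
  "clip l r f = glue r (glue l (\<lambda>k x. 0) f) (\<lambda>k x. 0)"

lemma clip_simps:
  "l < x \<Longrightarrow> x \<le> r \<Longrightarrow> clip l r f k x = f k x" "x \<le> l \<Longrightarrow> clip l r f k x = 0" "x > r \<Longrightarrow> clip l r f k x = 0"
  by (auto simp: clip_def glue_def)

lemma HS_clip:
  assumes f: "pw2 f" and l: "\<And>k. k \<le> 1 \<Longrightarrow> f k l = 0" and r: "\<And>k. k \<le> 1 \<Longrightarrow> f k r = 0" and lr: "l < r"
  shows "HS {l..r} (clip l r f)"
proof -
  have p: "pw2 (clip l r f)" unfolding clip_def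
    by (intro pw2_glue f pw2_zero) (use l r lr in \<open>auto simp: glue_def\<close>)
  have "(\<lambda>x. (clip l r f k x)\<^sup>2) integrable_on UNIV" if "k \<le> 2" for k
  proof -
    have "(\<lambda>x. (clip l r f k x)\<^sup>2) integrable_on {l..r}" using p that unfolding pw2_def by blast
    then have "(\<lambda>x. if x \<in> {l..r} then (clip l r f k x)\<^sup>2 else 0) integrable_on UNIV"
      by (simp only: integrable_restrict_UNIV)
    moreover have "(\<lambda>x. if x \<in> {l..r} then (clip l r f k x)\<^sup>2 else 0) = (\<lambda>x. (clip l r f k x)\<^sup>2)"
      by (auto simp: clip_def glue_def)
    ultimately show ?thesis by simp
  qed
  then show ?thesis using p unfolding HS_def pw2_def by (auto simp: clip_def glue_def)
qed

lemma continuous_zero_right: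
  fixes f :: "real \<Rightarrow> real"
  assumes c: "continuous_on UNIV f" and z: "\<And>x. x > r \<Longrightarrow> f x = 0"
  shows "f r = 0"
proof -
  have "(f \<longlongrightarrow> f r) (at_right r)"
    using c by (metis UNIV_I continuous_on_def tendsto_within_subset subset_UNIV)
  moreover have "(f \<longlongrightarrow> 0) (at_right r)"
    by (rule tendsto_eventually) (auto simp: eventually_at_filter z)
  ultimately show ?thesis using tendsto_unique trivial_limit_at_right_real by blast
qed

lemma continuous_zero_left:
  fixes f :: "real \<Rightarrow> real"
  assumes c: "continuous_on UNIV f" and z: "\<And>x. x < r \<Longrightarrow> f x = 0"
  shows "f r = 0"
proof -
  have "(f \<longlongrightarrow> f r) (at_left r)"
    using c by (metis UNIV_I continuous_on_def tendsto_within_subset subset_UNIV)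
  moreover have "(f \<longlongrightarrow> 0) (at_left r)"
    by (rule tendsto_eventually) (auto simp: eventually_at_filter z)
  ultimately show ?thesis using tendsto_unique trivial_limit_at_left_real by blast
qed

lemma HS_endpoints:
  assumes "HS {l..r} y" "k \<le> 1"
  shows "y k l = 0" "y k r = 0"
proof -
  have z: "y k x = 0" if "x \<notin> {l..r}" for x using HS_zero_off[OF assms(1)] assms(2) that by auto
  show "y k l = 0" by (rule continuous_zero_left[OF HS_cont[OF assms]]) (auto intro: z)
  show "y k r = 0" by (rule continuous_zero_right[OF HS_cont[OF assms]]) (auto intro: z)
qed

lemma HS_right_endpoint:
  assumes "HS S y" "k \<le> 1" "S \<subseteq> {..r}"
  shows "y k r = 0"
proof (rule continuous_zero_right[OF HS_cont[OF assms(1,2)]])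
  fix x assume "r < x"
  then have "x \<notin> S" using assms(3) by auto
  then show "y k x = 0" using HS_zero_off[OF assms(1)] assms(2) by auto
qed

text \<open>Cauchy-Schwarz against the constant 1, obtained by integrating
  \<open>(f - t)^2 >= 0\<close> with \<open>t\<close> the mean of \<open>f\<close>.\<close>

lemma integral_square_bound:
  fixes f :: "real \<Rightarrow> real"
  assumes I: "(f has_integral I) {a..b}" and f2: "(\<lambda>x. (f x)\<^sup>2) integrable_on {a..b}" and ab: "a \<le> b"
  shows "I\<^sup>2 \<le> (b - a) * integral {a..b} (\<lambda>x. (f x)\<^sup>2)"
proof (cases "a = b")
  case True then show ?thesis using integral_unique[OF I] by simp
next
  case False
  define t where "t = I / (b - a)"
  have pos: "b - a > 0" using ab False by simp
  have "((\<lambda>x. (f x)\<^sup>2 - 2 * t * f x + t\<^sup>2) has_integral (integral {a..b} (\<lambda>x. (f x)\<^sup>2) - 2 * t * I + t\<^sup>2 * (b - a))) {a..b}"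
    using has_integral_add[OF has_integral_diff[OF integrable_integral[OF f2] has_integral_mult_right[OF I, of "2 * t"]] has_integral_const_real[of "t\<^sup>2" a b]] ab
    by (simp add: mult.commute)
  then have "0 \<le> integral {a..b} (\<lambda>x. (f x)\<^sup>2) - 2 * t * I + t\<^sup>2 * (b - a)"
  proof (rule has_integral_nonneg)
    fix x
    have "0 \<le> (f x - t)\<^sup>2" by simp
    then show "0 \<le> (f x)\<^sup>2 - 2 * t * f x + t\<^sup>2" by (simp add: power2_diff algebra_simps)
  qed
  moreover have "t * (b - a) = I" using pos by (simp add: t_def)
  then have "t\<^sup>2 * (b - a) = t * I" by (simp add: power2_eq_square mult.assoc)
  ultimately have "t * I \<le> integral {a..b} (\<lambda>x. (f x)\<^sup>2)" by (simp add: mult.commute)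
  then have "(b - a) * (t * I) \<le> (b - a) * integral {a..b} (\<lambda>x. (f x)\<^sup>2)" using pos by (intro mult_left_mono) auto
  moreover have "(b - a) * (t * I) = I\<^sup>2" using \<open>t * (b - a) = I\<close> by (simp add: power2_eq_square mult.commute mult.left_commute)
  ultimately show ?thesis by simp
qed

lemma integral_zero_continuous:
  fixes f :: "real \<Rightarrow> real"
  assumes c: "continuous_on {a..b} f" and ab: "a < b" and I: "integral {a..b} (\<lambda>x. (f x)\<^sup>2) \<le> 0" and x: "x \<in> {a..b}"
  shows "f x = 0"
proof -
  have c2: "continuous_on {a..b} (\<lambda>x. (f x)\<^sup>2)" using c by (intro continuous_intros)
  have "integral {a..b} (\<lambda>x. (f x)\<^sup>2) = 0"
    using I integral_nonneg[OF integrable_continuous_real[OF c2]] by simp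
  then have "((\<lambda>x. (f x)\<^sup>2) has_integral 0) {a..b}"
    using integrable_integral[OF integrable_continuous_real[OF c2]] by simp
  then have "(f x)\<^sup>2 = 0"
    using has_integral_0_cbox_imp_0[of a b "\<lambda>x. (f x)\<^sup>2" x] c2 ab x by (simp add: box_real)
  then show ?thesis by simp
qed

lemma pw_ftc:
  assumes y: "pw y" and k: "k \<le> 1" and ab: "a \<le> b"
  shows "(y (Suc k) has_integral (y k b - y k a)) {a..b}"
proof -
  obtain F where F: "finite F" "\<And>x. x \<notin> F \<Longrightarrow> (y 0 has_real_derivative y 1 x) (at x)"
    "\<And>x. x \<notin> F \<Longrightarrow> (y 1 has_real_derivative y 2 x) (at x)"
    using y unfolding pw_def by blast
  show ?thesis
  proof (rule fundamental_theorem_of_calculus_strong[OF F(1) ab])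
    fix x assume "x \<in> {a..b} - F"
    then have "(y k has_real_derivative y (Suc k) x) (at x)"
      using F(2,3)[of x] k by (cases "k = 0") (auto simp: numeral_2_eq_2 le_Suc_eq)
    then show "(y k has_vector_derivative y (Suc k) x) (at x)"
      by (simp add: has_real_derivative_iff_has_vector_derivative)
  qed (rule pw_cont[OF y k])
qed

section \<open>Intervals on which the clamped form is negative\<close>

context pot
begin

text \<open>Negative definiteness on functions clamped at \<open>a\<close> and \<open>b\<close>;
  they are left free outside, so that one function can be tested on several intervals. The
  inequality gives maximality of broken solutions, the strictness gives unique solvability of the
  clamped problem.\<close>

definition neg :: "real \<Rightarrow> real \<Rightarrow> real \<Rightarrow> bool" where
  "neg lam a b \<longleftrightarrow> (\<forall>y. HS UNIV y \<longrightarrow> (\<forall>k\<le>1. y k a = 0 \<and> y k b = 0) \<longrightarrow>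
     integral {a..b} (qi lam y y) \<le> 0 \<and> (integral {a..b} (qi lam y y) = 0 \<longrightarrow> (\<forall>x\<in>{a..b}. y 0 x = 0)))"

text \<open>The tail estimate needs no boundary data, which is what makes it usable for a priori bounds.\<close>

lemma tail_bound:
  assumes y: "pw2 y" and V: "\<And>x. x \<in> {a..b} \<Longrightarrow> V x \<le> - m / 2" and lam: "lam \<ge> 0"
    and I: "(qi lam y y has_integral I) {a..b}"
  shows "integral {a..b} (\<lambda>x. (y 0 x)\<^sup>2) \<le> - (2 / m) * I" "integral {a..b} (\<lambda>x. (y 2 x)\<^sup>2) \<le> - (2 + 4 / m) * I" "I \<le> 0"
proof -
  have y2: "(\<lambda>x. (y k x)\<^sup>2) integrable_on {a..b}" if "k \<le> 2" for k using y that unfolding pw2_def by blast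
  \<comment> \<open>Pointwise coercivity. It controls \<open>y 0\<close> and
    \<open>y 2 + y 0\<close>; the bound for \<open>y 2\<close> follows from
    \<open>2 (p + q)^2 + 2 q^2 - p^2 = (p + 2 q)^2\<close>.\<close>
  have pt: "(m / 2) * (y 0 x)\<^sup>2 + (y 2 x + y 0 x)\<^sup>2 \<le> - qi lam y y x" if "x \<in> {a..b}" for x
  proof -
    have "(V x - lam) * (y 0 x)\<^sup>2 \<le> (- m / 2) * (y 0 x)\<^sup>2"
      using V[OF that] lam by (intro mult_right_mono) auto
    then show ?thesis by (simp add: qi_def power2_eq_square algebra_simps)
  qed
  have I': "((\<lambda>x. - qi lam y y x) has_integral - I) {a..b}" using I by (rule has_integral_neg)
  have 1: "(m / 2) * integral {a..b} (\<lambda>x. (y 0 x)\<^sup>2) \<le> - I"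
  proof (rule has_integral_le[OF has_integral_mult_right[OF integrable_integral[OF y2]] I'])
    fix x assume "x \<in> {a..b}"
    from pt[OF this] show "m / 2 * (y 0 x)\<^sup>2 \<le> - qi lam y y x" using zero_le_power2[of "y 2 x + y 0 x"] by linarith
  qed simp
  then show a: "integral {a..b} (\<lambda>x. (y 0 x)\<^sup>2) \<le> - (2 / m) * I" using m_pos by (simp add: field_simps)
  have "integral {a..b} (\<lambda>x. (y 2 x)\<^sup>2) \<le> 2 * (- I) + 2 * integral {a..b} (\<lambda>x. (y 0 x)\<^sup>2)"
  proof (rule has_integral_le[OF integrable_integral[OF y2] has_integral_add[OF has_integral_mult_right[OF I'] has_integral_mult_right[OF integrable_integral[OF y2]]]])
    fix x assume x: "x \<in> {a..b}"
    have "(y 2 x)\<^sup>2 \<le> 2 * (y 2 x + y 0 x)\<^sup>2 + 2 * (y 0 x)\<^sup>2"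
      using zero_le_power2[of "y 2 x + 2 * y 0 x"] by (simp add: power2_eq_square algebra_simps)
    moreover have "(y 2 x + y 0 x)\<^sup>2 \<le> - qi lam y y x"
      using pt[OF x] m_pos zero_le_power2[of "y 0 x"] mult_nonneg_nonneg[of "m / 2" "(y 0 x)\<^sup>2"] by linarith
    ultimately show "(y 2 x)\<^sup>2 \<le> 2 * - qi lam y y x + 2 * (y 0 x)\<^sup>2" by linarith
  qed auto
  also have "\<dots> \<le> 2 * (- I) + 2 * (- (2 / m) * I)" using a by linarith
  finally show "integral {a..b} (\<lambda>x. (y 2 x)\<^sup>2) \<le> - (2 + 4 / m) * I" by (simp add: algebra_simps)
  have "0 \<le> integral {a..b} (\<lambda>x. (y 0 x)\<^sup>2)" by (rule integral_nonneg[OF y2]) auto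
  then have "0 \<le> (m / 2) * integral {a..b} (\<lambda>x. (y 0 x)\<^sup>2)" using m_pos by simp
  then show "I \<le> 0" using 1 by linarith
qed

lemma neg_tail:
  assumes V: "\<And>x. x \<in> {a..b} \<Longrightarrow> V x \<le> - m / 2" and lam: "lam \<ge> 0" and ab: "a < b"
  shows "neg lam a b"
  unfolding neg_def
proof (intro allI impI)
  fix y assume y: "HS UNIV y" and "\<forall>k\<le>1. y k a = 0 \<and> y k b = 0"
  have I: "(qi lam y y has_integral integral {a..b} (qi lam y y)) {a..b}"
    using qi_int_Icc[OF y y] by (rule integrable_integral)
  note tb = tail_bound[OF HS_pw2[OF y] V lam I]
  show "integral {a..b} (qi lam y y) \<le> 0 \<and> (integral {a..b} (qi lam y y) = 0 \<longrightarrow> (\<forall>x\<in>{a..b}. y 0 x = 0))"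
  proof (intro conjI impI ballI)
    show "integral {a..b} (qi lam y y) \<le> 0" by (rule tb(3))
    fix x assume "integral {a..b} (qi lam y y) = 0" and x: "x \<in> {a..b}"
    then have 0: "integral {a..b} (\<lambda>x. (y 0 x)\<^sup>2) \<le> 0" using tb(1) by simp
    show "y 0 x = 0" by (rule integral_zero_continuous[OF HS_cont[OF y] ab 0 x]) simp
  qed
qed

text \<open>A Poincare argument: for clamped \<open>y\<close> on an interval of length at most
  \<open>h <= 1\<close> the integral of \<open>y^2\<close> is at most \<open>h * E\<close>, where
  \<open>E\<close> is that of \<open>y''^2\<close>. The density is at most
  \<open>- y''^2 / 2 + (1 + K) y^2\<close>, which integrates to at most
  \<open>- E / 4\<close>.\<close>

lemma neg_short:
  obtains h where "h > 0" "\<And>a b lam. a < b \<Longrightarrow> b \<le> a + h \<Longrightarrow> lam \<ge> 0 \<Longrightarrow> neg lam a b"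
proof -
  obtain K where K: "K \<ge> 0" "\<And>x. \<bar>V x\<bar> \<le> K" using V_bounded by blast
  \<comment> \<open>Chosen such that \<open>(1 + K) * h = 1 / 4\<close>, half of the coefficient
    \<open>1 / 2\<close> of the good term.\<close>
  define h where "h = 1 / (4 * (1 + K))"
  have h: "h > 0" "h \<le> 1" "(1 + K) * h = 1 / 4" using K(1) by (auto simp: h_def field_simps)
  show ?thesis
  proof (rule that[OF h(1)])
    fix a b lam assume ab: "a < b" "b \<le> a + h" and lam: "lam \<ge> (0::real)"
    show "neg lam a b" unfolding neg_def
    proof (intro allI impI)
      fix y assume y: "HS UNIV y" and z: "\<forall>k\<le>1. y k a = 0 \<and> y k b = 0"
      have p: "pw y" and y2: "\<And>k a b. k \<le> 2 \<Longrightarrow> (\<lambda>x. (y k x)\<^sup>2) integrable_on {a..b}"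
        using HS_pw2[OF y] unfolding pw2_def by auto
      define E where "E = integral {a..b} (\<lambda>x. (y 2 x)\<^sup>2)"
      have E0: "E \<ge> 0" unfolding E_def by (rule integral_nonneg[OF y2]) auto
      have sub: "integral {a..x} (\<lambda>x. (y k x)\<^sup>2) \<le> integral {a..b} (\<lambda>x. (y k x)\<^sup>2)" if "x \<in> {a..b}" "k \<le> 2" for x k
        using that by (intro integral_subset_le y2) auto
      have st: "(y k x)\<^sup>2 \<le> h * integral {a..b} (\<lambda>x. (y (Suc k) x)\<^sup>2)" if x: "x \<in> {a..b}" and k: "k \<le> 1" for x k
      proof -
        have "(y (Suc k) has_integral (y k x)) {a..x}" using pw_ftc[OF p k, of a x] x z k by auto
        from integral_square_bound[OF this y2] have "(y k x)\<^sup>2 \<le> (x - a) * integral {a..x} (\<lambda>x. (y (Suc k) x)\<^sup>2)"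
          using x k by auto
        also have "\<dots> \<le> h * integral {a..b} (\<lambda>x. (y (Suc k) x)\<^sup>2)"
          using x ab h k by (intro mult_mono sub integral_nonneg[OF y2]) auto
        finally show ?thesis .
      qed
      have up: "integral {a..b} (\<lambda>x. (y k x)\<^sup>2) \<le> h * c" if "\<And>x. x \<in> {a..b} \<Longrightarrow> (y k x)\<^sup>2 \<le> c" "k \<le> 2" "c \<ge> 0" for k c
      proof -
        have "integral {a..b} (\<lambda>x. (y k x)\<^sup>2) \<le> integral {a..b} (\<lambda>x. c)"
          using that by (intro integral_le y2) auto
        also have "\<dots> = (b - a) * c" using ab by simp
        also have "\<dots> \<le> h * c" using ab that by (intro mult_right_mono) auto
        finally show ?thesis .
      qed
      have hE: "0 \<le> h * E" using h E0 by simp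
      have 1: "integral {a..b} (\<lambda>x. (y 1 x)\<^sup>2) \<le> h * (h * E)"
        using st[of _ 1] hE by (intro up) (auto simp: E_def numeral_2_eq_2)
      have "h * (h * E) \<le> 1 * (1 * E)" using h E0 hE by (intro mult_mono) auto
      then have one': "integral {a..b} (\<lambda>x. (y 1 x)\<^sup>2) \<le> E" using 1 by simp
      have y0: "(y 0 x)\<^sup>2 \<le> h * E" if "x \<in> {a..b}" for x
      proof -
        have "(y 0 x)\<^sup>2 \<le> h * integral {a..b} (\<lambda>x. (y 1 x)\<^sup>2)" using st[OF that, of 0] by simp
        also have "\<dots> \<le> h * E" using one' h by (intro mult_left_mono) auto
        finally show ?thesis .
      qed
      have 0: "integral {a..b} (\<lambda>x. (y 0 x)\<^sup>2) \<le> h * (h * E)"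
        using y0 hE by (intro up) auto
      have "h * (h * E) \<le> h * (1 * E)" using h E0 by (intro mult_left_mono mult_right_mono) auto
      then have 0: "integral {a..b} (\<lambda>x. (y 0 x)\<^sup>2) \<le> h * E" using 0 by simp
      have "integral {a..b} (qi lam y y) \<le> integral {a..b} (\<lambda>x. - (1/2) * (y 2 x)\<^sup>2 + (1 + K) * (y 0 x)\<^sup>2)"
      proof (rule integral_le)
        show "qi lam y y integrable_on {a..b}" by (rule qi_int_Icc[OF y y])
        show "(\<lambda>x. - (1/2) * (y 2 x)\<^sup>2 + (1 + K) * (y 0 x)\<^sup>2) integrable_on {a..b}"
          by (intro integrable_add integrable_on_mult_right y2) auto
        fix x
        have "(V x - lam) * (y 0 x)\<^sup>2 \<le> K * (y 0 x)\<^sup>2"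
          using K(2)[of x] lam by (intro mult_right_mono) auto
        moreover have "- (y 2 x + y 0 x)\<^sup>2 \<le> - (1/2) * (y 2 x)\<^sup>2 + (y 0 x)\<^sup>2"
          using zero_le_power2[of "y 2 x + 2 * y 0 x"] by (simp add: power2_eq_square algebra_simps)
        ultimately show "qi lam y y x \<le> - (1/2) * (y 2 x)\<^sup>2 + (1 + K) * (y 0 x)\<^sup>2"
          by (simp add: qi_def power2_eq_square algebra_simps)
      qed
      also have "\<dots> = - (1/2) * E + (1 + K) * integral {a..b} (\<lambda>x. (y 0 x)\<^sup>2)"
        unfolding E_def by (subst integral_add[OF integrable_on_mult_right[OF y2] integrable_on_mult_right[OF y2]])
          (simp_all only: integral_mult_right order_refl zero_le)
      also have "\<dots> \<le> - (1/2) * E + (1 + K) * (h * E)" using 0 K(1) by (intro add_left_mono mult_left_mono) auto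
      also have "\<dots> = - (1/4) * E"       proof -
        have "(1 + K) * (h * E) = (1 / 4) * E" by (simp only: mult.assoc[symmetric] h(3))
        then show ?thesis by linarith
      qed
      finally have fin: "integral {a..b} (qi lam y y) \<le> - (1/4) * E" .
      show "integral {a..b} (qi lam y y) \<le> 0 \<and> (integral {a..b} (qi lam y y) = 0 \<longrightarrow> (\<forall>x\<in>{a..b}. y 0 x = 0))"
      proof (intro conjI impI ballI)
        show "integral {a..b} (qi lam y y) \<le> 0" using fin E0 by linarith
        fix x assume "integral {a..b} (qi lam y y) = 0" and x: "x \<in> {a..b}"
        then have "E = 0" using fin E0 by linarith
        then show "y 0 x = 0" using y0[OF x] by simp
      qed
    qed
  qed
qed

lemma Sol_pw2: assumes u: "Sol lam u" shows "pw2 u"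
proof -
  have "(u 0 has_real_derivative u 1 x) (at x)" "(u 1 has_real_derivative u 2 x) (at x)" for x
    using SolR_deriv[OF u, of 0] SolR_deriv[OF u, of 1] by (auto simp: numeral_2_eq_2)
  then have "pw u" unfolding pw_def
    using SolR_cont[OF u] by (auto intro!: exI[of _ "{}"] borel_measurable_continuous_onI)
  moreover have "(\<lambda>x. (u k x)\<^sup>2) integrable_on {a..b}" if "k \<le> 2" for k a b
    using SolR_cont[OF u, of k] that by (intro integrable_continuous_real continuous_intros) auto
  ultimately show ?thesis unfolding pw2_def by blast
qed

text \<open>Unique continuation: all derivatives vanish at the midpoint, and the Cauchy data there
  determine the solution.\<close>

lemma Sol_zero_on:
  assumes u: "Sol lam u" and z: "\<And>x. x \<in> {a<..<b} \<Longrightarrow> u 0 x = 0" and ab: "a < b" and k: "k \<le> 4"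
  shows "u k x = 0"
proof -
  have z': "\<forall>x\<in>{a<..<b}. u k x = 0" if "k < 4" for k
    using that
  proof (induction k)
    case 0 then show ?case using z by blast
  next
    case (Suc k)
    show ?case
    proof
      fix x assume x: "x \<in> {a<..<b}"
      have "(u k has_real_derivative u (Suc k) x) (at x)" using SolR_deriv[OF u, of k] Suc.prems by simp
      moreover have "(u k has_real_derivative 0) (at x)"
        by (rule has_field_derivative_transform_within_open[of "\<lambda>x. 0" _ _ "{a<..<b}"]) (use Suc x in auto)
      ultimately show "u (Suc k) x = 0" by (rule DERIV_unique)
    qed
  qed
  have "u k ((a+b)/2) = 0" if "k < 4" for k using z'[OF that] ab by auto
  then show ?thesis using Sol_zero_data[OF u, of "(a+b)/2"] k by blast
qed

section \<open>The clamped boundary value problem\<close>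

text \<open>For a solution the form over \<open>{a..b}\<close> reduces to boundary terms, which
  vanish here; the strictness in \<open>neg\<close> then leaves only 0.\<close>

lemma bvp_unique:
  assumes n: "neg lam a b" and ab: "a < b" and u: "Sol lam u"
    and za: "\<And>k. k \<le> 1 \<Longrightarrow> u k a = 0" and zb: "\<And>k. k \<le> 1 \<Longrightarrow> u k b = 0" and k: "k \<le> 4"
  shows "u k x = 0"
proof -
  have y: "HS {a..b} (clip a b u)" by (rule HS_clip[OF Sol_pw2[OF u] za zb ab])
  have "(qi lam u u has_integral (bdry u u b - bdry u u a)) {a..b}"
    using has_integral_bdry[OF u] Sol_pw2[OF u] ab unfolding pw2_def by auto
  then have "(qi lam u u has_integral 0) {a..b}" using za[of 0] za[of 1] zb[of 0] zb[of 1] by (simp add: bdry_def)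
  then have "(qi lam (clip a b u) (clip a b u) has_integral 0) {a..b}"
    by (rule has_integral_spike_finite[of "{a}", rotated 2]) (auto simp: qi_def clip_simps)
  then have "integral {a..b} (qi lam (clip a b u) (clip a b u)) = 0" by (rule integral_unique)
  moreover have "\<forall>k\<le>1. clip a b u k a = 0 \<and> clip a b u k b = 0" using HS_endpoints[OF y] by blast
  ultimately have "\<forall>x\<in>{a..b}. clip a b u 0 x = 0" using n HS_UNIV[OF y] unfolding neg_def by blast
  then have "u 0 x = 0" if "x \<in> {a<..<b}" for x using that by (auto simp: clip_simps dest!: bspec[of _ _ x])
  from Sol_zero_on[OF u this ab k] show ?thesis by blast
qed

lemma linear_system_2:
  fixes A B C D p q :: real
  assumes inj: "\<And>x y. A * x + B * y = 0 \<Longrightarrow> C * x + D * y = 0 \<Longrightarrow> x = 0 \<and> y = 0"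
  obtains x y where "A * x + B * y = p" "C * x + D * y = q"
proof -
  define \<Delta> where "\<Delta> = A * D - B * C"
  have "\<Delta> \<noteq> 0"
  proof
    \<comment> \<open>If the determinant vanishes, \<open>(- B, A)\<close> and
      \<open>(D, - C)\<close> lie in the kernel, so all entries are zero and the system is not
      injective after all.\<close>
    assume 0: "\<Delta> = 0"
    have "B = 0" "A = 0" using inj[of "-B" A] 0 by (auto simp: \<Delta>_def algebra_simps)
    moreover have "D = 0" "C = 0" using inj[of D "-C"] 0 by (auto simp: \<Delta>_def algebra_simps)
    ultimately show False using inj[of 1 1] by simp
  qed
  have "A * ((p * D - B * q) / \<Delta>) + B * ((A * q - p * C) / \<Delta>) = p * \<Delta> / \<Delta>"
    "C * ((p * D - B * q) / \<Delta>) + D * ((A * q - p * C) / \<Delta>) = q * \<Delta> / \<Delta>"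
    unfolding times_divide_eq_right add_divide_distrib[symmetric] by (simp_all add: \<Delta>_def algebra_simps)
  then show ?thesis using \<open>\<Delta> \<noteq> 0\<close>
    by (intro that[of "(p * D - B * q) / \<Delta>" "(A * q - p * C) / \<Delta>"]) simp_all
qed

text \<open>Shooting from \<open>a\<close>: the second and third derivatives there are free, and the
  2 by 2 system for value and slope at \<open>b\<close> is injective by
  \<open>bvp_unique\<close>.\<close>

lemma bvp_exists:
  assumes n: "neg lam a b" and ab: "a < b"
  obtains u where "Sol lam u" "\<And>k. k \<le> 1 \<Longrightarrow> u k a = \<alpha> k" "\<And>k. k \<le> 1 \<Longrightarrow> u k b = \<beta> k"
proof -
  obtain e where e: "\<And>i. Sol lam (e i)" "\<And>i k. k < 4 \<Longrightarrow> e i k a = (if i = k then 1 else (0::real))"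
  proof -
    have "\<forall>i. \<exists>u. Sol lam u \<and> (\<forall>k<4. u k a = (if i = k then 1 else 0))"
      using SolR_exists[where r = "\<lambda>x. 0" and lam = lam and a = a] by auto
    then show ?thesis using that by metis
  qed
  define U where "U c = (\<lambda>k x. \<Sum>i<(4::nat). c i * e i k x)" for c
  have U: "Sol lam (U c)" for c unfolding U_def by (rule Sol_lincomb) (rule e(1))
  have Ua: "U c k a = c k" if "k < 4" for c k
    unfolding U_def using that by (simp add: e(2) if_distrib[of "\<lambda>t. _ * t"] sum.delta cong: if_cong)
  define cc where "cc p q x y = (\<lambda>i::nat. if i = 0 then p else if i = 1 then q else if i = 2 then x else (y::real))" for p q x y
  have Ub: "U (cc p q x y) k b = p * e 0 k b + q * e 1 k b + e 2 k b * x + e 3 k b * y" for p q x y k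
    unfolding U_def cc_def by (simp add: eval_nat_numeral)
  have inj: "x = 0 \<and> y = 0" if "e 2 0 b * x + e 3 0 b * y = 0" "e 2 1 b * x + e 3 1 b * y = 0" for x y
  proof -
    have z: "U (cc 0 0 x y) k a = 0" if "k \<le> 1" for k
      using that by (subst Ua) (auto simp: cc_def le_Suc_eq)
    have z': "U (cc 0 0 x y) k b = 0" if "k \<le> 1" for k
      using that \<open>e 2 0 b * x + e 3 0 b * y = 0\<close> \<open>e 2 1 b * x + e 3 1 b * y = 0\<close> by (auto simp: Ub le_Suc_eq)
    have "U (cc 0 0 x y) 2 a = 0" "U (cc 0 0 x y) 3 a = 0" using bvp_unique[OF n ab U z z'] by auto
    then show ?thesis by (simp add: Ua) (simp add: cc_def)
  qed
  obtain x y where xy: "e 2 0 b * x + e 3 0 b * y = \<beta> 0 - (\<alpha> 0 * e 0 0 b + \<alpha> 1 * e 1 0 b)"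
    "e 2 1 b * x + e 3 1 b * y = \<beta> 1 - (\<alpha> 0 * e 0 1 b + \<alpha> 1 * e 1 1 b)"
    by (rule linear_system_2[OF inj])
  show ?thesis
  proof (rule that[OF U])
    fix k :: nat assume "k \<le> 1"
    then have k: "k = 0 \<or> k = 1" by auto
    show "U (cc (\<alpha> 0) (\<alpha> 1) x y) k a = \<alpha> k" using k by (subst Ua) (auto simp: cc_def)
    show "U (cc (\<alpha> 0) (\<alpha> 1) x y) k b = \<beta> k" using k xy by (auto simp: Ub)
  qed
qed

section \<open>Broken solutions on a grid\<close>

text \<open>For increasing \<open>g\<close>, \<open>G g u mm\<close> has \<open>mm\<close>
  breakpoints and \<open>mm + 1\<close> pieces; the piece \<open>u i\<close> is valid up to and
  including \<open>g i\<close>, and \<open>u mm\<close> beyond the last breakpoint.\<close>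

primrec G :: "(nat \<Rightarrow> real) \<Rightarrow> (nat \<Rightarrow> nat \<Rightarrow> real \<Rightarrow> real) \<Rightarrow> nat \<Rightarrow> nat \<Rightarrow> real \<Rightarrow> real" where
  "G g u 0 = u 0"
| "G g u (Suc i) = glue (g i) (G g u i) (u (Suc i))"

text \<open>What remains of the form at a broken solution after integration by parts.\<close>

definition J :: "(nat \<Rightarrow> real) \<Rightarrow> nat \<Rightarrow> (nat \<Rightarrow> nat \<Rightarrow> real \<Rightarrow> real) \<Rightarrow> (nat \<Rightarrow> real \<Rightarrow> real) \<Rightarrow> real" where
  "J g mm u y = (\<Sum>i<mm. bdry (u i) y (g i) - bdry (u (Suc i)) y (g i))"

lemma G_right:
  assumes g: "strict_mono g" and x: "\<And>i. i < mm \<Longrightarrow> g i < x"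
  shows "G g u mm k x = u mm k x"
proof (cases mm)
  case (Suc n)
  then show ?thesis using x[of n] by (simp add: glue_def)
qed simp

lemma G_match:
  assumes g: "strict_mono g" and match: "\<And>i k. i < mm \<Longrightarrow> k \<le> 1 \<Longrightarrow> u i k (g i) = u (Suc i) k (g i)"
    and x: "\<And>i. i < mm \<Longrightarrow> g i \<le> x" and k: "k \<le> 1"
  shows "G g u mm k x = u mm k x"
  using match x
proof (induction mm arbitrary: x)
  case (Suc mm)
  show ?case
  proof (cases "x = g mm")
    case True
    have "G g u mm k (g mm) = u mm k (g mm)"
      by (rule Suc.IH) (use Suc.prems g in \<open>auto simp: strict_mono_less_eq\<close>)
    then show ?thesis using True Suc.prems(1)[OF _ k, of mm] by (simp add: glue_def)
  next
    case False
    then have "g mm < x" using Suc.prems(2)[of mm] by simp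
    then show ?thesis by (simp add: glue_def)
  qed
qed simp

lemma G_val:
  assumes g: "strict_mono g" and i: "i \<le> mm" and lo: "\<And>j. j < i \<Longrightarrow> g j < x" and hi: "i < mm \<Longrightarrow> x \<le> g i"
  shows "G g u mm k x = u i k x"
  using i hi
proof (induction mm)
  case 0 then show ?case by simp
next
  case (Suc mm)
  show ?case
  proof (cases "i = Suc mm")
    case True
    then show ?thesis using lo[of mm] by (simp add: glue_def)
  next
    case False
    then have i: "i \<le> mm" using Suc.prems by simp
    then have x: "x \<le> g i" using Suc.prems by simp
    also have "g i \<le> g mm" using g i by (simp add: strict_mono_less_eq)
    finally show ?thesis using Suc.IH[OF i] x by (simp add: glue_def)
  qed
qed

lemma G_at:
  assumes g: "strict_mono g" and i: "i < mm"
  shows "G g u mm k (g i) = u i k (g i)"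
  by (rule G_val[OF g]) (use i g in \<open>auto simp: strict_mono_less\<close>)

lemma pw2_G:
  assumes g: "strict_mono g" and match: "\<And>i k. i < mm \<Longrightarrow> k \<le> 1 \<Longrightarrow> u i k (g i) = u (Suc i) k (g i)"
    and u: "\<And>i. i \<le> mm \<Longrightarrow> pw2 (u i)"
  shows "pw2 (G g u mm)"
  using match u
proof (induction mm)
  case (Suc mm)
  have "pw2 (glue (g mm) (G g u mm) (u (Suc mm)))"
  proof (rule pw2_glue)
    fix k :: nat assume k: "k \<le> 1"
    have "G g u mm k (g mm) = u mm k (g mm)"
      by (rule G_match[OF g _ _ k]) (use Suc.prems g in \<open>auto simp: strict_mono_less_eq\<close>)
    then show "G g u mm k (g mm) = u (Suc mm) k (g mm)" using Suc.prems(1)[OF _ k, of mm] by simp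
  qed (use Suc in auto)
  then show ?case by simp
qed simp

text \<open>The boundary terms of neighbouring pieces meet at each breakpoint, and their difference
  is what \<open>J\<close> collects; only the two outer ones remain.\<close>

lemma has_integral_G:
  assumes g: "strict_mono g" and u: "\<And>i. i \<le> mm \<Longrightarrow> Sol lam (u i)" and y: "pw y"
    and l: "mm > 0 \<Longrightarrow> l \<le> g 0" and r: "\<And>i. i < mm \<Longrightarrow> g i \<le> r" and lr: "l \<le> r"
  shows "(qi lam (G g u mm) y has_integral (J g mm u y + bdry (u mm) y r - bdry (u 0) y l)) {l..r}"
  using u l r lr
proof (induction mm arbitrary: r)
  case 0
  then show ?case using has_integral_bdry[of lam "u 0" y l r] y by (simp add: J_def)
next
  case (Suc mm)
  have lg: "l \<le> g mm" using Suc.prems(2) g by (meson order_trans strict_mono_less_eq zero_le zero_less_Suc)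
  have gr: "g mm \<le> r" using Suc.prems(3)[of mm] by simp
  have "(qi lam (G g u mm) y has_integral (J g mm u y + bdry (u mm) y (g mm) - bdry (u 0) y l)) {l..g mm}"
    by (rule Suc.IH) (use Suc.prems lg g in \<open>auto simp: strict_mono_less_eq\<close>)
  then have 1: "(qi lam (G g u (Suc mm)) y has_integral (J g mm u y + bdry (u mm) y (g mm) - bdry (u 0) y l)) {l..g mm}"
    by (rule has_integral_eq[rotated]) (auto simp: qi_def glue_def)
  have "(qi lam (u (Suc mm)) y has_integral (bdry (u (Suc mm)) y r - bdry (u (Suc mm)) y (g mm))) {g mm..r}"
    by (rule has_integral_bdry[OF Suc.prems(1) y gr]) simp
  then have 2: "(qi lam (G g u (Suc mm)) y has_integral (bdry (u (Suc mm)) y r - bdry (u (Suc mm)) y (g mm))) {g mm..r}"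
    by (rule has_integral_spike_finite[of "{g mm}", rotated 2]) (auto simp: qi_def glue_def)
  from has_integral_combine[OF lg gr 1 2] show ?case by (simp add: J_def algebra_simps)
qed

text \<open>On each interval between neighbouring points clamped functions make the form negative.
  Up to a nonpositive remainder the form thus depends only on values and slopes at the grid points.\<close>

definition grid :: "(nat \<Rightarrow> real) \<Rightarrow> nat \<Rightarrow> real \<Rightarrow> real \<Rightarrow> bool" where
  "grid g mm l r \<longleftrightarrow> strict_mono g \<and> 0 < mm \<and> l < g 0 \<and> g (mm - 1) < r \<and>
     (\<forall>lam\<ge>0. neg lam l (g 0) \<and> (\<forall>i. Suc i < mm \<longrightarrow> neg lam (g i) (g (Suc i))) \<and> neg lam (g (mm - 1)) r)"

text \<open>Hermite interpolation of \<open>w\<close> by solutions of the equation, as with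
  splines.\<close>

definition fits :: "(nat \<Rightarrow> real) \<Rightarrow> nat \<Rightarrow> real \<Rightarrow> real \<Rightarrow> real \<Rightarrow> (nat \<Rightarrow> nat \<Rightarrow> real \<Rightarrow> real) \<Rightarrow> (nat \<Rightarrow> real \<Rightarrow> real) \<Rightarrow> bool" where
  "fits g mm l r lam u w \<longleftrightarrow> (\<forall>i\<le>mm. Sol lam (u i)) \<and>
     (\<forall>k\<le>1. u 0 k l = 0 \<and> u mm k r = 0 \<and> (\<forall>i<mm. u i k (g i) = w k (g i) \<and> u (Suc i) k (g i) = w k (g i)))"

lemma grid_le:
  assumes "grid g mm l r"
  shows "i < mm \<Longrightarrow> g i < r" "l < g i" "l < r"
proof -
  have g: "strict_mono g" and l: "l < g 0" and r: "g (mm - 1) < r" and mm: "0 < mm" using assms by (auto simp: grid_def)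
  show "g i < r" if "i < mm" for i
  proof -
    have "g i \<le> g (mm - 1)" using g that by (simp add: strict_mono_less_eq)
    then show ?thesis using r by simp
  qed
  show "l < g i" for i
  proof -
    have "g 0 \<le> g i" using g by (simp add: strict_mono_less_eq)
    then show ?thesis using l by simp
  qed
  then show "l < r" using r less_trans by blast
qed

lemma fits_exists:
  assumes gr: "grid g mm l r" and lam: "lam \<ge> 0"
  shows "\<exists>u. fits g mm l r lam u w"
proof -
  have g: "strict_mono g" and mm: "0 < mm" and n0: "neg lam l (g 0)" and ni: "\<And>i. Suc i < mm \<Longrightarrow> neg lam (g i) (g (Suc i))"
    and nr: "neg lam (g (mm - 1)) r" and lr: "l < g 0" "g (mm - 1) < r"
    using gr lam by (auto simp: grid_def)
  \<comment> \<open>Piece \<open>i\<close> solves a clamped problem on \<open>{lo i..hi i}\<close>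
    with data \<open>dl\<close> and \<open>dh\<close>, which are zero at the outer ends
    \<open>l\<close> and \<open>r\<close>.\<close>
  define lo where "lo i = (if i = 0 then l else g (i - 1))" for i
  define hi where "hi i = (if i = mm then r else g i)" for i
  define dl where "dl i k = (if i = 0 then 0 else w k (g (i - 1)))" for i k
  define dh where "dh i k = (if i = mm then 0 else w k (g i))" for i k
  have "\<exists>u. Sol lam u \<and> (\<forall>k\<le>1. u k (lo i) = dl i k \<and> u k (hi i) = dh i k)" if "i \<le> mm" for i
  proof -
    have lt: "lo i < hi i" using g lr mm by (auto simp: lo_def hi_def strict_mono_less)
    have n: "neg lam (lo i) (hi i)" using n0 ni[of "i - 1"] nr mm that by (auto simp: lo_def hi_def)
    show ?thesis by (rule bvp_exists[OF n lt, of "dl i" "dh i"]) blast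
  qed
  then obtain u where u: "\<And>i. i \<le> mm \<Longrightarrow> Sol lam (u i)"
    "\<And>i k. i \<le> mm \<Longrightarrow> k \<le> 1 \<Longrightarrow> u i k (lo i) = dl i k \<and> u i k (hi i) = dh i k" by metis
  have "fits g mm l r lam u w" unfolding fits_def
  proof (intro conjI allI impI)
    fix k i :: nat assume k: "k \<le> 1" and i: "i < mm"
    show "u i k (g i) = w k (g i)" using u(2)[of i k] i k by (simp add: hi_def dh_def)
    show "u (Suc i) k (g i) = w k (g i)" using u(2)[of "Suc i" k] i k by (simp add: lo_def dl_def)
  next
    fix k :: nat assume k: "k \<le> 1"
    show "u 0 k l = 0" using u(2)[of 0 k] k by (simp add: lo_def dl_def)
    show "u mm k r = 0" using u(2)[of mm k] k by (simp add: hi_def dh_def)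
  qed (use u in auto)
  then show ?thesis by blast
qed

lemma integral_UNIV_Icc:
  fixes f :: "real \<Rightarrow> real"
  assumes "\<And>x. x \<notin> {l..r} \<Longrightarrow> f x = 0"
  shows "integral UNIV f = integral {l..r} f"
proof -
  have "integral UNIV (\<lambda>x. if x \<in> {l..r} then f x else 0) = integral {l..r} f" by (rule integral_restrict_UNIV)
  moreover have "(\<lambda>x. if x \<in> {l..r} then f x else 0) = f" using assms by auto
  ultimately show ?thesis by simp
qed

lemma Q_Icc:
  assumes "HS {l..r} v \<or> HS {l..r} w"
  shows "Q lam v w = integral {l..r} (qi lam v w)"
  unfolding Q_def
proof (rule integral_UNIV_Icc)
  fix x assume x: "x \<notin> {l..r}"
  have "(v 0 x = 0 \<and> v 2 x = 0) \<or> (w 0 x = 0 \<and> w 2 x = 0)"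
    using assms HS_zero_off[OF _ _ x, of v 0] HS_zero_off[OF _ _ x, of v 2]
      HS_zero_off[OF _ _ x, of w 0] HS_zero_off[OF _ _ x, of w 2] by auto
  then show "qi lam v w x = 0" by (auto simp: qi_def)
qed

text \<open>Vanishing to first order at every breakpoint makes \<open>y\<close> clamped on each grid
  interval, so \<open>neg\<close> applies to each and the integrals add up.\<close>

lemma neg_sum:
  assumes gr: "grid g mm l r" and lam: "lam \<ge> 0" and y: "HS {l..r} y" and z: "\<And>i k. i < mm \<Longrightarrow> k \<le> 1 \<Longrightarrow> y k (g i) = 0"
  shows "Q lam y y \<le> 0"
proof -
  have g: "strict_mono g" and mm: "0 < mm" and n0: "neg lam l (g 0)" and ni: "\<And>i. Suc i < mm \<Longrightarrow> neg lam (g i) (g (Suc i))"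
    and nr: "neg lam (g (mm - 1)) r" and lr: "l < g 0" "g (mm - 1) < r"
    using gr lam by (auto simp: grid_def)
  note yU = HS_UNIV[OF y]
  have int: "qi lam y y integrable_on {a..b}" for a b by (rule qi_int_Icc[OF y y])
  have "integral {l..g i} (qi lam y y) \<le> 0" if "i < mm" for i
    using that
  proof (induction i)
    case 0
    then show ?case using n0 yU z[of 0] HS_endpoints[OF y] unfolding neg_def by blast
  next
    case (Suc i)
    have "integral {g i..g (Suc i)} (qi lam y y) \<le> 0" using ni[OF Suc.prems] yU z[of i] z[of "Suc i"] Suc.prems
      unfolding neg_def by (metis Suc_lessD)
    moreover have "integral {l..g i} (qi lam y y) + integral {g i..g (Suc i)} (qi lam y y) = integral {l..g (Suc i)} (qi lam y y)"
      by (rule Henstock_Kurzweil_Integration.integral_combine[OF _ _ int])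
        (use grid_le(2)[OF gr, of i] g in \<open>auto simp: strict_mono_less_eq\<close>)
    ultimately show ?case using Suc by linarith
  qed
  from this[of "mm - 1"] have "integral {l..g (mm - 1)} (qi lam y y) \<le> 0" using mm by simp
  moreover have "integral {g (mm - 1)..r} (qi lam y y) \<le> 0"
    using nr yU z[of "mm - 1"] HS_endpoints[OF y] mm unfolding neg_def by (metis diff_less zero_less_one)
  moreover have "integral {l..g (mm - 1)} (qi lam y y) + integral {g (mm - 1)..r} (qi lam y y) = integral {l..r} (qi lam y y)"
    by (rule Henstock_Kurzweil_Integration.integral_combine[OF _ _ int]) (use grid_le(2)[OF gr, of "mm - 1"] lr in auto)
  ultimately show ?thesis using Q_Icc[of l r y y] y by simp
qed

lemma fits_HS:
  assumes gr: "grid g mm l r" and ft: "fits g mm l r lam u w"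
  shows "HS {l..r} (clip l r (G g u mm))"
proof (rule HS_clip)
  have g: "strict_mono g" using gr by (simp add: grid_def)
  have match: "\<And>i k. i < mm \<Longrightarrow> k \<le> 1 \<Longrightarrow> u i k (g i) = u (Suc i) k (g i)" using ft by (auto simp: fits_def)
  show "pw2 (G g u mm)" by (rule pw2_G[OF g match]) (use ft Sol_pw2 in \<open>auto simp: fits_def\<close>)
  show "l < r" by (rule grid_le(3)[OF gr])
  fix k :: nat assume k: "k \<le> 1"
  have "G g u mm k l = u 0 k l" by (rule G_val[OF g]) (use grid_le(2)[OF gr, of 0] in auto)
  then show "G g u mm k l = 0" using ft k by (simp add: fits_def)
  have "G g u mm k r = u mm k r" by (rule G_right[OF g]) (use grid_le(1)[OF gr] in auto)
  then show "G g u mm k r = 0" using ft k by (simp add: fits_def)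
qed

lemma fits_Q:
  assumes gr: "grid g mm l r" and ft: "fits g mm l r lam u w" and y: "HS {l..r} y"
  shows "Q lam (clip l r (G g u mm)) y = J g mm u y"
proof -
  have g: "strict_mono g" using gr by (simp add: grid_def)
  have p: "pw y" using y by (simp add: HS_def)
  have "(qi lam (G g u mm) y has_integral (J g mm u y + bdry (u mm) y r - bdry (u 0) y l)) {l..r}"
    by (rule has_integral_G[OF g _ p]) (use ft grid_le[OF gr] in \<open>auto simp: fits_def less_imp_le\<close>)
  then have "(qi lam (G g u mm) y has_integral J g mm u y) {l..r}"
    using HS_endpoints[OF y, of 0] HS_endpoints[OF y, of 1] by (simp add: bdry_def)
  then have "(qi lam (clip l r (G g u mm)) y has_integral J g mm u y) {l..r}"
    by (rule has_integral_spike_finite[of "{l}", rotated 2]) (auto simp: qi_def clip_simps)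
  then show ?thesis using Q_Icc[of l r "clip l r (G g u mm)" y] y by (simp add: integral_unique)
qed

lemma fits_val:
  assumes gr: "grid g mm l r" and ft: "fits g mm l r lam u w" and i: "i < mm" and k: "k \<le> 1"
  shows "clip l r (G g u mm) k (g i) = w k (g i)"
proof -
  have g: "strict_mono g" using gr by (simp add: grid_def)
  have "clip l r (G g u mm) k (g i) = G g u mm k (g i)"
    using grid_le(1)[OF gr i] grid_le(2)[OF gr, of i] by (simp add: clip_simps)
  then show ?thesis using G_at[OF g i] ft i k by (simp add: fits_def)
qed

text \<open>Replacing w by the broken solution with the same values and slopes at the grid points can
  only increase the form, because the difference vanishes to first order there.\<close>

lemma fits_max:
  assumes gr: "grid g mm l r" and lam: "lam \<ge> 0" and w: "HS {l..r} w" and ft: "fits g mm l r lam u w"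
  shows "Q lam w w \<le> J g mm u (clip l r (G g u mm))"
    "Q lam (clip l r (G g u mm)) (clip l r (G g u mm)) = J g mm u (clip l r (G g u mm))"
proof -
  let ?W = "clip l r (G g u mm)"
  note W = fits_HS[OF gr ft]
  define y where "y = add_scaled w (-1) ?W"
  have y: "HS {l..r} y" unfolding y_def by (rule HS_add_scaled[OF w W])
  have z: "y k (g i) = 0" if "i < mm" "k \<le> 1" for i k
    using fits_val[OF gr ft that] by (simp add: y_def add_scaled_def)
  \<comment> \<open>\<open>J\<close> sees \<open>y\<close> only through values and slopes at the
    breakpoints. Hence the interpolant is orthogonal to the error \<open>y\<close>, and the form of
    \<open>w\<close> splits into the two contributions.\<close>
  have "J g mm u y = 0" unfolding J_def bdry_def using z[of _ 0] z[of _ 1] by (intro sum.neutral) auto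
  then have "Q lam ?W y = 0" using fits_Q[OF gr ft y] by simp
  moreover have "w = add_scaled y 1 ?W" by (auto simp: y_def add_scaled_def)
  ultimately have "Q lam w w = Q lam y y + Q lam ?W ?W"
    using Q_add_scaled2[OF y W, of lam 1] Q_sym[of lam y ?W] by simp
  then show "Q lam w w \<le> J g mm u ?W" using neg_sum[OF gr lam y z] fits_Q[OF gr ft W] by simp
  show "Q lam ?W ?W = J g mm u ?W" by (rule fits_Q[OF gr ft W])
qed

end

subsection \<open>The index of the form\<close>

text \<open>Gaussian elimination for fewer equations than unknowns. All dimension counts below rest
  on it, including orthogonalisations that would otherwise invert a Gram matrix.\<close>

lemma homogeneous_system:
  fixes A :: "nat \<Rightarrow> 'i \<Rightarrow> real"
  assumes "finite I" "p < card I"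
  shows "\<exists>c. (\<exists>i\<in>I. c i \<noteq> 0) \<and> (\<forall>j<p. (\<Sum>i\<in>I. c i * A j i) = 0)"
  using assms
proof (induction p arbitrary: I A)
  case 0
  then obtain i where "i \<in> I" by fastforce
  then show ?case by (intro exI[of _ "\<lambda>_. 1"]) auto
next
  case (Suc p)
  show ?case
  proof (cases "\<forall>i\<in>I. A p i = 0")
    case True
    obtain c where c: "\<exists>i\<in>I. c i \<noteq> 0" "\<forall>j<p. (\<Sum>i\<in>I. c i * A j i) = 0"
      using Suc.IH[of I A] Suc.prems by auto
    moreover have "(\<Sum>i\<in>I. c i * A p i) = 0" using True by (intro sum.neutral) auto
    ultimately show ?thesis by (intro exI[of _ c]) (auto simp: less_Suc_eq)
  next
    case False
    then obtain i0 where i0: "i0 \<in> I" "A p i0 \<noteq> 0" by blast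
    \<comment> \<open>Equation \<open>p\<close> is solved for the unknown \<open>i0\<close> and
      substituted into the others.\<close>
    define A' where "A' j i = A j i - A j i0 * A p i / A p i0" for j i
    have "finite (I - {i0})" "p < card (I - {i0})" using Suc.prems i0 by auto
    from Suc.IH[OF this, of A'] obtain c where c: "\<exists>i\<in>I - {i0}. c i \<noteq> 0" "\<forall>j<p. (\<Sum>i\<in>I - {i0}. c i * A' j i) = 0"
      by blast
    define e where "e = - (\<Sum>i\<in>I - {i0}. c i * A p i) / A p i0"
    define c' where "c' i = (if i = i0 then e else c i)" for i
    have sum: "(\<Sum>i\<in>I. c' i * A j i) = e * A j i0 + (\<Sum>i\<in>I - {i0}. c i * A j i)" for j
      using sum.remove[OF Suc.prems(1) i0(1), of "\<lambda>i. c' i * A j i"] by (auto simp: c'_def)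
    have "(\<Sum>i\<in>I. c' i * A j i) = 0" if "j < Suc p" for j
    proof (cases "j = p")
      case True
      then show ?thesis using i0(2) by (simp add: sum e_def)
    next
      case False
      then have "j < p" using that by simp
      then have "0 = (\<Sum>i\<in>I - {i0}. c i * A' j i)" using c by simp
      also have "\<dots> = (\<Sum>i\<in>I - {i0}. c i * A j i) - (\<Sum>i\<in>I - {i0}. (A j i0 / A p i0) * (c i * A p i))"
        unfolding A'_def by (simp add: sum_subtractf[symmetric] algebra_simps)
      also have "(\<Sum>i\<in>I - {i0}. (A j i0 / A p i0) * (c i * A p i)) = (A j i0 / A p i0) * (\<Sum>i\<in>I - {i0}. c i * A p i)"
        by (simp only: sum_distrib_left)
      also have "(\<Sum>i\<in>I - {i0}. c i * A j i) - \<dots> = (\<Sum>i\<in>I - {i0}. c i * A j i) + e * A j i0"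
        unfolding e_def by simp
      finally show ?thesis unfolding sum by simp
    qed
    moreover have "\<exists>i\<in>I. c' i \<noteq> 0" using c(1) by (auto simp: c'_def)
    ultimately show ?thesis by (intro exI[of _ c']) auto
  qed
qed

lemma homogeneous_nat:
  fixes A :: "nat \<Rightarrow> nat \<Rightarrow> real"
  assumes "p < d"
  obtains c where "\<exists>i<d. c i \<noteq> 0" "\<And>j. j < p \<Longrightarrow> (\<Sum>i<d. c i * A j i) = 0"
  using homogeneous_system[of "{..<d}" p A] assms by auto

lemma sum_squares_pos:
  fixes c :: "nat \<Rightarrow> real"
  assumes "\<exists>i<d. c i \<noteq> 0"
  shows "(\<Sum>i<d. (c i)\<^sup>2) > 0"
proof -
  obtain i where "i < d" "c i \<noteq> 0" using assms by blast
  then show ?thesis by (intro sum_pos2[of _ i]) auto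
qed

text \<open>The exceptional points concern \<open>v 1\<close> only: \<open>v 0\<close> differs from
  an antiderivative of the continuous \<open>v 1\<close> by no more than a constant, which is fixed
  at 0.\<close>

lemma pw_deriv:
  assumes v: "pw v"
  shows "(v 0 has_real_derivative v 1 x) (at x)"
proof -
  define F where "F = antideriv 0 (v 0 0) (v 1)"
  have c: "continuous_on UNIV (v 1)" using v by (simp add: pw_def)
  have F: "F 0 = v 0 0" "\<And>x. (F has_real_derivative v 1 x) (at x)"
    using antideriv(1,2)[OF c] by (auto simp: F_def)
  have diff: "F b - F a = v 0 b - v 0 a" if "a \<le> b" for a b
  proof -
    have "(v 1 has_integral (F b - F a)) {a..b}"
      by (rule fundamental_theorem_of_calculus[OF that],
          rule has_real_derivative_iff_has_vector_derivative[THEN iffD1], rule has_field_derivative_at_within, rule F(2))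
    moreover have "(v 1 has_integral (v 0 b - v 0 a)) {a..b}" using pw_ftc[OF v _ that, of 0] by simp
    ultimately show ?thesis by (rule has_integral_unique)
  qed
  have "F x = v 0 x" for x
    using diff[of 0 x] diff[of x 0] F(1) by (cases "0 \<le> x") auto
  then have "F = v 0" by auto
  then show ?thesis using F(2) by simp
qed

lemma Hc_common:
  fixes w :: "nat \<Rightarrow> nat \<Rightarrow> real \<Rightarrow> real"
  assumes "\<And>i. i < d \<Longrightarrow> Hc S (w i)"
  obtains T where "\<And>i T'. i < d \<Longrightarrow> T \<le> T' \<Longrightarrow> HS (S \<inter> {-T'..T'}) (w i)"
proof -
  obtain T where T: "\<And>i. i < d \<Longrightarrow> HS (S \<inter> {-T i..T i}) (w i)" using assms unfolding Hc_def by metis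
  define T' where "T' = (\<Sum>i<d. \<bar>T i\<bar>)"
  have le: "T i \<le> T'" if "i < d" for i
  proof -
    have "\<bar>T i\<bar> \<le> (\<Sum>i<d. \<bar>T i\<bar>)"
      using member_le_sum[of i "{..<d}" "\<lambda>i. \<bar>T i\<bar>"] that by auto
    then show ?thesis unfolding T'_def by linarith
  qed
  show ?thesis
  proof (rule that[of T'])
    fix i T'' assume i: "i < d" and "T' \<le> T''"
    then have "T i \<le> T''" using le[OF i] by linarith
    then have "S \<inter> {-T i..T i} \<subseteq> S \<inter> {-T''..T''}" by auto
    then show "HS (S \<inter> {-T''..T''}) (w i)" using HS_mono[OF T[OF i]] by blast
  qed
qed

section \<open>Choice of the grids\<close>

context pot
begin

lemma tails:
  obtains A B where "A < B" "\<And>x. x \<le> A \<Longrightarrow> V x \<le> - m / 2" "\<And>x. x \<ge> B \<Longrightarrow> V x \<le> - m / 2"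
proof -
  obtain b where b: "\<And>x. x \<ge> b \<Longrightarrow> V x < - m / 2"
    using order_tendstoD(2)[OF V_top, of "- m / 2"] m_pos unfolding eventually_at_top_linorder by auto
  obtain a where a: "\<And>x. x \<le> a \<Longrightarrow> V x < - m / 2"
    using order_tendstoD(2)[OF V_bot, of "- m / 2"] m_pos unfolding eventually_at_bot_linorder by auto
  show ?thesis
  proof (rule that[of "min a b - 1" b])
    show "V x \<le> - m / 2" if "x \<le> min a b - 1" for x
    proof -
      have "x \<le> a" using that by linarith
      from a[OF this] show ?thesis by simp
    qed
    show "V x \<le> - m / 2" if "b \<le> x" for x using b[OF that] by simp
  qed auto
qed

text \<open>The factor 2 is slack: in \<open>grid_left_exists\<close> the last grid interval has
  length \<open>h'\<close> plus a displacement of the end by less than \<open>h'\<close>, and must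
  still be short.\<close>

lemma subdivide:
  fixes a b h :: real
  assumes "a < b" "h > 0"
  obtains N h' where "0 < (N::nat)" "0 < h'" "2 * h' \<le> h" "a + real N * h' = b"
proof -
  define N where "N = nat \<lceil>2 * (b - a) / h\<rceil>"
  have pos: "2 * (b - a) / h > 0" using assms by simp
  have N: "real N \<ge> 2 * (b - a) / h" unfolding N_def by linarith
  then have N0: "real N > 0" using pos by linarith
  show ?thesis
  proof (rule that[of N "(b - a) / real N"])
    show "0 < N" using N0 by simp
    show "2 * ((b - a) / real N) \<le> h" using N N0 assms by (simp add: field_simps)
  qed (use N0 assms in auto)
qed

text \<open>One grid serves all right ends near \<open>s\<close> and all left ends far out. Short
  intervals cover the core, and the interval ending at \<open>g 0\<close> lies in the coercive
  tail.\<close>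

lemma grid_left_exists:
  obtains g mm \<delta> where "\<delta> > 0" "\<And>l r. l < g 0 \<Longrightarrow> \<bar>r - s\<bar> < \<delta> \<Longrightarrow> grid g mm l r"
    "\<And>x. x \<le> g 0 \<Longrightarrow> V x \<le> - m / 2" "g (mm - 1) < s - \<delta> / 2" "0 < mm"
proof -
  obtain A B where AB: "\<And>x. x \<le> A \<Longrightarrow> V x \<le> - m / 2" by (rule tails) (rule that)
  obtain h where h: "h > 0" "\<And>a b lam. a < b \<Longrightarrow> b \<le> a + h \<Longrightarrow> lam \<ge> 0 \<Longrightarrow> neg lam a b" by (rule neg_short) (rule that)
  define a where "a = min A s - 1"
  have "a < s" by (simp add: a_def)
  then obtain N h' where N: "0 < (N::nat)" "0 < h'" "2 * h' \<le> h" "a + real N * h' = s" by (rule subdivide[OF _ h(1)]) (rule that)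
  define g where "g i = a + real i * h'" for i
  have Va: "V x \<le> - m / 2" if "x \<le> a" for x using AB[of x] that by (simp add: a_def)
  have gN: "g (N - 1) = s - h'" using N(1,4) by (simp add: g_def of_nat_diff algebra_simps)
  show ?thesis
  proof (rule that[of h' g N])
    fix l r assume l: "l < g 0" and r: "\<bar>r - s\<bar> < h'"
    show "grid g N l r" unfolding grid_def
    proof (intro conjI allI impI)
      show "strict_mono g" using N(2) by (auto simp: strict_mono_def g_def)
      show "g (N - 1) < r" using gN r by auto
      fix lam :: real assume lam: "0 \<le> lam"
      show "neg lam l (g 0)" by (rule neg_tail[OF Va lam l]) (auto simp: g_def)
      show "neg lam (g i) (g (Suc i))" for i
        using N by (intro h(2) lam) (auto simp: g_def algebra_simps)
      show "neg lam (g (N - 1)) r" using gN r N(3) by (intro h(2) lam) auto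
    qed (use N(1) l in auto)
  qed (use N gN Va in \<open>auto simp: g_def\<close>)
qed

lemma grid_line_exists:
  obtains g mm where "\<And>l r. l < g 0 \<Longrightarrow> g (mm - 1) < r \<Longrightarrow> grid g mm l r"
    "\<And>x. x \<le> g 0 \<Longrightarrow> V x \<le> - m / 2" "\<And>x. x \<ge> g (mm - 1) \<Longrightarrow> V x \<le> - m / 2" "0 < mm"
proof -
  obtain A B where AB: "A < B" "\<And>x. x \<le> A \<Longrightarrow> V x \<le> - m / 2" "\<And>x. x \<ge> B \<Longrightarrow> V x \<le> - m / 2" by (rule tails) (rule that)
  obtain h where h: "h > 0" "\<And>a b lam. a < b \<Longrightarrow> b \<le> a + h \<Longrightarrow> lam \<ge> 0 \<Longrightarrow> neg lam a b" by (rule neg_short) (rule that)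
  obtain N h' where N: "0 < (N::nat)" "0 < h'" "2 * h' \<le> h" "A + real N * h' = B" by (rule subdivide[OF AB(1) h(1)]) (rule that)
  define g where "g i = A + real i * h'" for i
  have gN: "g N = B" "g 0 = A" using N(4) by (auto simp: g_def)
  show ?thesis
  proof (rule that[of g "Suc N"])
    fix l r assume l: "l < g 0" and r: "g (Suc N - 1) < r"
    show "grid g (Suc N) l r" unfolding grid_def
    proof (intro conjI allI impI)
      show "strict_mono g" using N(2) by (auto simp: strict_mono_def g_def)
      fix lam :: real assume lam: "0 \<le> lam"
      show "neg lam l (g 0)" by (rule neg_tail[OF AB(2) lam l]) (auto simp: g_def)
      show "neg lam (g i) (g (Suc i))" for i
        using N by (intro h(2) lam) (auto simp: g_def algebra_simps)
      show "neg lam (g (Suc N - 1)) r" using r gN by (intro neg_tail[OF AB(3) lam]) auto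
    qed (use l r in auto)
  qed (use AB gN in auto)
qed

section \<open>Positive families and the index\<close>

text \<open>The uniform \<open>\<epsilon>\<close> implies linear independence and is the margin that
  survives small changes of \<open>lam\<close>, truncation and translation.\<close>

definition pos_family :: "real set \<Rightarrow> real \<Rightarrow> nat \<Rightarrow> (nat \<Rightarrow> nat \<Rightarrow> real \<Rightarrow> real) \<Rightarrow> bool" where
  "pos_family S lam d w \<longleftrightarrow> (\<forall>i<d. Hc S (w i)) \<and>
     (\<exists>\<epsilon>>0. \<forall>c. \<epsilon> * (\<Sum>i<d. (c i)\<^sup>2) \<le> Q lam (lincomb d c w) (lincomb d c w))"

definition pos :: "real set \<Rightarrow> real \<Rightarrow> nat \<Rightarrow> bool" where
  "pos S lam d \<longleftrightarrow> (\<exists>w. pos_family S lam d w)"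

definition index :: "real set \<Rightarrow> real \<Rightarrow> nat" where
  "index S lam = (GREATEST d. pos S lam d)"

lemma pos_0: "pos S lam 0"
proof -
  have "Q lam (\<lambda>k x. 0) (\<lambda>k x. 0) = 0" by (simp add: Q_def qi_def[abs_def])
  then show ?thesis unfolding pos_def pos_family_def lincomb_def by (auto intro: exI[of _ 1])
qed

lemma pos_mono_S: "pos S lam d \<Longrightarrow> S \<subseteq> S' \<Longrightarrow> pos S' lam d"
  unfolding pos_def pos_family_def using Hc_mono by meson

lemma pos_mono_lam: assumes "pos S lam d" "lam' \<le> lam" shows "pos S lam' d"
proof -
  obtain w \<epsilon> where w: "\<And>i. i < d \<Longrightarrow> Hc S (w i)" and e: "\<epsilon> > 0"
    "\<And>c. \<epsilon> * (\<Sum>i<d. (c i)\<^sup>2) \<le> Q lam (lincomb d c w) (lincomb d c w)"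
    using assms unfolding pos_def pos_family_def by blast
  have "\<epsilon> * (\<Sum>i<d. (c i)\<^sup>2) \<le> Q lam' (lincomb d c w) (lincomb d c w)" for c
  proof -
    have h: "HS S (lincomb d c w)" using w Hc_HS by (intro HS_lincomb) auto
    have "0 \<le> (lam - lam') * N2 (lincomb d c w) (lincomb d c w)" using N2_nonneg[OF h] assms(2) by simp
    then show ?thesis using e(2)[of c] Q_lam[OF h h, of lam' lam] by (simp add: algebra_simps)
  qed
  then show ?thesis using w e(1) unfolding pos_def pos_family_def by blast
qed

lemma pos_le: assumes "pos S lam d" "d' \<le> d" shows "pos S lam d'"
proof -
  obtain w \<epsilon> where w: "\<And>i. i < d \<Longrightarrow> Hc S (w i)" and e: "\<epsilon> > 0"
    "\<And>c. \<epsilon> * (\<Sum>i<d. (c i)\<^sup>2) \<le> Q lam (lincomb d c w) (lincomb d c w)"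
    using assms unfolding pos_def pos_family_def by blast
  have "\<epsilon> * (\<Sum>i<d'. (c i)\<^sup>2) \<le> Q lam (lincomb d' c w) (lincomb d' c w)" for c
  proof -
    define c' where "c' i = (if i < d' then c i else 0)" for i
    have s: "(\<Sum>i<d. F (c' i) i) = (\<Sum>i<d'. F (c i) i)" if "\<And>i. F 0 i = 0" for F :: "real \<Rightarrow> nat \<Rightarrow> real"
      using assms(2) that by (intro sum.mono_neutral_cong_right) (auto simp: c'_def)
    have "lincomb d c' w = lincomb d' c w" unfolding lincomb_def using s[of "\<lambda>c i. c * w i _ _"] by (intro ext) simp
    then show ?thesis using e(2)[of c'] s[of "\<lambda>c i. c\<^sup>2"] by simp
  qed
  then show ?thesis using w e(1) assms(2) unfolding pos_def pos_family_def by (meson less_le_trans)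
qed

text \<open>Among more than \<open>2 * mm\<close> directions some combination vanishes to first
  order at all \<open>mm\<close> grid points, and there the form is not positive. The grid is that
  of the line, hence the bound is uniform in \<open>S\<close> and \<open>lam\<close>, and
  \<open>GREATEST\<close> in \<open>index\<close> is meaningful.\<close>

lemma pos_bounded: "\<exists>b. \<forall>S lam d. lam \<ge> 0 \<longrightarrow> pos S lam d \<longrightarrow> d \<le> b"
proof -
  obtain g mm where g: "\<And>l r. l < g 0 \<Longrightarrow> g (mm - 1) < r \<Longrightarrow> grid g mm l r" and mm: "0 < mm" by (rule grid_line_exists) (rule that)
  have "d \<le> 2 * mm" if lam: "lam \<ge> 0" and p: "pos S lam d" for S lam d
  proof (rule ccontr)
    assume "\<not> d \<le> 2 * mm"
    then have d: "2 * mm < d" by simp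
    obtain w \<epsilon> where w: "\<And>i. i < d \<Longrightarrow> Hc S (w i)" and e: "\<epsilon> > 0"
      "\<And>c. \<epsilon> * (\<Sum>i<d. (c i)\<^sup>2) \<le> Q lam (lincomb d c w) (lincomb d c w)"
      using p unfolding pos_def pos_family_def by blast
    obtain T where T: "\<And>i T'. i < d \<Longrightarrow> T \<le> T' \<Longrightarrow> HS (S \<inter> {-T'..T'}) (w i)"
      by (rule Hc_common[where d = d and w = w and S = S, OF w]) (assumption | rule that)+
    define R where "R = max \<bar>T\<bar> (max (1 - g 0) (1 + g (mm - 1)))"
    have R: "T \<le> R" "-R < g 0" "g (mm - 1) < R" by (auto simp: R_def)
    have gr: "grid g mm (-R) R" by (rule g[OF R(2,3)])
    \<comment> \<open>Condition \<open>j\<close> stands for the grid point \<open>j div 2\<close>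
      and the derivative of order \<open>j mod 2\<close>.\<close>
    obtain c where c: "\<exists>i<d. c i \<noteq> 0" "\<And>j. j < 2 * mm \<Longrightarrow> (\<Sum>i<d. c i * w i (j mod 2) (g (j div 2))) = 0"
      using homogeneous_nat[OF d, of "\<lambda>j i. w i (j mod 2) (g (j div 2))"] by blast
    have "HS {-R..R} (w i)" if "i < d" for i using HS_mono[OF T[OF that R(1)]] by blast
    then have h: "HS {-R..R} (lincomb d c w)" by (rule HS_lincomb)
    have "lincomb d c w k (g i) = 0" if "i < mm" "k \<le> 1" for i k
    proof -
      have "2 * i + k < 2 * mm" "(2 * i + k) mod 2 = k" "(2 * i + k) div 2 = i" using that by auto
      then show ?thesis using c(2)[of "2 * i + k"] by (simp add: lincomb_def)
    qed
    then have "Q lam (lincomb d c w) (lincomb d c w) \<le> 0" by (intro neg_sum[OF gr lam h]) auto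
    moreover have "0 < \<epsilon> * (\<Sum>i<d. (c i)\<^sup>2)" using e(1) sum_squares_pos[OF c(1)] by simp
    ultimately show False using e(2)[of c] by linarith
  qed
  then show ?thesis by blast
qed

lemma pos_index: "lam \<ge> 0 \<Longrightarrow> pos S lam (index S lam)"
  unfolding index_def using pos_bounded pos_0 GreatestI_nat by (metis (no_types, lifting))

lemma pos_iff: "lam \<ge> 0 \<Longrightarrow> pos S lam d \<longleftrightarrow> d \<le> index S lam"
proof
  assume lam: "lam \<ge> 0" and "pos S lam d"
  then show "d \<le> index S lam" unfolding index_def using pos_bounded Greatest_le_nat by (metis (no_types, lifting))
qed (use pos_index pos_le in blast)

section \<open>The kernel of the form\<close>

definition weak_kernel :: "real set \<Rightarrow> real \<Rightarrow> (nat \<Rightarrow> real \<Rightarrow> real) \<Rightarrow> bool" where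
  "weak_kernel S lam v \<longleftrightarrow> HS S v \<and> (\<forall>y. Hc S y \<longrightarrow> Q lam v y = 0)"

text \<open>An exact statement rather than a limit, as \<open>y\<close> has compact support:
  truncation far out preserves orthogonality to finitely many test functions.\<close>

lemma cutoff_orth:
  assumes y: "Hc S y"
  shows "\<forall>\<^sub>F n in sequentially. Q lam (cutoff n v) y = Q lam v y"
proof -
  obtain T where T: "HS (S \<inter> {-T..T}) y" using y unfolding Hc_def by blast
  show ?thesis
  proof (rule eventually_sequentiallyI[of "nat \<lceil>\<bar>T\<bar>\<rceil>"])
    fix n assume "nat \<lceil>\<bar>T\<bar>\<rceil> \<le> n"
    then have n: "\<bar>T\<bar> \<le> real n" by (simp add: nat_ceiling_le_eq)
    have "qi lam (cutoff n v) y = qi lam v y"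
    proof
      fix x
      show "qi lam (cutoff n v) y x = qi lam v y x"
      proof (cases "\<bar>x\<bar> \<le> real (Suc n)")
        case True
        then show ?thesis using cutoff_in[OF True, of 0 v] cutoff_in[OF True, of 2 v] by (simp add: qi_def)
      next
        case False
        then have "x \<notin> S \<inter> {-T..T}" using n by auto
        then have "y 0 x = 0" "y 2 x = 0" using HS_zero_off[OF T] by auto
        then show ?thesis by (simp add: qi_def)
      qed
    qed
    then show "Q lam (cutoff n v) y = Q lam v y" by (simp add: Q_def)
  qed
qed

lemma pos_extend:
  assumes w: "pos_family S lam p w" and v: "Hc S v" and q: "Q lam v v > 0" and o: "\<And>j. j < p \<Longrightarrow> Q lam v (w j) = 0"
  shows "pos S lam (Suc p)"
proof -
  obtain \<epsilon> where wc: "\<And>i. i < p \<Longrightarrow> Hc S (w i)" and e: "\<epsilon> > 0"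
    "\<And>c. \<epsilon> * (\<Sum>i<p. (c i)\<^sup>2) \<le> Q lam (lincomb p c w) (lincomb p c w)"
    using w unfolding pos_family_def by blast
  define w' where "w' i = (if i < p then w i else v)" for i
  have lcp: "lincomb (Suc p) c w' = add_scaled (lincomb p c w) (c p) v" for c
  proof -
    have "lincomb p c w' = lincomb p c w" by (auto simp: lincomb_def w'_def)
    then show ?thesis by (simp add: lincomb_Suc w'_def)
  qed
  have h: "HS S (w i)" if "i < p" for i using wc[OF that] by (rule Hc_HS)
  have "min \<epsilon> (Q lam v v) * (\<Sum>i<Suc p. (c i)\<^sup>2) \<le> Q lam (lincomb (Suc p) c w') (lincomb (Suc p) c w')" for c
  proof -
    have 0: "Q lam (lincomb p c w) v = 0"
      using Q_lincomb[OF h Hc_HS[OF v], where d = p and lam = lam and c = c] o by (simp add: Q_sym[of lam _ v])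
    have lcH: "HS S (lincomb p c w)" by (rule HS_lincomb[OF h])
    have "Q lam (lincomb (Suc p) c w') (lincomb (Suc p) c w') = Q lam (lincomb p c w) (lincomb p c w) + (c p)\<^sup>2 * Q lam v v"
      unfolding lcp using Q_add_scaled2[OF lcH Hc_HS[OF v], of lam "c p"] 0 by simp
    moreover have "min \<epsilon> (Q lam v v) * (\<Sum>i<p. (c i)\<^sup>2) \<le> \<epsilon> * (\<Sum>i<p. (c i)\<^sup>2)"
      by (intro mult_right_mono sum_nonneg) auto
    moreover have "min \<epsilon> (Q lam v v) * (c p)\<^sup>2 \<le> Q lam v v * (c p)\<^sup>2" by (intro mult_right_mono) auto
    ultimately show ?thesis using e(2)[of c] by (simp add: algebra_simps)
  qed
  moreover have "min \<epsilon> (Q lam v v) > 0" using e(1) q by simp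
  moreover have "\<forall>i<Suc p. Hc S (w' i)" using wc v by (auto simp: w'_def)
  ultimately show ?thesis unfolding pos_def pos_family_def by blast
qed

text \<open>If \<open>v\<close> were not orthogonal to some test function \<open>z\<close> that is
  orthogonal to the family, then \<open>v + t z\<close> would have positive form for a suitable
  \<open>t\<close>, and its truncation would extend the maximal family. A general test function is
  reduced to this case by subtracting a combination of the family.\<close>

lemma maximal_imp_weak_kernel:
  assumes w: "pos_family S lam p w" and mx: "\<not> pos S lam (Suc p)" and v: "HS S v" and q: "Q lam v v \<ge> 0"
    and o: "\<And>j. j < p \<Longrightarrow> Q lam v (w j) = 0"
  shows "weak_kernel S lam v"
proof -
  obtain \<epsilon> where wc: "\<And>i. i < p \<Longrightarrow> Hc S (w i)" and e: "\<epsilon> > 0"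
    "\<And>c. \<epsilon> * (\<Sum>i<p. (c i)\<^sup>2) \<le> Q lam (lincomb p c w) (lincomb p c w)"
    using w unfolding pos_family_def by blast
  have wH: "HS S (w i)" if "i < p" for i using Hc_HS[OF wc[OF that]] .
  have step1: "Q lam v z = 0" if z: "Hc S z" and zo: "\<And>j. j < p \<Longrightarrow> Q lam z (w j) = 0" for z
  proof (rule ccontr)
    assume ne: "Q lam v z \<noteq> 0"
    note zH = Hc_HS[OF z]
    \<comment> \<open>With \<open>t a = Q lam v z\<close> the form of \<open>v + t z\<close> is
      \<open>Q lam v v + t^2 a + t^2 (a + Q lam z z)\<close>; both \<open>a\<close> and
      \<open>a + Q lam z z\<close> are positive by this choice.\<close>
    define a where "a = 1 + \<bar>Q lam z z\<bar>"
    define t where "t = Q lam v z / a"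
    define v' where "v' = add_scaled v t z"
    have v'H: "HS S v'" unfolding v'_def by (rule HS_add_scaled[OF v zH])
    have a: "a > 0" "a + Q lam z z > 0" by (auto simp: a_def)
    have ta: "t * a = Q lam v z" using a by (simp add: t_def)
    have "Q lam v' v' = Q lam v v + 2 * t * (t * a) + t\<^sup>2 * Q lam z z"
      unfolding v'_def Q_add_scaled2[OF v zH] ta by simp
    also have "\<dots> = Q lam v v + t\<^sup>2 * a + t\<^sup>2 * (a + Q lam z z)" by (simp add: power2_eq_square algebra_simps)
    finally have eq: "Q lam v' v' = Q lam v v + t\<^sup>2 * a + t\<^sup>2 * (a + Q lam z z)" .
    have "t \<noteq> 0" using ne a by (simp add: t_def)
    then have "t\<^sup>2 * a > 0" "t\<^sup>2 * (a + Q lam z z) > 0" using a by auto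
    then have pos': "Q lam v' v' > 0" using eq q by linarith
    have o': "Q lam v' (w j) = 0" if "j < p" for j
      unfolding v'_def using Q_add_scaled[OF v zH wH[OF that], of lam t] o[OF that] zo[OF that] by simp
    have "\<forall>\<^sub>F n in sequentially. Q lam (cutoff n v') (cutoff n v') > 0"
      using order_tendstoD(1)[OF cutoff_lim2[OF v'H v'H] pos'] .
    moreover have "\<forall>\<^sub>F n in sequentially. \<forall>j\<in>{..<p}. Q lam (cutoff n v') (w j) = 0"
      using cutoff_orth[OF wc, of _ lam v'] o' by (intro eventually_ball_finite) auto
    ultimately have "\<forall>\<^sub>F n in sequentially. Q lam (cutoff n v') (cutoff n v') > 0 \<and> (\<forall>j\<in>{..<p}. Q lam (cutoff n v') (w j) = 0)"
      by (rule eventually_conj)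
    then obtain n where "Q lam (cutoff n v') (cutoff n v') > 0" "\<forall>j\<in>{..<p}. Q lam (cutoff n v') (w j) = 0"
      by (metis (mono_tags, lifting) eventually_sequentially order_refl)
    then have "pos S lam (Suc p)" using pos_extend[OF w Hc_cutoff[OF v'H]] by simp
    then show False using mx by simp
  qed
  have "Q lam v y = 0" if y: "Hc S y" for y
  proof -
    define w' where "w' i = (if i < p then w i else y)" for i
    have lcp: "lincomb (Suc p) c w' = add_scaled (lincomb p c w) (c p) y" for c
    proof -
      have "lincomb p c w' = lincomb p c w" by (auto simp: lincomb_def w'_def)
      then show ?thesis by (simp add: lincomb_Suc w'_def)
    qed
    have w'c: "Hc S (w' i)" if "i < Suc p" for i using that wc y by (auto simp: w'_def)
    \<comment> \<open>A combination of the family and \<open>y\<close> orthogonal to the family, by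
      counting. The coefficient of \<open>y\<close> cannot vanish, since the form is definite on the
      family alone.\<close>
    obtain c where c: "\<exists>i<Suc p. c i \<noteq> 0" "\<And>j. j < p \<Longrightarrow> (\<Sum>i<Suc p. c i * Q lam (w' i) (w j)) = 0"
      using homogeneous_nat[of p "Suc p" "\<lambda>j i. Q lam (w' i) (w j)"] by blast
    define z where "z = lincomb (Suc p) c w'"
    have z: "Hc S z" unfolding z_def by (rule Hc_lincomb[OF w'c])
    have zo: "Q lam z (w j) = 0" if "j < p" for j
      unfolding z_def using Q_lincomb[OF Hc_HS[OF w'c] wH[OF that], where d = "Suc p" and lam = lam and c = c] c(2)[OF that] by simp
    have cp: "c p \<noteq> 0"
    proof
      assume 0: "c p = 0"
      then have zz: "z = lincomb p c w" unfolding z_def lcp by (simp add: add_scaled_def)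
      have "Q lam z z = (\<Sum>i<p. c i * Q lam z (w i))"
        using Q_lincomb_right[OF wH Hc_HS[OF z], where d = p and lam = lam and c = c] zz by simp
      also have "\<dots> = 0" using zo by simp
      finally have "\<epsilon> * (\<Sum>i<p. (c i)\<^sup>2) \<le> 0" using e(2)[of c] zz by simp
      moreover have "\<exists>i<p. c i \<noteq> 0" using c(1) 0 less_Suc_eq by auto
      then have "0 < \<epsilon> * (\<Sum>i<p. (c i)\<^sup>2)" using e(1) sum_squares_pos by simp
      ultimately show False by simp
    qed
    have "0 = Q lam v z" using step1[OF z zo] by simp
    also have "\<dots> = Q lam (lincomb p c w) v + c p * Q lam y v"
      unfolding z_def lcp Q_sym[of lam v] by (rule Q_add_scaled[OF HS_lincomb[OF wH] Hc_HS[OF y] v])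
    also have "Q lam (lincomb p c w) v = 0" using Q_lincomb[OF wH v, where d = p and lam = lam and c = c] o by (simp add: Q_sym[of lam _ v])
    finally show ?thesis using cp by (simp add: Q_sym)
  qed
  then show ?thesis using v unfolding weak_kernel_def by blast
qed

text \<open>Interior regularity: compare \<open>v\<close> with the solution \<open>u\<close> having
  its values and slopes at \<open>a\<close> and \<open>b\<close>. The difference, extended by zero,
  is itself a test function, so its form vanishes, and \<open>neg\<close> makes it zero.\<close>

lemma weak_kernel_local:
  assumes v: "weak_kernel S lam v" and ab: "a < b" "{a..b} \<subseteq> S" and n: "neg lam a b"
  obtains u where "Sol lam u" "\<And>x k. x \<in> {a..b} \<Longrightarrow> k \<le> 1 \<Longrightarrow> v k x = u k x"
proof -
  have vH: "HS S v" using v by (simp add: weak_kernel_def)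
  obtain u where u: "Sol lam u" "\<And>k. k \<le> 1 \<Longrightarrow> u k a = v k a" "\<And>k. k \<le> 1 \<Longrightarrow> u k b = v k b"
    using bvp_exists[OF n ab(1), of "\<lambda>k. v k a" "\<lambda>k. v k b"] by blast
  define f where "f = add_scaled v (-1) u"
  have f: "pw2 f" unfolding f_def by (rule pw2_add_scaled[OF HS_pw2[OF vH] Sol_pw2[OF u(1)]])
  have fa: "f k a = 0" and fb: "f k b = 0" if "k \<le> 1" for k using u(2,3)[OF that] by (auto simp: f_def add_scaled_def)
  define y where "y = clip a b f"
  have y: "HS {a..b} y" unfolding y_def by (rule HS_clip[OF f fa fb ab(1)])
  have "Hc S y" unfolding Hc_def
    by (rule exI[of _ "max \<bar>a\<bar> \<bar>b\<bar>"], rule HS_mono[OF y]) (use ab in \<open>auto simp: abs_if\<close>)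
  then have "Q lam v y = 0" using v by (simp add: weak_kernel_def)
  then have "integral {a..b} (qi lam v y) = 0" using Q_Icc[of a b v y lam] y by simp
  then have 1: "(qi lam v y has_integral 0) {a..b}" using integrable_integral[OF qi_int_Icc[OF vH y]] by metis
  have "(qi lam u y has_integral (bdry u y b - bdry u y a)) {a..b}"
    using has_integral_bdry[OF u(1)] y ab by (auto simp: HS_def)
  then have 2: "(qi lam u y has_integral 0) {a..b}"
    using HS_endpoints[OF y, of 0] HS_endpoints[OF y, of 1] by (simp add: bdry_def)
  have "((\<lambda>x. qi lam v y x - qi lam u y x) has_integral (0 - 0)) {a..b}" by (rule has_integral_diff[OF 1 2])
  then have "(qi lam y y has_integral (0 - 0)) {a..b}"
    by (rule has_integral_spike_finite[of "{a}", rotated 2])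
      (auto simp: qi_def y_def clip_simps f_def add_scaled_def algebra_simps)
  then have "integral {a..b} (qi lam y y) = 0" by (simp add: integral_unique)
  moreover have "\<forall>k\<le>1. y k a = 0 \<and> y k b = 0" using HS_endpoints[OF y] by blast
  ultimately have y0: "y 0 x = 0" if "x \<in> {a..b}" for x using n HS_UNIV[OF y] that unfolding neg_def by blast
  have f0: "f 0 x = 0" if "x \<in> {a..b}" for x
    using y0[OF that] fa[of 0] that by (cases "x = a") (auto simp: y_def clip_simps)
  have f1: "f 1 x = 0" if "x \<in> {a..b}" for x
  proof (cases "x = a \<or> x = b")
    case True then show ?thesis using fa[of 1] fb[of 1] by auto
  next
    case False
    then have x: "x \<in> {a<..<b}" using that by auto
    have "(f 0 has_real_derivative f 1 x) (at x)" using pw_deriv f unfolding pw2_def by blast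
    moreover have "(f 0 has_real_derivative 0) (at x)"
      by (rule has_field_derivative_transform_within_open[of "\<lambda>x. 0" _ _ "{a<..<b}"]) (use f0 x in auto)
    ultimately show ?thesis by (rule DERIV_unique)
  qed
  show ?thesis
  proof (rule that[OF u(1)])
    fix x k assume x: "x \<in> {a..b}" and "k \<le> (1::nat)"
    then have "k = 0 \<or> k = 1" by auto
    then show "v k x = u k x" using f0[OF x] f1[OF x] by (auto simp: f_def add_scaled_def)
  qed
qed

lemma Sol_eq_on:
  assumes u: "Sol lam u" and v: "Sol lam v" and eq: "\<And>x. x \<in> {a<..<b} \<Longrightarrow> u 0 x = v 0 x" and ab: "a < b" and k: "k \<le> 4"
  shows "u k x = v k x"
proof -
  have s: "Sol lam (\<lambda>k x. \<Sum>i<2. (if i = 0 then 1 else -1) * (if i = 0 then u else v) k x)"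
    by (rule Sol_lincomb) (use u v in auto)
  have "(\<Sum>i<(2::nat). (if i = 0 then 1 else -1) * (if i = 0 then u else v) k x) = 0"
    by (rule Sol_zero_on[OF s _ ab k]) (use eq in \<open>auto simp: numeral_2_eq_2\<close>)
  then show ?thesis by (simp add: numeral_2_eq_2)
qed

lemma weak_kernel_left:
  assumes v: "weak_kernel S lam v" and lam: "lam \<ge> 0" and c: "{..c} \<subseteq> S"
  obtains u where "Sol lam u" "\<And>x k. x \<le> c \<Longrightarrow> k \<le> 1 \<Longrightarrow> v k x = u k x"
proof -
  obtain h where h: "h > 0" "\<And>a b lam. a < b \<Longrightarrow> b \<le> a + h \<Longrightarrow> lam \<ge> 0 \<Longrightarrow> neg lam a b" by (rule neg_short) (rule that)
  \<comment> \<open>Windows of length \<open>h\<close> moved by \<open>h / 2\<close> overlap, so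
    unique continuation identifies the local solutions of neighbouring windows.\<close>
  define b where "b n = c - real n * (h / 2)" for n
  have "\<exists>u. Sol lam u \<and> (\<forall>x\<in>{b n - h..b n}. \<forall>k\<le>1. v k x = u k x)" for n
  proof -
    have "b n \<le> c" using h by (simp add: b_def)
    then have sub: "{b n - h..b n} \<subseteq> S" using c by force
    have lt: "b n - h < b n" using h by simp
    have "neg lam (b n - h) (b n)" using h lam by auto
    show ?thesis by (rule weak_kernel_local[OF v lt sub \<open>neg lam (b n - h) (b n)\<close>]) blast
  qed
  then obtain u where u: "\<And>n. Sol lam (u n)" "\<And>n x k. x \<in> {b n - h..b n} \<Longrightarrow> k \<le> 1 \<Longrightarrow> v k x = u n k x" by metis
  have "u (Suc n) k x = u n k x" if "k \<le> 4" for n k x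
  proof (rule Sol_eq_on[OF u(1) u(1) _ _ that])
    have bS: "b (Suc n) = b n - h / 2" by (simp add: b_def algebra_simps)
    show "b n - h < b (Suc n)" using bS h by linarith
    fix x assume "x \<in> {b n - h<..<b (Suc n)}"
    then have "x \<in> {b n - h..b n}" "x \<in> {b (Suc n) - h..b (Suc n)}" using bS h by auto
    then show "u (Suc n) 0 x = u n 0 x" using u(2)[of x n 0] u(2)[of x "Suc n" 0] by simp
  qed
  then have all: "u n k x = u 0 k x" if "k \<le> 4" for n k x using that by (induction n) auto
  show ?thesis
  proof (rule that[OF u(1)[of 0]])
    fix x k assume x: "x \<le> c" and k: "k \<le> (1::nat)"
    define n where "n = nat \<lfloor>(c - x) / (h / 2)\<rfloor>"
    have "0 \<le> (c - x) / (h / 2)" using x h by simp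
    then have "real n \<le> (c - x) / (h / 2)" "(c - x) / (h / 2) < real n + 1" unfolding n_def by linarith+
    then have "real n * (h / 2) \<le> c - x" "c - x < (real n + 1) * (h / 2)" using h by (auto simp: field_simps)
    then have "x \<in> {b n - h..b n}" using h by (auto simp: b_def algebra_simps)
    from u(2)[OF this k] all[of k n x] k show "v k x = u 0 k x" by simp
  qed
qed

definition side :: "real set \<Rightarrow> bool" where
  "side S \<longleftrightarrow> S = UNIV \<or> (\<exists>s. S = {..s})"

lemma weak_kernel_Sol:
  assumes v: "weak_kernel S lam v" and lam: "lam \<ge> 0" and S: "side S"
  obtains u where "Sol lam u" "\<And>x k. x \<in> S \<Longrightarrow> k \<le> 1 \<Longrightarrow> v k x = u k x"
proof (cases "S = UNIV")
  case True
  have "\<exists>u. Sol lam u \<and> (\<forall>x\<le>c. \<forall>k\<le>1. v k x = u k x)" for c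
    using weak_kernel_left[OF v lam, of c] True by (metis subset_UNIV)
  then obtain u where u: "\<And>c. Sol lam (u c)" "\<And>c x k. x \<le> c \<Longrightarrow> k \<le> 1 \<Longrightarrow> v k x = u c k x" by metis
  show ?thesis
  proof (rule that[OF u(1)[of 0]])
    fix x k assume k: "k \<le> (1::nat)"
    have "u (max x 0) k x = u 0 k x"
    proof (rule Sol_eq_on[OF u(1) u(1), of "-1" 0])
      fix y :: real assume "y \<in> {-1<..<0}"
      then have "y \<le> max x 0" "y \<le> 0" by auto
      then show "u (max x 0) 0 y = u 0 0 y" using u(2)[of y 0 0] u(2)[of y "max x 0" 0] by simp
    qed (use k in auto)
    then show "v k x = u 0 k x" using u(2)[of x "max x 0" k] k by simp
  qed
next
  case False
  then obtain s where s: "S = {..s}" using S by (auto simp: side_def)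
  have "{..s} \<subseteq> S" by (simp add: s)
  from weak_kernel_left[OF v lam this] obtain u where "Sol lam u" "\<And>x k. x \<le> s \<Longrightarrow> k \<le> 1 \<Longrightarrow> v k x = u k x" by metis
  then show ?thesis by (intro that[of u]) (simp_all add: s)
qed

end

subsection \<open>Square integrability\<close>

text \<open>Integration by parts against a merely integrable derivative: on an interval of length h the
  defect is of order h times the integral of the modulus of f, so it vanishes under refinement.\<close>

lemma integration_by_parts_indefinite:
  fixes f F y y1 :: "real \<Rightarrow> real"
  assumes ab: "a \<le> b" and f: "f absolutely_integrable_on {a..b}"
    and F: "\<And>x x'. a \<le> x \<Longrightarrow> x \<le> x' \<Longrightarrow> x' \<le> b \<Longrightarrow> (f has_integral (F x' - F x)) {x..x'}"
    and y: "\<And>x. x \<in> {a..b} \<Longrightarrow> (y has_real_derivative y1 x) (at x within {a..b})" and y1: "continuous_on {a..b} y1"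
  shows "((\<lambda>x. f x * y x) has_integral (F b * y b - F a * y a - integral {a..b} (\<lambda>x. F x * y1 x))) {a..b}"
proof -
  have cy: "continuous_on {a..b} y" using y by (rule DERIV_continuous_on)
  have bcy: "bounded (y ` {a..b})" by (intro compact_imp_bounded compact_continuous_image cy compact_Icc)
  have fy: "(\<lambda>x. y x * f x) absolutely_integrable_on {a..b}"
    by (rule absolutely_integrable_bounded_measurable_product_real[OF _ _ bcy f])
      (auto intro!: continuous_imp_measurable_on_sets_lebesgue cy)
  have fyi: "(\<lambda>x. f x * y x) integrable_on {a..b}"
    using set_lebesgue_integral_eq_integral(1)[OF fy] by (simp add: mult.commute)
  have fabs: "(\<lambda>x. \<bar>f x\<bar>) integrable_on {a..b}" using f unfolding absolutely_integrable_on_def by simp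
  define A where "A x = integral {a..x} (\<lambda>x. \<bar>f x\<bar>)" for x
  have Adiff: "integral {x..x'} (\<lambda>x. \<bar>f x\<bar>) = A x' - A x" if "a \<le> x" "x \<le> x'" "x' \<le> b" for x x'
    unfolding A_def using Henstock_Kurzweil_Integration.integral_combine[of a x x' "\<lambda>x. \<bar>f x\<bar>"] that
      integrable_subinterval_real[OF fabs, of a x'] by auto
  have fabs': "(\<lambda>x. \<bar>f x\<bar>) integrable_on {x..x'}" if "a \<le> x" "x' \<le> b" for x x'
    using integrable_subinterval_real[OF fabs, of x x'] that by auto
  have Fd: "\<bar>F x' - F x\<bar> \<le> A x' - A x" if x: "a \<le> x" "x \<le> x'" "x' \<le> b" for x x'
  proof -
    have "norm (integral {x..x'} f) \<le> integral {x..x'} (\<lambda>x. \<bar>f x\<bar>)"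
      by (rule Henstock_Kurzweil_Integration.integral_norm_bound_integral[OF _ fabs'])
        (use F[OF x] x in auto)
    then show ?thesis using F[OF x] Adiff[OF x] by (simp add: integral_unique)
  qed
  obtain K where K: "\<And>x. x \<in> {a..b} \<Longrightarrow> \<bar>y1 x\<bar> \<le> K" "K \<ge> 0"
  proof -
    have "\<exists>K. \<forall>x\<in>{a..b}. \<bar>y1 x\<bar> \<le> K"
      using compact_imp_bounded[OF compact_continuous_image[OF y1 compact_Icc]] by (simp add: bounded_iff)
    then obtain K where "\<And>x. x \<in> {a..b} \<Longrightarrow> \<bar>y1 x\<bar> \<le> K" by blast
    then show ?thesis by (intro that[of "max K 0"]) (auto simp: le_max_iff_disj)
  qed
  have ydiff: "\<bar>y x' - y x\<bar> \<le> K * (x' - x)" if x: "a \<le> x" "x \<le> x'" "x' \<le> b" for x x'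
  proof -
    have "norm (y x' - y x) \<le> K * norm (x' - x)"
      by (rule field_differentiable_bound[of "{a..b}" y y1]) (use y K x in auto)
    then show ?thesis using x by simp
  qed
  have cF: "continuous_on {a..b} F"
  proof -
    have "continuous_on {a..b} (\<lambda>x. F a + integral {a..x} f)"
      by (intro continuous_intros indefinite_integral_continuous_1) (use F[of a b] ab in auto)
    moreover have "F a + integral {a..x} f = F x" if "x \<in> {a..b}" for x
      using F[of a x] that by (auto simp: integral_unique)
    ultimately show ?thesis by (rule continuous_on_eq)
  qed
  have Fy1: "(\<lambda>x. F x * y1 x) integrable_on {x..x'}" if "a \<le> x" "x' \<le> b" for x x'
    using that by (intro integrable_continuous_real continuous_on_subset[OF continuous_on_mult[OF cF y1]]) auto
  have y1i: "(y1 has_integral (y x' - y x)) {x..x'}" if x: "a \<le> x" "x \<le> x'" "x' \<le> b" for x x'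
    by (rule fundamental_theorem_of_calculus[OF x(2)])
      (use x in \<open>auto simp: has_real_derivative_iff_has_vector_derivative[symmetric] intro: has_field_derivative_subset[OF y]\<close>)
  \<comment> \<open>The defect of the formula on \<open>{a..x}\<close>. Freezing \<open>y\<close> at
    the right end and \<open>F\<close> at the left end of a subinterval writes its increment as two
    small errors, each at most \<open>K\<close> times length times the increment of
    \<open>A\<close>.\<close>
  define \<Phi> where "\<Phi> x = integral {a..x} (\<lambda>x. f x * y x) - F x * y x + integral {a..x} (\<lambda>x. F x * y1 x)" for x
  have step: "\<bar>\<Phi> x' - \<Phi> x\<bar> \<le> 2 * K * (x' - x) * (A x' - A x)" if x: "a \<le> x" "x \<le> x'" "x' \<le> b" for x x'
  proof -
    have i1: "integral {a..x'} (\<lambda>x. f x * y x) - integral {a..x} (\<lambda>x. f x * y x) = integral {x..x'} (\<lambda>x. f x * y x)"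
      using Henstock_Kurzweil_Integration.integral_combine[of a x x' "\<lambda>x. f x * y x"] x integrable_subinterval_real[OF fyi, of a x'] by auto
    have i2: "integral {a..x'} (\<lambda>x. F x * y1 x) - integral {a..x} (\<lambda>x. F x * y1 x) = integral {x..x'} (\<lambda>x. F x * y1 x)"
      using Henstock_Kurzweil_Integration.integral_combine[of a x x' "\<lambda>x. F x * y1 x"] x Fy1[of a x'] by auto
    have h1: "((\<lambda>t. f t * y t - y x' * f t) has_integral (integral {x..x'} (\<lambda>x. f x * y x) - y x' * (F x' - F x))) {x..x'}"
      by (intro has_integral_diff has_integral_mult_right F x integrable_integral integrable_subinterval_real[OF fyi]; (use x in auto)?)
    have h2: "((\<lambda>t. F t * y1 t - F x * y1 t) has_integral (integral {x..x'} (\<lambda>x. F x * y1 x) - F x * (y x' - y x))) {x..x'}"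
      by (intro has_integral_diff has_integral_mult_right y1i x integrable_integral Fy1; (use x in auto)?)
    have A0: "A x' - A x \<ge> 0" using Adiff[OF x] integral_nonneg[OF fabs'[of x x']] x by auto
    have b1: "\<bar>integral {x..x'} (\<lambda>x. f x * y x) - y x' * (F x' - F x)\<bar> \<le> K * (x' - x) * (A x' - A x)"
    proof -
      have "norm (integral {x..x'} (\<lambda>t. f t * y t - y x' * f t)) \<le> integral {x..x'} (\<lambda>t. K * (x' - x) * \<bar>f t\<bar>)"
      proof (rule Henstock_Kurzweil_Integration.integral_norm_bound_integral)
        show "(\<lambda>t. f t * y t - y x' * f t) integrable_on {x..x'}" using h1 by blast
        show "(\<lambda>t. K * (x' - x) * \<bar>f t\<bar>) integrable_on {x..x'}" using fabs'[of x x'] x by (intro integrable_on_mult_right) auto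
        fix t assume t: "t \<in> {x..x'}"
        have "\<bar>y x' - y t\<bar> \<le> K * (x' - t)" using t x by (intro ydiff) auto
        also have "\<dots> \<le> K * (x' - x)" using t K(2) by (intro mult_left_mono) auto
        finally have "\<bar>y t - y x'\<bar> * \<bar>f t\<bar> \<le> K * (x' - x) * \<bar>f t\<bar>" by (intro mult_right_mono) auto
        then show "norm (f t * y t - y x' * f t) \<le> K * (x' - x) * \<bar>f t\<bar>"
          unfolding real_norm_def abs_mult[symmetric] by (simp add: algebra_simps)
      qed
      then show ?thesis using h1 Adiff[OF x] by (simp add: integral_unique)
    qed
    have b2: "\<bar>integral {x..x'} (\<lambda>x. F x * y1 x) - F x * (y x' - y x)\<bar> \<le> K * (x' - x) * (A x' - A x)"
    proof -
      have "norm (integral {x..x'} (\<lambda>t. F t * y1 t - F x * y1 t)) \<le> integral {x..x'} (\<lambda>t. (A x' - A x) * K)"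
      proof (rule Henstock_Kurzweil_Integration.integral_norm_bound_integral)
        show "(\<lambda>t. F t * y1 t - F x * y1 t) integrable_on {x..x'}" using h2 by blast
        fix t assume t: "t \<in> {x..x'}"
        have "\<bar>F t - F x\<bar> \<le> A t - A x" using t x by (intro Fd) auto
        also have "\<dots> \<le> A x' - A x" using Adiff[of t x'] integral_nonneg[OF fabs'[of t x']] t x by auto
        finally have "\<bar>F t - F x\<bar> * \<bar>y1 t\<bar> \<le> (A x' - A x) * K" using K t x A0 by (intro mult_mono) auto
        then show "norm (F t * y1 t - F x * y1 t) \<le> (A x' - A x) * K"
          unfolding real_norm_def abs_mult[symmetric] by (simp add: algebra_simps)
      qed auto
      then show ?thesis using h2 x by (simp add: integral_unique algebra_simps)
    qed
    have "\<Phi> x' - \<Phi> x = (integral {x..x'} (\<lambda>x. f x * y x) - y x' * (F x' - F x)) + (integral {x..x'} (\<lambda>x. F x * y1 x) - F x * (y x' - y x))"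
      unfolding \<Phi>_def using i1 i2 by (simp add: algebra_simps)
    then show ?thesis using b1 b2 by linarith
  qed
  have "\<bar>\<Phi> b - \<Phi> a\<bar> \<le> 2 * K * (b - a) * A b * (1 / real (Suc n))" for n
  proof -
    define h where "h = (b - a) / real (Suc n)"
    define p where "p i = a + real i * h" for i
    have h0: "h \<ge> 0" using ab by (simp add: h_def)
    have pn: "p (Suc n) = b" "p 0 = a" by (auto simp: p_def h_def)
    have pm: "p i \<le> p j" if "i \<le> j" for i j using that h0 by (simp add: p_def mult_right_mono)
    have "\<Phi> b - \<Phi> a = (\<Sum>i<Suc n. \<Phi> (p (Suc i)) - \<Phi> (p i))"
      using sum_lessThan_telescope[of "\<lambda>i. \<Phi> (p i)" "Suc n"] pn by (simp del: sum.lessThan_Suc)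
    also have "\<bar>\<dots>\<bar> \<le> (\<Sum>i<Suc n. \<bar>\<Phi> (p (Suc i)) - \<Phi> (p i)\<bar>)" by (rule sum_abs)
    also have "\<dots> \<le> (\<Sum>i<Suc n. 2 * K * h * (A (p (Suc i)) - A (p i)))"
    proof (rule sum_mono)
      fix i assume i: "i \<in> {..<Suc n}"
      have "\<bar>\<Phi> (p (Suc i)) - \<Phi> (p i)\<bar> \<le> 2 * K * (p (Suc i) - p i) * (A (p (Suc i)) - A (p i))"
        using pm[of 0 i] pm[of i "Suc i"] pm[of "Suc i" "Suc n"] i pn by (intro step) auto
      then show "\<bar>\<Phi> (p (Suc i)) - \<Phi> (p i)\<bar> \<le> 2 * K * h * (A (p (Suc i)) - A (p i))"
        by (simp add: p_def algebra_simps)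
    qed
    also have "\<dots> = 2 * K * h * (A b - A a)"
      unfolding sum_distrib_left[symmetric] using sum_lessThan_telescope[of "\<lambda>i. A (p i)" "Suc n"] pn
      by (simp del: sum.lessThan_Suc)
    also have "A a = 0" by (simp add: A_def)
    finally show ?thesis by (simp add: h_def)
  qed
  moreover have "(\<lambda>n. 2 * K * (b - a) * A b * (1 / real (Suc n))) \<longlonglongrightarrow> 2 * K * (b - a) * A b * 0"
    by (intro tendsto_intros LIMSEQ_Suc[OF lim_1_over_n])
  ultimately have "\<bar>\<Phi> b - \<Phi> a\<bar> \<le> 2 * K * (b - a) * A b * 0"
    by (intro LIMSEQ_le_const) auto
  then have "\<Phi> b = \<Phi> a" by simp
  then have "integral {a..b} (\<lambda>x. f x * y x) = F b * y b - F a * y a - integral {a..b} (\<lambda>x. F x * y1 x)"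
    by (simp add: \<Phi>_def)
  then show ?thesis using integrable_integral[OF fyi] by simp
qed

lemma square_integrable_imp_abs_integrable:
  fixes f :: "real \<Rightarrow> real"
  assumes "f integrable_on {a..b}" "(\<lambda>x. (f x)\<^sup>2) integrable_on {a..b}"
  shows "f absolutely_integrable_on {a..b}"
proof (rule absolutely_integrable_absolutely_integrable_ubound[OF assms(1)])
  have "(\<lambda>x. (f x)\<^sup>2) absolutely_integrable_on {a..b}"
    using assms(2) by (intro nonnegative_absolutely_integrable_1) auto
  then show "(\<lambda>x. 1 + (f x)\<^sup>2) absolutely_integrable_on {a..b}"
    by (intro set_integral_add(1)) (auto simp: absolutely_integrable_on_const)
  fix x
  have "2 * f x \<le> 1 + (f x)\<^sup>2" using zero_le_power2[of "f x - 1"] by (simp add: power2_diff)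
  then show "f x \<le> 1 + (f x)\<^sup>2" using zero_le_power2[of "f x"] by linarith
qed

text \<open>Monotone convergence along the windows \<open>{-n..n}\<close>; it turns uniform bounds
  on compact intervals into integrability on \<open>S\<close>.\<close>

lemma bounded_integrals_imp_integrable:
  fixes f :: "real \<Rightarrow> real"
  assumes f0: "\<And>x. x \<in> S \<Longrightarrow> f x \<ge> 0" and S: "\<And>n::nat. \<exists>a b. S \<inter> {-real n..real n} = {a..b}"
    and i: "\<And>a b. {a..b} \<subseteq> S \<Longrightarrow> f integrable_on {a..b}" and C: "\<And>a b. {a..b} \<subseteq> S \<Longrightarrow> integral {a..b} f \<le> C"
  shows "f integrable_on S"
proof -
  define g where "g n x = (if x \<in> S \<inter> {-real n..real n} then f x else 0)" for n x
  have gi: "g n integrable_on UNIV" "integral UNIV (g n) \<le> C" "integral UNIV (g n) \<ge> 0" for n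
  proof -
    obtain a b where ab: "S \<inter> {-real n..real n} = {a..b}" using S by blast
    then have sub: "{a..b} \<subseteq> S" by blast
    show "g n integrable_on UNIV" "integral UNIV (g n) \<le> C" unfolding g_def ab
      using i[OF sub] C[OF sub] by (auto simp only: integrable_restrict_UNIV integral_restrict_UNIV)
    then show "integral UNIV (g n) \<ge> 0" using f0 by (intro integral_nonneg) (auto simp: g_def)
  qed
  have "(\<lambda>x. if x \<in> S then f x else 0) integrable_on UNIV \<and> (\<lambda>n. integral UNIV (g n)) \<longlonglongrightarrow> integral UNIV (\<lambda>x. if x \<in> S then f x else 0)"
  proof (rule monotone_convergence_increasing[OF gi(1)])
    show "g k x \<le> g (Suc k) x" for k x using f0 by (auto simp: g_def)
    show "(\<lambda>k. g k x) \<longlonglongrightarrow> (if x \<in> S then f x else 0)" for x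
    proof (rule tendsto_eventually, rule eventually_sequentiallyI[of "nat \<lceil>\<bar>x\<bar>\<rceil>"])
      fix n assume "nat \<lceil>\<bar>x\<bar>\<rceil> \<le> n"
      then have "\<bar>x\<bar> \<le> real n" by (simp add: nat_ceiling_le_eq)
      then show "g n x = (if x \<in> S then f x else 0)" by (auto simp: g_def)
    qed
    show "bounded (range (\<lambda>n. integral UNIV (g n)))"
      unfolding bounded_iff using gi by (intro exI[of _ C]) auto
  qed
  then show ?thesis by (simp add: integrable_restrict_UNIV)
qed

lemma side_Int:
  assumes "S = UNIV \<or> (\<exists>s. S = {..s})" shows "\<exists>a b. S \<inter> {-real n..real n} = {a..b}"
proof (cases "S = UNIV")
  case False
  then obtain s where "S = {..s}" using assms by blast
  then have "S \<inter> {-real n..real n} = {-real n..min s (real n)}" by auto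
  then show ?thesis by blast
qed auto

text \<open>If f' were not square integrable, \<open>(f\<^sup>2)' = 2 f f'\<close> would tend to minus infinity at the far
  end, contradicting the square integrability of f.\<close>

lemma derivative_square_bound_left:
  fixes f0 f1 f2 :: "real \<Rightarrow> real"
  assumes d: "\<And>x. x \<le> s \<Longrightarrow> (f0 has_real_derivative f1 x) (at x within {..s})"
    and ac: "\<And>x y. x \<le> y \<Longrightarrow> y \<le> s \<Longrightarrow> (f2 has_integral (f1 y - f1 x)) {x..y}"
    and i2: "\<And>x. x \<le> s \<Longrightarrow> (\<lambda>x. (f2 x)\<^sup>2) integrable_on {x..s}"
    and C0: "\<And>x. x \<le> s \<Longrightarrow> integral {x..s} (\<lambda>x. (f0 x)\<^sup>2) \<le> C"
    and C2: "\<And>x. x \<le> s \<Longrightarrow> integral {x..s} (\<lambda>x. (f2 x)\<^sup>2) \<le> C"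
  shows "\<exists>C'. \<forall>x\<le>s. integral {x..s} (\<lambda>x. (f1 x)\<^sup>2) \<le> C'"
proof (rule ccontr)
  assume "\<nexists>C'. \<forall>x\<le>s. integral {x..s} (\<lambda>x. (f1 x)\<^sup>2) \<le> C'"
  \<comment> \<open>The threshold beats the boundary term at \<open>s\<close> and the bound
    \<open>C\<close> for the mixed integral of \<open>f2 * f0\<close>; the extra 1 yields
    \<open>f0 * f1 <= -1\<close> to the left of \<open>x0\<close>.\<close>
  then have "\<exists>x0\<le>s. \<not> integral {x0..s} (\<lambda>x. (f1 x)\<^sup>2) \<le> \<bar>f1 s * f0 s\<bar> + C + 1" by simp
  then obtain x0 where x0': "x0 \<le> s \<and> \<not> integral {x0..s} (\<lambda>x. (f1 x)\<^sup>2) \<le> \<bar>f1 s * f0 s\<bar> + C + 1" by (rule exE)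
  note x0 = conjunct1[OF x0'] conjunct2[OF x0', unfolded not_le]
  have d': "(f0 has_real_derivative f1 x) (at x within {a..s})" if "x \<in> {a..s}" for x a
    by (rule has_field_derivative_subset[OF d]) (use that in auto)
  have c0: "continuous_on {a..s} f0" for a using d' by (rule DERIV_continuous_on)
  have c1: "continuous_on {a..s} f1" for a
  proof (cases "a \<le> s")
    case True
    have "continuous_on {a..s} (\<lambda>x. f1 a + integral {a..x} f2)"
      by (intro continuous_intros indefinite_integral_continuous_1) (use ac[of a s] True in auto)
    moreover have "f1 a + integral {a..x} f2 = f1 x" if "x \<in> {a..s}" for x
      using ac[of a x] that by (auto simp: integral_unique)
    ultimately show ?thesis by (rule continuous_on_eq)
  qed auto
  have i0: "(\<lambda>x. (f0 x)\<^sup>2) integrable_on {x..s}" and i1: "(\<lambda>x. (f1 x)\<^sup>2) integrable_on {x..s}" for x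
    by (intro integrable_continuous_real continuous_intros c0 c1)+
  have key: "f0 x * f1 x \<le> -1" if x: "x \<le> x0" for x
  proof -
    have xs: "x \<le> s" using x x0 by simp
    have ai: "f2 absolutely_integrable_on {x..s}"
      by (rule square_integrable_imp_abs_integrable) (use ac[of x s] i2 xs in auto)
    have ib: "((\<lambda>x. f2 x * f0 x) has_integral (f1 s * f0 s - f1 x * f0 x - integral {x..s} (\<lambda>x. f1 x * f1 x))) {x..s}"
      by (rule integration_by_parts_indefinite[OF xs ai]) (use ac d' c1 in auto)
    have "integral {x..s} (\<lambda>x. (f0 x)\<^sup>2) / 2 + integral {x..s} (\<lambda>x. (f2 x)\<^sup>2) / 2 + integral {x..s} (\<lambda>x. f2 x * f0 x) \<ge> 0"
    proof -
      have "((\<lambda>x. (f0 x)\<^sup>2 / 2 + (f2 x)\<^sup>2 / 2 + f2 x * f0 x) has_integral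
        (integral {x..s} (\<lambda>x. (f0 x)\<^sup>2) / 2 + integral {x..s} (\<lambda>x. (f2 x)\<^sup>2) / 2 + integral {x..s} (\<lambda>x. f2 x * f0 x))) {x..s}"
        using ib i0 i2[OF xs] by (intro has_integral_add has_integral_divide integrable_integral) auto
      then show ?thesis
      proof (rule has_integral_nonneg)
        fix t
        have "0 \<le> (f0 t + f2 t)\<^sup>2" by simp
        then show "0 \<le> (f0 t)\<^sup>2 / 2 + (f2 t)\<^sup>2 / 2 + f2 t * f0 t" by (simp add: power2_sum algebra_simps)
      qed
    qed
    moreover have "integral {x..s} (\<lambda>x. f2 x * f0 x) = f1 s * f0 s - f1 x * f0 x - integral {x..s} (\<lambda>x. (f1 x)\<^sup>2)"
      using ib by (simp add: integral_unique power2_eq_square)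
    moreover have "integral {x0..s} (\<lambda>x. (f1 x)\<^sup>2) \<le> integral {x..s} (\<lambda>x. (f1 x)\<^sup>2)"
      using x by (intro integral_subset_le i1) auto
    ultimately have "f1 x * f0 x \<le> -1" using x0(2) C0[OF xs] C2[OF xs] by linarith
    then show ?thesis by (simp add: mult.commute)
  qed
  have big: "(f0 x)\<^sup>2 \<ge> 1" if x: "x \<le> x0 - 1" for x
  proof -
    have "(f0 x0)\<^sup>2 + 2 * x0 \<le> (f0 x)\<^sup>2 + 2 * x"
    proof (rule DERIV_nonpos_imp_decreasing_open[of x x0 "\<lambda>x. (f0 x)\<^sup>2 + 2 * x"])
      show "x \<le> x0" using x by simp
      fix t assume t: "x < t" "t < x0"
      have ts: "t \<in> {..<s}" using t x0 by simp
      then have "(f0 has_real_derivative f1 t) (at t within {..<s})"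
        by (intro has_field_derivative_subset[OF d]) auto
      then have "(f0 has_real_derivative f1 t) (at t)" using at_within_open[OF ts] by simp
      then have "((\<lambda>x. (f0 x)\<^sup>2 + 2 * x) has_real_derivative 2 * (f0 t * f1 t) + 2) (at t)"
        by (auto intro!: derivative_eq_intros)
      moreover have "2 * (f0 t * f1 t) + 2 \<le> 0" using key[of t] t by simp
      ultimately show "\<exists>y. ((\<lambda>x. (f0 x)\<^sup>2 + 2 * x) has_real_derivative y) (at t) \<and> y \<le> 0" by blast
    next
      show "continuous_on {x..x0} (\<lambda>x. (f0 x)\<^sup>2 + 2 * x)"
        using x0 by (intro continuous_intros continuous_on_subset[OF c0[of x]]) auto
    qed
    then show ?thesis using x zero_le_power2[of "f0 x0"] by linarith
  qed
  \<comment> \<open>On a window of this length left of \<open>x0 - 1\<close> the square of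
    \<open>f0\<close> is at least 1, so its integral exceeds \<open>C\<close>.\<close>
  define N where "N = \<bar>C\<bar> + 1"
  have "N = integral {x0 - 1 - N..x0 - 1} (\<lambda>x. 1)" by (simp add: N_def)
  also have "\<dots> \<le> integral {x0 - 1 - N..x0 - 1} (\<lambda>x. (f0 x)\<^sup>2)"
    using big x0(1) by (intro integral_le integrable_subinterval_real[OF i0[of "x0 - 1 - N"]]) auto
  also have "\<dots> \<le> integral {x0 - 1 - N..s} (\<lambda>x. (f0 x)\<^sup>2)"
    using x0(1) by (intro integral_subset_le i0 integrable_subinterval_real[OF i0[of "x0 - 1 - N"]]) auto
  also have "\<dots> \<le> C" using x0(1) by (intro C0) (auto simp: N_def)
  finally show False by (simp add: N_def)
qed

lemma derivative_square_bound_right: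
  fixes f0 f1 f2 :: "real \<Rightarrow> real"
  assumes d: "\<And>x. x \<ge> s \<Longrightarrow> (f0 has_real_derivative f1 x) (at x)"
    and ac: "\<And>x y. x \<le> y \<Longrightarrow> x \<ge> s \<Longrightarrow> (f2 has_integral (f1 y - f1 x)) {x..y}"
    and i2: "\<And>x. x \<ge> s \<Longrightarrow> (\<lambda>x. (f2 x)\<^sup>2) integrable_on {s..x}"
    and C0: "\<And>x. x \<ge> s \<Longrightarrow> integral {s..x} (\<lambda>x. (f0 x)\<^sup>2) \<le> C"
    and C2: "\<And>x. x \<ge> s \<Longrightarrow> integral {s..x} (\<lambda>x. (f2 x)\<^sup>2) \<le> C"
  shows "\<exists>C'. \<forall>x\<ge>s. integral {s..x} (\<lambda>x. (f1 x)\<^sup>2) \<le> C'"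
proof -
  have refl: "integral {x..-s} (\<lambda>x. h (-x)) = integral {s..-x} h" for h :: "real \<Rightarrow> real" and x
    using Henstock_Kurzweil_Integration.integral_reflect_real[of "-x" s h] by simp
  have "\<exists>C'. \<forall>x\<le>-s. integral {x..-s} (\<lambda>x. (- f1 (-x))\<^sup>2) \<le> C'"
  proof (rule derivative_square_bound_left[of "-s" "\<lambda>x. f0 (-x)" "\<lambda>x. - f1 (-x)" "\<lambda>x. f2 (-x)" C])
    fix x assume "x \<le> -s"
    then have "(f0 has_real_derivative f1 (-x)) (at (-x))" using d by simp
    then show "((\<lambda>x. f0 (-x)) has_real_derivative - f1 (-x)) (at x within {..-s})"
      using DERIV_chain2[of f0 "f1 (-x)" uminus x "-1" "{..-s}"] DERIV_minus[OF DERIV_ident, of x "{..-s}"] by simp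
  next
    fix x y assume xy: "x \<le> y" "y \<le> -s"
    have "(f2 has_integral (f1 (-x) - f1 (-y))) {-y..-x}" using xy by (intro ac) auto
    then show "((\<lambda>x. f2 (-x)) has_integral - f1 (-y) - - f1 (-x)) {x..y}"
      using has_integral_reflect_real[of f2 "f1 (-x) - f1 (-y)" "-x" "-y"] by simp
  next
    fix x assume x: "x \<le> -s"
    show "(\<lambda>x. (f2 (-x))\<^sup>2) integrable_on {x..-s}"
      using Henstock_Kurzweil_Integration.integrable_reflect_real[of "\<lambda>x. (f2 x)\<^sup>2" "-x" s] i2[of "-x"] x by simp
    show "integral {x..-s} (\<lambda>x. (f0 (-x))\<^sup>2) \<le> C" using refl[of x "\<lambda>x. (f0 x)\<^sup>2"] C0[of "-x"] x by simp
    show "integral {x..-s} (\<lambda>x. (f2 (-x))\<^sup>2) \<le> C" using refl[of x "\<lambda>x. (f2 x)\<^sup>2"] C2[of "-x"] x by simp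
  qed
  then obtain C' where C': "\<And>x. x \<le> -s \<Longrightarrow> integral {x..-s} (\<lambda>x. (f1 (-x))\<^sup>2) \<le> C'" by auto
  have "integral {s..x} (\<lambda>x. (f1 x)\<^sup>2) \<le> C'" if "x \<ge> s" for x
    using C'[of "-x"] refl[of "-x" "\<lambda>x. (f1 x)\<^sup>2"] that by simp
  then show ?thesis by blast
qed

text \<open>A value at x is controlled by the integral over the unit interval to the left of x.\<close>

lemma square_integrable_tendsto_zero:
  fixes f0 f1 :: "real \<Rightarrow> real"
  assumes d: "\<And>x. x < s \<Longrightarrow> (f0 has_real_derivative f1 x) (at x)" and c: "\<And>a. continuous_on {a..s} f0" "\<And>a. continuous_on {a..s} f1"
    and i: "(\<lambda>x. (f0 x)\<^sup>2) integrable_on {..s}" "(\<lambda>x. (f1 x)\<^sup>2) integrable_on {..s}"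
  shows "(f0 \<longlongrightarrow> 0) at_bot"
proof (rule tendstoI)
  fix e :: real assume e: "e > 0"
  define h where "h x = (f0 x)\<^sup>2 + (f1 x)\<^sup>2" for x
  have hi: "h integrable_on {..s}" unfolding h_def using i by (intro integrable_add)
  have hic: "h integrable_on {a..b}" if "b \<le> s" for a b
    using that unfolding h_def by (intro integrable_continuous_real continuous_intros continuous_on_subset[OF c(1)[of a]] continuous_on_subset[OF c(2)[of a]]) auto
  have h0: "h x \<ge> 0" for x by (simp add: h_def)
  define X where "X = (\<lambda>x. integral {x..s} h) ` {..s}"
  have bdd: "bdd_above X" unfolding X_def
    by (rule bdd_aboveI2[of _ _ "integral {..s} h"]) (auto intro!: integral_subset_le hic hi h0)
  have ne: "X \<noteq> {}" by (auto simp: X_def)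
  \<comment> \<open>Beyond the point \<open>a\<close> obtained from this, less than
    \<open>e^2 / 2\<close> of the mass of \<open>h\<close> is left for any unit interval.\<close>
  have "Sup X - e\<^sup>2 / 2 < Sup X" using e by simp
  then obtain y where "y \<in> X" "Sup X - e\<^sup>2 / 2 < y"
    using less_cSup_iff[OF ne bdd] by blast
  then obtain a where a: "a \<le> s" "Sup X - e\<^sup>2 / 2 < integral {a..s} h"
    by (auto simp: X_def)
  have "dist (f0 x) 0 < e" if x: "x < min a s" for x
  proof -
    have xs: "x < s" "x < a" using x by auto
    have small: "integral {x-1..x} h < e\<^sup>2 / 2"
    proof -
      have "integral {x-1..x} h + integral {x..s} h = integral {x-1..s} h"
        using xs by (intro Henstock_Kurzweil_Integration.integral_combine hic) auto
      moreover have "integral {x-1..s} h \<le> Sup X" using xs by (intro cSup_upper bdd) (auto simp: X_def)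
      moreover have "integral {a..s} h \<le> integral {x..s} h" using xs a h0 by (intro integral_subset_le hic) auto
      ultimately show ?thesis using a(2) by linarith
    qed
    have ptw: "(f0 x)\<^sup>2 \<le> (f0 y)\<^sup>2 + integral {x-1..x} h" if y: "y \<in> {x-1..x}" for y
    proof -
      have "((\<lambda>t. 2 * f0 t * f1 t) has_integral ((f0 x)\<^sup>2 - (f0 y)\<^sup>2)) {y..x}"
      proof (rule fundamental_theorem_of_calculus)
        fix t assume "t \<in> {y..x}"
        then have "(f0 has_real_derivative f1 t) (at t)" using d xs by auto
        then have "(f0 has_real_derivative f1 t) (at t within {y..x})" by (rule has_field_derivative_at_within)
        then have "((\<lambda>t. (f0 t)\<^sup>2) has_real_derivative 2 * f0 t * f1 t) (at t within {y..x})"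
          by (auto intro!: derivative_eq_intros)
        then show "((\<lambda>t. (f0 t)\<^sup>2) has_vector_derivative 2 * f0 t * f1 t) (at t within {y..x})"
          by (simp add: has_real_derivative_iff_has_vector_derivative)
      qed (use y in auto)
      then have "(f0 x)\<^sup>2 - (f0 y)\<^sup>2 \<le> integral {y..x} h"
        by (rule has_integral_le[OF _ integrable_integral[OF hic]]) (use xs sum_squares_bound in \<open>auto simp: h_def\<close>)
      also have "\<dots> \<le> integral {x-1..x} h" using y xs h0 by (intro integral_subset_le hic) auto
      finally show ?thesis by simp
    qed
    \<comment> \<open>The pointwise bound averaged over the unit interval gives
      \<open>(f0 x)^2 <= 2 * integral {x-1..x} h\<close>.\<close>
    have "integral {x-1..x} (\<lambda>y. (f0 x)\<^sup>2 - integral {x-1..x} h) \<le> integral {x-1..x} h"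
    proof (rule integral_le)
      show "h integrable_on {x-1..x}" using xs by (intro hic) auto
      fix y assume "y \<in> {x-1..x}"
      from ptw[OF this] show "(f0 x)\<^sup>2 - integral {x-1..x} h \<le> h y"
        using zero_le_power2[of "f1 y"] unfolding h_def[of y] by linarith
    qed auto
    then have "(f0 x)\<^sup>2 < e\<^sup>2" using small by simp
    then have "\<bar>f0 x\<bar> < e" using e by (metis abs_le_square_iff abs_of_pos linorder_not_le)
    then show ?thesis by simp
  qed
  then show "\<forall>\<^sub>F x in at_bot. dist (f0 x) 0 < e"
    unfolding eventually_at_bot_dense by blast
qed

text \<open>Supplies \<open>u 1\<close> from \<open>u 0\<close> and \<open>u 2\<close>, and
  \<open>u 3\<close> from \<open>u 2\<close> and \<open>u 4\<close>, so that only even orders have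
  to be estimated by the form or the equation.\<close>

lemma square_integrable_middle:
  fixes f0 f1 f2 :: "real \<Rightarrow> real"
  assumes d0: "\<And>x. (f0 has_real_derivative f1 x) (at x)" and d1: "\<And>x. (f1 has_real_derivative f2 x) (at x)"
    and c2: "continuous_on UNIV f2" and S: "S = UNIV \<or> (\<exists>s. S = {..s})"
    and i0: "(\<lambda>x. (f0 x)\<^sup>2) integrable_on S" and i2: "(\<lambda>x. (f2 x)\<^sup>2) integrable_on S"
  shows "(\<lambda>x. (f1 x)\<^sup>2) integrable_on S"
proof -
  have c0: "continuous_on A f0" and c1: "continuous_on A f1" for A
    using d0 d1 by (meson DERIV_isCont continuous_at_imp_continuous_on)+
  have ii: "(\<lambda>x. (f0 x)\<^sup>2) integrable_on {a..b}" "(\<lambda>x. (f1 x)\<^sup>2) integrable_on {a..b}" "(\<lambda>x. (f2 x)\<^sup>2) integrable_on {a..b}" for a b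
    by (intro integrable_continuous_real continuous_intros c0 c1 continuous_on_subset[OF c2] subset_UNIV)+
  define C where "C = max (integral S (\<lambda>x. (f0 x)\<^sup>2)) (integral S (\<lambda>x. (f2 x)\<^sup>2))"
  have C: "integral {a..b} (\<lambda>x. (f0 x)\<^sup>2) \<le> C" "integral {a..b} (\<lambda>x. (f2 x)\<^sup>2) \<le> C" if "{a..b} \<subseteq> S" for a b
    unfolding C_def using integral_subset_le[OF that ii(1) i0] integral_subset_le[OF that ii(3) i2]
    by (auto simp: le_max_iff_disj)
  have ac: "(f2 has_integral (f1 y - f1 x)) {x..y}" if "x \<le> y" for x y
    by (rule fundamental_theorem_of_calculus[OF that], rule has_real_derivative_iff_has_vector_derivative[THEN iffD1],
        rule has_field_derivative_at_within, rule d1)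
  have left: "\<exists>C'. \<forall>x\<le>s. integral {x..s} (\<lambda>x. (f1 x)\<^sup>2) \<le> C'" if "{..s} \<subseteq> S" for s
    by (rule derivative_square_bound_left[of s f0 f1 f2 C])
      (use that ac ii C in \<open>auto intro: has_field_derivative_at_within d0 intro!: C\<close>)
  have "\<exists>C'. \<forall>a b. {a..b} \<subseteq> S \<longrightarrow> integral {a..b} (\<lambda>x. (f1 x)\<^sup>2) \<le> C'"
  proof (cases "S = UNIV")
    case True
    have "{..0} \<subseteq> S" using True by simp
    from left[OF this] obtain C1 where C1: "\<And>x. x \<le> 0 \<Longrightarrow> integral {x..0} (\<lambda>x. (f1 x)\<^sup>2) \<le> C1" by blast
    have "\<exists>C'. \<forall>x\<ge>0. integral {0..x} (\<lambda>x. (f1 x)\<^sup>2) \<le> C'"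
      by (rule derivative_square_bound_right[of 0 f0 f1 f2 C])
        (use ac ii C True in \<open>auto intro: d0\<close>)
    then obtain C2 where C2: "\<And>x. x \<ge> 0 \<Longrightarrow> integral {0..x} (\<lambda>x. (f1 x)\<^sup>2) \<le> C2" by blast
    have "integral {a..b} (\<lambda>x. (f1 x)\<^sup>2) \<le> C1 + C2" for a b
    proof -
      have "integral {a..b} (\<lambda>x. (f1 x)\<^sup>2) \<le> integral {min a 0..max b 0} (\<lambda>x. (f1 x)\<^sup>2)"
        by (intro integral_subset_le ii) auto
      also have "\<dots> = integral {min a 0..0} (\<lambda>x. (f1 x)\<^sup>2) + integral {0..max b 0} (\<lambda>x. (f1 x)\<^sup>2)"
        by (intro Henstock_Kurzweil_Integration.integral_combine[symmetric] ii) auto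
      also have "\<dots> \<le> C1 + C2" by (intro add_mono C1 C2) auto
      finally show ?thesis .
    qed
    then show ?thesis by blast
  next
    case False
    then obtain s where s: "S = {..s}" using S by blast
    then obtain C1 where C1: "\<And>x. x \<le> s \<Longrightarrow> integral {x..s} (\<lambda>x. (f1 x)\<^sup>2) \<le> C1" using left[of s] by blast
    have "integral {a..b} (\<lambda>x. (f1 x)\<^sup>2) \<le> max 0 C1" if "{a..b} \<subseteq> S" for a b
    proof (cases "a \<le> b")
      case True
      then have b: "b \<le> s" using that s by auto
      have "integral {a..b} (\<lambda>x. (f1 x)\<^sup>2) \<le> integral {a..s} (\<lambda>x. (f1 x)\<^sup>2)"
        using b by (intro integral_subset_le ii) auto
      also have "\<dots> \<le> C1" using True b by (intro C1) auto
      finally show ?thesis by simp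
    qed simp
    then show ?thesis by blast
  qed
  then obtain C' where C': "\<And>a b. {a..b} \<subseteq> S \<Longrightarrow> integral {a..b} (\<lambda>x. (f1 x)\<^sup>2) \<le> C'" by blast
  show ?thesis by (rule bounded_integrals_imp_integrable[OF _ side_Int[OF S] ii(2) C']) auto
qed

subsection \<open>Eigenfunctions\<close>

lemma lin_indep_on_cong:
  assumes "\<And>i x. i < n \<Longrightarrow> x \<in> S \<Longrightarrow> f i x = g i x"
  shows "lin_indep_on S n f \<longleftrightarrow> lin_indep_on S n g"
proof -
  have "(\<Sum>i<n. c i * f i x) = (\<Sum>i<n. c i * g i x)" if "x \<in> S" for c x
    using assms that by (intro sum.cong) auto
  then show ?thesis unfolding lin_indep_on_def by (simp cong: ball_cong)
qed

context pot
begin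

text \<open>The operators of the statement, with an arbitrary potential in place of \<open>f' \<circ> \<phi>\<close>.\<close>

definition Lop_pot :: "(nat \<Rightarrow> real \<Rightarrow> real) \<Rightarrow> real \<Rightarrow> real" where
  "Lop_pot D x = - D 4 x - 2 * D 2 x - D 0 x + V x * D 0 x"

text \<open>The second clause is vacuous on the line, so this covers the domains of both
  operators.\<close>

definition clamped_dom :: "real set \<Rightarrow> (nat \<Rightarrow> real \<Rightarrow> real) \<Rightarrow> bool" where
  "clamped_dom S D \<longleftrightarrow> H4 S D \<and> (\<forall>s. S = {..s} \<longrightarrow> D 0 s = 0 \<and> D 1 s = 0)"

definition eigspace :: "real set \<Rightarrow> real \<Rightarrow> (nat \<Rightarrow> real \<Rightarrow> real) set" where
  "eigspace S lam = {D. clamped_dom S D \<and> (AE x in lborel. x \<in> S \<longrightarrow> Lop_pot D x = lam * D 0 x)}"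

definition eig_dim :: "real set \<Rightarrow> real \<Rightarrow> enat" where
  "eig_dim S lam = Sup {enat n | n. \<exists>Ds. (\<forall>i<n. Ds i \<in> eigspace S lam) \<and> lin_indep_on S n (\<lambda>i. Ds i 0)}"

text \<open>The classical representative of an eigenfunction, continued as a solution beyond the end
  of \<open>S\<close>. Unlike the \<open>D\<close> of \<open>H4\<close>, it satisfies the equation
  at every point.\<close>

definition eigfun :: "real set \<Rightarrow> real \<Rightarrow> (nat \<Rightarrow> real \<Rightarrow> real) \<Rightarrow> bool" where
  "eigfun S lam u \<longleftrightarrow> Sol lam u \<and> (\<forall>k\<le>4. (\<lambda>x. (u k x)\<^sup>2) integrable_on S) \<and>
     (\<forall>s. S = {..s} \<longrightarrow> u 0 s = 0 \<and> u 1 s = 0)"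

definition indep :: "real set \<Rightarrow> real \<Rightarrow> nat \<Rightarrow> bool" where
  "indep S lam n \<longleftrightarrow> (\<exists>u. (\<forall>i<n. eigfun S lam (u i)) \<and> lin_indep_on S n (\<lambda>i. u i 0))"

definition nullity :: "real set \<Rightarrow> real \<Rightarrow> nat" where
  "nullity S lam = (GREATEST n. indep S lam n)"

lemma rhs_sq_bound:
  obtains K where "K \<ge> 0" "\<And>u x. (rhs lam u x)\<^sup>2 \<le> K * ((u 2 x)\<^sup>2 + (u 0 x)\<^sup>2)"
proof -
  obtain K where K: "K \<ge> 0" "\<And>x. \<bar>V x\<bar> \<le> K" by (rule V_bounded) (rule that)
  define M where "M = 1 + K + \<bar>lam\<bar>"
  have "(rhs lam u x)\<^sup>2 \<le> (8 + 2 * M\<^sup>2) * ((u 2 x)\<^sup>2 + (u 0 x)\<^sup>2)" for u x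
  proof -
    have b: "\<bar>1 - V x + lam\<bar> \<le> M" using K(2)[of x] by (auto simp: M_def)
    have "(1 - V x + lam)\<^sup>2 \<le> M\<^sup>2" using power_mono[OF b, of 2] by simp
    then have "(1 - V x + lam)\<^sup>2 * (u 0 x)\<^sup>2 \<le> M\<^sup>2 * (u 0 x)\<^sup>2" by (intro mult_right_mono) auto
    moreover have "(- 2 * p - q)\<^sup>2 \<le> 8 * p\<^sup>2 + 2 * q\<^sup>2" for p q :: real
      using zero_le_power2[of "2 * p - q"] by (simp add: power2_eq_square algebra_simps)
    from this[of "u 2 x" "(1 - V x + lam) * u 0 x"]
    have "(rhs lam u x)\<^sup>2 \<le> 8 * (u 2 x)\<^sup>2 + 2 * ((1 - V x + lam)\<^sup>2 * (u 0 x)\<^sup>2)"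
      unfolding rhs_def by (simp only: power_mult_distrib)
    ultimately have "(rhs lam u x)\<^sup>2 \<le> 8 * (u 2 x)\<^sup>2 + 2 * (M\<^sup>2 * (u 0 x)\<^sup>2)" by linarith
    moreover have "0 \<le> 8 * (u 0 x)\<^sup>2" "0 \<le> 2 * (M\<^sup>2 * (u 2 x)\<^sup>2)" by auto
    moreover have "(8 + 2 * M\<^sup>2) * ((u 2 x)\<^sup>2 + (u 0 x)\<^sup>2) =
      8 * (u 2 x)\<^sup>2 + 2 * (M\<^sup>2 * (u 0 x)\<^sup>2) + 8 * (u 0 x)\<^sup>2 + 2 * (M\<^sup>2 * (u 2 x)\<^sup>2)"
      by (simp add: algebra_simps)
    ultimately show ?thesis by linarith
  qed
  then show ?thesis by (intro that[of "8 + 2 * M\<^sup>2"]) auto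
qed

text \<open>The equation bounds \<open>u 4\<close> by \<open>u 0\<close> and \<open>u 2\<close>; the
  odd orders follow by interpolation.\<close>

lemma Sol_square_integrable:
  assumes u: "Sol lam u" and S: "side S" and i0: "(\<lambda>x. (u 0 x)\<^sup>2) integrable_on S" and i2: "(\<lambda>x. (u 2 x)\<^sup>2) integrable_on S"
    and k: "k \<le> 4"
  shows "(\<lambda>x. (u k x)\<^sup>2) integrable_on S"
proof -
  have S': "S = UNIV \<or> (\<exists>s. S = {..s})" using S by (simp add: side_def)
  have c: "continuous_on A (u k)" if "k \<le> 4" for k A using Sol_cont[OF u that] .
  obtain K where K: "K \<ge> 0" "\<And>u x. (rhs lam u x)\<^sup>2 \<le> K * ((u 2 x)\<^sup>2 + (u 0 x)\<^sup>2)" by (rule rhs_sq_bound) (rule that)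
  have hi: "(\<lambda>x. K * ((u 2 x)\<^sup>2 + (u 0 x)\<^sup>2)) integrable_on S" using i0 i2 by (intro integrable_on_mult_right integrable_add)
  have i4: "(\<lambda>x. (u 4 x)\<^sup>2) integrable_on S"
  proof (rule bounded_integrals_imp_integrable[OF _ side_Int[OF S']])
    fix a b assume ab: "{a..b} \<subseteq> S"
    show ii: "(\<lambda>x. (u 4 x)\<^sup>2) integrable_on {a..b}" by (intro integrable_continuous_real continuous_intros c) auto
    have hii: "(\<lambda>x. K * ((u 2 x)\<^sup>2 + (u 0 x)\<^sup>2)) integrable_on {a..b}" by (intro integrable_continuous_real continuous_intros c) auto
    have "integral {a..b} (\<lambda>x. (u 4 x)\<^sup>2) \<le> integral {a..b} (\<lambda>x. K * ((u 2 x)\<^sup>2 + (u 0 x)\<^sup>2))"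
      by (rule integral_le[OF ii hii]) (use K SolR_4[OF u] in auto)
    also have "\<dots> \<le> integral S (\<lambda>x. K * ((u 2 x)\<^sup>2 + (u 0 x)\<^sup>2))"
      by (rule integral_subset_le[OF ab hii hi]) (use K in auto)
    finally show "integral {a..b} (\<lambda>x. (u 4 x)\<^sup>2) \<le> integral S (\<lambda>x. K * ((u 2 x)\<^sup>2 + (u 0 x)\<^sup>2))" .
  qed auto
  have d: "(u k has_real_derivative u (Suc k) x) (at x)" if "k < 4" for k x using SolR_deriv[OF u that] .
  have i1: "(\<lambda>x. (u 1 x)\<^sup>2) integrable_on S"
    by (rule square_integrable_middle[OF _ _ c S' i0 i2]) (use d[of 0] d[of 1] in \<open>auto simp: numeral_2_eq_2\<close>)
  have i3: "(\<lambda>x. (u 3 x)\<^sup>2) integrable_on S"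
    by (rule square_integrable_middle[OF _ _ c S' i2 i4]) (use d[of 2] d[of 3] in \<open>auto simp: eval_nat_numeral\<close>)
  have "k = 0 \<or> k = 1 \<or> k = 2 \<or> k = 3 \<or> k = 4" using k by auto
  then show ?thesis using i0 i1 i2 i3 i4 by blast
qed

lemma eigfun_imp_eigspace:
  assumes u: "eigfun S lam u"
  shows "u \<in> eigspace S lam"
proof -
  have s: "Sol lam u" using u by (simp add: eigfun_def)
  have d: "(u k has_real_derivative u (Suc k) x) (at x within A)" if "k < 4" for k x A
    using SolR_deriv[OF s that] by (rule has_field_derivative_at_within)
  have "(u 4 has_integral (u 3 y - u 3 x)) {x..y}" if "x \<le> y" for x y
    by (rule fundamental_theorem_of_calculus[OF that], rule has_real_derivative_iff_has_vector_derivative[THEN iffD1])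
      (use d[of 3] in \<open>simp add: eval_nat_numeral\<close>)
  moreover have "Lop_pot u x = lam * u 0 x" for x using SolR_4[OF s, of x] by (simp add: Lop_pot_def rhs_def algebra_simps)
  ultimately show ?thesis using u d unfolding eigspace_def clamped_dom_def H4_def eigfun_def by auto
qed

text \<open>Regularity: by the equation almost everywhere, \<open>D 3\<close> is an indefinite
  integral of the continuous function \<open>rhs lam D\<close>, hence classically differentiable.
  The Gronwall estimate then identifies \<open>D\<close> on \<open>S\<close> with the global
  solution having the same data at one point.\<close>

lemma eigspace_imp_eigfun:
  assumes D: "D \<in> eigspace S lam" and S: "side S"
  shows "\<exists>u. eigfun S lam u \<and> (\<forall>x\<in>S. \<forall>k<4. u k x = D k x)"
proof -
  have S': "S = UNIV \<or> (\<exists>s. S = {..s})" using S by (simp add: side_def)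
  have H: "H4 S D" and bc: "\<forall>s. S = {..s} \<longrightarrow> D 0 s = 0 \<and> D 1 s = 0"
    and ae: "AE x in lborel. x \<in> S \<longrightarrow> Lop_pot D x = lam * D 0 x"
    using D by (auto simp: eigspace_def clamped_dom_def)
  have dk: "(D k has_real_derivative D (Suc k) x) (at x within S)" if "k < 3" "x \<in> S" for k x
    using H that by (simp add: H4_def)
  have d4: "(D 4 has_integral (D 3 y - D 3 x)) {x..y}" if "x \<in> S" "y \<in> S" "x \<le> y" for x y
    using H that by (simp add: H4_def)
  have c: "continuous_on S (D k)" if "k < 3" for k using dk[OF that] by (rule DERIV_continuous_on)
  have cr: "continuous_on S (rhs lam D)" by (intro rhs_cont c) auto
  obtain N where N: "N \<in> null_sets lborel" "{x \<in> space lborel. \<not> (x \<in> S \<longrightarrow> Lop_pot D x = lam * D 0 x)} \<subseteq> N"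
    using ae unfolding eventually_ae_filter by blast
  have negl: "negligible N" using N(1) null_sets_completionI[of N lborel] by (simp add: negligible_iff_null_sets)
  have r: "(rhs lam D has_integral (D 3 y - D 3 x)) {x..y}" if "x \<in> S" "y \<in> S" "x \<le> y" for x y
  proof (rule has_integral_spike[OF negl _ d4[OF that]])
    fix t assume t: "t \<in> {x..y} - N"
    then have "t \<in> S" using that S' by auto
    then have "Lop_pot D t = lam * D 0 t" using N(2) t by auto
    then show "rhs lam D t = D 4 t" by (simp add: Lop_pot_def rhs_def algebra_simps)
  qed
  \<comment> \<open>\<open>D 4\<close> is determined only almost everywhere; it is replaced by its
    continuous version.\<close>
  define D' where "D' k = (if k = 4 then rhs lam D else D k)" for k
  have sub: "{\<alpha>..\<beta>} \<subseteq> S" if "\<beta> \<in> S" for \<alpha> \<beta> using that S' by auto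
  have D'd: "(D' k has_real_derivative D' (Suc k) x) (at x within {\<alpha>..\<beta>})" if "k < 4" "x \<in> {\<alpha>..\<beta>}" "\<beta> \<in> S" for k x \<alpha> \<beta>
  proof (cases "k = 3")
    case False
    then have "k < 3" using that by simp
    then have "(D k has_real_derivative D (Suc k) x) (at x within {\<alpha>..\<beta>})"
      using has_field_derivative_subset[OF dk sub[OF that(3)]] that sub[OF that(3), of \<alpha>] by blast
    then show ?thesis using \<open>k < 3\<close> by (simp add: D'_def)
  next
    case True
    have "((\<lambda>x. D 3 \<alpha> + integral {\<alpha>..x} (rhs lam D)) has_real_derivative rhs lam D x) (at x within {\<alpha>..\<beta>})"
      using integral_has_real_derivative[OF continuous_on_subset[OF cr sub[OF that(3)]] that(2)]
      by (auto intro!: derivative_eq_intros)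
    moreover have "D 3 \<alpha> + integral {\<alpha>..y} (rhs lam D) = D 3 y" if y: "y \<in> {\<alpha>..\<beta>}" for y
    proof -
      have "\<alpha> \<in> S" "y \<in> S" "\<alpha> \<le> y" using y sub[OF \<open>\<beta> \<in> S\<close>, of \<alpha>] by auto
      from integral_unique[OF r[OF this]] show ?thesis by simp
    qed
    ultimately have "(D 3 has_real_derivative rhs lam D x) (at x within {\<alpha>..\<beta>})"
      using that(2) by (elim has_field_derivative_transform_within[where d = 1]) auto
    then show ?thesis using True by (simp add: D'_def)
  qed
  obtain x0 where x0: "x0 \<in> S" using S' by auto
  obtain u where u: "Sol lam u" "\<And>k. k < 4 \<Longrightarrow> u k x0 = D k x0"
    using SolR_exists[where r = "\<lambda>x. 0" and lam = lam and a = x0 and c = "\<lambda>k. D k x0"] by auto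
  have eq: "u k x = D k x" if x: "x \<in> S" and k: "k < 4" for x k
  proof -
    define \<alpha> where "\<alpha> = min x x0"
    define \<beta> where "\<beta> = max x x0"
    have \<beta>: "\<beta> \<in> S" using x x0 by (simp add: \<beta>_def max_def)
    obtain C where C: "C \<ge> 1" "\<forall>x\<in>{\<alpha>..\<beta>}. \<forall>l\<in>{-\<bar>lam\<bar>..\<bar>lam\<bar>}. 2 + \<bar>1 - V x + l\<bar> \<le> C"
      using bounded_coeff[of \<alpha> \<beta> "\<bar>lam\<bar>"] by blast
    have "\<exists>B. \<forall>x\<in>{\<alpha>..\<beta>}. \<bar>D' 0 x\<bar> \<le> B"
      using compact_imp_bounded[OF compact_continuous_image[OF continuous_on_subset[OF c[of 0] sub[OF \<beta>]] compact_Icc]]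
      by (simp add: bounded_iff D'_def)
    then obtain B where B: "\<And>x. x \<in> {\<alpha>..\<beta>} \<Longrightarrow> \<bar>D' 0 x\<bar> \<le> B" by blast
    have "(\<Sum>k<4. (u k x - D' k x)\<^sup>2) \<le> ((\<Sum>k<4. (u k x0 - D' k x0)\<^sup>2) + (B * (lam - lam))\<^sup>2) * exp (4 * C * \<bar>x - x0\<bar>)"
    proof (rule Sol_gronwall[where S = "{\<alpha>..\<beta>}" and lam = lam and lam' = lam and v = D' and u = u, OF refl _ _ _ _ _ C(1) _ B])
      show "x0 \<in> {\<alpha>..\<beta>}" "x \<in> {\<alpha>..\<beta>}" by (auto simp: \<alpha>_def \<beta>_def)
      show "(D' k has_real_derivative D' (Suc k) x) (at x within {\<alpha>..\<beta>})" if "k < 4" "x \<in> {\<alpha>..\<beta>}" for k x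
        by (rule D'd[OF that \<beta>])
      show "D' 4 x = rhs lam D' x" for x by (simp add: D'_def rhs_def)
      fix y assume "y \<in> {\<alpha>..\<beta>}"
      moreover have "lam \<in> {-\<bar>lam\<bar>..\<bar>lam\<bar>}" by auto
      ultimately show "2 + \<bar>1 - V y + lam\<bar> \<le> C" using C(2) by blast
    qed (use SolR_deriv[OF u(1)] SolR_4[OF u(1)] in \<open>auto intro: has_field_derivative_at_within\<close>)
    also have "\<dots> = 0" using u(2) by (simp add: D'_def)
    finally have "(\<Sum>k<4. (u k x - D' k x)\<^sup>2) \<le> 0" .
    moreover have "(u k x - D' k x)\<^sup>2 \<le> (\<Sum>k<4. (u k x - D' k x)\<^sup>2)"
      by (rule member_le_sum[of k "{..<4}" "\<lambda>k. (u k x - D' k x)\<^sup>2"]) (use k in auto)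
    ultimately have "(u k x - D' k x)\<^sup>2 \<le> 0" by linarith
    then show ?thesis using k by (simp add: D'_def)
  qed
  have sq: "(\<lambda>x. (u k x)\<^sup>2) integrable_on S" if "k < 4" for k
    by (rule integrable_eq[of "\<lambda>x. (D k x)\<^sup>2"]) (use H eq that in \<open>auto simp: H4_def\<close>)
  have "eigfun S lam u" unfolding eigfun_def
  proof (intro conjI allI impI u(1))
    show "(\<lambda>x. (u k x)\<^sup>2) integrable_on S" if "k \<le> 4" for k
      by (rule Sol_square_integrable[OF u(1) S sq sq that]) auto
    fix s assume s: "S = {..s}"
    then show "u 0 s = 0" "u 1 s = 0" using bc eq[of s 0] eq[of s 1] by auto
  qed
  then show ?thesis using eq by blast
qed

lemma side_infinite: assumes "side S" obtains a b where "a < b" "{a..b} \<subseteq> S"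
proof -
  consider "S = UNIV" | s where "S = {..s}" using assms by (auto simp: side_def)
  then show ?thesis
  proof cases
    case 1 then show ?thesis using that[of 0 1] by simp
  next
    case 2
    have "{s - 1..s} \<subseteq> S" using 2 by auto
    then show ?thesis using that[of "s - 1" s] by simp
  qed
qed

lemma indep_le_4:
  assumes i: "indep S lam n"
  shows "n \<le> 4"
proof (rule ccontr)
  assume "\<not> n \<le> 4"
  then have n: "4 < n" by simp
  obtain u where u: "\<And>i. i < n \<Longrightarrow> eigfun S lam (u i)" "lin_indep_on S n (\<lambda>i. u i 0)" using i by (auto simp: indep_def)
  obtain c where c: "\<exists>i<n. c i \<noteq> 0" "\<And>k. k < 4 \<Longrightarrow> (\<Sum>i<n. c i * u i k 0) = 0"
    using homogeneous_nat[OF n, of "\<lambda>k i. u i k 0"] by blast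
  have "Sol lam (\<lambda>k x. \<Sum>i<n. c i * u i k x)" using u by (intro Sol_lincomb) (auto simp: eigfun_def)
  then have "(\<Sum>i<n. c i * u i 0 x) = 0" for x
    by (rule Sol_zero_data[where u = "\<lambda>k x. \<Sum>i<n. c i * u i k x" and a = 0]) (use c(2) in auto)
  then show False using u(2) c(1) unfolding lin_indep_on_def by blast
qed

lemma indep_0: "indep S lam 0"
  unfolding indep_def lin_indep_on_def by auto

lemma indep_nullity: "indep S lam (nullity S lam)" "indep S lam n \<Longrightarrow> n \<le> nullity S lam"
  unfolding nullity_def using GreatestI_nat[of "indep S lam", OF indep_0] Greatest_le_nat[of "indep S lam"] indep_le_4 by blast+

lemma eig_dim_nullity:
  assumes S: "side S"
  shows "eig_dim S lam = enat (nullity S lam)"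
proof -
  have iff: "(\<exists>Ds. (\<forall>i<n. Ds i \<in> eigspace S lam) \<and> lin_indep_on S n (\<lambda>i. Ds i 0)) \<longleftrightarrow> indep S lam n" for n
  proof
    assume "\<exists>Ds. (\<forall>i<n. Ds i \<in> eigspace S lam) \<and> lin_indep_on S n (\<lambda>i. Ds i 0)"
    then obtain Ds where Ds: "\<And>i. i < n \<Longrightarrow> Ds i \<in> eigspace S lam" "lin_indep_on S n (\<lambda>i. Ds i 0)" by blast
    have "\<forall>i. \<exists>u. i < n \<longrightarrow> eigfun S lam u \<and> (\<forall>x\<in>S. \<forall>k<4. u k x = Ds i k x)"
      using eigspace_imp_eigfun[OF Ds(1) S] by blast
    then obtain u where u: "\<And>i. i < n \<Longrightarrow> eigfun S lam (u i) \<and> (\<forall>x\<in>S. \<forall>k<4. u i k x = Ds i k x)" by metis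
    have "lin_indep_on S n (\<lambda>i. u i 0)"
      using Ds(2) by (subst lin_indep_on_cong[where g = "\<lambda>i. Ds i 0"]) (use u in auto)
    then show "indep S lam n" unfolding indep_def using u by blast
  next
    assume "indep S lam n"
    then show "\<exists>Ds. (\<forall>i<n. Ds i \<in> eigspace S lam) \<and> lin_indep_on S n (\<lambda>i. Ds i 0)"
      unfolding indep_def using eigfun_imp_eigspace by blast
  qed
  have "eig_dim S lam = Sup {enat n | n. indep S lam n}" unfolding eig_dim_def iff ..
  also have "\<dots> = enat (nullity S lam)"
  proof (rule antisym)
    show "Sup {enat n |n. indep S lam n} \<le> enat (nullity S lam)"
      using indep_nullity(2) by (intro Sup_least) auto
    show "enat (nullity S lam) \<le> Sup {enat n |n. indep S lam n}"
      using indep_nullity(1) by (intro Sup_upper) auto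
  qed
  finally show ?thesis .
qed

text \<open>A maximal independent family spans, and unique continuation extends the relation from
  \<open>u 0\<close> on \<open>S\<close> to all derivatives on the line. For \<open>n = 0\<close> it
  says that every eigenfunction vanishes, and it is used in that form as well.\<close>

lemma nullity_span:
  assumes u: "\<And>i. i < n \<Longrightarrow> eigfun S lam (u i)" "lin_indep_on S n (\<lambda>i. u i 0)" "n = nullity S lam"
    and v: "eigfun S lam v" and S: "side S"
  obtains c where "\<And>k x. k \<le> 4 \<Longrightarrow> v k x = (\<Sum>i<n. c i * u i k x)"
proof -
  define w where "w i = (if i < n then u i else v)" for i
  have "\<not> indep S lam (Suc n)" using indep_nullity(2)[of S lam "Suc n"] u(3) by auto
  moreover have w: "eigfun S lam (w i)" if "i < Suc n" for i using that u(1) v by (auto simp: w_def)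
  ultimately have "\<not> lin_indep_on S (Suc n) (\<lambda>i. w i 0)" unfolding indep_def by blast
  then obtain c where c: "\<And>x. x \<in> S \<Longrightarrow> (\<Sum>i<Suc n. c i * w i 0 x) = 0" "\<not> (\<forall>i<Suc n. c i = 0)"
    unfolding lin_indep_on_def by blast
  obtain a b where ab: "a < b" "{a..b} \<subseteq> S" by (rule side_infinite[OF S]) (rule that)
  have s: "Sol lam (\<lambda>k x. \<Sum>i<Suc n. c i * w i k x)" using w by (intro Sol_lincomb) (auto simp: eigfun_def)
  have z: "(\<Sum>i<Suc n. c i * w i k x) = 0" if "k \<le> 4" for k x
  proof (rule Sol_zero_on[OF s _ ab(1) that])
    fix x assume "x \<in> {a<..<b}"
    then have "x \<in> S" using ab(2) by auto
    then show "(\<Sum>i<Suc n. c i * w i 0 x) = 0" by (rule c(1))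
  qed
  have sp: "(\<Sum>i<Suc n. c i * w i k x) = (\<Sum>i<n. c i * u i k x) + c n * v k x" for k x
    by (simp add: w_def)
  have "c n \<noteq> 0"
  proof
    assume 0: "c n = 0"
    then have "\<forall>x\<in>S. (\<Sum>i<n. c i * u i 0 x) = 0" using z[of 0] sp by simp
    then have "\<forall>i<n. c i = 0" using u(2) unfolding lin_indep_on_def by blast
    then show False using c(2) 0 less_Suc_eq by auto
  qed
  then have "v k x = (\<Sum>i<n. (- c i / c n) * u i k x)" if "k \<le> 4" for k x
  proof -
    have "v k x = - (\<Sum>i<n. c i * u i k x) / c n" using z[OF that, of x] sp[of k x] \<open>c n \<noteq> 0\<close> by (simp add: field_simps)
    also have "\<dots> = (\<Sum>i<n. (- c i / c n) * u i k x)"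
      by (simp add: sum_negf sum_divide_distrib)
    finally show ?thesis .
  qed
  then show ?thesis by (rule that)
qed

section \<open>Eigenfunctions, kernel of the form, and decay\<close>

definition zero_ext :: "real set \<Rightarrow> (nat \<Rightarrow> real \<Rightarrow> real) \<Rightarrow> nat \<Rightarrow> real \<Rightarrow> real" where
  "zero_ext S u = (\<lambda>k x. if x \<in> S then u k x else 0)"

lemma zero_ext_HS:
  assumes u: "eigfun S lam u" and S: "side S"
  shows "HS S (zero_ext S u)"
proof -
  have s: "Sol lam u" using u by (simp add: eigfun_def)
  have pu: "pw u" using Sol_pw2[OF s] by (simp add: pw2_def)
  have p: "pw (zero_ext S u)"
  proof (cases "S = UNIV")
    case True
    then show ?thesis using pu by (simp add: zero_ext_def)
  next
    case False
    then obtain r where r: "S = {..r}" using S by (auto simp: side_def)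
    have "u k r = 0" if "k \<le> 1" for k using u r that by (auto simp: eigfun_def le_Suc_eq)
    then have "pw (glue r u (\<lambda>k x. 0))" by (intro pw_glue pu pw_zero) auto
    moreover have "glue r u (\<lambda>k x. 0) = zero_ext S u" by (auto simp: glue_def zero_ext_def r)
    ultimately show ?thesis by simp
  qed
  have "(\<lambda>x. (zero_ext S u k x)\<^sup>2) integrable_on UNIV" if "k \<le> 2" for k
  proof -
    have "(\<lambda>x. if x \<in> S then (u k x)\<^sup>2 else 0) integrable_on UNIV"
      using u that by (simp add: integrable_restrict_UNIV eigfun_def)
    moreover have "(\<lambda>x. if x \<in> S then (u k x)\<^sup>2 else 0) = (\<lambda>x. (zero_ext S u k x)\<^sup>2)" by (auto simp: zero_ext_def)
    ultimately show ?thesis by simp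
  qed
  then show ?thesis unfolding HS_def using p by (auto simp: zero_ext_def)
qed

lemma Q_Sol_Hc:
  assumes s: "Sol lam u" and uv: "\<And>k x. x \<in> S \<Longrightarrow> k \<le> 2 \<Longrightarrow> v k x = u k x" and y: "Hc S y"
  shows "Q lam v y = 0"
proof -
  obtain T where T: "HS (S \<inter> {-T..T}) y" using y by (auto simp: Hc_def)
  define R where "R = \<bar>T\<bar> + 1"
  have out: "y k x = 0" if "k \<le> 2" "x \<notin> S \<inter> {-T..T}" for k x using HS_zero_off[OF T that] .
  have "qi lam v y x = qi lam u y x" for x
  proof (cases "x \<in> S")
    case True then show ?thesis using uv[OF True, of 0] uv[OF True, of 2] by (simp add: qi_def)
  next
    case False then show ?thesis using out[of 0 x] out[of 2 x] by (simp add: qi_def)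
  qed
  then have "Q lam v y = integral UNIV (qi lam u y)" unfolding Q_def by presburger
  also have "\<dots> = integral {-R..R} (qi lam u y)"
  proof (rule integral_UNIV_Icc)
    fix x assume "x \<notin> {-R..R}"
    then have "x \<notin> S \<inter> {-T..T}" by (auto simp: R_def)
    then show "qi lam u y x = 0" using out[of 0 x] out[of 2 x] by (simp add: qi_def)
  qed
  also have "\<dots> = bdry u y R - bdry u y (-R)"
    using T by (intro integral_unique has_integral_bdry[OF s]) (auto simp: HS_def R_def)
  also have "\<dots> = 0"
  proof -
    have "y k R = 0" "y k (-R) = 0" if "k \<le> 1" for k using that by (auto intro!: out simp: R_def)
    from this[of 0] this[of 1] show ?thesis by (simp add: bdry_def)
  qed
  finally show ?thesis .
qed

lemma eigfun_weak_kernel: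
  assumes u: "eigfun S lam u" and S: "side S"
  shows "weak_kernel S lam (zero_ext S u)"
proof -
  have s: "Sol lam u" using u by (simp add: eigfun_def)
  have "Q lam (zero_ext S u) y = 0" if "Hc S y" for y by (rule Q_Sol_Hc[OF s _ that]) (simp add: zero_ext_def)
  then show ?thesis using zero_ext_HS[OF assms] by (simp add: weak_kernel_def)
qed

lemma weak_kernel_eigfun:
  assumes v: "weak_kernel S lam v" and lam: "lam \<ge> 0" and S: "side S"
  obtains u where "eigfun S lam u" "\<And>x k. x \<in> S \<Longrightarrow> k \<le> 1 \<Longrightarrow> v k x = u k x"
proof -
  obtain u where u: "Sol lam u" "\<And>x k. x \<in> S \<Longrightarrow> k \<le> 1 \<Longrightarrow> v k x = u k x"
    by (rule weak_kernel_Sol[OF v lam S]) (rule that)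
  have vH: "HS S v" using v by (simp add: weak_kernel_def)
  obtain F where F: "finite F" "\<And>x. x \<notin> F \<Longrightarrow> (v 1 has_real_derivative v 2 x) (at x)"
    using vH unfolding HS_def pw_def by blast
  \<comment> \<open>Up to its end point \<open>S\<close> is open; there equality of
    \<open>v 1\<close> with \<open>u 1\<close> may be differentiated, which identifies
    \<open>v 2\<close> off a finite set.\<close>
  have Si: "\<exists>T. finite T \<and> (\<exists>A. open A \<and> S - T \<subseteq> A \<and> A \<subseteq> S)"
  proof -
    consider "S = UNIV" | s where "S = {..s}" using S by (auto simp: side_def)
    then show ?thesis
    proof cases
      case 1 then show ?thesis by (intro exI[of _ "{}"]) auto
    next
      case 2 then show ?thesis by (intro exI[of _ "{s}"] conjI exI[of _ "{..<s}"]) auto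
    qed
  qed
  then obtain T A where TA: "finite T" "open A" "S - T \<subseteq> A" "A \<subseteq> S" by blast
  have v2: "v 2 x = u 2 x" if "x \<in> S - (F \<union> T)" for x
  proof -
    have xA: "x \<in> A" using that TA by blast
    have "(v 1 has_real_derivative u 2 x) (at x)"
      by (rule has_field_derivative_transform_within_open[of "u 1" _ _ A])
        (use TA xA u(2)[of _ 1] SolR_deriv[OF u(1), of 1 x] in \<open>auto simp: numeral_2_eq_2\<close>)
    then show ?thesis using F(2)[of x] that DERIV_unique by blast
  qed
  have vi: "(\<lambda>x. (v k x)\<^sup>2) integrable_on S" if "k \<le> 2" for k
  proof -
    have "(\<lambda>x. (v k x)\<^sup>2) integrable_on UNIV" using vH that by (simp add: HS_def)
    moreover have "(\<lambda>x. (v k x)\<^sup>2) = (\<lambda>x. if x \<in> S then (v k x)\<^sup>2 else 0)" using HS_zero_off[OF vH that] by auto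
    ultimately show ?thesis using integrable_restrict_UNIV by metis
  qed
  have i0: "(\<lambda>x. (u 0 x)\<^sup>2) integrable_on S"
    by (rule integrable_eq[OF vi[of 0]]) (use u(2)[of _ 0] in auto)
  have i2: "(\<lambda>x. (u 2 x)\<^sup>2) integrable_on S"
    by (rule integrable_spike_finite[of "F \<union> T", OF _ _ vi[of 2]]) (use F(1) TA(1) v2 in auto)
  have "eigfun S lam u" unfolding eigfun_def
  proof (intro conjI allI impI u(1))
    show "(\<lambda>x. (u k x)\<^sup>2) integrable_on S" if "k \<le> 4" for k
      by (rule Sol_square_integrable[OF u(1) S i0 i2 that])
    fix s assume s: "S = {..s}"
    then have sS: "s \<in> S" by simp
    show "u 0 s = 0" "u 1 s = 0"
      using u(2)[OF sS, of 0] u(2)[OF sS, of 1] HS_right_endpoint[OF vH, of 0 s] HS_right_endpoint[OF vH, of 1 s] s by auto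
  qed
  then show ?thesis using u(2) by (rule that)
qed

text \<open>On solutions the form over a tail interval is a difference of boundary terms, and these
  tend to 0 with the solution. Coercivity then bounds the integrals of \<open>u 0\<close> squared
  and \<open>u 2\<close> squared uniformly; \<open>4 + 8 / m\<close> covers both.\<close>

lemma decay_square_integrable:
  assumes u: "Sol lam u" and lam: "lam \<ge> 0" and d: "\<And>k. k < 4 \<Longrightarrow> (u k \<longlongrightarrow> 0) at_bot" and k: "k \<le> 4"
  shows "(\<lambda>x. (u k x)\<^sup>2) integrable_on {..s}"
proof -
  obtain A B where AB: "A < B" "\<And>x. x \<le> A \<Longrightarrow> V x \<le> - m / 2" "\<And>x. x \<ge> B \<Longrightarrow> V x \<le> - m / 2" by (rule tails) (rule that)
  define A' where "A' = min A s"
  have S: "side {..s}" by (auto simp: side_def)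
  have S': "{..s} = UNIV \<or> (\<exists>s'. {..s} = {..s'})" by auto
  have "((\<lambda>x. bdry u u x) \<longlongrightarrow> (0 + 0) * 0 - (0 + 0) * 0) at_bot"
    unfolding bdry_def by (intro tendsto_intros d) auto
  then have "\<forall>\<^sub>F x in at_bot. \<bar>bdry u u x\<bar> < 1" using tendstoD[of "bdry u u" 0 at_bot 1] by simp
  then obtain X where X: "\<And>x. x \<le> X \<Longrightarrow> \<bar>bdry u u x\<bar> < 1" unfolding eventually_at_bot_linorder by blast
  define Y where "Y = min X A'"
  have c: "continuous_on A (u k)" if "k \<le> 4" for k A using Sol_cont[OF u that] .
  have ii: "(\<lambda>x. (u k x)\<^sup>2) integrable_on {a..b}" if "k \<le> 4" for k a b
    by (intro integrable_continuous_real continuous_intros c that)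
  have tb: "integral {a..Y} (\<lambda>x. (u k x)\<^sup>2) \<le> (4 + 8 / m)" if a: "a \<le> Y" and k: "k = 0 \<or> k = 2" for a k
  proof -
    have I: "(qi lam u u has_integral (bdry u u Y - bdry u u a)) {a..Y}"
      using has_integral_bdry[OF u _ a] Sol_pw2[OF u] by (simp add: pw2_def)
    have V: "V x \<le> - m / 2" if "x \<in> {a..Y}" for x using that AB(2)[of x] by (auto simp: Y_def A'_def)
    note t = tail_bound[OF Sol_pw2[OF u] V lam I]
    have "\<bar>bdry u u Y - bdry u u a\<bar> \<le> 2" using X[of Y] X[of a] a by (auto simp: Y_def)
    then have b: "- (bdry u u Y - bdry u u a) \<le> 2" by linarith
    define E where "E = - (bdry u u Y - bdry u u a)"
    have E: "(2 / m) * E \<le> (2 / m) * 2" "(2 + 4 / m) * E \<le> (2 + 4 / m) * 2"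
      using m_pos b unfolding E_def by (intro mult_left_mono; simp)+
    have t': "integral {a..Y} (\<lambda>x. (u 0 x)\<^sup>2) \<le> (2 / m) * E" "integral {a..Y} (\<lambda>x. (u 2 x)\<^sup>2) \<le> (2 + 4 / m) * E"
      using t(1,2) unfolding E_def by (simp_all only: mult_minus_left mult_minus_right)
    have m0: "0 < 4 / m" using m_pos by simp
    have "(2 / m) * 2 = 4 / m" "(2 + 4 / m) * 2 = 4 + 8 / m" "8 / m = 4 / m + 4 / m" by (auto simp: field_simps)
    then have "integral {a..Y} (\<lambda>x. (u 0 x)\<^sup>2) \<le> 4 + 8 / m" "integral {a..Y} (\<lambda>x. (u 2 x)\<^sup>2) \<le> 4 + 8 / m"
      using t' E m0 by linarith+
    then show ?thesis using k by blast
  qed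
  have fin: "(\<lambda>x. (u k x)\<^sup>2) integrable_on {..s}" if k: "k = 0 \<or> k = 2" for k
  proof (rule bounded_integrals_imp_integrable[OF _ side_Int[OF S']])
    have k4: "k \<le> 4" using k by auto
    fix a b assume ab: "{a..b} \<subseteq> {..s}"
    show "(\<lambda>x. (u k x)\<^sup>2) integrable_on {a..b}" by (rule ii[OF k4])
    have Ys: "Y \<le> s" by (simp add: Y_def A'_def)
    have "integral {a..b} (\<lambda>x. (u k x)\<^sup>2) \<le> integral {min a Y..s} (\<lambda>x. (u k x)\<^sup>2)"
      using ab Ys by (intro integral_subset_le ii k4) auto
    also have "\<dots> = integral {min a Y..Y} (\<lambda>x. (u k x)\<^sup>2) + integral {Y..s} (\<lambda>x. (u k x)\<^sup>2)"
      using Ys by (intro Henstock_Kurzweil_Integration.integral_combine[symmetric] ii k4) auto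
    also have "\<dots> \<le> (4 + 8 / m) + integral {Y..s} (\<lambda>x. (u k x)\<^sup>2)" by (intro add_right_mono tb k) auto
    finally show "integral {a..b} (\<lambda>x. (u k x)\<^sup>2) \<le> (4 + 8 / m) + integral {Y..s} (\<lambda>x. (u k x)\<^sup>2)" .
  qed auto
  show ?thesis by (rule Sol_square_integrable[OF u S fin fin k]) auto
qed

text \<open>The bridge between decay, which defines \<open>Eu\<close>, and square integrability,
  which defines the operator domain.\<close>

lemma eigfun_half_iff:
  assumes lam: "lam \<ge> 0"
  shows "eigfun {..s} lam u \<longleftrightarrow> Sol lam u \<and> (\<forall>k<4. (u k \<longlongrightarrow> 0) at_bot) \<and> u 0 s = 0 \<and> u 1 s = 0"
proof
  assume u: "eigfun {..s} lam u"
  then have s: "Sol lam u" by (simp add: eigfun_def)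
  have "(u k \<longlongrightarrow> 0) at_bot" if k: "k < 4" for k
    by (rule square_integrable_tendsto_zero[of s "u k" "u (Suc k)"])
      (use u k Sol_cont[OF s] SolR_deriv[OF s k] in \<open>auto simp: eigfun_def\<close>)
  then show "Sol lam u \<and> (\<forall>k<4. (u k \<longlongrightarrow> 0) at_bot) \<and> u 0 s = 0 \<and> u 1 s = 0"
    using u s by (auto simp: eigfun_def)
next
  assume "Sol lam u \<and> (\<forall>k<4. (u k \<longlongrightarrow> 0) at_bot) \<and> u 0 s = 0 \<and> u 1 s = 0"
  then show "eigfun {..s} lam u" unfolding eigfun_def
    using decay_square_integrable[OF _ lam] by auto
qed

end

subsection \<open>Semicontinuity of the index\<close>

lemma common_convergent_subsequence:
  fixes X :: "nat \<Rightarrow> 'i \<Rightarrow> real"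
  assumes "finite I" and b: "\<And>n i. i \<in> I \<Longrightarrow> \<bar>X n i\<bar> \<le> 1"
  shows "\<exists>\<sigma> Y. strict_mono (\<sigma> :: nat \<Rightarrow> nat) \<and> (\<forall>i\<in>I. (\<lambda>n. X (\<sigma> n) i) \<longlonglongrightarrow> Y i)"
  using assms
proof (induction I rule: finite_induct)
  case empty
  then show ?case by (intro exI[of _ id]) (auto simp: strict_mono_def)
next
  case (insert j I)
  then obtain \<sigma> Y where s: "strict_mono (\<sigma> :: nat \<Rightarrow> nat)" "\<forall>i\<in>I. (\<lambda>n. X (\<sigma> n) i) \<longlonglongrightarrow> Y i" by auto
  have "\<forall>n. X (\<sigma> n) j \<in> {-1..1}" using insert.prems[of j] by (auto simp: abs_le_iff minus_le_iff)
  moreover have "seq_compact {-1..1::real}" using compact_imp_seq_compact compact_Icc by blast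
  ultimately obtain y \<tau> where t: "strict_mono \<tau>" "((\<lambda>n. X (\<sigma> n) j) \<circ> \<tau>) \<longlonglongrightarrow> y"
    unfolding seq_compact_def by metis
  show ?case
  proof (intro exI[of _ "\<sigma> \<circ> \<tau>"] exI[of _ "Y(j := y)"] conjI ballI)
    show "strict_mono (\<sigma> \<circ> \<tau>)" using s(1) t(1) by (rule strict_mono_o)
    fix i assume "i \<in> insert j I"
    then show "(\<lambda>n. X ((\<sigma> \<circ> \<tau>) n) i) \<longlonglongrightarrow> (Y(j := y)) i"
    proof (cases "i = j")
      case True then show ?thesis using t(2) by (simp add: o_def)
    next
      case False
      then have "i \<in> I" using \<open>i \<in> insert j I\<close> by simp
      then have "((\<lambda>n. X (\<sigma> n) i) \<circ> \<tau>) \<longlonglongrightarrow> Y i" using LIMSEQ_subseq_LIMSEQ[OF _ t(1)] s(2) by blast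
      then show ?thesis using False by (simp add: o_def)
    qed
  qed
qed

context pot
begin

text \<open>\<open>J\<close> tested with the broken solution itself. This writes its form in terms
  of finitely many numbers, which is what passes to a limit.\<close>

definition jump_energy :: "(nat \<Rightarrow> real) \<Rightarrow> nat \<Rightarrow> (nat \<Rightarrow> nat \<Rightarrow> real \<Rightarrow> real) \<Rightarrow> real" where
  "jump_energy g mm z = (\<Sum>i<mm. bdry (z i) (z i) (g i) - bdry (z (Suc i)) (z i) (g i))"

lemma bdry_lincomb: "bdry (\<lambda>k x. \<Sum>i<d. c i * U i k x) y x = (\<Sum>i<d. c i * bdry (U i) y x)"
  unfolding bdry_def by (simp add: algebra_simps sum.distrib sum_subtractf sum_distrib_left)

lemma J_lincomb: "J g mm (\<lambda>q k x. \<Sum>i<d. c i * U i q k x) y = (\<Sum>i<d. c i * J g mm (U i) y)"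
proof -
  have "J g mm (\<lambda>q k x. \<Sum>i<d. c i * U i q k x) y = (\<Sum>q<mm. \<Sum>i<d. c i * (bdry (U i q) y (g q) - bdry (U i (Suc q)) y (g q)))"
    unfolding J_def bdry_lincomb by (simp add: sum_subtractf[symmetric] right_diff_distrib)
  also have "\<dots> = (\<Sum>i<d. \<Sum>q<mm. c i * (bdry (U i q) y (g q) - bdry (U i (Suc q)) y (g q)))" by (rule sum.swap)
  finally show ?thesis by (simp add: J_def sum_distrib_left)
qed

text \<open>With more than \<open>p + r\<close> positive directions, some combination meets
  \<open>p\<close> orthogonality conditions to a family and \<open>r\<close> conditions on its
  Cauchy data at \<open>g 0\<close>. Its interpolant keeps the positive form by
  \<open>fits_max\<close> and is then normalised.\<close>

lemma broken_solution_exists: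
  assumes gr: "grid g mm a b" and lam: "lam \<ge> 0" and W: "\<And>i. i < d \<Longrightarrow> HS {a..b} (W i)"
    and P: "\<And>c. \<exists>i<d. c i \<noteq> 0 \<Longrightarrow> Q lam (lincomb d c W) (lincomb d c W) > 0" and pr: "p + r < d"
  shows "\<exists>z. (\<forall>q\<le>mm. Sol lam (z q)) \<and> (\<forall>q<mm. \<forall>k\<le>1. z q k (g q) = z (Suc q) k (g q)) \<and>
    (\<forall>k\<le>1. z 0 k a = 0 \<and> z mm k b = 0) \<and> (\<forall>j<p. J g mm z (w j) = 0) \<and>
    (\<forall>j<r. (\<Sum>k<4. e j k * z 0 k (g 0)) = 0) \<and> jump_energy g mm z > 0 \<and>
    (\<Sum>q\<le>mm. \<Sum>k<4. (z q k (g (q - 1)))\<^sup>2) = 1"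
proof -
  have g: "strict_mono g" and mm: "0 < mm" using gr by (auto simp: grid_def)
  have "\<forall>i. \<exists>u. fits g mm a b lam u (W i)" using fits_exists[OF gr lam] by blast
  then obtain U where U: "\<And>i. fits g mm a b lam (U i) (W i)" by metis
  define A where "A j i = (if j < p then J g mm (U i) (w j) else (\<Sum>k<4. e (j - p) k * U i 0 k (g 0)))" for j i
  obtain c where c: "\<exists>i<d. c i \<noteq> 0" "\<And>j. j < p + r \<Longrightarrow> (\<Sum>i<d. c i * A j i) = 0"
    using homogeneous_nat[OF pr, of A] by blast
  define z where "z q = (\<lambda>k x. \<Sum>i<d. c i * U i q k x)" for q
  have ft: "fits g mm a b lam z (lincomb d c W)" unfolding fits_def
  proof (intro conjI allI impI)
    show "Sol lam (z q)" if "q \<le> mm" for q unfolding z_def using U that by (intro Sol_lincomb) (auto simp: fits_def)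
  qed (use U in \<open>auto simp: z_def lincomb_def fits_def intro!: sum.neutral sum.cong\<close>)
  have hW: "HS {a..b} (lincomb d c W)" by (rule HS_lincomb[OF W])
  have eq: "J g mm z (clip a b (G g z mm)) = jump_energy g mm z"
    unfolding J_def jump_energy_def
  proof (intro sum.cong refl)
    fix i assume i: "i \<in> {..<mm}"
    have "clip a b (G g z mm) k (g i) = z i k (g i)" for k
      using grid_le(1)[OF gr, of i] grid_le(2)[OF gr, of i] i G_at[OF g, of i mm z k] by (simp add: clip_simps)
    then show "bdry (z i) (clip a b (G g z mm)) (g i) - bdry (z (Suc i)) (clip a b (G g z mm)) (g i) =
      bdry (z i) (z i) (g i) - bdry (z (Suc i)) (z i) (g i)" by (simp add: bdry_def)
  qed
  have J2pos: "jump_energy g mm z > 0" using fits_max(1)[OF gr lam hW ft] P[OF c(1)] eq by simp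
  \<comment> \<open>All Cauchy data of all pieces, each taken at its left breakpoint; by truncated
    subtraction piece 0 is measured at \<open>g 0\<close>. If the sum vanished, so would every piece
    and with it the energy.\<close>
  define \<nu> where "\<nu> = (\<Sum>q\<le>mm. \<Sum>k<4. (z q k (g (q - 1)))\<^sup>2)"
  have \<nu>0: "\<nu> \<ge> 0" unfolding \<nu>_def by (intro sum_nonneg) auto
  have "\<nu> \<noteq> 0"
  proof
    assume "\<nu> = 0"
    then have "\<forall>q\<in>{..mm}. (\<Sum>k<4. (z q k (g (q - 1)))\<^sup>2) = 0"
      unfolding \<nu>_def by (subst (asm) sum_nonneg_eq_0_iff) (auto intro: sum_nonneg)
    then have "z q k (g (q - 1)) = 0" if "q \<le> mm" "k < 4" for q k
      using that by (auto simp: sum_nonneg_eq_0_iff)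
    then have "z q k x = 0" if "q \<le> mm" "k \<le> 4" for q k x
      using Sol_zero_data[of lam "z q" "g (q - 1)" k x] ft that by (auto simp: fits_def)
    then have "jump_energy g mm z = 0" unfolding jump_energy_def bdry_def by (intro sum.neutral) auto
    then show False using J2pos by simp
  qed
  then have \<nu>: "\<nu> > 0" using \<nu>0 by simp
  define t where "t = 1 / sqrt \<nu>"
  have t: "t > 0" "t\<^sup>2 * \<nu> = 1" using \<nu> by (auto simp: t_def power_divide)
  define y where "y q = (\<lambda>k x. t * z q k x)" for q
  have bdt: "bdry (y q) (y q') x = t\<^sup>2 * bdry (z q) (z q') x" for q q' x
    unfolding bdry_def y_def by (simp add: power2_eq_square algebra_simps)
  have bdt1: "bdry (y q) f x = t * bdry (z q) f x" for q f x unfolding bdry_def y_def by (simp add: algebra_simps)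
  show ?thesis
  proof (intro exI[of _ y] conjI allI impI)
    show "Sol lam (y q)" if "q \<le> mm" for q
      using Sol_lincomb[of "Suc 0" lam "\<lambda>_. z q" "\<lambda>_. t"] ft that by (simp add: y_def fits_def)
    show "y q k (g q) = y (Suc q) k (g q)" if "q < mm" "k \<le> 1" for q k
      using ft that by (simp add: y_def fits_def)
    show "y 0 k a = 0" "y mm k b = 0" if "k \<le> 1" for k using ft that by (auto simp: y_def fits_def)
    show "J g mm y (w j) = 0" if "j < p" for j
    proof -
      have "J g mm z (w j) = 0" unfolding z_def J_lincomb using c(2)[of j] that by (simp add: A_def)
      moreover have "J g mm y (w j) = t * J g mm z (w j)"
        unfolding J_def bdt1 by (simp add: sum_distrib_left right_diff_distrib)
      ultimately show ?thesis by simp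
    qed
    show "(\<Sum>k<4. e j k * y 0 k (g 0)) = 0" if "j < r" for j
    proof -
      have "0 = (\<Sum>i<d. \<Sum>k<4. e j k * (c i * U i 0 k (g 0)))" using c(2)[of "p + j"] that
        by (simp add: A_def sum_distrib_left mult.left_commute)
      also have "\<dots> = (\<Sum>k<4. e j k * z 0 k (g 0))"
        unfolding z_def by (subst sum.swap) (simp add: sum_distrib_left)
      finally have "(\<Sum>k<4. e j k * z 0 k (g 0)) = 0" by simp
      then have "t * (\<Sum>k<4. e j k * z 0 k (g 0)) = 0" by simp
      then show ?thesis unfolding y_def by (simp add: sum_distrib_left mult.left_commute)
    qed
    have "jump_energy g mm y = t\<^sup>2 * jump_energy g mm z" unfolding jump_energy_def bdt by (simp add: sum_distrib_left right_diff_distrib)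
    then show "jump_energy g mm y > 0" using J2pos t by simp
    have "(\<Sum>q\<le>mm. \<Sum>k<4. (y q k (g (q - 1)))\<^sup>2) = t\<^sup>2 * \<nu>"
      unfolding y_def \<nu>_def by (simp add: power_mult_distrib sum_distrib_left)
    then show "(\<Sum>q\<le>mm. \<Sum>k<4. (y q k (g (q - 1)))\<^sup>2) = 1" using t by simp
  qed
qed

lemma bdry_bound:
  assumes "\<And>k. k < 4 \<Longrightarrow> \<bar>u k x\<bar> \<le> 1"
  shows "\<bar>bdry u u x\<bar> \<le> 4"
proof -
  have b: "\<bar>u i x * u j x\<bar> \<le> 1" if "i < 4" "j < 4" for i j
    unfolding abs_mult using assms[OF that(1)] assms[OF that(2)] by (intro mult_le_one) auto
  have "bdry u u x = u 3 x * u 0 x + u 1 x * u 0 x - u 2 x * u 1 x - u 0 x * u 1 x" by (simp add: bdry_def algebra_simps)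
  then show ?thesis using b[of 3 0] b[of 1 0] b[of 2 1] b[of 0 1] by linarith
qed

text \<open>Boundary values of size one force a uniform bound on the tail, since the form is
  coercive there and reduces to a boundary term on solutions.\<close>

lemma tail_limit_bound:
  assumes z: "\<And>n. Sol (l n) (z n)" and l: "l \<longlonglongrightarrow> lam" "\<And>n. l n \<ge> 0" and u: "Sol lam u"
    and lim: "\<And>k. k < 4 \<Longrightarrow> (\<lambda>n. z n k c) \<longlonglongrightarrow> u k c" and one: "\<And>n k. k < 4 \<Longrightarrow> \<bar>z n k c\<bar> \<le> 1"
    and V: "\<And>x. x \<in> {a..b} \<Longrightarrow> V x \<le> - m / 2" and ab: "a \<le> b"
    and ev: "\<forall>\<^sub>F n in sequentially. \<exists>a' b'. a' \<le> a \<and> b \<le> b' \<and> (\<forall>x\<in>{a'..b'}. V x \<le> - m / 2) \<and>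
      ((b' = c \<and> (\<forall>k\<le>1. z n k a' = 0)) \<or> (a' = c \<and> (\<forall>k\<le>1. z n k b' = 0)))"
    and k: "k = 0 \<or> k = 2"
  shows "integral {a..b} (\<lambda>x. (u k x)\<^sup>2) \<le> 2 * (4 * (2 + 4 / m)) + 2"
proof -
  have k4: "k < 4" using k by auto
  \<comment> \<open>Then passing from \<open>z n\<close> to the limit costs at most
    \<open>2 \<epsilon>^2 (b - a) <= 2\<close>, the last summand of the bound.\<close>
  define \<epsilon> where "\<epsilon> = 1 / sqrt (b - a + 1)"
  have e: "\<epsilon> > 0" "\<epsilon>\<^sup>2 * (b - a) \<le> 1" using ab by (auto simp: \<epsilon>_def power_divide divide_simps)
  have ul: "uniform_limit {a..b} (\<lambda>n. z n k) (u k) sequentially"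
    by (rule Sol_limit_uniform[OF z l(1) u lim k4])
  obtain n where n: "(\<forall>x\<in>{a..b}. dist (z n k x) (u k x) < \<epsilon>) \<and> (\<exists>a' b'. a' \<le> a \<and> b \<le> b' \<and> (\<forall>x\<in>{a'..b'}. V x \<le> - m / 2) \<and>
      ((b' = c \<and> (\<forall>k\<le>1. z n k a' = 0)) \<or> (a' = c \<and> (\<forall>k\<le>1. z n k b' = 0))))"
    using eventually_happens'[OF sequentially_bot eventually_conj[OF uniform_limitD[OF ul e(1)] ev]] by (rule exE)
  have clip: "\<And>x. x \<in> {a..b} \<Longrightarrow> dist (z n k x) (u k x) < \<epsilon>" using n by (auto dest: conjunct1)
  obtain a' b' where ab': "a' \<le> a" "b \<le> b'" and V'': "\<forall>x\<in>{a'..b'}. V x \<le> - m / 2"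
    and bc: "(b' = c \<and> (\<forall>k\<le>1. z n k a' = 0)) \<or> (a' = c \<and> (\<forall>k\<le>1. z n k b' = 0))"
    using conjunct2[OF n] by (elim exE conjE)
  have V': "\<And>x. x \<in> {a'..b'} \<Longrightarrow> V x \<le> - m / 2" using V'' by (rule bspec)
  define I where "I = bdry (z n) (z n) b' - bdry (z n) (z n) a'"
  have pz: "pw2 (z n)" by (rule Sol_pw2[OF z])
  have HI: "(qi (l n) (z n) (z n) has_integral I) {a'..b'}"
    unfolding I_def using ab ab' pz by (intro has_integral_bdry[OF z]) (auto simp: pw2_def)
  note tb = tail_bound[OF pz V' l(2) HI]
  have "\<bar>bdry (z n) (z n) c\<bar> \<le> 4" using one by (intro bdry_bound) auto
  moreover have "bdry (z n) (z n) a' = 0 \<or> bdry (z n) (z n) b' = 0"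
    using bc by (auto simp: bdry_def)
  ultimately have I4: "- I \<le> 4" using bc unfolding I_def by (auto simp: bdry_def)
  have m0: "0 < 2 / m" using m_pos by simp
  have mI: "(2 + 4 / m) * (- I) \<le> (2 + 4 / m) * 4" "(2 / m) * (- I) \<le> (2 / m) * 4"
    using m_pos I4 by (intro mult_left_mono; simp)+
  have "(2 + 4 / m) * 4 = 4 * (2 + 4 / m)" "(2 / m) * 4 \<le> 4 * (2 + 4 / m)" using m_pos by (auto simp: field_simps)
  moreover have "integral {a'..b'} (\<lambda>x. (z n 0 x)\<^sup>2) \<le> (2 / m) * (- I)" "integral {a'..b'} (\<lambda>x. (z n 2 x)\<^sup>2) \<le> (2 + 4 / m) * (- I)"
    using tb(1,2) by (simp_all only: mult_minus_left mult_minus_right)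
  ultimately have "integral {a'..b'} (\<lambda>x. (z n k x)\<^sup>2) \<le> 4 * (2 + 4 / m)" using k mI by auto
  moreover have zi: "(\<lambda>x. (z n k x)\<^sup>2) integrable_on {\<alpha>..\<beta>}" for \<alpha> \<beta> using pz k unfolding pw2_def by auto
  then have "integral {a..b} (\<lambda>x. (z n k x)\<^sup>2) \<le> integral {a'..b'} (\<lambda>x. (z n k x)\<^sup>2)"
    using ab' by (intro integral_subset_le) auto
  ultimately have zb: "integral {a..b} (\<lambda>x. (z n k x)\<^sup>2) \<le> 4 * (2 + 4 / m)" by linarith
  have ui: "(\<lambda>x. (u k x)\<^sup>2) integrable_on {a..b}" using Sol_pw2[OF u] k unfolding pw2_def by auto
  have "integral {a..b} (\<lambda>x. (u k x)\<^sup>2) \<le> integral {a..b} (\<lambda>x. 2 * (z n k x)\<^sup>2 + 2 * \<epsilon>\<^sup>2)"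
  proof (rule integral_le[OF ui])
    show "(\<lambda>x. 2 * (z n k x)\<^sup>2 + 2 * \<epsilon>\<^sup>2) integrable_on {a..b}"
      by (intro integrable_add integrable_on_mult_right zi) auto
    fix x assume "x \<in> {a..b}"
    then have "\<bar>u k x - z n k x\<bar> \<le> \<epsilon>" using clip[of x] by (simp add: dist_real_def abs_minus_commute less_imp_le)
    then have "(u k x - z n k x)\<^sup>2 \<le> \<epsilon>\<^sup>2" using e(1) by (metis abs_le_square_iff abs_of_pos)
    moreover have "(u k x)\<^sup>2 \<le> 2 * (z n k x)\<^sup>2 + 2 * (u k x - z n k x)\<^sup>2"
      using zero_le_power2[of "u k x - 2 * z n k x"] by (simp add: power2_eq_square algebra_simps)
    ultimately show "(u k x)\<^sup>2 \<le> 2 * (z n k x)\<^sup>2 + 2 * \<epsilon>\<^sup>2" by linarith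
  qed
  also have "\<dots> = 2 * integral {a..b} (\<lambda>x. (z n k x)\<^sup>2) + 2 * \<epsilon>\<^sup>2 * (b - a)"
    by (subst integral_add[OF integrable_on_mult_right[OF zi]]) (use ab in auto)
  also have "\<dots> \<le> 2 * (4 * (2 + 4 / m)) + 2" using zb e(2) by linarith
  finally show ?thesis .
qed

lemma Sol_right_square_integrable:
  assumes u: "Sol lam u" and b: "\<And>x k. x \<ge> s \<Longrightarrow> k = 0 \<or> k = 2 \<Longrightarrow> integral {s..x} (\<lambda>x. (u k x)\<^sup>2) \<le> C" and k: "k \<le> 2"
  shows "(\<lambda>x. (u k x)\<^sup>2) integrable_on {s..}"
proof -
  have c: "continuous_on A (u k)" if "k \<le> 4" for k A using Sol_cont[OF u that] .
  have ii: "(\<lambda>x. (u k x)\<^sup>2) integrable_on {a..b}" if "k \<le> 4" for k a b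
    by (intro integrable_continuous_real continuous_intros c that)
  have d: "(u k has_real_derivative u (Suc k) x) (at x)" if "k < 4" for k x using SolR_deriv[OF u that] .
  have "\<exists>C'. \<forall>x\<ge>s. integral {s..x} (\<lambda>x. (u 1 x)\<^sup>2) \<le> C'"
  proof (rule derivative_square_bound_right[of s "u 0" "u 1" "u 2" C])
    show "(u 0 has_real_derivative u 1 x) (at x)" for x using d[of 0] by simp
    show "(u 2 has_integral u 1 y - u 1 x) {x..y}" if "x \<le> y" for x y
      using pw_ftc[of u 1 x y] Sol_pw2[OF u] that by (simp add: pw2_def numeral_2_eq_2)
  qed (use ii b in auto)
  then obtain C' where C': "\<And>x. x \<ge> s \<Longrightarrow> integral {s..x} (\<lambda>x. (u 1 x)\<^sup>2) \<le> C'" by blast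
  have "k = 0 \<or> k = 1 \<or> k = 2" using k by auto
  then have bk: "integral {s..x} (\<lambda>x. (u k x)\<^sup>2) \<le> max C C'" if "x \<ge> s" for x
    using b[OF that, of k] C'[OF that] by (auto simp: le_max_iff_disj)
  show ?thesis
  proof (rule bounded_integrals_imp_integrable[where C = "max 0 (max C C')"])
    show "\<exists>a b. {s..} \<inter> {- real n..real n} = {a..b}" for n
      by (rule exI[of _ "max s (- real n)"], rule exI[of _ "real n"]) auto
    fix a b assume ab: "{a..b} \<subseteq> {s..}"
    show "(\<lambda>x. (u k x)\<^sup>2) integrable_on {a..b}" using k by (intro ii) auto
    show "integral {a..b} (\<lambda>x. (u k x)\<^sup>2) \<le> max 0 (max C C')"
    proof (cases "a \<le> b")
      case True
      then have sa: "s \<le> a" using ab by auto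
      have "integral {a..b} (\<lambda>x. (u k x)\<^sup>2) \<le> integral {s..b} (\<lambda>x. (u k x)\<^sup>2)"
        using sa k by (intro integral_subset_le ii) auto
      also have "\<dots> \<le> max C C'" using True sa by (intro bk) auto
      finally show ?thesis by simp
    qed simp
  qed auto
qed

lemma Sol_left_square_integrable:
  assumes u: "Sol lam u" and b: "\<And>x k. x \<le> s \<Longrightarrow> k = 0 \<or> k = 2 \<Longrightarrow> integral {x..s} (\<lambda>x. (u k x)\<^sup>2) \<le> C" and k: "k \<le> 2"
  shows "(\<lambda>x. (u k x)\<^sup>2) integrable_on {..s}"
proof -
  have c: "continuous_on A (u k)" if "k \<le> 4" for k A using Sol_cont[OF u that] .
  have ii: "(\<lambda>x. (u k x)\<^sup>2) integrable_on {a..b}" if "k \<le> 4" for k a b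
    by (intro integrable_continuous_real continuous_intros c that)
  have S: "side {..s}" by (auto simp: side_def)
  have S': "{..s} = UNIV \<or> (\<exists>s'. {..s} = {..s'})" by auto
  have fin: "(\<lambda>x. (u k x)\<^sup>2) integrable_on {..s}" if k: "k = 0 \<or> k = 2" for k
  proof (rule bounded_integrals_imp_integrable[OF _ side_Int[OF S'], where C = "max 0 C"])
    fix a b assume ab: "{a..b} \<subseteq> {..s}"
    show "(\<lambda>x. (u k x)\<^sup>2) integrable_on {a..b}" using k by (intro ii) auto
    show "integral {a..b} (\<lambda>x. (u k x)\<^sup>2) \<le> max 0 C"
    proof (cases "a \<le> b")
      case True
      then have bs: "b \<le> s" using ab by auto
      have "integral {a..b} (\<lambda>x. (u k x)\<^sup>2) \<le> integral {a..s} (\<lambda>x. (u k x)\<^sup>2)"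
        using bs k by (intro integral_subset_le ii) auto
      also have "\<dots> \<le> C" using True bs k by (intro b) auto
      finally show ?thesis by simp
    qed simp
  qed auto
  show ?thesis by (rule Sol_square_integrable[OF u S fin fin]) (use k in auto)
qed

text \<open>The two ways in which approximating intervals may end on the right: at clamped ends
  converging to \<open>s\<close>, or inside the coercive tail with ends going to infinity.\<close>

definition ending :: "real set \<Rightarrow> real \<Rightarrow> (nat \<Rightarrow> real) \<Rightarrow> bool" where
  "ending S b R \<longleftrightarrow> (\<exists>s. S = {..s} \<and> R \<longlonglongrightarrow> s \<and> b < s) \<or>
     (S = UNIV \<and> filterlim R at_top sequentially \<and> (\<forall>x\<ge>b. V x \<le> - m / 2))"

lemma Q_broken:
  assumes g: "strict_mono g" and u: "\<And>q. q \<le> mm \<Longrightarrow> Sol lam (u q)" and v: "\<And>x k. x \<in> S \<Longrightarrow> v k x = G g u mm k x"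
    and y: "Hc S y"
  shows "Q lam v y = J g mm u y"
proof -
  obtain T where T: "HS (S \<inter> {-T..T}) y" using y by (auto simp: Hc_def)
  define R where "R = \<bar>T\<bar> + 1 + (\<Sum>i\<le>mm. \<bar>g i\<bar>)"
  have sum0: "0 \<le> (\<Sum>i\<le>mm. \<bar>g i\<bar>)" by (intro sum_nonneg) auto
  have gR: "\<bar>g i\<bar> < R" if "i \<le> mm" for i
    using member_le_sum[of i "{..mm}" "\<lambda>i. \<bar>g i\<bar>"] that unfolding R_def by auto
  have out: "y k x = 0" if "k \<le> 2" "x \<notin> S \<inter> {-T..T}" for k x using HS_zero_off[OF T that] .
  have out': "y k x = 0" if "k \<le> 2" "\<bar>x\<bar> \<ge> R" for k x
  proof (rule out[OF that(1)], rule notI)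
    assume "x \<in> S \<inter> {-T..T}"
    then have "\<bar>x\<bar> \<le> \<bar>T\<bar>" by auto
    then show False using that(2) sum0 unfolding R_def by linarith
  qed
  have "qi lam v y x = qi lam (G g u mm) y x" for x
  proof (cases "x \<in> S")
    case True then show ?thesis using v[OF True] by (simp add: qi_def)
  next
    case False then show ?thesis using out[of 0 x] out[of 2 x] by (simp add: qi_def)
  qed
  then have "Q lam v y = integral UNIV (qi lam (G g u mm) y)" unfolding Q_def by presburger
  also have "\<dots> = integral {-R..R} (qi lam (G g u mm) y)"
  proof (rule integral_UNIV_Icc)
    fix x assume "x \<notin> {-R..R}"
    then have "\<bar>x\<bar> \<ge> R" by auto
    then show "qi lam (G g u mm) y x = 0" using out'[of 0 x] out'[of 2 x] by (simp add: qi_def)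
  qed
  also have "\<dots> = J g mm u y + bdry (u mm) y R - bdry (u 0) y (-R)"
  proof (rule integral_unique, rule has_integral_G[OF g u])
    show "pw y" using T by (simp add: HS_def)
    show "-R \<le> g 0" using gR[of 0] by auto
    show "g i \<le> R" if "i < mm" for i using gR[of i] that by auto
    show "-R \<le> R" using gR[of 0] by auto
  qed
  also have "\<dots> = J g mm u y"
    using out'[of 0 R] out'[of 1 R] out'[of 0 "-R"] out'[of 1 "-R"] by (simp add: bdry_def)
  finally show ?thesis .
qed

text \<open>In a limit, positive directions can only be lost to the kernel.\<close>

lemma index_semicontinuous_core:
  assumes S: "side S" and lam: "lam \<ge> 0" and l: "l \<longlonglongrightarrow> lam" "\<And>n. l n \<ge> 0"
    and gr: "\<And>n. grid g mm (L n) (R n)" and Vl: "\<And>x. x \<le> g 0 \<Longrightarrow> V x \<le> - m / 2"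
    and L: "filterlim L at_bot sequentially" and R: "ending S (g (mm - 1)) R"
    and W: "\<And>n i. i < d \<Longrightarrow> HS {L n..R n} (W n i)"
    and P: "\<And>n c. \<exists>i<d. c i \<noteq> 0 \<Longrightarrow> Q (l n) (lincomb d c (W n)) (lincomb d c (W n)) > 0"
  shows "d \<le> index S lam + nullity S lam"
proof (rule ccontr)
  assume "\<not> d \<le> index S lam + nullity S lam"
  define p where "p = index S lam"
  define r where "r = nullity S lam"
  have pr: "p + r < d" using \<open>\<not> d \<le> index S lam + nullity S lam\<close> by (simp add: p_def r_def)
  have g: "strict_mono g" and mm: "0 < mm" using gr[of 0] by (auto simp: grid_def)
  obtain w where w: "pos_family S lam p w" using pos_index[OF lam, of S] unfolding pos_def p_def by blast
  have wc: "Hc S (w j)" if "j < p" for j using w that by (simp add: pos_family_def)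
  obtain e where e: "\<And>j. j < r \<Longrightarrow> eigfun S lam (e j)" "lin_indep_on S r (\<lambda>i. e i 0)"
    using indep_nullity(1)[of S lam] unfolding indep_def r_def by blast
  \<comment> \<open>The \<open>p\<close> conditions make the limit orthogonal to a maximal family,
    the \<open>r\<close> conditions keep it away from the kernel. Together they contradict the
    normalisation.\<close>
  define B where "B n z \<longleftrightarrow> (\<forall>q\<le>mm. Sol (l n) (z q)) \<and> (\<forall>q<mm. \<forall>k\<le>1. z q k (g q) = z (Suc q) k (g q)) \<and>
    (\<forall>k\<le>1. z 0 k (L n) = 0 \<and> z mm k (R n) = 0) \<and> (\<forall>j<p. J g mm z (w j) = 0) \<and>
    (\<forall>j<r. (\<Sum>k<4. e j k (g 0) * z 0 k (g 0)) = 0) \<and> jump_energy g mm z > 0 \<and>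
    (\<Sum>q\<le>mm. \<Sum>k<4. (z q k (g (q - 1)))\<^sup>2) = 1" for n and z :: "nat \<Rightarrow> nat \<Rightarrow> real \<Rightarrow> real"
  have "\<exists>z. B n z" for n
    unfolding B_def by (rule broken_solution_exists[OF gr l(2) W P pr])
  then obtain z where B: "\<And>n. B n (z n)" by metis
  have z: "\<And>n q. q \<le> mm \<Longrightarrow> Sol (l n) (z n q)"
    "\<And>n q k. q < mm \<Longrightarrow> k \<le> 1 \<Longrightarrow> z n q k (g q) = z n (Suc q) k (g q)"
    "\<And>n k. k \<le> 1 \<Longrightarrow> z n 0 k (L n) = 0" "\<And>n k. k \<le> 1 \<Longrightarrow> z n mm k (R n) = 0"
    "\<And>n j. j < p \<Longrightarrow> J g mm (z n) (w j) = 0" "\<And>n j. j < r \<Longrightarrow> (\<Sum>k<4. e j k (g 0) * z n 0 k (g 0)) = 0"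
    "\<And>n. jump_energy g mm (z n) > 0" "\<And>n. (\<Sum>q\<le>mm. \<Sum>k<4. (z n q k (g (q - 1)))\<^sup>2) = 1"
    using B unfolding B_def by simp_all
  have one: "\<bar>z n q k (g (q - 1))\<bar> \<le> 1" if "q \<le> mm" "k < 4" for n q k
  proof -
    have "(z n q k (g (q - 1)))\<^sup>2 \<le> (\<Sum>k<4. (z n q k (g (q - 1)))\<^sup>2)"
      by (rule member_le_sum[of k "{..<4}" "\<lambda>k. (z n q k (g (q - 1)))\<^sup>2"]) (use that in auto)
    also have "\<dots> \<le> (\<Sum>q\<le>mm. \<Sum>k<4. (z n q k (g (q - 1)))\<^sup>2)"
      by (rule member_le_sum[of q "{..mm}" "\<lambda>q. \<Sum>k<4. (z n q k (g (q - 1)))\<^sup>2"]) (use that in \<open>auto intro: sum_nonneg\<close>)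
    finally show ?thesis using z(8)[of n] by (simp add: abs_square_le_1)
  qed
  obtain \<sigma> Y where \<sigma>: "strict_mono (\<sigma> :: nat \<Rightarrow> nat)"
    and Y: "\<forall>i\<in>{..mm} \<times> {..<4::nat}. (\<lambda>n. z (\<sigma> n) (fst i) (snd i) (g (fst i - 1))) \<longlonglongrightarrow> Y i"
    using common_convergent_subsequence[of "{..mm} \<times> {..<4}" "\<lambda>n i. z n (fst i) (snd i) (g (fst i - 1))"] one by auto
  have l': "(\<lambda>n. l (\<sigma> n)) \<longlonglongrightarrow> lam" using LIMSEQ_subseq_LIMSEQ[OF l(1) \<sigma>] by (simp add: o_def)
  have "\<forall>q. \<exists>u. Sol lam u \<and> (\<forall>k<4. u k (g (q - 1)) = Y (q, k))"
    using SolR_exists[where r = "\<lambda>x. 0" and lam = lam] by auto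
  then obtain u where u: "\<And>q. Sol lam (u q)" "\<And>q k. k < 4 \<Longrightarrow> u q k (g (q - 1)) = Y (q, k)" by metis
  have lim0: "(\<lambda>n. z (\<sigma> n) q k (g (q - 1))) \<longlonglongrightarrow> u q k (g (q - 1))" if "q \<le> mm" "k < 4" for q k
    using Y that u(2) by fastforce
  have lim: "(\<lambda>n. z (\<sigma> n) q k (xs n)) \<longlonglongrightarrow> u q k x" if "q \<le> mm" "k < 4" "xs \<longlonglongrightarrow> x" for q k xs x
    by (rule Sol_limit[OF z(1)[OF that(1)] l' u(1) lim0[OF that(1)] that(2,3)])
  have limc: "(\<lambda>n. z (\<sigma> n) q k x) \<longlonglongrightarrow> u q k x" if "q \<le> mm" "k < 4" for q k x
    by (rule lim[OF that tendsto_const])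
  have match: "u q k (g q) = u (Suc q) k (g q)" if "q < mm" "k \<le> 1" for q k
  proof (rule LIMSEQ_unique[OF limc])
    show "(\<lambda>n. z (\<sigma> n) q k (g q)) \<longlonglongrightarrow> u (Suc q) k (g q)"
      using limc[of "Suc q" k "g q"] z(2)[OF that] that by simp
  qed (use that in auto)
  have limbd: "(\<lambda>n. bdry (z (\<sigma> n) q) (y n) x) \<longlonglongrightarrow> bdry (u q) y' x"
    if "q \<le> mm" "(\<lambda>n. y n 0 x) \<longlonglongrightarrow> y' 0 x" "(\<lambda>n. y n 1 x) \<longlonglongrightarrow> y' 1 x" for q y y' x
    unfolding bdry_def by (intro tendsto_intros limc that) auto
  have Jw: "J g mm u (w j) = 0" if "j < p" for j
  proof (rule LIMSEQ_unique)
    show "(\<lambda>n. J g mm (z (\<sigma> n)) (w j)) \<longlonglongrightarrow> J g mm u (w j)"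
      unfolding J_def by (intro tendsto_sum tendsto_diff limbd) auto
    show "(\<lambda>n. J g mm (z (\<sigma> n)) (w j)) \<longlonglongrightarrow> 0" using z(5)[OF that] by simp
  qed
  have J2u: "jump_energy g mm u \<ge> 0"
  proof (rule LIMSEQ_le_const)
    show "(\<lambda>n. jump_energy g mm (z (\<sigma> n))) \<longlonglongrightarrow> jump_energy g mm u"
      unfolding jump_energy_def by (intro tendsto_sum tendsto_diff limbd limc) auto
    show "\<exists>N. \<forall>n\<ge>N. 0 \<le> jump_energy g mm (z (\<sigma> n))" using z(7) by (auto intro: less_imp_le)
  qed
  have eu: "(\<Sum>k<4. e j k (g 0) * u 0 k (g 0)) = 0" if "j < r" for j
  proof (rule LIMSEQ_unique)
    show "(\<lambda>n. \<Sum>k<4. e j k (g 0) * z (\<sigma> n) 0 k (g 0)) \<longlonglongrightarrow> (\<Sum>k<4. e j k (g 0) * u 0 k (g 0))"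
      by (intro tendsto_sum tendsto_mult tendsto_const limc) auto
    show "(\<lambda>n. \<Sum>k<4. e j k (g 0) * z (\<sigma> n) 0 k (g 0)) \<longlonglongrightarrow> 0" using z(6)[OF that] by simp
  qed
  have norm1: "(\<Sum>q\<le>mm. \<Sum>k<4. (u q k (g (q - 1)))\<^sup>2) = 1"
  proof (rule LIMSEQ_unique)
    show "(\<lambda>n. \<Sum>q\<le>mm. \<Sum>k<4. (z (\<sigma> n) q k (g (q - 1)))\<^sup>2) \<longlonglongrightarrow> (\<Sum>q\<le>mm. \<Sum>k<4. (u q k (g (q - 1)))\<^sup>2)"
      by (intro tendsto_sum tendsto_power limc) auto
    show "(\<lambda>n. \<Sum>q\<le>mm. \<Sum>k<4. (z (\<sigma> n) q k (g (q - 1)))\<^sup>2) \<longlonglongrightarrow> 1" using z(8) by simp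
  qed
  have Ls: "filterlim (\<lambda>n. L (\<sigma> n)) at_bot sequentially"
    using filterlim_compose[OF L filterlim_subseq[OF \<sigma>]] .
  have left: "(\<lambda>x. (u 0 k x)\<^sup>2) integrable_on {..g 0}" if "k \<le> 2" for k
  proof (rule Sol_left_square_integrable[OF u(1) _ that])
    fix a k assume a: "a \<le> g 0" and k: "k = 0 \<or> k = (2::nat)"
    show "integral {a..g 0} (\<lambda>x. (u 0 k x)\<^sup>2) \<le> 2 * (4 * (2 + 4 / m)) + 2"
    proof (rule tail_limit_bound[where z = "\<lambda>n. z (\<sigma> n) 0" and l = "\<lambda>n. l (\<sigma> n)" and lam = lam and c = "g 0"])
      have "\<forall>\<^sub>F n in sequentially. L (\<sigma> n) \<le> a" using Ls unfolding filterlim_at_bot by blast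
      then show "\<forall>\<^sub>F n in sequentially. \<exists>a' b'. a' \<le> a \<and> g 0 \<le> b' \<and> (\<forall>x\<in>{a'..b'}. V x \<le> - m / 2) \<and>
        (b' = g 0 \<and> (\<forall>k\<le>1. z (\<sigma> n) 0 k a' = 0) \<or> a' = g 0 \<and> (\<forall>k\<le>1. z (\<sigma> n) 0 k b' = 0))"
      proof eventually_elim
        case (elim n)
        show ?case by (rule exI[of _ "L (\<sigma> n)"], rule exI[of _ "g 0"]) (use elim Vl z(3) in auto)
      qed
    qed (use a k Vl one[of 0] limc[of 0] z(1) l' l(2) u(1) in auto)
  qed
  \<comment> \<open>The limit function: the pieces with limiting Cauchy data, glued. That it lies in
    the form domain is the tail bound on the left and, on the right, either the tail bound or the
    clamped limit end.\<close>
  define v where "v k x = (if x \<in> S then G g u mm k x else 0)" for k x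
  have pG: "pw2 (G g u mm)" by (rule pw2_G[OF g match]) (use Sol_pw2[OF u(1)] in auto)
  have gS: "{..g (mm - 1)} \<subseteq> S" using R by (auto simp: ending_def)
  have g0m: "g 0 \<le> g (mm - 1)" using g by (simp add: strict_mono_less_eq)
  have vHS: "HS S v"
  proof -
    have vl: "(\<lambda>x. (v k x)\<^sup>2) integrable_on {..g 0}" if "k \<le> 2" for k
    proof (rule integrable_eq[OF left[OF that]])
      fix x assume "x \<in> {..g 0}"
      then have "x \<in> S" "G g u mm k x = u 0 k x" using gS g0m G_val[OF g, of 0 mm x u k] by auto
      then show "(u 0 k x)\<^sup>2 = (v k x)\<^sup>2" by (simp add: v_def)
    qed
    have "pw2 v \<and> (\<exists>c\<ge>g 0. \<forall>k\<le>2. (\<lambda>x. (v k x)\<^sup>2) integrable_on {c..})"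
    proof (cases "S = UNIV")
      case True
      then have R': "filterlim R at_top sequentially" "\<And>x. x \<ge> g (mm - 1) \<Longrightarrow> V x \<le> - m / 2"
        using R by (auto simp: ending_def)
      have Rs: "filterlim (\<lambda>n. R (\<sigma> n)) at_top sequentially"
        using filterlim_compose[OF R'(1) filterlim_subseq[OF \<sigma>]] .
      have right: "(\<lambda>x. (u mm k x)\<^sup>2) integrable_on {g (mm - 1)..}" if "k \<le> 2" for k
      proof (rule Sol_right_square_integrable[OF u(1) _ that])
        fix b k assume b: "b \<ge> g (mm - 1)" and k: "k = 0 \<or> k = (2::nat)"
        show "integral {g (mm - 1)..b} (\<lambda>x. (u mm k x)\<^sup>2) \<le> 2 * (4 * (2 + 4 / m)) + 2"
        proof (rule tail_limit_bound[where z = "\<lambda>n. z (\<sigma> n) mm" and l = "\<lambda>n. l (\<sigma> n)" and lam = lam and c = "g (mm - 1)"])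
          have "\<forall>\<^sub>F n in sequentially. R (\<sigma> n) \<ge> b" using Rs unfolding filterlim_at_top by blast
          then show "\<forall>\<^sub>F n in sequentially. \<exists>a' b'. a' \<le> g (mm - 1) \<and> b \<le> b' \<and> (\<forall>x\<in>{a'..b'}. V x \<le> - m / 2) \<and>
            (b' = g (mm - 1) \<and> (\<forall>k\<le>1. z (\<sigma> n) mm k a' = 0) \<or> a' = g (mm - 1) \<and> (\<forall>k\<le>1. z (\<sigma> n) mm k b' = 0))"
          proof eventually_elim
            case (elim n)
            show ?case by (rule exI[of _ "g (mm - 1)"], rule exI[of _ "R (\<sigma> n)"]) (use elim R'(2) z(4) in auto)
          qed
        qed (use b k R'(2) one[of mm] limc[of mm] z(1) l' l(2) u(1) in auto)
      qed
      have vG: "v = G g u mm" using True by (intro ext) (simp add: v_def)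
      have "(\<lambda>x. (v k x)\<^sup>2) integrable_on {g (mm - 1)..}" if "k \<le> 2" for k
      proof (rule integrable_spike_finite[OF _ _ right[OF that], of "{g (mm - 1)}"])
        fix x assume x: "x \<in> {g (mm - 1)..} - {g (mm - 1)}"
        have "g i < x" if "i < mm" for i
        proof -
          have "g i \<le> g (mm - 1)" using g that by (simp add: strict_mono_less_eq)
          then show ?thesis using x by auto
        qed
        then have "G g u mm k x = u mm k x" by (rule G_right[OF g])
        then show "(v k x)\<^sup>2 = (u mm k x)\<^sup>2" by (simp add: vG)
      qed simp
      then show ?thesis using pG vG g0m by auto
    next
      case False
      then obtain s where s: "S = {..s}" "R \<longlonglongrightarrow> s" "g (mm - 1) < s" using R by (auto simp: ending_def)
      have Rs: "(\<lambda>n. R (\<sigma> n)) \<longlonglongrightarrow> s" using LIMSEQ_subseq_LIMSEQ[OF s(2) \<sigma>] by (simp add: o_def)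
      have us: "u mm k s = 0" if "k \<le> 1" for k
      proof (rule LIMSEQ_unique[OF lim[OF _ _ Rs]])
        show "(\<lambda>n. z (\<sigma> n) mm k (R (\<sigma> n))) \<longlonglongrightarrow> 0" using z(4)[OF that] by simp
      qed (use that in auto)
      have "G g u mm k s = u mm k s" for k
      proof (rule G_right[OF g])
        fix i assume "i < mm"
        then have "g i \<le> g (mm - 1)" using g by (simp add: strict_mono_less_eq)
        then show "g i < s" using s(3) by simp
      qed
      then have "pw2 (glue s (G g u mm) (\<lambda>k x. 0))" by (intro pw2_glue pG pw2_zero) (use us in auto)
      moreover have "glue s (G g u mm) (\<lambda>k x. 0) = v" by (intro ext) (simp add: glue_def v_def s(1))
      moreover have "(\<lambda>x. (v k x)\<^sup>2) integrable_on {s..}" for k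
        by (rule integrable_spike_finite[of "{s}" _ _ "\<lambda>x. 0"]) (auto simp: v_def s(1) intro: integrable_0)
      ultimately show ?thesis using s(3) g0m by (intro conjI exI[of _ s]) auto
    qed
    then obtain c where pv: "pw2 v" and c: "c \<ge> g 0" "\<And>k. k \<le> 2 \<Longrightarrow> (\<lambda>x. (v k x)\<^sup>2) integrable_on {c..}" by blast
    have "(\<lambda>x. (v k x)\<^sup>2) integrable_on UNIV" if k: "k \<le> 2" for k
    proof -
      have mid: "(\<lambda>x. (v k x)\<^sup>2) integrable_on {g 0..c}" using pv k by (simp add: pw2_def)
      have "{..g 0} \<inter> {g 0..c} = {g 0}" "({..g 0} \<union> {g 0..c}) \<inter> {c..} = {c}" using c(1) by auto
      then have n: "negligible ({..g 0} \<inter> {g 0..c})" "negligible (({..g 0} \<union> {g 0..c}) \<inter> {c..})" by auto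
      have "(\<lambda>x. (v k x)\<^sup>2) integrable_on (({..g 0} \<union> {g 0..c}) \<union> {c..})"
        by (rule integrable_Un[OF n(2) integrable_Un[OF n(1) vl[OF k] mid] c(2)[OF k]])
      moreover have "({..g 0} \<union> {g 0..c}) \<union> {c..} = UNIV" using c(1) by auto
      ultimately show ?thesis by simp
    qed
    then show ?thesis unfolding HS_def using pv by (auto simp: pw2_def v_def)
  qed
  have Qv: "Q lam v y = J g mm u y" if "Hc S y" for y
    by (rule Q_broken[OF g u(1) _ that]) (simp add: v_def)
  have vg: "v k (g i) = u i k (g i)" if "i < mm" for i k
  proof -
    have "g i \<le> g (mm - 1)" using g that by (simp add: strict_mono_less_eq)
    then have "g i \<in> S" using gS by auto
    then show ?thesis using G_at[OF g that] by (simp add: v_def)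
  qed
  have "Q lam v v \<ge> 0"
  proof (rule LIMSEQ_le_const)
    show "(\<lambda>n. Q lam v (cutoff n v)) \<longlonglongrightarrow> Q lam v v" by (rule cutoff_lim[OF vHS vHS])
    \<comment> \<open>From here on the cutoffs leave \<open>v\<close> unchanged at all grid points,
      so testing with them gives exactly the jump energy of the limit, which is nonnegative.\<close>
    define N where "N = nat \<lceil>(\<Sum>i<mm. \<bar>g i\<bar>)\<rceil>"
    have "Q lam v (cutoff n v) = jump_energy g mm u" if "N \<le> n" for n
    proof -
      have "\<bar>g i\<bar> \<le> real (Suc n)" if "i < mm" for i
      proof -
        have "\<bar>g i\<bar> \<le> (\<Sum>i<mm. \<bar>g i\<bar>)" by (rule member_le_sum[of i "{..<mm}" "\<lambda>i. \<bar>g i\<bar>"]) (use that in auto)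
        also have "\<dots> \<le> real n" using \<open>N \<le> n\<close> unfolding N_def by (simp add: nat_ceiling_le_eq)
        finally show ?thesis by simp
      qed
      then have "cutoff n v k (g i) = u i k (g i)" if "i < mm" "k \<le> 2" for i k
        using cutoff_in[of "g i" n k v] vg that by simp
      then have "J g mm u (cutoff n v) = jump_energy g mm u" unfolding J_def jump_energy_def bdry_def by (intro sum.cong) auto
      then show ?thesis using Qv[OF Hc_cutoff[OF vHS]] by simp
    qed
    then show "\<exists>N. \<forall>n\<ge>N. 0 \<le> Q lam v (cutoff n v)" using J2u by (intro exI[of _ N]) simp
  qed
  moreover have "Q lam v (w j) = 0" if "j < p" for j using Qv[OF wc[OF that]] Jw[OF that] by simp
  moreover have "\<not> pos S lam (Suc p)" using pos_iff[OF lam, of S "Suc p"] by (simp add: p_def)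
  ultimately have "weak_kernel S lam v" using maximal_imp_weak_kernel[OF w _ vHS] by blast
  then obtain f where f: "eigfun S lam f" "\<And>x k. x \<in> S \<Longrightarrow> k \<le> 1 \<Longrightarrow> v k x = f k x"
    by (rule weak_kernel_eigfun[OF _ lam S]) (rule that)
  have fs: "Sol lam f" using f(1) by (simp add: eigfun_def)
  have fu: "f k x = u 0 k x" if "k \<le> 4" for k x
  proof (rule Sol_eq_on[OF fs u(1) _ _ that, of "g 0 - 1" "g 0"])
    fix x assume "x \<in> {g 0 - 1<..<g 0}"
    then have x: "x \<le> g 0" "x \<in> S" using gS g0m by auto
    have "G g u mm 0 x = u 0 0 x" by (rule G_val[OF g]) (use x in auto)
    then show "f 0 x = u 0 0 x" using f(2)[OF x(2), of 0] x(2) by (simp add: v_def)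
  qed simp
  obtain c where c: "\<And>k x. k \<le> 4 \<Longrightarrow> f k x = (\<Sum>i<r. c i * e i k x)"
    by (rule nullity_span[OF e(1,2) r_def f(1) S]) (assumption | rule that)+
  \<comment> \<open>The kernel element \<open>f\<close> is a combination of the \<open>e i\<close>,
    while its Cauchy data at \<open>g 0\<close> are orthogonal to those of each \<open>e i\<close>.
    So \<open>f\<close> vanishes, and then every piece of the broken limit does.\<close>
  have "(\<Sum>k<4. (f k (g 0))\<^sup>2) = (\<Sum>k<4. \<Sum>i<r. c i * (e i k (g 0) * u 0 k (g 0)))"
  proof (intro sum.cong refl)
    fix k assume "k \<in> {..<4::nat}"
    then have k: "k \<le> 4" by simp
    have "(f k (g 0))\<^sup>2 = (\<Sum>i<r. c i * e i k (g 0)) * u 0 k (g 0)"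
      using c[OF k, of "g 0"] fu[OF k, of "g 0"] by (simp add: power2_eq_square)
    then show "(f k (g 0))\<^sup>2 = (\<Sum>i<r. c i * (e i k (g 0) * u 0 k (g 0)))"
      by (simp add: sum_distrib_right mult.assoc)
  qed
  also have "\<dots> = (\<Sum>i<r. c i * (\<Sum>k<4. e i k (g 0) * u 0 k (g 0)))"
    by (subst sum.swap) (simp add: sum_distrib_left)
  also have "\<dots> = 0" using eu by simp
  finally have "\<forall>k\<in>{..<4}. (f k (g 0))\<^sup>2 = 0" by (subst (asm) sum_nonneg_eq_0_iff) auto
  then have f0: "f k x = 0" if "k \<le> 4" for k x using Sol_zero_data[OF fs, of "g 0" k x] that by auto
  have "u q k x = 0" if q: "q \<le> mm" and k: "k \<le> 4" for q k x
  proof -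
    define lo where "lo = (if q = 0 then g 0 - 1 else g (q - 1))"
    have "\<exists>hi>lo. \<forall>x. lo < x \<and> x < hi \<longrightarrow> x \<in> S \<and> (q < mm \<longrightarrow> x \<le> g q)"
    proof (cases "q < mm")
      case True
      have "g q \<le> g (mm - 1)" using g True by (simp add: strict_mono_less_eq)
      moreover have "lo < g q" using g by (auto simp: lo_def strict_mono_less)
      ultimately show ?thesis using gS True by (intro exI[of _ "g q"]) auto
    next
      case False
      then have q: "q = mm" using q by simp
      then have lo: "lo = g (mm - 1)" using mm by (simp add: lo_def)
      show ?thesis
      proof (cases "S = UNIV")
        case True
        then show ?thesis using q by (intro exI[of _ "lo + 1"]) auto
      next
        case False
        then obtain s where "S = {..s}" "g (mm - 1) < s" using R by (auto simp: ending_def)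
        then show ?thesis using lo q by (intro exI[of _ s]) auto
      qed
    qed
    then obtain hi where hi: "lo < hi" "\<And>x. lo < x \<Longrightarrow> x < hi \<Longrightarrow> x \<in> S \<and> (q < mm \<longrightarrow> x \<le> g q)" by blast
    show ?thesis
    proof (rule Sol_zero_on[OF u(1) _ hi(1) k])
      fix x assume "x \<in> {lo<..<hi}"
      then have x: "lo < x" "x < hi" by auto
      have "G g u mm 0 x = u q 0 x"
      proof (rule G_val[OF g q])
        fix j assume j: "j < q"
        then have "g j \<le> g (q - 1)" using g by (simp add: strict_mono_less_eq)
        then show "g j < x" using x j by (auto simp: lo_def)
      qed (use hi(2)[OF x] in auto)
      then show "u q 0 x = 0" using hi(2)[OF x] f(2)[of x 0] f0[of 0 x] by (simp add: v_def)
    qed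
  qed
  then show False using norm1 by simp
qed

end

subsection \<open>Index, eigenvalues and conjugate points\<close>

definition shift :: "real \<Rightarrow> (nat \<Rightarrow> real \<Rightarrow> real) \<Rightarrow> nat \<Rightarrow> real \<Rightarrow> real" where
  "shift h v = (\<lambda>k x. v k (x + h))"

lemma HS_shift:
  assumes v: "HS {a..b} v"
  shows "HS {a - h..b - h} (shift h v)"
proof -
  have p: "pw v" using v by (simp add: HS_def)
  obtain F where F: "finite F" "\<And>x. x \<notin> F \<Longrightarrow> (v 0 has_real_derivative v 1 x) (at x)"
    "\<And>x. x \<notin> F \<Longrightarrow> (v 1 has_real_derivative v 2 x) (at x)"
    using p unfolding pw_def by blast
  have out: "shift h v k x = 0" if "k \<le> 2" "x \<notin> {a - h..b - h}" for k x
    unfolding shift_def by (rule HS_zero_off[OF v that(1)]) (use that(2) in auto)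
  have "pw (shift h v)" unfolding pw_def
  proof (intro conjI exI[of _ "(\<lambda>x. x - h) ` F"] allI impI)
    have c: "continuous_on UNIV (shift h v k)" if "k \<le> 1" for k
      unfolding shift_def by (intro continuous_on_compose2[OF HS_cont[OF v that, of UNIV]] continuous_intros) auto
    show "continuous_on UNIV (shift h v 0)" "continuous_on UNIV (shift h v 1)" by (rule c, simp)+
    show "shift h v 2 \<in> borel_measurable borel"
      unfolding shift_def using measurable_compose[OF _ HS_borel[OF v, of 2], of "\<lambda>x. x + h" borel] by simp
    fix x assume "x \<notin> (\<lambda>x. x - h) ` F"
    then have x: "x + h \<notin> F" by (metis add_diff_cancel_right' imageI)
    show "(shift h v 0 has_real_derivative shift h v 1 x) (at x)" "(shift h v 1 has_real_derivative shift h v 2 x) (at x)"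
      unfolding shift_def using F(2)[OF x] F(3)[OF x] by (simp_all add: DERIV_shift)
  qed (use F(1) in auto)
  moreover have "(\<lambda>x. (shift h v k x)\<^sup>2) integrable_on UNIV" if k: "k \<le> 2" for k
  proof -
    have "((\<lambda>x. (v k x)\<^sup>2) has_integral integral {a..b} (\<lambda>x. (v k x)\<^sup>2)) {a..b}"
      using v k by (intro integrable_integral) (auto simp: HS_def intro: integrable_on_subinterval)
    from has_integral_shift_real_ivl[OF this, of h]
    have "(\<lambda>x. (shift h v k x)\<^sup>2) integrable_on {a - h..b - h}" unfolding shift_def by blast
    then have "(\<lambda>x. if x \<in> {a - h..b - h} then (shift h v k x)\<^sup>2 else 0) integrable_on UNIV"
      by (simp only: integrable_restrict_UNIV)
    moreover have "(\<lambda>x. if x \<in> {a - h..b - h} then (shift h v k x)\<^sup>2 else 0) = (\<lambda>x. (shift h v k x)\<^sup>2)"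
      using out[OF k] by auto
    ultimately show ?thesis by simp
  qed
  ultimately show ?thesis unfolding HS_def using out by blast
qed

lemma N2_pos:
  assumes v: "HS S v" and x: "v 0 x \<noteq> 0"
  shows "N2 v v > 0"
proof (rule ccontr)
  assume "\<not> N2 v v > 0"
  then have n: "integral UNIV (\<lambda>x. v 0 x * v 0 x) \<le> 0" by (simp add: N2_def)
  have i: "(\<lambda>x. v 0 x * v 0 x) integrable_on UNIV" using HS_prod_int[OF v v, of 0 0] by simp
  have "integral {x-1..x+1} (\<lambda>x. v 0 x * v 0 x) \<le> integral UNIV (\<lambda>x. v 0 x * v 0 x)"
    by (rule integral_subset_le[OF _ integrable_on_subinterval[OF i] i]) auto
  then have "integral {x-1..x+1} (\<lambda>x. (v 0 x)\<^sup>2) \<le> 0" using n by (simp add: power2_eq_square)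
  from integral_zero_continuous[OF HS_cont[OF v] _ this, of x] x show False by simp
qed

lemma N2_lincomb:
  assumes w: "\<And>i. i < d \<Longrightarrow> HS S (w i)" and y: "HS S' y"
  shows "N2 (lincomb d c w) y = (\<Sum>i<d. c i * N2 (w i) y)"
proof -
  have "(\<lambda>x. lincomb d c w 0 x * y 0 x) = (\<lambda>x. \<Sum>i<d. c i * (w i 0 x * y 0 x))"
    by (auto simp: lincomb_def sum_distrib_right mult.assoc)
  then have "N2 (lincomb d c w) y = integral UNIV (\<lambda>x. \<Sum>i<d. c i * (w i 0 x * y 0 x))" by (simp add: N2_def)
  also have "\<dots> = (\<Sum>i<d. integral UNIV (\<lambda>x. c i * (w i 0 x * y 0 x)))"
    using HS_prod_int[OF w y, of _ 0 0] by (intro integral_sum integrable_on_mult_right) auto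
  finally show ?thesis by (simp add: N2_def)
qed

lemma N2_lincomb_bound:
  assumes w: "\<And>i. i < d \<Longrightarrow> HS S (w i)"
  shows "N2 (lincomb d c w) (lincomb d c w) \<le> (\<Sum>i<d. (c i)\<^sup>2) * (\<Sum>i<d. N2 (w i) (w i))"
proof -
  have wi: "(\<lambda>x. w i 0 x * w i 0 x) integrable_on UNIV" if "i < d" for i
    using HS_prod_int[OF w[OF that] w[OF that], of 0 0] by simp
  have "N2 (lincomb d c w) (lincomb d c w) \<le> integral UNIV (\<lambda>x. (\<Sum>i<d. (c i)\<^sup>2) * (\<Sum>i<d. w i 0 x * w i 0 x))"
    unfolding N2_def
  proof (rule integral_le)
    show "(\<lambda>x. lincomb d c w 0 x * lincomb d c w 0 x) integrable_on UNIV"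
      by (rule HS_prod_int[OF HS_lincomb HS_lincomb]) (use w in auto)
    show "(\<lambda>x. (\<Sum>i<d. (c i)\<^sup>2) * (\<Sum>i<d. w i 0 x * w i 0 x)) integrable_on UNIV"
      by (intro integrable_on_mult_right integrable_sum wi) auto
    show "lincomb d c w 0 x * lincomb d c w 0 x \<le> (\<Sum>i<d. (c i)\<^sup>2) * (\<Sum>i<d. w i 0 x * w i 0 x)" for x
      using Cauchy_Schwarz_ineq_sum[of c "\<lambda>i. w i 0 x" "{..<d}"] by (simp add: lincomb_def power2_eq_square)
  qed
  also have "\<dots> = (\<Sum>i<d. (c i)\<^sup>2) * (\<Sum>i<d. N2 (w i) (w i))"
    unfolding N2_def integral_mult_right by (subst integral_sum) (auto simp: wi)
  finally show ?thesis .
qed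

context pot
begin

lemma index_semicontinuous_half:
  assumes lam: "lam \<ge> 0" and l: "l \<longlonglongrightarrow> lam" "\<And>n. l n \<ge> 0" and s: "sn \<longlonglongrightarrow> s"
    and p: "\<And>n. pos {..sn n} (l n) d"
  shows "d \<le> index {..s} lam + nullity {..s} lam"
proof -
  obtain g mm \<delta> where gd: "\<delta> > 0" "\<And>l r. l < g 0 \<Longrightarrow> \<bar>r - s\<bar> < \<delta> \<Longrightarrow> grid g mm l r"
    "\<And>x. x \<le> g 0 \<Longrightarrow> V x \<le> - m / 2" "g (mm - 1) < s - \<delta> / 2" "0 < mm" by (rule grid_left_exists) (rule that)
  obtain N where N: "\<And>n. n \<ge> N \<Longrightarrow> \<bar>sn n - s\<bar> < \<delta>"
    using tendstoD[OF s gd(1)] by (auto simp: eventually_sequentially dist_real_def)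
  have "\<forall>n. \<exists>w. pos_family {..sn n} (l n) d w" using p by (simp add: pos_def)
  then obtain W where W: "\<And>n. pos_family {..sn n} (l n) d (W n)" by metis
  have "\<exists>T. \<forall>i<d. \<forall>T'\<ge>T. HS ({..sn n} \<inter> {-T'..T'}) (W n i)" for n
  proof -
    have "\<And>i. i < d \<Longrightarrow> Hc {..sn n} (W n i)" using W[of n] by (simp add: pos_family_def)
    then show ?thesis by (rule Hc_common[where d = d and S = "{..sn n}" and w = "W n"]) blast+
  qed
  then obtain T where T: "\<And>n i T'. i < d \<Longrightarrow> T n \<le> T' \<Longrightarrow> HS ({..sn n} \<inter> {-T'..T'}) (W n i)" by metis
  \<comment> \<open>Left of the supports, left of the grid, and tending to minus infinity.\<close>
  define L where "L n = - max (T n) (max (1 - g 0) (real n))" for n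
  have Lg: "L n < g 0" for n by (auto simp: L_def)
  have S: "side {..s}" by (auto simp: side_def)
  show ?thesis
  proof (rule index_semicontinuous_core[OF S lam, of "\<lambda>n. l (n + N)" g mm "\<lambda>n. L (n + N)" "\<lambda>n. sn (n + N)" d "\<lambda>n. W (n + N)"])
    show "(\<lambda>n. l (n + N)) \<longlonglongrightarrow> lam" using l(1) by (rule LIMSEQ_ignore_initial_segment)
    show "filterlim (\<lambda>n. L (n + N)) at_bot sequentially" unfolding filterlim_at_bot
    proof
      fix Z :: real
      show "\<forall>\<^sub>F n in sequentially. L (n + N) \<le> Z"
      proof (rule eventually_sequentiallyI[of "nat \<lceil>\<bar>Z\<bar>\<rceil>"])
        fix n assume "nat \<lceil>\<bar>Z\<bar>\<rceil> \<le> n"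
        then have "\<bar>Z\<bar> \<le> real n" by (simp add: nat_ceiling_le_eq)
        then show "L (n + N) \<le> Z" by (auto simp: L_def)
      qed
    qed
    show "ending {..s} (g (mm - 1)) (\<lambda>n. sn (n + N))"
      unfolding ending_def using LIMSEQ_ignore_initial_segment[OF s, of N] gd(1,4) by auto
    show "grid g mm (L (n + N)) (sn (n + N))" for n by (intro gd(2) Lg N) simp
    show "HS {L (n + N)..sn (n + N)} (W (n + N) i)" if "i < d" for n i
      by (rule HS_mono[OF T[OF that, of "n + N" "- L (n + N)"]]) (auto simp: L_def)
    show "Q (l (n + N)) (lincomb d c (W (n + N))) (lincomb d c (W (n + N))) > 0" if c: "\<exists>i<d. c i \<noteq> 0" for n c
    proof -
      obtain \<epsilon> where "\<epsilon> > 0" "\<epsilon> * (\<Sum>i<d. (c i)\<^sup>2) \<le> Q (l (n + N)) (lincomb d c (W (n + N))) (lincomb d c (W (n + N)))"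
        using W[of "n + N"] by (auto simp: pos_family_def)
      moreover have "0 < \<epsilon> * (\<Sum>i<d. (c i)\<^sup>2)" using \<open>\<epsilon> > 0\<close> sum_squares_pos[OF c] by simp
      ultimately show ?thesis by linarith
    qed
  qed (use l(2) gd(3) in auto)
qed

lemma index_semicontinuous_line:
  assumes lam: "lam \<ge> 0" and l: "l \<longlonglongrightarrow> lam" "\<And>n. l n \<ge> 0" and p: "\<And>n. pos UNIV (l n) d"
  shows "d \<le> index UNIV lam + nullity UNIV lam"
proof -
  obtain g mm where g: "\<And>l r. l < g 0 \<Longrightarrow> g (mm - 1) < r \<Longrightarrow> grid g mm l r"
    "\<And>x. x \<le> g 0 \<Longrightarrow> V x \<le> - m / 2" "\<And>x. x \<ge> g (mm - 1) \<Longrightarrow> V x \<le> - m / 2" "0 < mm"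
    by (rule grid_line_exists) (rule that)
  have "\<forall>n. \<exists>w. pos_family UNIV (l n) d w" using p by (simp add: pos_def)
  then obtain W where W: "\<And>n. pos_family UNIV (l n) d (W n)" by metis
  have "\<exists>T. \<forall>i<d. \<forall>T'\<ge>T. HS (UNIV \<inter> {-T'..T'}) (W n i)" for n
  proof -
    have "\<And>i. i < d \<Longrightarrow> Hc UNIV (W n i)" using W[of n] by (simp add: pos_family_def)
    then show ?thesis by (rule Hc_common[where d = d and S = UNIV and w = "W n"]) blast+
  qed
  then obtain T where T: "\<And>n i T'. i < d \<Longrightarrow> T n \<le> T' \<Longrightarrow> HS (UNIV \<inter> {-T'..T'}) (W n i)" by metis
  define R where "R n = max (T n) (max (max (1 - g 0) (1 + g (mm - 1))) (real n))" for n
  have Rg: "- R n < g 0" "g (mm - 1) < R n" for n by (auto simp: R_def)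
  have big: "\<forall>\<^sub>F n in sequentially. Z \<le> R n" for Z
  proof (rule eventually_sequentiallyI[of "nat \<lceil>\<bar>Z\<bar>\<rceil>"])
    fix n assume "nat \<lceil>\<bar>Z\<bar>\<rceil> \<le> n"
    then have "\<bar>Z\<bar> \<le> real n" by (simp add: nat_ceiling_le_eq)
    then show "Z \<le> R n" by (auto simp: R_def)
  qed
  have S: "side UNIV" by (auto simp: side_def)
  show ?thesis
  proof (rule index_semicontinuous_core[OF S lam l, of g mm "\<lambda>n. - R n" R d W])
    show "filterlim (\<lambda>n. - R n) at_bot sequentially" unfolding filterlim_at_bot
    proof
      fix Z show "\<forall>\<^sub>F n in sequentially. - R n \<le> Z" using big[of "- Z"] by eventually_elim simp
    qed
    show "ending UNIV (g (mm - 1)) R"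
      unfolding ending_def filterlim_at_top using g(3) big by auto
    show "grid g mm (- R n) (R n)" for n by (intro g(1) Rg)
    show "HS {- R n..R n} (W n i)" if "i < d" for n i
      by (rule HS_mono[OF T[OF that, of n "R n"]]) (auto simp: R_def)
    show "Q (l n) (lincomb d c (W n)) (lincomb d c (W n)) > 0" if c: "\<exists>i<d. c i \<noteq> 0" for n c
    proof -
      obtain \<epsilon> where "\<epsilon> > 0" "\<epsilon> * (\<Sum>i<d. (c i)\<^sup>2) \<le> Q (l n) (lincomb d c (W n)) (lincomb d c (W n))"
        using W[of n] by (auto simp: pos_family_def)
      moreover have "0 < \<epsilon> * (\<Sum>i<d. (c i)\<^sup>2)" using \<open>\<epsilon> > 0\<close> sum_squares_pos[OF c] by simp
      ultimately show ?thesis by linarith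
    qed
  qed (use g(2) in auto)
qed

lemma index_semicontinuous:
  assumes "side S" "lam \<ge> 0" "l \<longlonglongrightarrow> lam" "\<And>n. l n \<ge> 0" "\<And>n. pos S (l n) d"
  shows "d \<le> index S lam + nullity S lam"
proof (cases "S = UNIV")
  case True
  then show ?thesis using index_semicontinuous_line[of lam l d] assms by simp
next
  case False
  then obtain s where "S = {..s}" using assms(1) by (auto simp: side_def)
  then show ?thesis using index_semicontinuous_half[of lam l "\<lambda>_. s" s d] assms by simp
qed

section \<open>The index counts the positive eigenvalues\<close>

text \<open>\<open>lam\<close> enters the form through \<open>- lam * N2\<close> only, and
  \<open>N2\<close> is at most \<open>K\<close> times the sum of the squared coefficients; the
  chosen \<open>\<delta>\<close> uses up half of the margin \<open>\<epsilon>\<close>.\<close>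

lemma pos_open:
  assumes "pos S lam d"
  obtains \<delta> where "\<delta> > 0" "\<And>lam'. lam' < lam + \<delta> \<Longrightarrow> pos S lam' d"
proof -
  obtain w \<epsilon> where w: "\<And>i. i < d \<Longrightarrow> Hc S (w i)" and e: "\<epsilon> > 0"
    "\<And>c. \<epsilon> * (\<Sum>i<d. (c i)\<^sup>2) \<le> Q lam (lincomb d c w) (lincomb d c w)"
    using assms unfolding pos_def pos_family_def by blast
  have wH: "HS S (w i)" if "i < d" for i using Hc_HS[OF w[OF that]] .
  define K where "K = (\<Sum>i<d. N2 (w i) (w i))"
  have K: "K \<ge> 0" unfolding K_def by (intro sum_nonneg N2_nonneg[OF wH]) auto
  define \<delta> where "\<delta> = \<epsilon> / (2 * (K + 1))"
  have d: "\<delta> > 0" "\<delta> * K \<le> \<epsilon> / 2" using e(1) K by (auto simp: \<delta>_def field_simps)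
  have near: "pos S lam' d" if l: "lam \<le> lam'" "lam' < lam + \<delta>" for lam'
  proof -
    have "\<epsilon> / 2 * (\<Sum>i<d. (c i)\<^sup>2) \<le> Q lam' (lincomb d c w) (lincomb d c w)" for c
    proof -
      have h: "HS S (lincomb d c w)" by (rule HS_lincomb[OF wH])
      have s0: "0 \<le> (\<Sum>i<d. (c i)\<^sup>2)" by (intro sum_nonneg) auto
      have "(lam' - lam) * N2 (lincomb d c w) (lincomb d c w) \<le> \<delta> * ((\<Sum>i<d. (c i)\<^sup>2) * K)"
        using N2_lincomb_bound[OF wH, where c = c] N2_nonneg[OF h] l d(1) unfolding K_def by (intro mult_mono) auto
      also have "\<dots> = (\<delta> * K) * (\<Sum>i<d. (c i)\<^sup>2)" by simp
      also have "\<dots> \<le> \<epsilon> / 2 * (\<Sum>i<d. (c i)\<^sup>2)" using d(2) s0 by (rule mult_right_mono)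
      finally show ?thesis using Q_lam[OF h h, of lam' lam] e(2)[of c] by (simp add: field_simps)
    qed
    then show ?thesis using w e(1) unfolding pos_def pos_family_def by (metis half_gt_zero)
  qed
  have "pos S lam' d" if "lam' < lam + \<delta>" for lam'
  proof (cases "lam \<le> lam'")
    case True then show ?thesis using near that by blast
  next
    case False
    then show ?thesis using pos_mono_lam[OF assms] by simp
  qed
  then show ?thesis using d(1) by (intro that)
qed

lemma pos_large:
  obtains \<Lambda> where "\<Lambda> \<ge> 0" "\<And>S lam d. lam \<ge> \<Lambda> \<Longrightarrow> pos S lam d \<Longrightarrow> d = 0"
proof -
  obtain K where K: "K \<ge> 0" "\<And>x. \<bar>V x\<bar> \<le> K" by (rule V_bounded) (rule that)
  have "d = 0" if lam: "lam \<ge> K" and p: "pos S lam d" for S lam d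
  proof (rule ccontr)
    assume "d \<noteq> 0"
    then have "pos S lam 1" using pos_le[OF p, of 1] by simp
    then obtain w \<epsilon> where w: "Hc S (w 0)" and e: "\<epsilon> > 0"
      "\<And>c. \<epsilon> * (\<Sum>i<(1::nat). (c i)\<^sup>2) \<le> Q lam (lincomb 1 c w) (lincomb 1 c w)"
      unfolding pos_def pos_family_def by auto
    have wH: "HS S (lincomb 1 (\<lambda>_. 1) w)" using Hc_HS[OF w] by (intro HS_lincomb) auto
    define v where "v = lincomb 1 (\<lambda>_. 1) w"
    have "qi lam v v x \<le> 0" for x
    proof -
      have "(V x - lam) * (v 0 x)\<^sup>2 \<le> 0" using K(2)[of x] lam by (intro mult_nonpos_nonneg) auto
      then show ?thesis using zero_le_power2[of "v 2 x + v 0 x"] unfolding qi_def by (simp add: power2_eq_square algebra_simps)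
    qed
    then have "Q lam v v \<le> 0"
      unfolding Q_def using integral_le[OF _ integrable_0, of "qi lam v v" UNIV] qi_int[OF wH wH, of lam] by (auto simp: v_def)
    then show False using e(1) e(2)[of "\<lambda>_. 1"] by (simp add: v_def)
  qed
  then show ?thesis using K(1) by (intro that)
qed

text \<open>Truncation enlarges the class of test functions from compact support to the whole form
  domain, so eigenfunctions may be tested with each other.\<close>

lemma eigfun_Q:
  assumes u: "eigfun S lam u" and S: "side S" and v: "HS S v"
  shows "Q lam (zero_ext S u) v = 0"
proof (rule LIMSEQ_unique)
  show "(\<lambda>n. Q lam (zero_ext S u) (cutoff n v)) \<longlonglongrightarrow> Q lam (zero_ext S u) v"
    by (rule cutoff_lim[OF zero_ext_HS[OF u S] v])
  show "(\<lambda>n. Q lam (zero_ext S u) (cutoff n v)) \<longlonglongrightarrow> 0"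
    using eigfun_weak_kernel[OF u S] Hc_cutoff[OF v] by (simp add: weak_kernel_def)
qed

lemma eigfun_Q0:
  assumes u: "eigfun S lam u" and S: "side S" and v: "HS S v"
  shows "Q 0 (zero_ext S u) v = lam * N2 (zero_ext S u) v"
  using eigfun_Q[OF assms] Q_lam[OF zero_ext_HS[OF u S] v, of lam 0] by simp

lemma eigfun_orth:
  assumes u: "eigfun S lam u" and v: "eigfun S lam' v" and S: "side S" and ne: "lam \<noteq> lam'"
  shows "N2 (zero_ext S u) (zero_ext S v) = 0"
proof -
  have "lam * N2 (zero_ext S u) (zero_ext S v) = lam' * N2 (zero_ext S v) (zero_ext S u)"
    using eigfun_Q0[OF u S zero_ext_HS[OF v S]] eigfun_Q0[OF v S zero_ext_HS[OF u S]] Q_sym by metis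
  then show ?thesis using ne by (simp add: N2_sym[of "zero_ext S v"])
qed

lemma eigfun_lincomb:
  assumes u: "\<And>i. i < n \<Longrightarrow> eigfun S lam (u i)" and S: "side S"
  shows "eigfun S lam (\<lambda>k x. \<Sum>i<n. c i * u i k x)" "zero_ext S (\<lambda>k x. \<Sum>i<n. c i * u i k x) = lincomb n c (\<lambda>i. zero_ext S (u i))"
proof -
  define f where "f = (\<lambda>k x. \<Sum>i<n. c i * u i k x)"
  have s: "Sol lam f" unfolding f_def using u by (intro Sol_lincomb) (auto simp: eigfun_def)
  show ve: "zero_ext S (\<lambda>k x. \<Sum>i<n. c i * u i k x) = lincomb n c (\<lambda>i. zero_ext S (u i))"
    by (intro ext) (simp add: zero_ext_def lincomb_def)
  then have h: "HS S (zero_ext S f)" unfolding f_def using zero_ext_HS[OF u S] by (simp add: HS_lincomb)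
  have i: "(\<lambda>x. (f k x)\<^sup>2) integrable_on S" if "k \<le> 2" for k
  proof -
    have "(\<lambda>x. (zero_ext S f k x)\<^sup>2) integrable_on UNIV" using h that by (simp add: HS_def)
    moreover have "(\<lambda>x. (zero_ext S f k x)\<^sup>2) = (\<lambda>x. if x \<in> S then (f k x)\<^sup>2 else 0)" by (auto simp: zero_ext_def)
    ultimately show ?thesis by (simp add: integrable_restrict_UNIV)
  qed
  have "eigfun S lam f" unfolding eigfun_def
  proof (intro conjI allI impI s)
    show "(\<lambda>x. (f k x)\<^sup>2) integrable_on S" if "k \<le> 4" for k
      by (rule Sol_square_integrable[OF s S i i that]) auto
    show "f 0 r = 0" "f 1 r = 0" if "S = {..r}" for r
      using u that by (auto simp: f_def eigfun_def)
  qed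
  then show "eigfun S lam (\<lambda>k x. \<Sum>i<n. c i * u i k x)" by (simp add: f_def)
qed

definition ortho :: "real set \<Rightarrow> nat \<Rightarrow> (nat \<Rightarrow> real) \<Rightarrow> (nat \<Rightarrow> nat \<Rightarrow> real \<Rightarrow> real) \<Rightarrow> bool" where
  "ortho S n l u \<longleftrightarrow> (\<forall>i<n. eigfun S (l i) (u i)) \<and>
     (\<forall>i<n. \<forall>j<n. N2 (zero_ext S (u i)) (zero_ext S (u j)) = (if i = j then 1 else 0))"

text \<open>Gram-Schmidt by counting: while fewer than \<open>nullity\<close> functions are chosen,
  some combination of a basis is orthogonal to all of them.\<close>

lemma ortho_eigenspace:
  assumes S: "side S" and n: "n \<le> nullity S lam"
  shows "\<exists>u. ortho S n (\<lambda>_. lam) u"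
  using n
proof (induction n)
  case 0
  then show ?case by (simp add: ortho_def)
next
  case (Suc n)
  then obtain u where u: "ortho S n (\<lambda>_. lam) u" by auto
  define N where "N = nullity S lam"
  obtain f where f: "\<And>i. i < N \<Longrightarrow> eigfun S lam (f i)" "lin_indep_on S N (\<lambda>i. f i 0)"
    using indep_nullity(1)[of S lam] unfolding indep_def N_def by blast
  have "n < N" using Suc.prems by (simp add: N_def)
  then obtain c where c: "\<exists>i<N. c i \<noteq> 0" "\<And>j. j < n \<Longrightarrow> (\<Sum>i<N. c i * N2 (zero_ext S (f i)) (zero_ext S (u j))) = 0"
    using homogeneous_nat[of n N "\<lambda>j i. N2 (zero_ext S (f i)) (zero_ext S (u j))"] by blast
  define F where "F = (\<lambda>k x. \<Sum>i<N. c i * f i k x)"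
  have Fe: "eigfun S lam F" and Fv: "zero_ext S F = lincomb N c (\<lambda>i. zero_ext S (f i))"
    using eigfun_lincomb[OF f(1) S, where c = c and n = N] by (simp_all add: F_def)
  have FH: "HS S (zero_ext S F)" by (rule zero_ext_HS[OF Fe S])
  obtain x where x: "x \<in> S" "F 0 x \<noteq> 0"
    using f(2) c(1) unfolding lin_indep_on_def F_def by blast
  then have "zero_ext S F 0 x \<noteq> 0" by (simp add: zero_ext_def)
  then have Np: "N2 (zero_ext S F) (zero_ext S F) > 0" by (rule N2_pos[OF FH])
  define t where "t = 1 / sqrt (N2 (zero_ext S F) (zero_ext S F))"
  have t: "t * t * N2 (zero_ext S F) (zero_ext S F) = 1" using Np by (simp add: t_def)
  define h where "h = (\<lambda>k x. t * F k x)"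
  have he: "eigfun S lam h" and hv: "zero_ext S h = lincomb 1 (\<lambda>_. t) (\<lambda>_. zero_ext S F)"
    using eigfun_lincomb[of "Suc 0" S lam "\<lambda>_. F" "\<lambda>_. t"] Fe S by (simp_all add: h_def)
  have hN: "N2 (zero_ext S h) y = t * N2 (zero_ext S F) y" if "HS S y" for y
    unfolding hv using N2_lincomb[of 1 S "\<lambda>_. zero_ext S F" S y "\<lambda>_. t"] FH that by simp
  have uH: "HS S (zero_ext S (u j))" if "j < n" for j using u that zero_ext_HS[OF _ S] by (auto simp: ortho_def)
  have hu: "N2 (zero_ext S h) (zero_ext S (u j)) = 0" if "j < n" for j
  proof -
    have "N2 (zero_ext S F) (zero_ext S (u j)) = 0"
      unfolding Fv using N2_lincomb[of N S "\<lambda>i. zero_ext S (f i)" S "zero_ext S (u j)" c] zero_ext_HS[OF f(1) S] uH[OF that] c(2)[OF that] by simp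
    then show ?thesis using hN[OF uH[OF that]] by simp
  qed
  have hh: "N2 (zero_ext S h) (zero_ext S h) = 1"
    using hN[OF zero_ext_HS[OF he S]] N2_sym[of "zero_ext S F" "zero_ext S h"] hN[OF FH] t by simp
  define u' where "u' i = (if i < n then u i else h)" for i
  have "ortho S (Suc n) (\<lambda>_. lam) u'" unfolding ortho_def
  proof (intro conjI allI impI)
    show "eigfun S lam (u' i)" if "i < Suc n" for i using u he that by (auto simp: u'_def ortho_def)
    fix i j assume ij: "i < Suc n" "j < Suc n"
    consider "i < n" "j < n" | "i < n" "j = n" | "i = n" "j < n" | "i = n" "j = n" using ij by linarith
    then show "N2 (zero_ext S (u' i)) (zero_ext S (u' j)) = (if i = j then 1 else 0)"
    proof cases
      case 1 then show ?thesis using u by (simp add: u'_def ortho_def)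
    next
      case 2 then show ?thesis using hu[of i] N2_sym[of "zero_ext S h"] by (simp add: u'_def)
    next
      case 3 then show ?thesis using hu[of j] by (simp add: u'_def)
    next
      case 4 then show ?thesis using hh by (simp add: u'_def)
    qed
  qed
  then show ?case by blast
qed

lemma ortho_all:
  assumes S: "side S" and L: "finite L"
  shows "\<exists>l u. ortho S (\<Sum>lam\<in>L. nullity S lam) l u \<and> (\<forall>i<(\<Sum>lam\<in>L. nullity S lam). l i \<in> L)"
  using L
proof (induction L rule: finite_induct)
  case empty
  then show ?case by (simp add: ortho_def)
next
  case (insert lam L)
  define n where "n = (\<Sum>lam\<in>L. nullity S lam)"
  obtain l u where lu: "ortho S n l u" "\<And>i. i < n \<Longrightarrow> l i \<in> L" using insert.IH by (auto simp: n_def)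
  obtain f where f: "ortho S (nullity S lam) (\<lambda>_. lam) f" using ortho_eigenspace[OF S order_refl] by blast
  define l' where "l' i = (if i < n then l i else lam)" for i
  define u' where "u' i = (if i < n then u i else f (i - n))" for i
  have sum: "(\<Sum>lam\<in>insert lam L. nullity S lam) = n + nullity S lam" using insert.hyps by (simp add: n_def)
  have "ortho S (n + nullity S lam) l' u'" unfolding ortho_def
  proof (intro conjI allI impI)
    show e: "eigfun S (l' i) (u' i)" if "i < n + nullity S lam" for i
      using lu(1) f that by (auto simp: l'_def u'_def ortho_def)
    fix i j assume ij: "i < n + nullity S lam" "j < n + nullity S lam"
    consider "i < n" "j < n" | "\<not> i < n" "\<not> j < n" | "i < n \<longleftrightarrow> \<not> j < n" by blast
    then show "N2 (zero_ext S (u' i)) (zero_ext S (u' j)) = (if i = j then 1 else 0)"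
    proof cases
      case 1 then show ?thesis using lu(1) by (simp add: u'_def ortho_def)
    next
      case 2
      then have "i - n < nullity S lam" "j - n < nullity S lam" "i - n = j - n \<longleftrightarrow> i = j" using ij by auto
      then show ?thesis using f 2 by (simp add: u'_def ortho_def)
    next
      case 3
      then have "l' i \<noteq> l' j" using lu(2) insert.hyps by (auto simp: l'_def)
      then have "N2 (zero_ext S (u' i)) (zero_ext S (u' j)) = 0" using eigfun_orth[OF e e S] ij by blast
      then show ?thesis using 3 by auto
    qed
  qed
  moreover have "\<forall>i<n + nullity S lam. l' i \<in> insert lam L" using lu(2) by (auto simp: l'_def)
  ultimately show ?case unfolding sum by blast
qed

text \<open>Orthonormal eigenfunctions diagonalise the form at 0, with the eigenvalues on the
  diagonal. Truncation perturbs each entry by less than \<open>\<eta>\<close>, hence the quadratic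
  form by at most \<open>\<eta> * d\<close> times the sum of squares, which is half of the least
  eigenvalue.\<close>

lemma pos_of_eigenvalues:
  assumes S: "side S" and L: "finite L" "\<And>lam. lam \<in> L \<Longrightarrow> lam > 0"
  shows "pos S 0 (\<Sum>lam\<in>L. nullity S lam)"
proof -
  define d where "d = (\<Sum>lam\<in>L. nullity S lam)"
  obtain l u where lu: "ortho S d l u" "\<And>i. i < d \<Longrightarrow> l i \<in> L" using ortho_all[OF S L(1)] by (auto simp: d_def)
  define v where "v i = zero_ext S (u i)" for i
  have vH: "HS S (v i)" if "i < d" for i using lu(1) that zero_ext_HS[OF _ S] by (auto simp: v_def ortho_def)
  \<comment> \<open>The 1 keeps the minimum meaningful for empty \<open>L\<close>.\<close>
  define \<mu> where "\<mu> = Min (insert 1 L)"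
  have mu: "\<mu> > 0" "\<And>i. i < d \<Longrightarrow> \<mu> \<le> l i" using L lu(2) by (auto simp: \<mu>_def)
  define \<eta> where "\<eta> = \<mu> / (2 * (real d + 1))"
  have eta: "\<eta> > 0" "\<eta> * real d \<le> \<mu> / 2" using mu(1) by (auto simp: \<eta>_def field_simps)
  have Qv: "Q 0 (v i) (v j) = (if i = j then l i else 0)" if "i < d" "j < d" for i j
    using eigfun_Q0[of S "l i" "u i" "v j"] lu(1) that S vH by (auto simp: v_def ortho_def)
  have "\<forall>\<^sub>F n in sequentially. \<forall>i\<in>{..<d}. \<forall>j\<in>{..<d}. dist (Q 0 (cutoff n (v i)) (cutoff n (v j))) (Q 0 (v i) (v j)) < \<eta>"
    using tendstoD[OF cutoff_lim2[OF vH vH] eta(1)] by (intro eventually_ball_finite ballI) auto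
  then obtain n where n: "\<And>i j. i < d \<Longrightarrow> j < d \<Longrightarrow> \<bar>Q 0 (cutoff n (v i)) (cutoff n (v j)) - Q 0 (v i) (v j)\<bar> < \<eta>"
    by (auto simp: eventually_sequentially dist_real_def)
  define w where "w i = cutoff n (v i)" for i
  have wc: "Hc S (w i)" if "i < d" for i unfolding w_def by (rule Hc_cutoff[OF vH[OF that]])
  have "\<mu> / 2 * (\<Sum>i<d. (c i)\<^sup>2) \<le> Q 0 (lincomb d c w) (lincomb d c w)" for c
  proof -
    have "(\<Sum>i<d. \<Sum>j<d. c i * c j * Q 0 (v i) (v j)) - (\<Sum>i<d. \<Sum>j<d. \<eta> * (\<bar>c i\<bar> * \<bar>c j\<bar>)) \<le> (\<Sum>i<d. \<Sum>j<d. c i * c j * Q 0 (w i) (w j))"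
      unfolding sum_subtractf[symmetric]
    proof (intro sum_mono)
      fix i j assume "i \<in> {..<d}" "j \<in> {..<d}"
      then have "\<bar>Q 0 (w i) (w j) - Q 0 (v i) (v j)\<bar> \<le> \<eta>" using n[of i j] by (simp add: w_def)
      then have "\<bar>c i * c j\<bar> * \<bar>Q 0 (w i) (w j) - Q 0 (v i) (v j)\<bar> \<le> \<bar>c i * c j\<bar> * \<eta>" by (rule mult_left_mono) simp
      then have "\<bar>c i * c j * (Q 0 (w i) (w j) - Q 0 (v i) (v j))\<bar> \<le> \<eta> * (\<bar>c i\<bar> * \<bar>c j\<bar>)"
        by (simp add: abs_mult mult.commute)
      then show "c i * c j * Q 0 (v i) (v j) - \<eta> * (\<bar>c i\<bar> * \<bar>c j\<bar>) \<le> c i * c j * Q 0 (w i) (w j)"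
        unfolding right_diff_distrib by linarith
    qed
    moreover have "(\<Sum>i<d. \<Sum>j<d. c i * c j * Q 0 (v i) (v j)) = (\<Sum>i<d. l i * (c i)\<^sup>2)"
    proof (intro sum.cong refl)
      fix i assume i: "i \<in> {..<d}"
      have "(\<Sum>j<d. c i * c j * Q 0 (v i) (v j)) = (\<Sum>j<d. if i = j then l i * (c i)\<^sup>2 else 0)"
        using Qv i by (intro sum.cong) (auto simp: power2_eq_square)
      then show "(\<Sum>j<d. c i * c j * Q 0 (v i) (v j)) = l i * (c i)\<^sup>2" using i by (simp add: sum.delta)
    qed
    moreover have "(\<Sum>i<d. \<mu> * (c i)\<^sup>2) \<le> (\<Sum>i<d. l i * (c i)\<^sup>2)"
      using mu(2) by (intro sum_mono mult_right_mono) auto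
    moreover have "(\<Sum>i<d. \<Sum>j<d. \<eta> * (\<bar>c i\<bar> * \<bar>c j\<bar>)) \<le> \<mu> / 2 * (\<Sum>i<d. (c i)\<^sup>2)"
    proof -
      have "(\<Sum>i<d. \<Sum>j<d. \<eta> * (\<bar>c i\<bar> * \<bar>c j\<bar>)) = \<eta> * (\<Sum>i<d. \<bar>c i\<bar>)\<^sup>2"
        unfolding power2_eq_square sum_product by (simp add: sum_distrib_left)
      also have "\<dots> \<le> \<eta> * (real d * (\<Sum>i<d. (c i)\<^sup>2))"
        using Cauchy_Schwarz_ineq_sum[of "\<lambda>_. 1" "\<lambda>i. \<bar>c i\<bar>" "{..<d}"] eta(1) by (intro mult_left_mono) auto
      also have "\<dots> = (\<eta> * real d) * (\<Sum>i<d. (c i)\<^sup>2)" by simp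
      also have "\<dots> \<le> \<mu> / 2 * (\<Sum>i<d. (c i)\<^sup>2)" using eta(2) by (intro mult_right_mono sum_nonneg) auto
      finally show ?thesis .
    qed
    moreover have "Q 0 (lincomb d c w) (lincomb d c w) = (\<Sum>i<d. \<Sum>j<d. c i * c j * Q 0 (w i) (w j))"
      by (rule Q_lincomb2) (use Hc_HS[OF wc] in auto)
    moreover have "(\<Sum>i<d. \<mu> * (c i)\<^sup>2) = \<mu> / 2 * (\<Sum>i<d. (c i)\<^sup>2) + \<mu> / 2 * (\<Sum>i<d. (c i)\<^sup>2)"
      by (simp add: sum_distrib_left[symmetric])
    ultimately show ?thesis by linarith
  qed
  then show ?thesis using wc mu(1) unfolding pos_def pos_family_def d_def[symmetric] by (metis half_gt_zero)
qed

text \<open>The index \<open>d\<close> at \<open>lam0\<close> persists on an open range of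
  parameters and is lost at the supremum \<open>ls\<close> of that range. By semicontinuity at most
  \<open>nullity S ls\<close> is lost there, and the induction continues from
  \<open>ls\<close>.\<close>

lemma index_le_eigenvalues:
  assumes S: "side S"
  shows "lam0 \<ge> 0 \<Longrightarrow> \<exists>L. finite L \<and> (\<forall>lam\<in>L. lam > lam0) \<and> index S lam0 \<le> (\<Sum>lam\<in>L. nullity S lam)"
proof (induction "index S lam0" arbitrary: lam0 rule: less_induct)
  case less
  define d where "d = index S lam0"
  show ?case
  proof (cases "d = 0")
    case True
    then show ?thesis by (intro exI[of _ "{}"]) (auto simp: d_def)
  next
    case False
    obtain \<Lambda> where L: "\<Lambda> \<ge> 0" "\<And>S lam d. lam \<ge> \<Lambda> \<Longrightarrow> pos S lam d \<Longrightarrow> d = 0" using pos_large by metis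
    \<comment> \<open>Bounded above by \<open>pos_large\<close>; by \<open>pos_open\<close> it
      contains neither its supremum nor \<open>lam0\<close> as a last point.\<close>
    define A where "A = {lam. lam \<ge> lam0 \<and> pos S lam d}"
    have p0: "lam0 \<in> A" using pos_index[OF less.prems] by (simp add: A_def d_def)
    have bdd: "bdd_above A"     proof (rule bdd_aboveI[of _ \<Lambda>])
      fix x assume "x \<in> A"
      then have "pos S x d" by (simp add: A_def)
      then show "x \<le> \<Lambda>" using L(2)[of x S d] False unfolding d_def by (cases "x \<le> \<Lambda>") auto
    qed
    define ls where "ls = Sup A"
    have ls0: "lam0 \<le> ls" unfolding ls_def by (rule cSup_upper[OF p0 bdd])
    then have lspos: "ls \<ge> 0" using less.prems by simp
    obtain \<delta> where dl: "\<delta> > 0" "\<And>lam'. lam' < lam0 + \<delta> \<Longrightarrow> pos S lam' d"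
      by (rule pos_open[of S lam0 d]) (use p0 in \<open>auto simp: A_def intro: that\<close>)
    have "lam0 + \<delta> / 2 \<in> A" using dl by (simp add: A_def)
    then have "lam0 + \<delta> / 2 \<le> ls" unfolding ls_def by (rule cSup_upper[OF _ bdd])
    then have lt: "lam0 < ls" using dl(1) by linarith
    have np: "\<not> pos S ls d"
    proof
      assume "pos S ls d"
      then obtain \<delta>' where d': "\<delta>' > 0" "\<And>lam'. lam' < ls + \<delta>' \<Longrightarrow> pos S lam' d" by (rule pos_open) (rule that)
      have "ls + \<delta>' / 2 \<in> A" using d' ls0 by (simp add: A_def)
      then have "ls + \<delta>' / 2 \<le> ls" unfolding ls_def by (rule cSup_upper[OF _ bdd])
      then show False using d'(1) by simp
    qed
    have "\<exists>l\<in>A. ls - 1 / real (Suc n) < l" for n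
    proof -
      have "ls - 1 / real (Suc n) < Sup A" unfolding ls_def by simp
      then show ?thesis using less_cSup_iff[of A] p0 bdd by blast
    qed
    then obtain l where l: "\<And>n. l n \<in> A" "\<And>n. ls - 1 / real (Suc n) < l n" by metis
    have lup: "l n \<le> ls" for n unfolding ls_def by (rule cSup_upper[OF l(1) bdd])
    have "l \<longlonglongrightarrow> ls"
    proof (rule tendsto_sandwich[of "\<lambda>n. ls - 1 / real (Suc n)" _ _ "\<lambda>_. ls"])
      have "(\<lambda>n. ls - 1 / real (Suc n)) \<longlonglongrightarrow> ls - 0"
        by (intro tendsto_diff tendsto_const LIMSEQ_Suc[OF lim_1_over_n])
      then show "(\<lambda>n. ls - 1 / real (Suc n)) \<longlonglongrightarrow> ls" by simp
    qed (use l(2) lup in \<open>auto intro!: always_eventually less_imp_le\<close>)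
    then have semi: "d \<le> index S ls + nullity S ls"
      by (rule index_semicontinuous[OF S lspos]) (use l(1) less.prems in \<open>auto simp: A_def intro: order_trans\<close>)
    have "index S ls < index S lam0" using np pos_iff[OF lspos, of S d] by (simp add: d_def)
    from less.hyps[OF this lspos] obtain L where L: "finite L" "\<forall>lam\<in>L. lam > ls" "index S ls \<le> (\<Sum>lam\<in>L. nullity S lam)" by blast
    have "ls \<notin> L" using L(2) by auto
    then have "(\<Sum>lam\<in>insert ls L. nullity S lam) = nullity S ls + (\<Sum>lam\<in>L. nullity S lam)" using L(1) by simp
    then show ?thesis using semi L lt by (intro exI[of _ "insert ls L"]) (auto simp: d_def)
  qed
qed

definition Mor_pot :: "real set \<Rightarrow> enat" where
  "Mor_pot S = (let P = {lam. lam > 0 \<and> eig_dim S lam > 0} in if finite P then (\<Sum>lam\<in>P. eig_dim S lam) else \<infinity>)"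

lemma Mor_pot_index:
  assumes S: "side S"
  shows "Mor_pot S = enat (index S 0)"
proof -
  define P where "P = {lam. lam > 0 \<and> nullity S lam > 0}"
  have Peq: "{lam. lam > 0 \<and> eig_dim S lam > 0} = P"
    unfolding P_def eig_dim_nullity[OF S] by (simp add: zero_enat_def)
  have up: "(\<Sum>lam\<in>L. nullity S lam) \<le> index S 0" if "finite L" "L \<subseteq> P" for L
    using pos_of_eigenvalues[OF S that(1)] that(2) pos_iff[of 0 S] by (auto simp: P_def)
  have fin: "finite P"
  proof (rule ccontr)
    assume "\<not> finite P"
    then obtain L where L: "finite L" "card L = Suc (index S 0)" "L \<subseteq> P"
      using infinite_arbitrarily_large by blast
    have "card L = (\<Sum>lam\<in>L. 1)" by simp
    also have "\<dots> \<le> (\<Sum>lam\<in>L. nullity S lam)" using L(3) by (intro sum_mono) (auto simp: P_def)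
    also have "\<dots> \<le> index S 0" by (rule up[OF L(1,3)])
    finally show False using L(2) by simp
  qed
  obtain L where L: "finite L" "\<forall>lam\<in>L. lam > (0::real)" "index S 0 \<le> (\<Sum>lam\<in>L. nullity S lam)"
    using index_le_eigenvalues[OF S, of 0] by auto
  have "(\<Sum>lam\<in>L. nullity S lam) = (\<Sum>lam\<in>L \<inter> P. nullity S lam)"
    using L(1,2) by (intro sum.mono_neutral_right) (auto simp: P_def)
  also have "\<dots> \<le> (\<Sum>lam\<in>P. nullity S lam)" by (rule sum_mono2[OF fin]) auto
  finally have "index S 0 = (\<Sum>lam\<in>P. nullity S lam)" using L(3) up[OF fin] by simp
  moreover have "(\<Sum>lam\<in>P. eig_dim S lam) = enat (\<Sum>lam\<in>P. nullity S lam)"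
    unfolding eig_dim_nullity[OF S] of_nat_eq_enat[symmetric] by simp
  ultimately show ?thesis unfolding Mor_pot_def Peq using fin by simp
qed

section \<open>The index of the half-line as a function of its end\<close>

lemma index_half_mono: "a \<le> b \<Longrightarrow> index {..a} 0 \<le> index {..b} 0"
  using pos_mono_S[OF pos_index[of 0 "{..a}"], of "{..b}"] pos_iff[of 0] by auto

lemma index_half_le_line: "index {..a} 0 \<le> index UNIV 0"
  using pos_mono_S[OF pos_index[of 0 "{..a}"], of UNIV] pos_iff[of 0] by auto

lemma index_half_eventually:
  obtains s0 where "\<And>s. s \<ge> s0 \<Longrightarrow> index {..s} 0 = index UNIV 0"
proof -
  define d where "d = index UNIV 0"
  obtain w where w: "pos_family UNIV 0 d w" using pos_index[of 0 UNIV] by (auto simp: pos_def d_def)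
  have Hw: "\<And>i. i < d \<Longrightarrow> Hc UNIV (w i)" using w by (simp add: pos_family_def)
  obtain T where T: "\<And>i T'. i < d \<Longrightarrow> T \<le> T' \<Longrightarrow> HS (UNIV \<inter> {-T'..T'}) (w i)"
    using Hw by (rule Hc_common[where d = d and S = UNIV and w = w]) blast+
  have "index {..s} 0 = d" if s: "s \<ge> T" for s
  proof -
    have "Hc {..s} (w i)" if "i < d" for i
      unfolding Hc_def by (rule exI[of _ T], rule HS_mono[OF T[OF that order_refl]]) (use s in auto)
    then have "pos {..s} 0 d" using w unfolding pos_def pos_family_def by blast
    then show ?thesis using pos_iff[of 0] index_half_le_line[of s] by (simp add: d_def)
  qed
  then show ?thesis by (intro that) (auto simp: d_def)
qed

text \<open>Such a half-line lies entirely in the coercive tail, where no direction is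
  positive.\<close>

lemma index_half_zero:
  obtains A where "\<And>s. s \<le> A \<Longrightarrow> index {..s} 0 = 0"
proof -
  obtain A B where AB: "A < B" "\<And>x. x \<le> A \<Longrightarrow> V x \<le> - m / 2" "\<And>x. x \<ge> B \<Longrightarrow> V x \<le> - m / 2" by (rule tails) (rule that)
  have "index {..s} 0 = 0" if s: "s \<le> A" for s
  proof (rule ccontr)
    assume "index {..s} 0 \<noteq> 0"
    then have "pos {..s} 0 1" using pos_iff[of 0 "{..s}" 1] by simp
    then obtain w \<epsilon> where w: "Hc {..s} (w 0)" and e: "\<epsilon> > 0"
      "\<And>c. \<epsilon> * (\<Sum>i<(1::nat). (c i)\<^sup>2) \<le> Q 0 (lincomb 1 c w) (lincomb 1 c w)"
      unfolding pos_def pos_family_def by auto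
    have vc: "Hc {..s} (lincomb 1 (\<lambda>_. 1) w)" using w by (intro Hc_lincomb) auto
    define v where "v = lincomb 1 (\<lambda>_. 1) w"
    obtain T where T: "HS ({..s} \<inter> {-T..T}) v" using vc by (auto simp: Hc_def v_def)
    have v: "HS {-T..s} v" by (rule HS_mono[OF T]) auto
    have I: "(qi 0 v v has_integral integral {-T..s} (qi 0 v v)) {-T..s}"
      using qi_int_Icc[OF v v] by (rule integrable_integral)
    have "integral {-T..s} (qi 0 v v) \<le> 0"
      by (rule tail_bound(3)[OF HS_pw2[OF v] AB(2) _ I]) (use s in auto)
    then have "Q 0 v v \<le> 0" using Q_Icc[of "-T" s v v 0] v by simp
    then show False using e(1) e(2)[of "\<lambda>_. 1"] by (simp add: v_def)
  qed
  then show ?thesis by (rule that)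
qed

lemma index_half_right:
  obtains \<delta> where "\<delta> > 0" "\<And>b. s < b \<Longrightarrow> b < s + \<delta> \<Longrightarrow> index {..b} 0 \<le> index {..s} 0 + nullity {..s} 0"
proof -
  define d where "d = Suc (index {..s} 0 + nullity {..s} 0)"
  have "\<exists>\<delta>>0. \<forall>b. s < b \<and> b < s + \<delta> \<longrightarrow> index {..b} 0 < d"
  proof (rule ccontr)
    assume "\<not> ?thesis"
    then have "\<forall>n. \<exists>b. s < b \<and> b < s + 1 / real (Suc n) \<and> d \<le> index {..b} 0"
      by (metis not_le of_nat_0_less_iff zero_less_Suc zero_less_divide_1_iff)
    then obtain b where b: "\<And>n. s < b n" "\<And>n. b n < s + 1 / real (Suc n)" "\<And>n. d \<le> index {..b n} 0" by metis
    have "b \<longlonglongrightarrow> s"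
    proof (rule tendsto_sandwich[of "\<lambda>_. s" _ _ "\<lambda>n. s + 1 / real (Suc n)"])
      have "(\<lambda>n. s + 1 / real (Suc n)) \<longlonglongrightarrow> s + 0"
        by (intro tendsto_add tendsto_const LIMSEQ_Suc[OF lim_1_over_n])
      then show "(\<lambda>n. s + 1 / real (Suc n)) \<longlonglongrightarrow> s" by simp
    qed (use b(1,2) in \<open>auto intro!: always_eventually less_imp_le\<close>)
    then have "d \<le> index {..s} 0 + nullity {..s} 0"
      by (intro index_semicontinuous_half[of 0 "\<lambda>_. 0" b]) (use b(3) pos_iff[of 0] in auto)
    then show False by (simp add: d_def)
  qed
  then obtain \<delta> where "\<delta> > 0" "\<And>b. s < b \<Longrightarrow> b < s + \<delta> \<Longrightarrow> index {..b} 0 < d" by blast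
  then show ?thesis by (intro that[of \<delta>]) (auto simp: d_def less_Suc_eq_le)
qed

lemma index_half_strict:
  assumes n: "nullity {..s} 0 > 0" and sb: "s < b"
  shows "index {..s} 0 < index {..b} 0"
proof (rule ccontr)
  assume "\<not> index {..s} 0 < index {..b} 0"
  then have eq: "index {..b} 0 = index {..s} 0" using index_half_mono[of s b] sb by simp
  define p where "p = index {..s} 0"
  obtain w where w: "pos_family {..s} 0 p w" using pos_index[of 0 "{..s}"] by (auto simp: pos_def p_def)
  have wc: "Hc {..s} (w j)" if "j < p" for j using w that by (simp add: pos_family_def)
  have w': "pos_family {..b} 0 p w" using w Hc_mono[of "{..s}" _ "{..b}"] sb unfolding pos_family_def by auto
  have S: "side {..s}" "side {..b}" by (auto simp: side_def)
  obtain f where f: "\<And>i. i < nullity {..s} 0 \<Longrightarrow> eigfun {..s} 0 (f i)" "lin_indep_on {..s} (nullity {..s} 0) (\<lambda>i. f i 0)"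
    using indep_nullity(1)[of "{..s}" 0] unfolding indep_def by blast
  define u where "u = f 0"
  have u: "eigfun {..s} 0 u" using f(1) n by (simp add: u_def)
  define z where "z = zero_ext {..s} u"
  have zs: "HS {..s} z" unfolding z_def by (rule zero_ext_HS[OF u S(1)])
  have zb: "HS {..b} z" by (rule HS_mono[OF zs]) (use sb in auto)
  have "Q 0 z z = 0" unfolding z_def by (rule eigfun_Q[OF u S(1) zero_ext_HS[OF u S(1)]])
  moreover have "Q 0 z (w j) = 0" if "j < p" for j
    unfolding z_def by (rule eigfun_Q[OF u S(1) Hc_HS[OF wc[OF that]]])
  moreover have "\<not> pos {..b} 0 (Suc p)" using pos_iff[of 0 "{..b}" "Suc p"] eq by (simp add: p_def)
  \<comment> \<open>With equal indices the family maximal on \<open>{..s}\<close> is still maximal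
    on \<open>{..b}\<close>; \<open>z\<close> has form 0 and is orthogonal to it.\<close>
  ultimately have "weak_kernel {..b} 0 z" using maximal_imp_weak_kernel[OF w' _ zb] by simp
  then obtain h where h: "eigfun {..b} 0 h" "\<And>x k. x \<in> {..b} \<Longrightarrow> k \<le> 1 \<Longrightarrow> z k x = h k x"
    by (rule weak_kernel_eigfun[OF _ _ S(2)]) (auto intro: that)
  have hs: "Sol 0 h" using h(1) by (simp add: eigfun_def)
  have "h 0 x = 0" for x
  proof (rule Sol_zero_on[OF hs _ sb])
    fix x assume "x \<in> {s<..<b}"
    then show "h 0 x = 0" using h(2)[of x 0] by (simp add: z_def zero_ext_def)
  qed simp
  then have u0: "u 0 x = 0" if "x \<le> s" for x using h(2)[of x 0] that sb by (simp add: z_def zero_ext_def)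
  have "\<forall>x\<in>{..s}. (\<Sum>i<nullity {..s} 0. (if i = 0 then 1 else 0::real) * f i 0 x) = 0"
    using u0 by (auto simp: u_def intro!: sum.neutral)
  then have "\<forall>i<nullity {..s} 0. (if i = 0 then 1 else 0) = (0::real)"
    using f(2)[unfolded lin_indep_on_def, rule_format, of "\<lambda>i. if i = 0 then 1 else 0"] by blast
  then show False using n by auto
qed

text \<open>Translating a maximal family by \<open>h = s - a\<close> carries it into
  \<open>{..a}\<close>. Only the potential term of the form changes, and by uniform continuity of
  \<open>V\<close> on the supports the loss stays below half of the margin
  \<open>\<epsilon>\<close>.\<close>

lemma index_half_left:
  obtains \<delta> where "\<delta> > 0" "\<And>a. s - \<delta> < a \<Longrightarrow> a \<le> s \<Longrightarrow> index {..a} 0 = index {..s} 0"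
proof -
  define d where "d = index {..s} 0"
  obtain w \<epsilon> where wc: "\<And>i. i < d \<Longrightarrow> Hc {..s} (w i)" and e: "\<epsilon> > 0"
    "\<And>c. \<epsilon> * (\<Sum>i<d. (c i)\<^sup>2) \<le> Q 0 (lincomb d c w) (lincomb d c w)"
    using pos_index[of 0 "{..s}"] by (auto simp: pos_def pos_family_def d_def)
  obtain T where T: "\<And>i T'. i < d \<Longrightarrow> T \<le> T' \<Longrightarrow> HS ({..s} \<inter> {-T'..T'}) (w i)"
    by (rule Hc_common[OF wc]) (assumption | rule that)+
  define R where "R = max \<bar>T\<bar> \<bar>s\<bar> + 1"
  have wR: "HS {-R..s} (w i)" if "i < d" for i
    by (rule HS_mono[OF T[OF that, of R]]) (auto simp: R_def)
  define K where "K = (\<Sum>i<d. N2 (w i) (w i))"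
  have K: "K \<ge> 0" unfolding K_def by (intro sum_nonneg N2_nonneg[OF wR]) auto
  define \<eta> where "\<eta> = \<epsilon> / (2 * (K + 1))"
  have eta: "\<eta> > 0" "\<eta> * K \<le> \<epsilon> / 2" using e(1) K by (auto simp: \<eta>_def field_simps)
  have "uniformly_continuous_on {-R-1..s} V" by (rule compact_uniformly_continuous[OF V_cont_on compact_Icc])
  then obtain \<delta>0 where d0: "\<delta>0 > 0" "\<And>x y. x \<in> {-R-1..s} \<Longrightarrow> y \<in> {-R-1..s} \<Longrightarrow> dist y x < \<delta>0 \<Longrightarrow> dist (V y) (V x) < \<eta>"
    using eta(1) unfolding uniformly_continuous_on_def by blast
  define \<delta> where "\<delta> = min \<delta>0 1"
  have "index {..a} 0 = index {..s} 0" if a: "s - \<delta> < a" "a \<le> s" for a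
  proof -
    define h where "h = s - a"
    have h: "0 \<le> h" "h < \<delta>0" "h < 1" using a by (auto simp: h_def \<delta>_def)
    define y where "y i = shift h (w i)" for i
    have yH: "HS {-R - h..a} (y i)" if "i < d" for i
      using HS_shift[OF wR[OF that], of h] by (simp add: y_def h_def)
    have yc: "Hc {..a} (y i)" if "i < d" for i
      unfolding Hc_def by (rule exI[of _ "R + 1"], rule HS_mono[OF yH[OF that]]) (use h a in \<open>auto simp: R_def\<close>)
    have "\<epsilon> / 2 * (\<Sum>i<d. (c i)\<^sup>2) \<le> Q 0 (lincomb d c y) (lincomb d c y)" for c
    proof -
      define v where "v = lincomb d c w"
      have v: "HS {-R..s} v" unfolding v_def by (rule HS_lincomb[OF wR])
      have yv: "lincomb d c y = shift h v" by (auto simp: lincomb_def shift_def y_def v_def)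
      have sv: "HS {-R - h..s - h} (shift h v)" by (rule HS_shift[OF v])
      have vv: "(\<lambda>x. v 0 x * v 0 x) integrable_on {-R..s}"
        using HS_prod_int[OF v v, of 0 0] by (auto intro: integrable_on_subinterval)
      have lo: "qi 0 v v x - \<eta> * (v 0 x * v 0 x) \<le> qi 0 (shift h v) (shift h v) (x - h)" if x: "x \<in> {-R..s}" for x
      proof -
        have "dist (V (x - h)) (V x) < \<eta>" using x h by (intro d0(2)) (auto simp: dist_real_def)
        then have "V x - \<eta> \<le> V (x - h)" by (auto simp: dist_real_def)
        then have "(V x - \<eta>) * (v 0 x * v 0 x) \<le> V (x - h) * (v 0 x * v 0 x)" by (intro mult_right_mono) auto
        then show ?thesis by (simp add: qi_def shift_def algebra_simps)
      qed
      have sint: "qi 0 (shift h v) (shift h v) integrable_on {-R - h..s - h}" by (rule qi_int_Icc[OF sv sv])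
      have hs: "((\<lambda>x. qi 0 (shift h v) (shift h v) (x - h)) has_integral Q 0 (shift h v) (shift h v)) {-R..s}"
        using has_integral_shift_real_ivl[OF integrable_integral[OF sint], of "-h"] Q_Icc[of "-R - h" "s - h" "shift h v" "shift h v" 0] sv
        by simp
      have hv: "((\<lambda>x. qi 0 v v x - \<eta> * (v 0 x * v 0 x)) has_integral (Q 0 v v - \<eta> * N2 v v)) {-R..s}"
      proof (intro has_integral_diff has_integral_mult_right)
        show "(qi 0 v v has_integral Q 0 v v) {-R..s}"
          using integrable_integral[OF qi_int_Icc[OF v v]] Q_Icc[of "-R" s v v 0] v by metis
        have "N2 v v = integral {-R..s} (\<lambda>x. v 0 x * v 0 x)"
          unfolding N2_def by (rule integral_UNIV_Icc) (use HS_zero_off[OF v, of 0] in auto)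
        then show "((\<lambda>x. v 0 x * v 0 x) has_integral N2 v v) {-R..s}" using integrable_integral[OF vv] by simp
      qed
      have "Q 0 v v - \<eta> * N2 v v \<le> Q 0 (shift h v) (shift h v)"
        by (rule has_integral_le[OF hv hs lo])
      moreover have "\<eta> * N2 v v \<le> \<epsilon> / 2 * (\<Sum>i<d. (c i)\<^sup>2)"
      proof -
        have "\<eta> * N2 v v \<le> \<eta> * ((\<Sum>i<d. (c i)\<^sup>2) * K)"
          using N2_lincomb_bound[OF wR, where c = c] eta(1) unfolding v_def K_def by (intro mult_left_mono) auto
        also have "\<dots> = (\<eta> * K) * (\<Sum>i<d. (c i)\<^sup>2)" by simp
        also have "\<dots> \<le> \<epsilon> / 2 * (\<Sum>i<d. (c i)\<^sup>2)" using eta(2) by (intro mult_right_mono sum_nonneg) auto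
        finally show ?thesis .
      qed
      ultimately show ?thesis unfolding yv using e(2)[of c] by (simp add: v_def field_simps)
    qed
    then have "pos {..a} 0 d" using yc e(1) unfolding pos_def pos_family_def by (metis half_gt_zero)
    then show ?thesis using pos_iff[of 0 "{..a}" d] index_half_mono[OF a(2)] by (simp add: d_def)
  qed
  moreover have "\<delta> > 0" using d0(1) by (simp add: \<delta>_def)
  ultimately show ?thesis by (intro that)
qed

text \<open>The index minus the number of conjugate points to the left is locally constant: to the
  left of \<open>t\<close> neither changes, and to the right both grow by
  \<open>nullity {..t} 0\<close>, which is 0 or 1. Constancy is then read off from a vanishing
  derivative.\<close>

lemma conjugate_count:
  assumes one: "\<And>s. nullity {..s} 0 \<le> 1"
  defines "C \<equiv> {s. nullity {..s} 0 > 0}"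
  shows "finite C" "index {..s} 0 = card {x\<in>C. x < s}"
proof -
  \<comment> \<open>Each conjugate point raises the index by at least one; with the index of the
    line as upper bound this gives finiteness.\<close>
  have bound: "(\<forall>b. (\<forall>x\<in>F. x < b) \<longrightarrow> card F \<le> index {..b} 0)" if "finite F" "F \<subseteq> C" for F
    using that
  proof (induction F rule: finite_linorder_max_induct)
    case empty then show ?case by simp
  next
    case (insert x A)
    show ?case
    proof (intro allI impI)
      fix b assume "\<forall>y\<in>insert x A. y < b"
      then have "x < b" by simp
      have "card A \<le> index {..x} 0" using insert by auto
      also have "\<dots> < index {..b} 0" using insert.prems \<open>x < b\<close> by (intro index_half_strict) (auto simp: C_def)
      finally show "card (insert x A) \<le> index {..b} 0" using insert.hyps by (auto simp: card_insert_if)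
    qed
  qed
  show fin: "finite C"
  proof (rule ccontr)
    assume "infinite C"
    then obtain F where F: "finite F" "card F = Suc (index UNIV 0)" "F \<subseteq> C"
      using infinite_arbitrarily_large by blast
    have "x < Max (insert 0 F) + 1" if "x \<in> F" for x
    proof -
      have "x \<le> Max (insert 0 F)" by (rule Max_ge) (use F(1) that in auto)
      then show ?thesis by simp
    qed
    then have "\<forall>x\<in>F. x < Max (insert 0 F) + 1" by blast
    then have "card F \<le> index {..Max (insert 0 F) + 1} 0" using bound[OF F(1,3)] by blast
    then show False using F(2) index_half_le_line[of "Max (insert 0 F) + 1"] by simp
  qed
  define f where "f t = real (index {..t} 0) - real (card {x\<in>C. x < t})" for t
  have fd: "(f has_real_derivative 0) (at t)" for t
  proof -
    obtain \<delta>1 where d1: "\<delta>1 > 0" "\<And>a. t - \<delta>1 < a \<Longrightarrow> a \<le> t \<Longrightarrow> index {..a} 0 = index {..t} 0" by (rule index_half_left) (rule that)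
    obtain \<delta>2 where d2: "\<delta>2 > 0" "\<And>b. t < b \<Longrightarrow> b < t + \<delta>2 \<Longrightarrow> index {..b} 0 \<le> index {..t} 0 + nullity {..t} 0" by (rule index_half_right) (rule that)
    obtain \<delta>3 where d3: "\<delta>3 > 0" "\<And>x. x \<in> C \<Longrightarrow> x \<noteq> t \<Longrightarrow> \<delta>3 \<le> dist t x" 
      using finite_set_avoid[OF fin, of t] by auto
    define \<delta> where "\<delta> = Min {\<delta>1, \<delta>2, \<delta>3}"
    have d: "\<delta> > 0" "\<delta> \<le> \<delta>1" "\<delta> \<le> \<delta>2" "\<delta> \<le> \<delta>3" using d1(1) d2(1) d3(1) by (auto simp: \<delta>_def)
    have "f a = f t" if a: "a \<in> {t - \<delta><..<t + \<delta>}" for a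
    proof (cases "a \<le> t")
      case True
      have "{x\<in>C. x < a} = {x\<in>C. x < t}"
      proof (intro Collect_cong conj_cong refl)
        fix x assume "x \<in> C"
        then show "x < a \<longleftrightarrow> x < t" using d3(2)[of x] a True d(4) by (auto simp: dist_real_def)
      qed
      then show ?thesis using d1(2)[of a] a True d(2) by (simp add: f_def)
    next
      case False
      then have ta: "t < a" by simp
      have ca: "{x\<in>C. x < a} = {x\<in>C. x < t} \<union> (if t \<in> C then {t} else {})"
      proof (intro set_eqI)
        fix x
        show "x \<in> {x\<in>C. x < a} \<longleftrightarrow> x \<in> {x\<in>C. x < t} \<union> (if t \<in> C then {t} else {})"
          using d3(2)[of x] a ta d(4) by (cases "x = t"; cases "x < t") (auto simp: dist_real_def)
      qed
      have cc: "card {x\<in>C. x < a} = card {x\<in>C. x < t} + nullity {..t} 0"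
      proof (cases "t \<in> C")
        case True
        then have "nullity {..t} 0 = 1" using one[of t] by (simp add: C_def)
        moreover have "card ({x\<in>C. x < t} \<union> {t}) = Suc (card {x\<in>C. x < t})" using fin by simp
        ultimately show ?thesis using ca True by simp
      next
        case False
        then have "nullity {..t} 0 = 0" by (simp add: C_def)
        then show ?thesis using ca False by simp
      qed
      have "index {..a} 0 = index {..t} 0 + nullity {..t} 0"
      proof (rule antisym)
        show "index {..a} 0 \<le> index {..t} 0 + nullity {..t} 0" using d2(2)[OF ta] a d(3) by auto
        show "index {..t} 0 + nullity {..t} 0 \<le> index {..a} 0"
          using index_half_strict[of t a] index_half_mono[of t a] one[of t] ta by (cases "nullity {..t} 0 = 0") auto
      qed
      then show ?thesis using cc by (simp add: f_def)
    qed
    note fc = this[symmetric]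
    show ?thesis
      by (rule has_field_derivative_transform_within_open[OF DERIV_const[of "f t"], where S = "{t - \<delta><..<t + \<delta>}"])
        (use d(1) in \<open>simp_all only: open_greaterThanLessThan fc greaterThanLessThan_iff, simp_all\<close>)
  qed
  have const: "f s = f t" for s t by (rule DERIV_isconst_all) (simp add: fd)
  obtain A where A: "\<And>s. s \<le> A \<Longrightarrow> index {..s} 0 = 0" using index_half_zero by metis
  \<comment> \<open>No conjugate point lies to the left of \<open>t\<close>, and the index is
    already zero there; this fixes the constant.\<close>
  define t where "t = Min (insert A C)"
  have "index {..t} 0 = 0" by (rule A) (use fin in \<open>simp add: t_def\<close>)
  moreover have "card {x\<in>C. x < t} = card ({} :: real set)"
    by (rule arg_cong[where f = card]) (use fin in \<open>auto simp: t_def not_less\<close>)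
  ultimately have "f t = 0" by (simp add: f_def)
  then have "f s = 0" using const[of s t] by simp
  then show "index {..s} 0 = card {x\<in>C. x < s}" by (simp add: f_def)
qed

end

subsection \<open>The inhomogeneous equation on a half-line\<close>

lemma square_integrable_left:
  fixes f :: "real \<Rightarrow> real"
  assumes c: "\<And>a. (\<lambda>x. (f x)\<^sup>2) integrable_on {a..s}" and C: "\<And>x. x \<le> s \<Longrightarrow> integral {x..s} (\<lambda>x. (f x)\<^sup>2) \<le> C"
  shows "(\<lambda>x. (f x)\<^sup>2) integrable_on {..s}"
proof (rule bounded_integrals_imp_integrable[OF _ side_Int])
  show "(\<lambda>x. (f x)\<^sup>2) integrable_on {a..b}" if "{a..b} \<subseteq> {..s}" for a b
    by (rule integrable_on_subinterval[OF c[of a]]) (use that in auto)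
  have C0: "0 \<le> C" using C[of s] by simp
  show "integral {a..b} (\<lambda>x. (f x)\<^sup>2) \<le> C" if ab: "{a..b} \<subseteq> {..s}" for a b
  proof (cases "a \<le> b")
    case True
    then have "b \<le> s" using ab by (auto simp: subset_eq)
    then have sub: "{a..b} \<subseteq> {a..s}" by auto
    have "integral {a..b} (\<lambda>x. (f x)\<^sup>2) \<le> integral {a..s} (\<lambda>x. (f x)\<^sup>2)"
      by (rule integral_subset_le[OF sub integrable_on_subinterval[OF c sub] c]) simp
    also have "\<dots> \<le> C" by (rule C) (use True \<open>b \<le> s\<close> in simp)
    finally show ?thesis .
  qed (use C0 in simp)
qed auto

lemma square_integrable_imp_integrable:
  fixes g :: "real \<Rightarrow> real"
  assumes g: "g \<in> borel_measurable lborel" and g2: "(\<lambda>x. (g x)\<^sup>2) integrable_on {..s}" and b: "b \<le> s"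
  shows "(\<lambda>x. (g x)\<^sup>2) integrable_on {a..b}" "g integrable_on {a..b}"
proof -
  show 2: "(\<lambda>x. (g x)\<^sup>2) integrable_on {a..b}" by (rule integrable_on_subinterval[OF g2]) (use b in auto)
  show "g integrable_on {a..b}"
  proof (rule measurable_bounded_by_integrable_imp_integrable)
    have "g \<in> borel_measurable lebesgue" using g by (rule measurable_completion)
    then show "g \<in> borel_measurable (lebesgue_on {a..b})" by (rule measurable_restrict_space1)
    show "(\<lambda>x. 1 + (g x)\<^sup>2) integrable_on {a..b}" by (intro integrable_add 2) auto
    have "\<bar>t\<bar> \<le> 1 + t\<^sup>2" for t :: real
      using zero_le_power2[of "\<bar>t\<bar> - 1 / 2"] by (simp add: power2_diff field_simps)
    then show "norm (g x) \<le> 1 + (g x)\<^sup>2" for x by simp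
  qed auto
qed

context pot
begin

text \<open>Solutions of \<open>L u = h\<close> on \<open>{..s}\<close> with \<open>h\<close> merely
  integrable: the equation for the fourth derivative, \<open>u 4 = rhs 0 u - h\<close>, is kept in
  integrated form.\<close>

definition weak_sol :: "real \<Rightarrow> (real \<Rightarrow> real) \<Rightarrow> (nat \<Rightarrow> real \<Rightarrow> real) \<Rightarrow> bool" where
  "weak_sol s h u \<longleftrightarrow> (\<forall>k<3. \<forall>x. (u k has_real_derivative u (Suc k) x) (at x)) \<and> continuous_on UNIV (u 3) \<and>
     (\<forall>x y. x \<le> y \<longrightarrow> y \<le> s \<longrightarrow> ((\<lambda>t. rhs 0 u t - h t) has_integral (u 3 y - u 3 x)) {x..y})"

lemma weak_sol_deriv: "weak_sol s h u \<Longrightarrow> k < 3 \<Longrightarrow> (u k has_real_derivative u (Suc k) x) (at x)"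
  by (simp add: weak_sol_def)

lemma weak_sol_cont: assumes "weak_sol s h u" "k \<le> 3" shows "continuous_on S (u k)"
proof (cases "k = 3")
  case True
  then show ?thesis using assms(1) continuous_on_subset[of UNIV "u 3" S] by (auto simp: weak_sol_def)
next
  case False
  then have "k < 3" using assms(2) by simp
  then show ?thesis using weak_sol_deriv[OF assms(1)] DERIV_isCont continuous_at_imp_continuous_on by metis
qed

lemma weak_sol_int: "weak_sol s h u \<Longrightarrow> x \<le> y \<Longrightarrow> y \<le> s \<Longrightarrow> ((\<lambda>t. rhs 0 u t - h t) has_integral (u 3 y - u 3 x)) {x..y}"
  by (simp add: weak_sol_def)

lemma weak_sol_Sol:
  assumes u: "Sol 0 u"
  shows "weak_sol s (\<lambda>x. 0) u"
  unfolding weak_sol_def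
proof (intro conjI allI impI)
  show "(u k has_real_derivative u (Suc k) x) (at x)" if "k < 3" for k x using SolR_deriv[OF u, of k x] that by simp
  show "continuous_on UNIV (u 3)" by (rule Sol_cont[OF u]) simp
  fix x y assume "x \<le> y" "y \<le> s"
  have "(u 3 has_real_derivative rhs 0 u t - 0) (at t)" for t
    using SolR_deriv[OF u, of 3 t] SolR_4[OF u, of t] by simp
  then show "((\<lambda>t. rhs 0 u t - 0) has_integral (u 3 y - u 3 x)) {x..y}"
    by (intro fundamental_theorem_of_calculus \<open>x \<le> y\<close>)
      (metis has_real_derivative_iff_has_vector_derivative has_vector_derivative_at_within)
qed

lemma weak_sol_lincomb:
  fixes n :: nat
  assumes "\<And>i. i < n \<Longrightarrow> weak_sol s (h i) (u i)"
  shows "weak_sol s (\<lambda>x. \<Sum>i<n. c i * h i x) (\<lambda>k x. \<Sum>i<n. c i * u i k x)"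
  unfolding weak_sol_def
proof (intro conjI allI impI)
  show "((\<lambda>x. \<Sum>i<n. c i * u i k x) has_real_derivative (\<Sum>i<n. c i * u i (Suc k) x)) (at x)" if "k < 3" for k x
    using weak_sol_deriv[OF assms that] by (auto intro!: derivative_eq_intros sum.cong)
  show "continuous_on UNIV (\<lambda>x. \<Sum>i<n. c i * u i 3 x)"
    using weak_sol_cont[OF assms, of _ 3] by (intro continuous_on_sum continuous_on_mult continuous_on_const) auto
  fix x y assume xy: "x \<le> y" "y \<le> s"
  have "((\<lambda>t. \<Sum>i<n. c i * (rhs 0 (u i) t - h i t)) has_integral (\<Sum>i<n. c i * (u i 3 y - u i 3 x))) {x..y}"
    by (intro has_integral_sum has_integral_mult_right weak_sol_int[OF assms xy] finite_lessThan) simp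
  moreover have "(\<lambda>t. \<Sum>i<n. c i * (rhs 0 (u i) t - h i t)) =
      (\<lambda>t. rhs 0 (\<lambda>k x. \<Sum>i<n. c i * u i k x) t - (\<Sum>i<n. c i * h i t))"
    unfolding rhs_def
    by (rule ext) (simp add: sum_subtractf[symmetric] sum_distrib_left right_diff_distrib algebra_simps)
  ultimately show "((\<lambda>t. rhs 0 (\<lambda>k x. \<Sum>i<n. c i * u i k x) t - (\<Sum>i<n. c i * h i t)) has_integral
      (\<Sum>i<n. c i * u i 3 y) - (\<Sum>i<n. c i * u i 3 x)) {x..y}"
    by (simp add: right_diff_distrib sum_subtractf)
qed

text \<open>A fourfold antiderivative \<open>P\<close> of \<open>- g\<close> absorbs the rough
  datum; the correction \<open>v\<close> then solves an equation with the continuous inhomogeneity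
  \<open>rhs 0 P\<close>, and \<open>p = P + v\<close>.\<close>

lemma weak_sol_exists:
  assumes g: "g \<in> borel_measurable lborel" and g2: "(\<lambda>x. (g x)\<^sup>2) integrable_on {..s}"
  obtains p where "weak_sol s g p" "\<And>k. k < 4 \<Longrightarrow> p k s = 0"
proof -
  define P3 where "P3 x = integral {x..s} g" for x
  have gi: "g integrable_on {a..b}" if "b \<le> s" for a b using square_integrable_imp_integrable[OF g g2 that] by blast
  have P3i: "P3 y - P3 x = - integral {x..y} g" if "x \<le> y" "y \<le> s" for x y
    using Henstock_Kurzweil_Integration.integral_combine[of x y s g] gi[of s x] that by (simp add: P3_def)
  \<comment> \<open>To the right of \<open>s\<close> the interval of integration is empty, so
    \<open>P3\<close> is continued by 0 and is continuous on the whole line.\<close>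
  have P3m: "P3 x = integral {min x s..s} g" for x by (cases "x \<le> s") (auto simp: P3_def min_def)
  have P3c: "continuous_on UNIV P3"
  proof -
    have "isCont P3 x" for x
    proof -
      define a where "a = min x s - 1"
      have "continuous_on {a..s} (\<lambda>x. integral {x..s} g)"
        by (rule indefinite_integral_continuous_1') (rule gi, simp)
      then have "continuous_on {a<..} (\<lambda>x. integral {min x s..s} g)"
        by (rule continuous_on_compose2) (use a_def in \<open>auto intro!: continuous_on_min continuous_on_id continuous_on_const\<close>)
      then have "continuous_on {a<..} P3" unfolding P3m[abs_def] .
      then show ?thesis by (rule continuous_on_interior) (simp add: a_def interior_open)
    qed
    then show ?thesis by (simp add: continuous_at_imp_continuous_on)
  qed
  define P2 where "P2 = antideriv s 0 P3"
  define P1 where "P1 = antideriv s 0 P2"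
  define P0 where "P0 = antideriv s 0 P1"
  note a2 = antideriv[OF P3c, of s 0, folded P2_def]
  note a1 = antideriv[OF a2(3), of s 0, folded P1_def]
  note a0 = antideriv[OF a1(3), of s 0, folded P0_def]
  define P where "P k = (if k = 0 then P0 else if k = 1 then P1 else if k = 2 then P2 else P3)" for k :: nat
  have Pd: "(P k has_real_derivative P (Suc k) x) (at x)" if "k < 3" for k x
  proof -
    have "k = 0 \<or> k = 1 \<or> k = 2" using that by auto
    then show ?thesis using a0(2)[of x] a1(2)[of x] a2(2)[of x] by (auto simp: P_def)
  qed
  have Ps: "P k s = 0" for k using a0(1) a1(1) a2(1) by (simp add: P_def P3_def)
  have Pc: "continuous_on UNIV (rhs 0 P)" using a0(3) a2(3) by (intro rhs_cont) (auto simp: P_def)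
  obtain v where v: "SolR 0 (rhs 0 P) v" "\<forall>k<4. v k s = 0"
    using SolR_exists[OF Pc, where lam = 0 and a = s and c = "\<lambda>k. 0"] by auto
  define p where "p k x = P k x + v k x" for k x
  have "weak_sol s g p"
    unfolding weak_sol_def
  proof (intro conjI allI impI)
    show "(p k has_real_derivative p (Suc k) x) (at x)" if "k < 3" for k x
      unfolding p_def by (rule DERIV_add[OF Pd[OF that] SolR_deriv[OF v(1)]]) (use that in simp)
    have "continuous_on UNIV (\<lambda>x. P 3 x + v 3 x)"
      using P3c SolR_cont[OF v(1), of 3] by (intro continuous_on_add) (auto simp: P_def)
    then show "continuous_on UNIV (p 3)" unfolding p_def .
    fix x y assume xy: "x \<le> y" "y \<le> s"
    have e: "v 4 t = rhs 0 p t" for t using SolR_4[OF v(1), of t] by (simp add: rhs_def p_def algebra_simps)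
    have "(v 3 has_real_derivative rhs 0 p t) (at t)" for t
      using SolR_deriv[OF v(1), of 3 t] e by simp
    then have "(rhs 0 p has_integral (v 3 y - v 3 x)) {x..y}"
      by (intro fundamental_theorem_of_calculus xy)
        (metis has_real_derivative_iff_has_vector_derivative has_vector_derivative_at_within)
    from has_integral_diff[OF this integrable_integral[OF gi[OF xy(2)]]]
    moreover have "v 3 y - v 3 x - integral {x..y} g = p 3 y - p 3 x"
      using P3i[OF xy] by (simp add: p_def P_def)
    ultimately show "((\<lambda>t. rhs 0 p t - g t) has_integral (p 3 y - p 3 x)) {x..y}" by simp
  qed
  moreover have "p k s = 0" if "k < 4" for k using Ps v(2) that by (simp add: p_def)
  ultimately show ?thesis by (rule that)
qed

text \<open>The energy identity: multiply the equation by \<open>u\<close> and integrate by parts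
  twice. The first time the derivative of \<open>u 3\<close> is only integrable; the clamped ends
  remove all boundary terms.\<close>

lemma weak_sol_form:
  assumes u: "weak_sol s h u" and as: "a \<le> s" and z: "\<And>k. k \<le> 1 \<Longrightarrow> u k a = 0 \<and> u k s = 0"
    and h: "h integrable_on {a..s}" "(\<lambda>x. (h x)\<^sup>2) integrable_on {a..s}"
  shows "((\<lambda>x. qi 0 u u x - h x * u 0 x) has_integral 0) {a..s}"
proof -
  let ?f = "\<lambda>t. rhs 0 u t - h t"
  have c: "continuous_on A (u k)" if "k \<le> 3" for k A by (rule weak_sol_cont[OF u that])
  have rc: "continuous_on {a..s} (rhs 0 u)" by (intro rhs_cont c) auto
  have fa: "?f absolutely_integrable_on {a..s}"
    by (intro set_integral_diff(1) absolutely_integrable_continuous_real rc square_integrable_imp_abs_integrable h)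
  have wd: "(u k has_real_derivative u (Suc k) x) (at x within A)" if "k < 3" for k x A
    by (rule has_field_derivative_at_within[OF weak_sol_deriv[OF u that]])
  have 1: "((\<lambda>x. ?f x * u 0 x) has_integral (u 3 s * u 0 s - u 3 a * u 0 a - integral {a..s} (\<lambda>x. u 3 x * u 1 x))) {a..s}"
  proof (rule integration_by_parts_indefinite[OF as fa])
    show "(?f has_integral (u 3 x' - u 3 x)) {x..x'}" if "a \<le> x" "x \<le> x'" "x' \<le> s" for x x'
      using weak_sol_int[OF u that(2,3)] .
    show "(u 0 has_real_derivative u 1 x) (at x within {a..s})" for x using wd[of 0] by simp
    show "continuous_on {a..s} (u 1)" by (rule c) simp
  qed
  have "((\<lambda>x. u 2 x * u 1 x) has_real_derivative (u 3 x * u 1 x + u 2 x * u 2 x)) (at x within {a..s})" for x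
    using DERIV_mult[OF wd[of 2 x "{a..s}"] wd[of 1 x "{a..s}"]] by (simp add: numeral_2_eq_2 numeral_3_eq_3 algebra_simps)
  then have 2: "((\<lambda>x. u 3 x * u 1 x + u 2 x * u 2 x) has_integral (u 2 s * u 1 s - u 2 a * u 1 a)) {a..s}"
    by (intro fundamental_theorem_of_calculus as) (simp add: has_real_derivative_iff_has_vector_derivative)
  have i3: "(\<lambda>x. u 3 x * u 1 x) integrable_on {a..s}"
    by (intro integrable_continuous_real continuous_intros c) auto
  have 3: "((\<lambda>x. u 2 x * u 2 x) has_integral (- integral {a..s} (\<lambda>x. u 3 x * u 1 x))) {a..s}"
    using has_integral_diff[OF 2 integrable_integral[OF i3]] z[of 1] by simp
  have e: "(\<lambda>x. ?f x * u 0 x - u 2 x * u 2 x) = (\<lambda>x. qi 0 u u x - h x * u 0 x)"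
    by (rule ext) (simp add: qi_def rhs_def algebra_simps)
  show ?thesis using has_integral_diff[OF 1 3] z[of 0] unfolding e by simp
qed

text \<open>The positive part of \<open>V + m / 2\<close> is charged to \<open>C\<close>. Of the
  remaining coercivity \<open>m / 2\<close>, Young's inequality spends \<open>m / 4\<close> on the
  term \<open>h * u\<close>, and \<open>m / 4\<close> is left for the bound.\<close>

lemma weak_sol_bound:
  assumes u: "weak_sol s h u" and as: "a \<le> s" and z: "\<And>k. k \<le> 1 \<Longrightarrow> u k a = 0 \<and> u k s = 0"
    and h: "h integrable_on {a..s}" "(\<lambda>x. (h x)\<^sup>2) integrable_on {a..s}"
    and C: "integral {a..s} (\<lambda>x. max 0 (V x + m / 2) * (u 0 x)\<^sup>2) + (1 / m) * integral {a..s} (\<lambda>x. (h x)\<^sup>2) \<le> C"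
  shows "integral {a..s} (\<lambda>x. (u 0 x)\<^sup>2) \<le> (4 / m) * C" "integral {a..s} (\<lambda>x. (u 2 x)\<^sup>2) \<le> (2 + 8 / m) * C"
proof -
  have c: "continuous_on A (u k)" if "k \<le> 3" for k A by (rule weak_sol_cont[OF u that])
  have i0: "(\<lambda>x. (u 0 x)\<^sup>2) integrable_on {a..s}" and i2: "(\<lambda>x. (u 2 x)\<^sup>2) integrable_on {a..s}"
    and iy: "(\<lambda>x. (u 2 x + u 0 x)\<^sup>2) integrable_on {a..s}"
    and ik: "(\<lambda>x. max 0 (V x + m / 2) * (u 0 x)\<^sup>2) integrable_on {a..s}"
    by (intro integrable_continuous_real continuous_intros c V_cont_on; simp)+
  have pt: "(m / 4) * (u 0 x)\<^sup>2 + (u 2 x + u 0 x)\<^sup>2 \<le>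
      max 0 (V x + m / 2) * (u 0 x)\<^sup>2 + (1 / m) * (h x)\<^sup>2 - (qi 0 u u x - h x * u 0 x)" for x
  proof -
    have "V x * (u 0 x)\<^sup>2 + (m / 2) * (u 0 x)\<^sup>2 \<le> max 0 (V x + m / 2) * (u 0 x)\<^sup>2"
      using mult_right_mono[of "V x + m / 2" "max 0 (V x + m / 2)" "(u 0 x)\<^sup>2"] by (simp add: distrib_right)
    moreover have "- (h x * u 0 x) \<le> (m / 4) * (u 0 x)\<^sup>2 + (1 / m) * (h x)\<^sup>2"
    proof -
      have "0 \<le> (m / 2 * u 0 x + h x)\<^sup>2 / m" using m_pos by simp
      also have "\<dots> = (m / 4) * (u 0 x)\<^sup>2 + (1 / m) * (h x)\<^sup>2 + h x * u 0 x"
        using m_pos by (simp add: power2_eq_square field_simps)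
      finally show ?thesis by simp
    qed
    moreover have "qi 0 u u x = V x * (u 0 x)\<^sup>2 - (u 2 x + u 0 x)\<^sup>2" by (simp add: qi_def power2_eq_square algebra_simps)
    moreover have "(m / 2) * (u 0 x)\<^sup>2 = (m / 4) * (u 0 x)\<^sup>2 + (m / 4) * (u 0 x)\<^sup>2" by (simp add: field_simps)
    ultimately show ?thesis by linarith
  qed
  have F: "((\<lambda>x. max 0 (V x + m / 2) * (u 0 x)\<^sup>2 + (1 / m) * (h x)\<^sup>2 - (qi 0 u u x - h x * u 0 x)) has_integral
      (integral {a..s} (\<lambda>x. max 0 (V x + m / 2) * (u 0 x)\<^sup>2) + (1 / m) * integral {a..s} (\<lambda>x. (h x)\<^sup>2) - 0)) {a..s}"
    by (intro has_integral_diff has_integral_add has_integral_mult_right integrable_integral ik h weak_sol_form[OF u as z])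
  have "((\<lambda>x. (m / 4) * (u 0 x)\<^sup>2 + (u 2 x + u 0 x)\<^sup>2) has_integral
      ((m / 4) * integral {a..s} (\<lambda>x. (u 0 x)\<^sup>2) + integral {a..s} (\<lambda>x. (u 2 x + u 0 x)\<^sup>2))) {a..s}"
    by (intro has_integral_add has_integral_mult_right integrable_integral i0 iy)
  from has_integral_le[OF this F pt]
  have main: "(m / 4) * integral {a..s} (\<lambda>x. (u 0 x)\<^sup>2) + integral {a..s} (\<lambda>x. (u 2 x + u 0 x)\<^sup>2) \<le> C"
    using C by simp
  have X: "0 \<le> integral {a..s} (\<lambda>x. (u 0 x)\<^sup>2)" by (rule integral_nonneg[OF i0]) simp
  have Y: "0 \<le> integral {a..s} (\<lambda>x. (u 2 x + u 0 x)\<^sup>2)" by (rule integral_nonneg[OF iy]) simp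
  have "(m / 4) * integral {a..s} (\<lambda>x. (u 0 x)\<^sup>2) \<le> C" using main Y by linarith
  then show 0: "integral {a..s} (\<lambda>x. (u 0 x)\<^sup>2) \<le> (4 / m) * C" using m_pos by (simp add: field_simps)
  have "integral {a..s} (\<lambda>x. (u 2 x)\<^sup>2) \<le> integral {a..s} (\<lambda>x. 2 * (u 2 x + u 0 x)\<^sup>2 + 2 * (u 0 x)\<^sup>2)"
  proof (rule integral_le[OF i2])
    show "(\<lambda>x. 2 * (u 2 x + u 0 x)\<^sup>2 + 2 * (u 0 x)\<^sup>2) integrable_on {a..s}"
      by (intro integrable_add integrable_on_mult_right i0 iy)
    show "(u 2 x)\<^sup>2 \<le> 2 * (u 2 x + u 0 x)\<^sup>2 + 2 * (u 0 x)\<^sup>2" for x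
      using zero_le_power2[of "u 2 x + 2 * u 0 x"] by (simp add: power2_eq_square algebra_simps)
  qed
  also have "\<dots> = 2 * integral {a..s} (\<lambda>x. (u 2 x + u 0 x)\<^sup>2) + 2 * integral {a..s} (\<lambda>x. (u 0 x)\<^sup>2)"
    by (subst Henstock_Kurzweil_Integration.integral_add) (auto intro!: integrable_on_mult_right i0 iy)
  also have "\<dots> \<le> 2 * C + 2 * ((4 / m) * C)"
    using main X m_pos 0 mult_nonneg_nonneg[of "m / 4" "integral {a..s} (\<lambda>x. (u 0 x)\<^sup>2)"] by linarith
  finally show "integral {a..s} (\<lambda>x. (u 2 x)\<^sup>2) \<le> (2 + 8 / m) * C" by (simp add: algebra_simps)
qed

lemma lincomb_square_tendsto:
  fixes w :: "nat \<Rightarrow> real \<Rightarrow> real"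
  assumes w: "\<And>i. i < n \<Longrightarrow> continuous_on UNIV (w i)" and c: "\<And>i. i < n \<Longrightarrow> (\<lambda>j. c j i) \<longlonglongrightarrow> c' i"
  shows "(\<lambda>j. integral {a..b} (\<lambda>x. (\<Sum>i<n. c j i * w i x)\<^sup>2)) \<longlonglongrightarrow> integral {a..b} (\<lambda>x. (\<Sum>i<n. c' i * w i x)\<^sup>2)"
proof -
  have i: "(\<lambda>x. w i x * w j x) integrable_on {a..b}" if "i < n" "j < n" for i j
    by (intro integrable_continuous_real continuous_on_mult continuous_on_subset[OF w subset_UNIV] that)
  have e: "integral {a..b} (\<lambda>x. (\<Sum>i<n. d i * w i x)\<^sup>2) = (\<Sum>i<n. \<Sum>j<n. d i * d j * integral {a..b} (\<lambda>x. w i x * w j x))" for d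
  proof -
    have "(\<lambda>x. (\<Sum>i<n. d i * w i x)\<^sup>2) = (\<lambda>x. \<Sum>i<n. \<Sum>j<n. d i * d j * (w i x * w j x))"
      by (rule ext) (simp add: power2_eq_square sum_product mult_ac)
    moreover have "((\<lambda>x. \<Sum>i<n. \<Sum>j<n. d i * d j * (w i x * w j x)) has_integral
        (\<Sum>i<n. \<Sum>j<n. d i * d j * integral {a..b} (\<lambda>x. w i x * w j x))) {a..b}"
      by (intro has_integral_sum has_integral_mult_right integrable_integral i) auto
    ultimately show ?thesis by (simp add: integral_unique)
  qed
  show ?thesis unfolding e by (intro tendsto_sum tendsto_mult c tendsto_const) auto
qed

text \<open>Two homogeneous solutions and one particular solution vanish to first order at
  \<open>s\<close>. Clamping at \<open>- n\<close> imposes two conditions on three coefficients;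
  normalised coefficients converge along a subsequence, and the energy bound makes the limit square
  integrable. Trivial kernel forces a nonzero weight on the particular solution, by which one
  divides.\<close>

lemma solvable_half:
  assumes nul0: "nullity {..s} 0 = 0"
    and g: "g \<in> borel_measurable lborel" and g2: "(\<lambda>x. (g x)\<^sup>2) integrable_on {..s}"
  shows "\<exists>D. clamped_dom {..s} D \<and> (\<forall>x. Lop_pot D x = g x)"
proof -
  have gi: "(\<lambda>x. (g x)\<^sup>2) integrable_on {a..b}" "g integrable_on {a..b}" if "b \<le> s" for a b
    using square_integrable_imp_integrable[OF g g2 that] by blast+
  obtain p where p: "weak_sol s g p" "\<And>k. k < 4 \<Longrightarrow> p k s = 0" using weak_sol_exists[OF g g2] by metis
  have "\<exists>u. Sol 0 u \<and> (\<forall>k<4. u k s = (if k = j then 1 else 0))" for j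
    by (rule SolR_exists[where r = "\<lambda>x. 0" and lam = 0 and a = s and c = "\<lambda>k. if k = j then 1 else 0"]) simp
  then obtain \<phi> where \<phi>: "\<And>j. Sol 0 (\<phi> j)" "\<And>j k. k < 4 \<Longrightarrow> \<phi> j k s = (if k = j then 1 else 0)" by metis
  \<comment> \<open>Position 2 carries the particular solution, so \<open>U c\<close> has datum
    \<open>c 2 * g\<close>.\<close>
  define w where "w i = (if i = 0 then \<phi> 2 else if i = 1 then \<phi> 3 else p)" for i :: nat
  define h where "h i x = (if i = 2 then g x else 0)" for i :: nat and x
  have ww: "weak_sol s (h i) (w i)" if i: "i < 3" for i
  proof -
    consider "i = 0" | "i = 1" | "i = 2" using i by linarith
    then show ?thesis
      using weak_sol_Sol[OF \<phi>(1), of s 2] weak_sol_Sol[OF \<phi>(1), of s 3] p(1) by cases (auto simp: w_def h_def[abs_def])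
  qed
  have ws: "w i k s = 0" if "k \<le> 1" for i k
    using \<phi>(2)[of k] p(2)[of k] that by (auto simp: w_def)
  define U where "U c k x = (\<Sum>i<3. c i * w i k x)" for c k x
  have Uw: "weak_sol s (\<lambda>x. c 2 * g x) (U c)" for c
  proof -
    have "(\<lambda>x. \<Sum>i<3. c i * h i x) = (\<lambda>x. c 2 * g x)" by (rule ext) (simp add: h_def numeral_3_eq_3 numeral_2_eq_2)
    moreover have "weak_sol s (\<lambda>x. \<Sum>i<3. c i * h i x) (\<lambda>k x. \<Sum>i<3. c i * w i k x)" by (rule weak_sol_lincomb[OF ww])
    ultimately show ?thesis unfolding U_def by simp
  qed
  have Us: "U c k s = 0" if "k \<le> 1" for c k using ws[OF that] by (simp add: U_def)
  have wc: "continuous_on A (w i k)" if "i < 3" "k \<le> 3" for i k A by (rule weak_sol_cont[OF ww that(2)]) (rule that(1))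
  have Uc: "continuous_on A (U c k)" if "k \<le> 3" for c k A by (rule weak_sol_cont[OF Uw that])
  have "\<exists>c. (\<Sum>i<3. (c i)\<^sup>2) = 1 \<and> (\<forall>k\<le>1. U c k (- real n) = 0)" for n
  proof -
    obtain c where c: "\<exists>i<3. c i \<noteq> 0" "\<And>j. j < 2 \<Longrightarrow> (\<Sum>i<3. c i * w i j (- real n)) = 0"
      using homogeneous_nat[of 2 3 "\<lambda>j i. w i j (- real n)"] by auto
    define r where "r = sqrt (\<Sum>i<3. (c i)\<^sup>2)"
    have r: "r > 0" using sum_squares_pos[OF c(1)] by (simp add: r_def)
    then have r2: "r\<^sup>2 = (\<Sum>i<3. (c i)\<^sup>2)" by (simp add: r_def sum_nonneg)
    have "(\<Sum>i<3. (c i / r)\<^sup>2) = (\<Sum>i<3. (c i)\<^sup>2) / r\<^sup>2" by (simp add: power_divide sum_divide_distrib)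
    then have "(\<Sum>i<3. (c i / r)\<^sup>2) = 1" using r by (simp add: r2[symmetric])
    moreover have "U (\<lambda>i. c i / r) k (- real n) = 0" if "k \<le> 1" for k
    proof -
      have "U (\<lambda>i. c i / r) k (- real n) = (\<Sum>i<3. c i * w i k (- real n)) / r" by (simp add: U_def sum_divide_distrib)
      then show ?thesis using c(2)[of k] that by simp
    qed
    ultimately show ?thesis by (intro exI[of _ "\<lambda>i. c i / r"]) blast
  qed
  then obtain c where c1: "\<And>n. (\<Sum>i<3. (c n i)\<^sup>2) = 1" and cn: "\<And>n k. k \<le> 1 \<Longrightarrow> U (c n) k (- real n) = 0" by metis
  have cb: "(c n i)\<^sup>2 \<le> 1" if "i < 3" for n i
    unfolding c1[of n, symmetric] by (rule member_le_sum) (use that in auto)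
  then have cb': "\<bar>c n i\<bar> \<le> 1" if "i \<in> {..<3}" for n i using that by (simp add: abs_square_le_1)
  obtain \<tau> e where tau: "strict_mono (\<tau> :: nat \<Rightarrow> nat)" and lim: "\<And>i. i < 3 \<Longrightarrow> (\<lambda>n. c (\<tau> n) i) \<longlonglongrightarrow> e i"
    using common_convergent_subsequence[of "{..<3::nat}" c, OF _ cb'] by auto
  have e1: "(\<Sum>i<3. (e i)\<^sup>2) = 1"
  proof -
    have "(\<lambda>n. \<Sum>i<3. (c (\<tau> n) i)\<^sup>2) \<longlonglongrightarrow> (\<Sum>i<3. (e i)\<^sup>2)" by (intro tendsto_sum tendsto_power lim) auto
    then show ?thesis unfolding c1 by (simp add: LIMSEQ_const_iff)
  qed
  obtain A B where AB: "A < B" "\<And>x. x \<le> A \<Longrightarrow> V x \<le> - m / 2" "\<And>x. x \<ge> B \<Longrightarrow> V x \<le> - m / 2" by (rule tails) (rule that)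
  define A' where "A' = min A s"
  \<comment> \<open>It vanishes left of \<open>A'\<close>, so only the fixed window
    \<open>{A'..s}\<close> contributes to the energy bound; there normalised coefficients and
    Cauchy-Schwarz give a bound independent of \<open>n\<close>.\<close>
  define \<kappa> where "\<kappa> x = max 0 (V x + m / 2)" for x
  have \<kappa>c: "continuous_on S \<kappa>" for S unfolding \<kappa>_def by (intro continuous_intros V_cont_on)
  have \<kappa>0: "\<kappa> x = 0" if "x \<le> A'" for x using AB(2)[of x] that by (simp add: \<kappa>_def A'_def)
  define C where "C = integral {A'..s} (\<lambda>x. \<kappa> x * (\<Sum>i<3. (w i 0 x)\<^sup>2)) + (1 / m) * integral {..s} (\<lambda>x. (g x)\<^sup>2)"
  have bnd: "integral {- real n..s} (\<lambda>x. (U (c n) 0 x)\<^sup>2) \<le> (4 / m) * C"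
    "integral {- real n..s} (\<lambda>x. (U (c n) 2 x)\<^sup>2) \<le> (2 + 8 / m) * C" if n: "- real n \<le> A'" for n
  proof -
    let ?h = "\<lambda>x. c n 2 * g x"
    have ns: "- real n \<le> s" using n by (simp add: A'_def)
    have hi: "?h integrable_on {- real n..s}" "(\<lambda>x. (?h x)\<^sup>2) integrable_on {- real n..s}"
      unfolding power_mult_distrib by (intro integrable_on_mult_right gi order_refl)+
    have ki: "(\<lambda>x. \<kappa> x * (U (c n) 0 x)\<^sup>2) integrable_on {a..b}" for a b
      by (intro integrable_continuous_real continuous_intros Uc \<kappa>c) auto
    have "integral {- real n..s} (\<lambda>x. \<kappa> x * (U (c n) 0 x)\<^sup>2) =
        integral {- real n..A'} (\<lambda>x. \<kappa> x * (U (c n) 0 x)\<^sup>2) + integral {A'..s} (\<lambda>x. \<kappa> x * (U (c n) 0 x)\<^sup>2)"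
      by (rule Henstock_Kurzweil_Integration.integral_combine[symmetric, OF n _ ki]) (simp add: A'_def)
    also have "integral {- real n..A'} (\<lambda>x. \<kappa> x * (U (c n) 0 x)\<^sup>2) = integral {- real n..A'} (\<lambda>x. 0)"
      by (rule integral_cong) (simp add: \<kappa>0)
    also have "integral {A'..s} (\<lambda>x. \<kappa> x * (U (c n) 0 x)\<^sup>2) \<le> integral {A'..s} (\<lambda>x. \<kappa> x * (\<Sum>i<3. (w i 0 x)\<^sup>2))"
    proof (rule integral_le[OF ki])
      show "(\<lambda>x. \<kappa> x * (\<Sum>i<3. (w i 0 x)\<^sup>2)) integrable_on {A'..s}"
        by (intro integrable_continuous_real continuous_intros wc \<kappa>c) auto
      show "\<kappa> x * (U (c n) 0 x)\<^sup>2 \<le> \<kappa> x * (\<Sum>i<3. (w i 0 x)\<^sup>2)" for x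
        using Cauchy_Schwarz_ineq_sum[of "c n" "\<lambda>i. w i 0 x" "{..<3}"] c1[of n]
        by (intro mult_left_mono) (auto simp: U_def \<kappa>_def)
    qed
    finally have 1: "integral {- real n..s} (\<lambda>x. \<kappa> x * (U (c n) 0 x)\<^sup>2) \<le> integral {A'..s} (\<lambda>x. \<kappa> x * (\<Sum>i<3. (w i 0 x)\<^sup>2))"
      by simp
    have "integral {- real n..s} (\<lambda>x. (?h x)\<^sup>2) \<le> integral {..s} (\<lambda>x. (g x)\<^sup>2)"
    proof -
      have "(?h x)\<^sup>2 \<le> (g x)\<^sup>2" for x using mult_right_mono[OF cb[of 2 n], of "(g x)\<^sup>2"] by (simp add: power_mult_distrib)
      then have "integral {- real n..s} (\<lambda>x. (?h x)\<^sup>2) \<le> integral {- real n..s} (\<lambda>x. (g x)\<^sup>2)"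
        by (intro integral_le hi gi(1)) auto
      also have "\<dots> \<le> integral {..s} (\<lambda>x. (g x)\<^sup>2)" by (rule integral_subset_le[OF _ gi(1) g2]) auto
      finally show ?thesis .
    qed
    then have "(1 / m) * integral {- real n..s} (\<lambda>x. (?h x)\<^sup>2) \<le> (1 / m) * integral {..s} (\<lambda>x. (g x)\<^sup>2)"
      using m_pos by (intro mult_left_mono) auto
    with 1 have "integral {- real n..s} (\<lambda>x. max 0 (V x + m / 2) * (U (c n) 0 x)\<^sup>2) +
        (1 / m) * integral {- real n..s} (\<lambda>x. (?h x)\<^sup>2) \<le> C"
      unfolding C_def \<kappa>_def by linarith
    from weak_sol_bound[OF Uw ns _ hi this] Us cn
    show "integral {- real n..s} (\<lambda>x. (U (c n) 0 x)\<^sup>2) \<le> (4 / m) * C"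
      "integral {- real n..s} (\<lambda>x. (U (c n) 2 x)\<^sup>2) \<le> (2 + 8 / m) * C" by blast+
  qed
  have lb: "integral {b..s} (\<lambda>x. (U e k x)\<^sup>2) \<le> K"
    if k: "k = 0 \<or> k = 2" and K: "\<And>n. - real n \<le> A' \<Longrightarrow> integral {- real n..s} (\<lambda>x. (U (c n) k x)\<^sup>2) \<le> K" for k K b
  proof (rule LIMSEQ_le_const2)
    have k3: "k \<le> 3" using k by auto
    show "(\<lambda>n. integral {b..s} (\<lambda>x. (U (c (\<tau> n)) k x)\<^sup>2)) \<longlonglongrightarrow> integral {b..s} (\<lambda>x. (U e k x)\<^sup>2)"
      unfolding U_def by (rule lincomb_square_tendsto) (use wc k3 lim in auto)
    obtain N where N: "real N \<ge> max (- A') (- b)" using real_arch_simple by blast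
    have "integral {b..s} (\<lambda>x. (U (c (\<tau> n)) k x)\<^sup>2) \<le> K" if "n \<ge> N" for n
    proof -
      have "real (\<tau> n) \<ge> real N" using seq_suble[OF tau, of n] that by simp
      then have l: "- real (\<tau> n) \<le> A'" "- real (\<tau> n) \<le> b" using N by auto
      have sub: "{b..s} \<subseteq> {- real (\<tau> n)..s}" using l by auto
      have i: "(\<lambda>x. (U (c (\<tau> n)) k x)\<^sup>2) integrable_on {x..s}" for x
        by (intro integrable_continuous_real continuous_intros Uc k3)
      have "integral {b..s} (\<lambda>x. (U (c (\<tau> n)) k x)\<^sup>2) \<le> integral {- real (\<tau> n)..s} (\<lambda>x. (U (c (\<tau> n)) k x)\<^sup>2)"
        by (rule integral_subset_le[OF sub i i]) simp
      also have "\<dots> \<le> K" by (rule K[OF l(1)])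
      finally show ?thesis .
    qed
    then show "\<exists>N. \<forall>n\<ge>N. integral {b..s} (\<lambda>x. (U (c (\<tau> n)) k x)\<^sup>2) \<le> K" by blast
  qed
  have l0: "integral {b..s} (\<lambda>x. (U e 0 x)\<^sup>2) \<le> (4 / m) * C" and l2: "integral {b..s} (\<lambda>x. (U e 2 x)\<^sup>2) \<le> (2 + 8 / m) * C" for b
    by (rule lb, simp, rule bnd, assumption)+
  have ui: "(\<lambda>x. (U e k x)\<^sup>2) integrable_on {a..b}" if "k \<le> 3" for k a b
    by (intro integrable_continuous_real continuous_intros Uc that)
  have s0: "(\<lambda>x. (U e 0 x)\<^sup>2) integrable_on {..s}" by (rule square_integrable_left[OF ui l0]) simp
  have s2: "(\<lambda>x. (U e 2 x)\<^sup>2) integrable_on {..s}" by (rule square_integrable_left[OF ui l2]) simp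
  have S: "side {..s}" by (auto simp: side_def)
  \<comment> \<open>Otherwise the limit is a homogeneous, square integrable, clamped solution, hence
    zero. Its second and third derivatives at \<open>s\<close> are \<open>e 0\<close> and
    \<open>e 1\<close>, against the normalisation.\<close>
  have e2: "e 2 \<noteq> 0"
  proof
    assume e2: "e 2 = 0"
    define v where "v k x = (\<Sum>i<2. e i * \<phi> (i + 2) k x)" for k x
    have sv: "Sol 0 v" unfolding v_def by (rule Sol_lincomb) (rule \<phi>(1))
    have vU: "v k x = U e k x" for k x
      using e2 by (simp add: v_def U_def w_def numeral_2_eq_2 numeral_3_eq_3)
    have "eigfun {..s} 0 v"
      unfolding eigfun_def using sv Us[of _ e] vU Sol_square_integrable[OF sv S] s0 s2 by auto
    then have z: "v k s = 0" if "k \<le> 4" for k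
      using nullity_span[of 0 "{..s}" 0 "\<lambda>i. v" v] nul0 S that by (auto simp: lin_indep_on_def)
    have "v 2 s = e 0" "v 3 s = e 1" using \<phi>(2) by (simp_all add: v_def numeral_2_eq_2)
    then show False using z[of 2] z[of 3] e1 e2 by (simp add: numeral_3_eq_3 numeral_2_eq_2)
  qed
  define d where "d i = e i / e 2" for i
  have Ud: "U d k x = U e k x / e 2" for k x by (simp add: U_def d_def sum_divide_distrib)
  have wU: "weak_sol s g (U d)" using Uw[of d] e2 by (simp add: d_def)
  define D where "D k = (if k = 4 then (\<lambda>x. rhs 0 (U d) x - g x) else U d k)" for k :: nat
  have dd: "(D k has_real_derivative D (Suc k) x) (at x within T)" if "k < 3" for k x T
    using has_field_derivative_at_within[OF weak_sol_deriv[OF wU that]] that by (simp add: D_def)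
  have D4: "(D 4 has_integral (D 3 y - D 3 x)) {x..y}" if "x \<le> y" "y \<le> s" for x y
    using weak_sol_int[OF wU that] by (simp add: D_def)
  have scale: "(\<lambda>x. (D k x)\<^sup>2) = (\<lambda>x. (1 / e 2)\<^sup>2 * (U e k x)\<^sup>2)" if "k < 4" for k
    using that by (auto simp: D_def Ud power_divide)
  have Di: "(\<lambda>x. (D k x)\<^sup>2) integrable_on {a..b}" if "k \<le> 3" for k a b
    using scale[of k] ui[OF that] that by (auto intro!: integrable_on_mult_right)
  have Di02: "(\<lambda>x. (D 0 x)\<^sup>2) integrable_on {..s}" "(\<lambda>x. (D 2 x)\<^sup>2) integrable_on {..s}"
    using s0 s2 scale[of 0] scale[of 2] by (auto intro!: integrable_on_mult_right)
  obtain K where K: "K \<ge> 0" "\<And>u x. (rhs 0 u x)\<^sup>2 \<le> K * ((u 2 x)\<^sup>2 + (u 0 x)\<^sup>2)" by (rule rhs_sq_bound) (rule that)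
  have Di4: "(\<lambda>x. (D 4 x)\<^sup>2) integrable_on {..s}"
  proof (rule measurable_bounded_by_integrable_imp_integrable)
    have "continuous_on UNIV (rhs 0 (U d))" by (intro rhs_cont Uc) auto
    then have "rhs 0 (U d) \<in> borel_measurable borel" by (rule borel_measurable_continuous_onI)
    then have "(\<lambda>x. (rhs 0 (U d) x - g x)\<^sup>2) \<in> borel_measurable lborel" using g by simp
    then have "(\<lambda>x. (rhs 0 (U d) x - g x)\<^sup>2) \<in> borel_measurable lebesgue" by (rule measurable_completion)
    then have "(\<lambda>x. (D 4 x)\<^sup>2) \<in> borel_measurable lebesgue" by (simp add: D_def)
    then show "(\<lambda>x. (D 4 x)\<^sup>2) \<in> borel_measurable (lebesgue_on {..s})" by (rule measurable_restrict_space1)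
    show "(\<lambda>x. 2 * (K * ((D 2 x)\<^sup>2 + (D 0 x)\<^sup>2)) + 2 * (g x)\<^sup>2) integrable_on {..s}"
      by (intro integrable_add integrable_on_mult_right Di02 g2)
    show "norm ((D 4 x)\<^sup>2) \<le> 2 * (K * ((D 2 x)\<^sup>2 + (D 0 x)\<^sup>2)) + 2 * (g x)\<^sup>2" for x
    proof -
      have "(rhs 0 (U d) x - g x)\<^sup>2 \<le> 2 * (rhs 0 (U d) x)\<^sup>2 + 2 * (g x)\<^sup>2"
        using zero_le_power2[of "rhs 0 (U d) x + g x"] by (simp add: power2_eq_square algebra_simps)
      then show ?thesis using K(2)[of "U d" x] by (simp add: D_def)
    qed
  qed auto
  have le: "integral {x..s} (\<lambda>x. (D k x)\<^sup>2) \<le> integral {..s} (\<lambda>x. (D k x)\<^sup>2)"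
    if "(\<lambda>x. (D k x)\<^sup>2) integrable_on {..s}" for k x
  proof -
    have sub: "{x..s} \<subseteq> {..s}" by auto
    show ?thesis by (rule integral_subset_le[OF sub integrable_on_subinterval[OF that sub] that]) simp
  qed
  have n: "0 \<le> integral {..s} (\<lambda>x. (D k x)\<^sup>2)" for k
    by (cases "(\<lambda>x. (D k x)\<^sup>2) integrable_on {..s}") (auto intro: integral_nonneg simp: not_integrable_integral)
  have Di1: "(\<lambda>x. (D 1 x)\<^sup>2) integrable_on {..s}"
  proof -
    have "\<exists>C'. \<forall>x\<le>s. integral {x..s} (\<lambda>x. (D 1 x)\<^sup>2) \<le> C'"
    proof (rule derivative_square_bound_left[of s "D 0" "D 1" "D 2" "integral {..s} (\<lambda>x. (D 0 x)\<^sup>2) + integral {..s} (\<lambda>x. (D 2 x)\<^sup>2)"])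
      show "integral {x..s} (\<lambda>x. (D 0 x)\<^sup>2) \<le> integral {..s} (\<lambda>x. (D 0 x)\<^sup>2) + integral {..s} (\<lambda>x. (D 2 x)\<^sup>2)"
        "integral {x..s} (\<lambda>x. (D 2 x)\<^sup>2) \<le> integral {..s} (\<lambda>x. (D 0 x)\<^sup>2) + integral {..s} (\<lambda>x. (D 2 x)\<^sup>2)" for x
        using le[OF Di02(1), of x] le[OF Di02(2), of x] n[of 0] n[of 2] by linarith+
      show "(D 0 has_real_derivative D 1 x) (at x within {..s})" for x using dd[of 0] by simp
      show "(D 2 has_integral (D 1 y - D 1 x)) {x..y}" if "x \<le> y" for x y
        using dd[of 1 _ "{x..y}"] that unfolding has_real_derivative_iff_has_vector_derivative
        by (intro fundamental_theorem_of_calculus) (auto simp: numeral_2_eq_2)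
      show "(\<lambda>x. (D 2 x)\<^sup>2) integrable_on {x..s}" for x by (rule Di) simp
    qed
    then show ?thesis using square_integrable_left[OF Di] by (metis one_le_numeral)
  qed
  have Di3: "(\<lambda>x. (D 3 x)\<^sup>2) integrable_on {..s}"
  proof -
    have "\<exists>C'. \<forall>x\<le>s. integral {x..s} (\<lambda>x. (D 3 x)\<^sup>2) \<le> C'"
    proof (rule derivative_square_bound_left[of s "D 2" "D 3" "D 4" "integral {..s} (\<lambda>x. (D 2 x)\<^sup>2) + integral {..s} (\<lambda>x. (D 4 x)\<^sup>2)"])
      show "integral {x..s} (\<lambda>x. (D 2 x)\<^sup>2) \<le> integral {..s} (\<lambda>x. (D 2 x)\<^sup>2) + integral {..s} (\<lambda>x. (D 4 x)\<^sup>2)"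
        "integral {x..s} (\<lambda>x. (D 4 x)\<^sup>2) \<le> integral {..s} (\<lambda>x. (D 2 x)\<^sup>2) + integral {..s} (\<lambda>x. (D 4 x)\<^sup>2)" for x
        using le[OF Di02(2), of x] le[OF Di4, of x] n[of 2] n[of 4] by linarith+
      show "(D 2 has_real_derivative D 3 x) (at x within {..s})" for x using dd[of 2] by (simp add: numeral_3_eq_3 numeral_2_eq_2)
      show "(D 4 has_integral (D 3 y - D 3 x)) {x..y}" if "x \<le> y" "y \<le> s" for x y by (rule D4[OF that])
      show "(\<lambda>x. (D 4 x)\<^sup>2) integrable_on {x..s}" for x by (rule integrable_on_subinterval[OF Di4]) auto
    qed
    then show ?thesis using square_integrable_left[OF Di] by (metis order_refl)
  qed
  have "(\<lambda>x. (D k x)\<^sup>2) integrable_on {..s}" if "k \<le> 4" for k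
  proof -
    have "k = 0 \<or> k = 1 \<or> k = 2 \<or> k = 3 \<or> k = 4" using that by auto
    then show ?thesis using Di02 Di1 Di3 Di4 by auto
  qed
  then have "clamped_dom {..s} D" unfolding clamped_dom_def H4_def using dd D4 Us[of _ d] by (auto simp: D_def)
  moreover have "Lop_pot D x = g x" for x by (simp add: Lop_pot_def D_def rhs_def algebra_simps)
  ultimately show ?thesis by blast
qed

lemma kernel_half:
  assumes nul0: "nullity {..s} 0 = 0" and D: "clamped_dom {..s} D" and ae: "AE x in lborel. x \<in> {..s} \<longrightarrow> Lop_pot D x = 0" and x: "x \<in> {..s}"
  shows "D 0 x = 0"
proof -
  have S: "side {..s}" by (auto simp: side_def)
  have "D \<in> eigspace {..s} 0" using D ae by (simp add: eigspace_def)
  then obtain u where u: "eigfun {..s} 0 u" "\<forall>x\<in>{..s}. \<forall>k<4. u k x = D k x" using eigspace_imp_eigfun[OF _ S] by blast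
  have "u 0 x = 0" using nullity_span[of 0 "{..s}" 0 "\<lambda>i. u" u] nul0 S u(1) by (auto simp: lin_indep_on_def)
  then show ?thesis using u(2) x by simp
qed

end

subsection \<open>The first-order system\<close>

lemma has_vector_derivative_vec_iff:
  fixes q :: "real \<Rightarrow> real^'n"
  shows "(q has_vector_derivative d) (at y) \<longleftrightarrow> (\<forall>i. ((\<lambda>x. q x $ i) has_real_derivative d $ i) (at y))"
proof -
  have "(q has_vector_derivative d) (at y) \<longleftrightarrow>
      (\<forall>i::'n. ((\<lambda>x. q x $ i) has_derivative (\<lambda>t. t * d $ i)) (at y))"
    unfolding has_vector_derivative_def has_derivative_componentwise_within[of q]
    by (auto simp: Basis_vec_def inner_axis)
  then show ?thesis unfolding has_field_derivative_def by (simp add: mult_commute_abs)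
qed

lemma tendsto_vec_iff:
  fixes q :: "real \<Rightarrow> real^'n"
  shows "(q \<longlongrightarrow> l) F \<longleftrightarrow> (\<forall>i. ((\<lambda>x. q x $ i) \<longlongrightarrow> l $ i) F)"
  using tendsto_vec_nth vec_tendstoI by metis

lemma vector_4:
  "(vector [a, b, c, d] :: ('a::zero)^4) $ 1 = a" "(vector [a, b, c, d] :: ('a::zero)^4) $ 2 = b"
  "(vector [a, b, c, d] :: ('a::zero)^4) $ 3 = c" "(vector [a, b, c, d] :: ('a::zero)^4) $ 4 = d"
  unfolding vector_def by simp_all

definition qvec :: "(nat \<Rightarrow> real \<Rightarrow> real) \<Rightarrow> real \<Rightarrow> real^4" where
  "qvec u x = vector [u 0 x, u 2 x, u 3 x + 2 * u 1 x, u 1 x]"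

lemma qvec_nth: "qvec u x $ 1 = u 0 x" "qvec u x $ 2 = u 2 x" "qvec u x $ 3 = u 3 x + 2 * u 1 x" "qvec u x $ 4 = u 1 x"
  by (simp_all add: qvec_def vector_4)

lemma less_4_cases: "(\<forall>k<4. P k) \<longleftrightarrow> P 0 \<and> P 1 \<and> P 2 \<and> P (3::nat)"
  by (auto simp: eval_nat_numeral All_less_Suc)

lemma qvec_eq_0: "qvec u x = 0 \<longleftrightarrow> (\<forall>k<4. u k x = 0)"
  unfolding vec_eq_iff forall_4 qvec_nth less_4_cases by auto

lemma qvec_lincomb:
  "qvec (\<lambda>k x. \<Sum>i<2. c i * f i k x) s = c 0 *\<^sub>R qvec (f 0) s + c (Suc 0) *\<^sub>R qvec (f (Suc 0)) s"
  unfolding vec_eq_iff forall_4 vector_add_component vector_scaleR_component qvec_nth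
  by (simp add: numeral_2_eq_2 algebra_simps)

lemma Bmat_mult:
  "(Bmat \<nu> \<mu> \<phi> x lam *v q) $ 1 = q $ 4" "(Bmat \<nu> \<mu> \<phi> x lam *v q) $ 2 = q $ 3 - 2 * q $ 4"
  "(Bmat \<nu> \<mu> \<phi> x lam *v q) $ 3 = (- lam - 1 + fnl' \<nu> \<mu> (\<phi> x)) * q $ 1" "(Bmat \<nu> \<mu> \<phi> x lam *v q) $ 4 = q $ 2"
  by (simp_all add: Bmat_def matrix_vector_mult_def sum_4 vector_4)

locale wave =
  fixes \<nu> \<mu> :: real and \<phi> :: "real \<Rightarrow> real"
  assumes stationary: "H1 \<nu> \<mu> \<phi>" and stable: "fnl' \<nu> \<mu> 0 < 0"

sublocale wave \<subseteq> pot "\<lambda>x. fnl' \<nu> \<mu> (\<phi> x)" "- fnl' \<nu> \<mu> 0"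
proof
  have "((deriv ^^ 0) \<phi>) differentiable (at x)" for x using stationary unfolding H1_def by blast
  then have "\<phi> differentiable (at x)" for x by simp
  then have c: "continuous_on UNIV \<phi>"
    by (simp add: differentiable_imp_continuous_within continuous_at_imp_continuous_on)
  show "continuous_on UNIV (\<lambda>x. fnl' \<nu> \<mu> (\<phi> x))" unfolding fnl'_def by (intro continuous_intros c)
  show "- fnl' \<nu> \<mu> 0 > 0" using stable by simp
  have l: "((\<lambda>x. fnl' \<nu> \<mu> (\<phi> x)) \<longlongrightarrow> fnl' \<nu> \<mu> 0) F" if "(\<phi> \<longlongrightarrow> 0) F" for F
    unfolding fnl'_def by (intro tendsto_intros that)
  show "((\<lambda>x. fnl' \<nu> \<mu> (\<phi> x)) \<longlongrightarrow> - (- fnl' \<nu> \<mu> 0)) at_top" "((\<lambda>x. fnl' \<nu> \<mu> (\<phi> x)) \<longlongrightarrow> - (- fnl' \<nu> \<mu> 0)) at_bot"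
    using l stationary by (auto simp: H1_def)
qed

context wave
begin

lemma Mor_Mor_pot:
  assumes "Dm = clamped_dom S"
  shows "Mor \<nu> \<mu> \<phi> S Dm = Mor_pot S"
proof -
  have "eigsp \<nu> \<mu> \<phi> S Dm lam = eigspace S lam" for lam
    unfolding eigsp_def eigspace_def assms Lop_def Lop_pot_def ..
  then have "eigdim \<nu> \<mu> \<phi> S Dm lam = eig_dim S lam" for lam
    unfolding eigdim_def eig_dim_def by simp
  then have e: "eigdim \<nu> \<mu> \<phi> S Dm = eig_dim S" ..
  show ?thesis unfolding Mor_def Mor_pot_def e ..
qed

lemma dom_line_clamped_dom: "dom_line = clamped_dom UNIV"
  by (rule ext) (simp add: dom_line_def clamped_dom_def not_UNIV_eq_Iic)

lemma dom_half_clamped_dom: "dom_half s = clamped_dom {..s}"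
  by (rule ext) (auto simp: dom_half_def clamped_dom_def)

lemma Eu_eq: "Eu \<nu> \<mu> \<phi> s lam = (\<lambda>u. qvec u s) ` {u. Sol lam u \<and> (\<forall>k<4. (u k \<longlongrightarrow> 0) at_bot)}"
proof (intro set_eqI iffI)
  fix v assume "v \<in> Eu \<nu> \<mu> \<phi> s lam"
  then obtain q where q: "\<And>y. (q has_vector_derivative (Bmat \<nu> \<mu> \<phi> y lam *v q y)) (at y)" "(q \<longlongrightarrow> 0) at_bot" "v = q s"
    unfolding Eu_def by blast
  have d: "((\<lambda>y. q y $ 1) has_real_derivative q y $ 4) (at y)"
    "((\<lambda>y. q y $ 2) has_real_derivative (q y $ 3 - 2 * q y $ 4)) (at y)"
    "((\<lambda>y. q y $ 3) has_real_derivative (- lam - 1 + fnl' \<nu> \<mu> (\<phi> y)) * q y $ 1) (at y)"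
    "((\<lambda>y. q y $ 4) has_real_derivative q y $ 2) (at y)" for y
    using q(1)[of y] unfolding has_vector_derivative_vec_iff forall_4 Bmat_mult by auto
  have l: "((\<lambda>y. q y $ i) \<longlongrightarrow> 0) at_bot" for i using q(2) unfolding tendsto_vec_iff by simp
  \<comment> \<open>The substitution read backwards; in particular \<open>u''' = q3 - 2 q4\<close>,
    because the third component is \<open>u''' + 2 u'\<close>.\<close>
  define u where "u k y = (if k = 0 then q y $ 1 else if k = 1 then q y $ 4 else if k = 2 then q y $ 2
      else if k = 3 then q y $ 3 - 2 * q y $ 4 else (- lam - 1 + fnl' \<nu> \<mu> (\<phi> y)) * q y $ 1 - 2 * q y $ 2)" for k :: nat and y
  have uu: "u 0 = (\<lambda>y. q y $ 1)" "u 1 = (\<lambda>y. q y $ 4)" "u 2 = (\<lambda>y. q y $ 2)" "u 3 = (\<lambda>y. q y $ 3 - 2 * q y $ 4)"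
    "u 4 = (\<lambda>y. (- lam - 1 + fnl' \<nu> \<mu> (\<phi> y)) * q y $ 1 - 2 * q y $ 2)"
    by (simp_all add: u_def fun_eq_iff)
  have sc: "Suc 0 = 1" "Suc 1 = 2" "Suc 2 = 3" "Suc 3 = 4" by simp_all
  have "Sol lam u"
    unfolding SolR_def less_4_cases sc uu(1-4)
  proof (intro conjI allI)
    show "((\<lambda>y. q y $ 3 - 2 * q y $ 4) has_real_derivative u 4 x) (at x)" for x
      unfolding uu by (intro DERIV_diff DERIV_cmult d)
    show "u 4 x = rhs lam u x + 0" for x unfolding rhs_def uu by (simp add: algebra_simps)
  qed (rule d)+
  moreover have "\<forall>k<4. (u k \<longlongrightarrow> 0) at_bot"
    unfolding less_4_cases uu using l tendsto_diff[OF l tendsto_mult_right_zero[OF l], of 3 2 4] by simp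
  moreover have "v = qvec u s" unfolding vec_eq_iff forall_4 qvec_nth uu q(3) by simp
  ultimately show "v \<in> (\<lambda>u. qvec u s) ` {u. Sol lam u \<and> (\<forall>k<4. (u k \<longlongrightarrow> 0) at_bot)}" by blast
next
  fix v assume "v \<in> (\<lambda>u. qvec u s) ` {u. Sol lam u \<and> (\<forall>k<4. (u k \<longlongrightarrow> 0) at_bot)}"
  then obtain u where u: "Sol lam u" and l: "\<forall>k<4. (u k \<longlongrightarrow> 0) at_bot" and v: "v = qvec u s" by blast
  have d: "(u 0 has_real_derivative u 1 y) (at y)" "(u 1 has_real_derivative u 2 y) (at y)"
    "(u 2 has_real_derivative u 3 y) (at y)" "(u 3 has_real_derivative u 4 y) (at y)" for y
    using SolR_deriv[OF u, of 0 y] SolR_deriv[OF u, of 1 y] SolR_deriv[OF u, of 2 y] SolR_deriv[OF u, of 3 y]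
    by (simp_all add: eval_nat_numeral)
  have "(qvec u has_vector_derivative (Bmat \<nu> \<mu> \<phi> y lam *v qvec u y)) (at y)" for y
    unfolding has_vector_derivative_vec_iff forall_4 Bmat_mult qvec_nth
  proof (intro conjI d)
    show "((\<lambda>x. u 2 x) has_real_derivative (u 3 y + 2 * u 1 y - 2 * u 1 y)) (at y)" using d(3) by simp
    have "((\<lambda>x. u 3 x + 2 * u 1 x) has_real_derivative (u 4 y + 2 * u 2 y)) (at y)"
      by (intro DERIV_add DERIV_cmult d)
    then show "((\<lambda>x. u 3 x + 2 * u 1 x) has_real_derivative ((- lam - 1 + fnl' \<nu> \<mu> (\<phi> y)) * u 0 y)) (at y)"
      using SolR_4[OF u, of y] by (simp add: rhs_def algebra_simps)
  qed
  moreover have "(qvec u \<longlongrightarrow> 0) at_bot"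
  proof -
    have "((\<lambda>x. u 3 x + 2 * u 1 x) \<longlongrightarrow> 0 + 2 * 0) at_bot" using l by (intro tendsto_intros) auto
    then show ?thesis using l unfolding tendsto_vec_iff forall_4 qvec_nth less_4_cases by simp
  qed
  ultimately show "v \<in> Eu \<nu> \<mu> \<phi> s lam" unfolding Eu_def v by blast
qed

text \<open>Membership in \<open>sand\<close> is the pair of clamped conditions at \<open>s\<close>,
  and decay means square integrability by \<open>eigfun_half_iff\<close>. Conjugate points thus
  become points of nonzero nullity.\<close>

lemma Eu_sand: "Eu \<nu> \<mu> \<phi> s 0 \<inter> sand = (\<lambda>u. qvec u s) ` {u. eigfun {..s} 0 u}"
  unfolding Eu_eq sand_def eigfun_half_iff[OF order_refl] by (auto simp: qvec_nth)

lemma zero_in_Eu_sand: "0 \<in> Eu \<nu> \<mu> \<phi> s 0 \<inter> sand"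
proof -
  have "eigfun {..s} 0 (\<lambda>k x. 0)" unfolding eigfun_half_iff[OF order_refl] using Sol_zero by simp
  moreover have "qvec (\<lambda>k x. 0) s = 0" by (simp add: qvec_eq_0)
  ultimately show ?thesis unfolding Eu_sand by (metis (mono_tags) image_eqI mem_Collect_eq)
qed

lemma qvec_zero_imp: "Sol lam u \<Longrightarrow> qvec u s = 0 \<Longrightarrow> u 0 x = 0"
  unfolding qvec_eq_0 by (rule Sol_zero_data[of lam u s 0 x]) auto

lemma conj_point_iff: "conj_point \<nu> \<mu> \<phi> s \<longleftrightarrow> nullity {..s} 0 > 0"
proof
  assume "conj_point \<nu> \<mu> \<phi> s"
  then obtain v where v: "v \<in> Eu \<nu> \<mu> \<phi> s 0 \<inter> sand" "v \<noteq> 0" unfolding conj_point_def using zero_in_Eu_sand by blast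
  then obtain u where u: "eigfun {..s} 0 u" "qvec u s \<noteq> 0" unfolding Eu_sand by blast
  show "nullity {..s} 0 > 0"
  proof (rule ccontr)
    assume "\<not> nullity {..s} 0 > 0"
    then have "u k s = 0" if "k \<le> 4" for k
      using nullity_span[of 0 "{..s}" 0 "\<lambda>i. u" u] u(1) that by (auto simp: lin_indep_on_def side_def)
    then show False using u(2) by (simp add: qvec_eq_0)
  qed
next
  assume n: "nullity {..s} 0 > 0"
  obtain f where f: "\<forall>i<nullity {..s} 0. eigfun {..s} 0 (f i)" "lin_indep_on {..s} (nullity {..s} 0) (\<lambda>i. f i 0)"
    using indep_nullity(1)[of "{..s}" 0] unfolding indep_def by blast
  have f0: "eigfun {..s} 0 (f 0)" using f(1) n by blast
  have "qvec (f 0) s \<noteq> 0"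
  proof
    assume "qvec (f 0) s = 0"
    then have z: "f 0 0 x = 0" for x using f0 qvec_zero_imp by (auto simp: eigfun_def)
    have "\<forall>x\<in>{..s}. (\<Sum>i<nullity {..s} 0. (if i = 0 then 1 else 0::real) * f i 0 x) = 0"
      using z by (auto intro!: sum.neutral)
    then have "\<forall>i<nullity {..s} 0. (if i = 0 then 1 else 0) = (0::real)"
      using f(2)[unfolded lin_indep_on_def, rule_format, of "\<lambda>i. if i = 0 then 1 else 0"] by blast
    then show False using n by auto
  qed
  then show "conj_point \<nu> \<mu> \<phi> s" unfolding conj_point_def Eu_sand using f0 by blast
qed

text \<open>The Cauchy data at \<open>s\<close> determine a solution, so two independent kernel
  functions would give two independent vectors in the intersection.\<close>

lemma nullity_le_1:
  assumes H3: "dim (Eu \<nu> \<mu> \<phi> s 0 \<inter> sand) \<le> 1"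
  shows "nullity {..s} 0 \<le> 1"
proof (rule ccontr)
  assume n: "\<not> nullity {..s} 0 \<le> 1"
  obtain f where f: "\<forall>i<nullity {..s} 0. eigfun {..s} 0 (f i)" "lin_indep_on {..s} (nullity {..s} 0) (\<lambda>i. f i 0)"
    using indep_nullity(1)[of "{..s}" 0] unfolding indep_def by blast
  define a where "a = qvec (f 0) s"
  define b where "b = qvec (f (Suc 0)) s"
  have ind: "c = 0 \<and> d = 0" if cd: "c *\<^sub>R a + d *\<^sub>R b = 0" for c d
  proof -
    define e where "e i = (if i = 0 then c else if i = 1 then d else 0)" for i :: nat
    have "Sol 0 (\<lambda>k x. \<Sum>i<2. e i * f i k x)"
      by (rule Sol_lincomb) (use f(1) n in \<open>auto simp: eigfun_def\<close>)
    moreover have "qvec (\<lambda>k x. \<Sum>i<2. e i * f i k x) s = 0"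
      using cd unfolding qvec_lincomb by (simp add: e_def a_def b_def)
    ultimately have z: "(\<Sum>i<2. e i * f i 0 x) = 0" for x using qvec_zero_imp by blast
    have "(\<Sum>i<nullity {..s} 0. e i * f i 0 x) = 0" for x
    proof -
      have "(\<Sum>i<nullity {..s} 0. e i * f i 0 x) = (\<Sum>i<2. e i * f i 0 x)"
        by (rule sum.mono_neutral_right) (use n in \<open>auto simp: e_def\<close>)
      then show ?thesis using z by simp
    qed
    then have "\<forall>i<nullity {..s} 0. e i = 0" using f(2)[unfolded lin_indep_on_def, rule_format, of e] by blast
    then have "e 0 = 0" "e 1 = 0" using n by auto
    then show ?thesis by (simp add: e_def)
  qed
  have ab: "a \<noteq> b" using ind[of 1 "-1"] by auto
  have b0: "b \<noteq> 0" using ind[of 0 1] by auto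
  have "a \<notin> span {b}"
  proof
    assume "a \<in> span {b}"
    then obtain k where "a = k *\<^sub>R b" by (auto simp: span_singleton)
    then show False using ind[of 1 "- k"] by auto
  qed
  then have "independent {a, b}" using b0 ab by (simp add: independent_insert)
  moreover have "{a, b} \<subseteq> Eu \<nu> \<mu> \<phi> s 0 \<inter> sand"
    unfolding Eu_sand a_def b_def using f(1) n by auto
  ultimately have "card {a, b} \<le> dim (Eu \<nu> \<mu> \<phi> s 0 \<inter> sand)" by (intro independent_card_le_dim)
  then show False using ab H3 by simp
qed

lemma conj_mult_1:
  assumes "dim (Eu \<nu> \<mu> \<phi> s 0 \<inter> sand) \<le> 1" and "conj_point \<nu> \<mu> \<phi> s"
  shows "conj_mult \<nu> \<mu> \<phi> s = 1"
proof -
  have "dim (Eu \<nu> \<mu> \<phi> s 0 \<inter> sand) \<noteq> 0"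
    using assms(2) zero_in_Eu_sand[of s] unfolding conj_point_def dim_eq_0 by blast
  then show ?thesis using assms(1) unfolding conj_mult_def by linarith
qed

end

theorem theorem3:
  fixes \<nu> \<mu> :: real and \<phi> :: "real \<Rightarrow> real"
  assumes H1: "H1 \<nu> \<mu> \<phi>"
    and H2: "fnl' \<nu> \<mu> 0 < 0"
    and H3: "\<forall>x. dim (Eu \<nu> \<mu> \<phi> x 0 \<inter> sand) \<le> 1"
  shows "\<exists>Linf::real.
     (\<forall>L > Linf.
        Mor \<nu> \<mu> \<phi> {..L} (dom_half L) = Mor \<nu> \<mu> \<phi> UNIV dom_line \<and>
        \<not> conj_point \<nu> \<mu> \<phi> L \<and>
        invertible_op \<nu> \<mu> \<phi> {..L} (dom_half L) \<and>
        finite {x. x < L \<and> conj_point \<nu> \<mu> \<phi> x} \<and>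
        (\<Sum>x\<in>{x. x < L \<and> conj_point \<nu> \<mu> \<phi> x}. conj_mult \<nu> \<mu> \<phi> x)
          = (\<Sum>x\<in>{x. conj_point \<nu> \<mu> \<phi> x}. conj_mult \<nu> \<mu> \<phi> x)) \<and>
     finite {x. conj_point \<nu> \<mu> \<phi> x} \<and>
     Mor \<nu> \<mu> \<phi> UNIV dom_line = enat (\<Sum>x\<in>{x. conj_point \<nu> \<mu> \<phi> x}. conj_mult \<nu> \<mu> \<phi> x)"
proof -
  interpret wave \<nu> \<mu> \<phi> by unfold_locales (rule H1, rule H2)
  define C where "C = {x. conj_point \<nu> \<mu> \<phi> x}"
  have Cn: "C = {x. nullity {..x} 0 > 0}" unfolding C_def conj_point_iff ..
  have n1: "nullity {..x} 0 \<le> 1" for x by (rule nullity_le_1[OF H3[rule_format]])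
  have fin: "finite C" and cnt: "\<And>s. index {..s} 0 = card {x\<in>C. x < s}"
    using conjugate_count[OF n1] unfolding Cn by auto
  obtain s0 where s0: "\<And>s. s \<ge> s0 \<Longrightarrow> index {..s} 0 = index UNIV 0" using index_half_eventually by metis
  \<comment> \<open>Beyond this point the half-line already has the index of the line and all
    conjugate points are passed; \<open>s0\<close> also covers the case of an empty
    \<open>C\<close>.\<close>
  define Linf where "Linf = Max (insert s0 C)"
  have Lm: "s0 \<le> Linf" "\<And>x. x \<in> C \<Longrightarrow> x \<le> Linf" unfolding Linf_def using fin by auto
  have mult: "(\<Sum>x\<in>C. conj_mult \<nu> \<mu> \<phi> x) = card C"
    using conj_mult_1 H3 by (simp add: C_def)
  have all: "{x. x < L \<and> conj_point \<nu> \<mu> \<phi> x} = C" if "L > Linf" for L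
  proof -
    have "x < L" if "x \<in> C" for x using Lm(2)[OF that] \<open>L > Linf\<close> by linarith
    then show ?thesis by (auto simp: C_def)
  qed
  have "{x\<in>C. x < Linf + 1} = C" using all[of "Linf + 1"] by (auto simp: C_def)
  then have line: "index UNIV 0 = card C" using cnt[of "Linf + 1"] s0[of "Linf + 1"] Lm(1) by simp
  have Mline: "Mor \<nu> \<mu> \<phi> UNIV dom_line = enat (index UNIV 0)"
    using Mor_Mor_pot[OF dom_line_clamped_dom] Mor_pot_index[of UNIV] by (simp add: side_def)
  have Mhalf: "Mor \<nu> \<mu> \<phi> {..L} (dom_half L) = enat (index {..L} 0)" for L
    using Mor_Mor_pot[OF dom_half_clamped_dom] Mor_pot_index[of "{..L}"] by (auto simp: side_def)
  have inv: "invertible_op \<nu> \<mu> \<phi> {..L} (dom_half L)" if "L > Linf" for L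
  proof -
    have LL: "Lop \<nu> \<mu> \<phi> D x = Lop_pot D x" for D x by (simp add: Lop_def Lop_pot_def)
    have nul0: "nullity {..L} 0 = 0" using Lm(2)[of L] that by (auto simp: Cn)
    show ?thesis unfolding invertible_op_def dom_half_clamped_dom LL
    proof (intro conjI allI impI ballI)
      show "D 0 x = 0" if "clamped_dom {..L} D \<and> (AE x in lborel. x \<in> {..L} \<longrightarrow> Lop_pot D x = 0)" "x \<in> {..L}" for D x
        using kernel_half[OF nul0 conjunct1[OF that(1)] conjunct2[OF that(1)] that(2)] .
      fix g :: "real \<Rightarrow> real" assume g: "g \<in> borel_measurable lborel \<and> (\<lambda>x. (g x)\<^sup>2) integrable_on {..L}"
      obtain D where "clamped_dom {..L} D" "\<And>x. Lop_pot D x = g x"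
        using solvable_half[OF nul0 conjunct1[OF g] conjunct2[OF g]] by blast
      then show "\<exists>D. clamped_dom {..L} D \<and> (AE x in lborel. x \<in> {..L} \<longrightarrow> Lop_pot D x = g x)"
        by (intro exI[of _ D]) simp
    qed
  qed
  show ?thesis
  proof (intro exI[of _ Linf] conjI allI impI)
    fix L assume L: "L > Linf"
    show "Mor \<nu> \<mu> \<phi> {..L} (dom_half L) = Mor \<nu> \<mu> \<phi> UNIV dom_line"
      unfolding Mline Mhalf using s0[of L] Lm(1) L by simp
    show "\<not> conj_point \<nu> \<mu> \<phi> L" using Lm(2)[of L] L by (auto simp: C_def)
    show "invertible_op \<nu> \<mu> \<phi> {..L} (dom_half L)" by (rule inv[OF L])
    show "finite {x. x < L \<and> conj_point \<nu> \<mu> \<phi> x}" unfolding all[OF L] by (rule fin)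
    show "(\<Sum>x\<in>{x. x < L \<and> conj_point \<nu> \<mu> \<phi> x}. conj_mult \<nu> \<mu> \<phi> x) = (\<Sum>x\<in>{x. conj_point \<nu> \<mu> \<phi> x}. conj_mult \<nu> \<mu> \<phi> x)"
      unfolding all[OF L] C_def[symmetric] ..
  next
    show "finite {x. conj_point \<nu> \<mu> \<phi> x}" using fin by (simp add: C_def)
    show "Mor \<nu> \<mu> \<phi> UNIV dom_line = enat (\<Sum>x\<in>{x. conj_point \<nu> \<mu> \<phi> x}. conj_mult \<nu> \<mu> \<phi> x)"
      unfolding Mline line C_def[symmetric] mult ..
  qed
qed

end
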